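(* Let $T$ be a complete theory which is NIP and unstable. Then there exist a finite set $A$, a formula $\theta(x)$ over $A$ and a relation $R(x,y)$, $\bigvee$-definable over $A$, which defines a dense linear quasi-order on $\theta(\mathcal U)$ admitting an infinite strictly increasing chain.
   Context: $\mathcal U$ is a monster model of $T$. A relation is $\bigvee$-definable over $A$ if it is defined by a (possibly infinite) disjunction of formulas with parameters from $A$. A linear quasi-order is a reflexive, transitive, total relation; it is dense if whenever $a<b$ (i.e. $a\le b$ and not $b\le a$) there is $c$ with $a<c<b$. *)

theory Defs
  imports Main
begin

unbundle cardinal_syntax

text \<open>First-order logic with equality over a language with arities. The symbols of a language form
  subsets of the types \<open>'f\<close> and \<open>'r\<close>, so that purely relational languages are covered; nullary
  function symbols are constants.\<close>

record ('f, 'r) language =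
  Funs :: "'f set"
  Rels :: "'r set"
  farity :: "'f \<Rightarrow> nat"
  rarity :: "'r \<Rightarrow> nat"

datatype 'f tm = Var nat | App 'f "'f tm list"

datatype ('f, 'r) fm =
    Eq "'f tm" "'f tm"
  | Rel 'r "'f tm list"
  | Neg "('f, 'r) fm"
  | And "('f, 'r) fm" "('f, 'r) fm"
  | Exi nat "('f, 'r) fm"

fun wf_tm :: "('f, 'r) language \<Rightarrow> 'f tm \<Rightarrow> bool" where
  "wf_tm L (Var i) \<longleftrightarrow> True"
| "wf_tm L (App f ts) \<longleftrightarrow> f \<in> Funs L \<and> length ts = farity L f \<and> (\<forall>t \<in> set ts. wf_tm L t)"

fun wf_fm :: "('f, 'r) language \<Rightarrow> ('f, 'r) fm \<Rightarrow> bool" where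
  "wf_fm L (Eq s t) \<longleftrightarrow> wf_tm L s \<and> wf_tm L t"
| "wf_fm L (Rel r ts) \<longleftrightarrow> r \<in> Rels L \<and> length ts = rarity L r \<and> (\<forall>t \<in> set ts. wf_tm L t)"
| "wf_fm L (Neg \<phi>) \<longleftrightarrow> wf_fm L \<phi>"
| "wf_fm L (And \<phi> \<psi>) \<longleftrightarrow> wf_fm L \<phi> \<and> wf_fm L \<psi>"
| "wf_fm L (Exi i \<phi>) \<longleftrightarrow> wf_fm L \<phi>"

fun tm_vars :: "'f tm \<Rightarrow> nat set" where
  "tm_vars (Var i) = {i}"
| "tm_vars (App f ts) = (\<Union>t \<in> set ts. tm_vars t)"

fun free_vars :: "('f, 'r) fm \<Rightarrow> nat set" where
  "free_vars (Eq s t) = tm_vars s \<union> tm_vars t"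
| "free_vars (Rel r ts) = (\<Union>t \<in> set ts. tm_vars t)"
| "free_vars (Neg \<phi>) = free_vars \<phi>"
| "free_vars (And \<phi> \<psi>) = free_vars \<phi> \<union> free_vars \<psi>"
| "free_vars (Exi i \<phi>) = free_vars \<phi> - {i}"

definition formulas :: "('f, 'r) language \<Rightarrow> ('f, 'r) fm set" where
  "formulas L = {\<phi>. wf_fm L \<phi>}"

definition sentences :: "('f, 'r) language \<Rightarrow> ('f, 'r) fm set" where
  "sentences L = {\<phi> \<in> formulas L. free_vars \<phi> = {}}"

record ('f, 'r, 'u) struct =
  univ :: "'u set"
  fint :: "'f \<Rightarrow> 'u list \<Rightarrow> 'u"
  rint :: "'r \<Rightarrow> 'u list \<Rightarrow> bool"

definition tuples :: "('f, 'r, 'u) struct \<Rightarrow> nat \<Rightarrow> 'u list set" where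
  "tuples M n = {a. length a = n \<and> set a \<subseteq> univ M}"

definition is_struct :: "('f, 'r) language \<Rightarrow> ('f, 'r, 'u) struct \<Rightarrow> bool" where
  "is_struct L M \<longleftrightarrow>
     univ M \<noteq> {} \<and> (\<forall>f \<in> Funs L. \<forall>a \<in> tuples M (farity L f). fint M f a \<in> univ M)"

fun eval :: "('f, 'r, 'u) struct \<Rightarrow> (nat \<Rightarrow> 'u) \<Rightarrow> 'f tm \<Rightarrow> 'u" where
  "eval M s (Var i) = s i"
| "eval M s (App f ts) = fint M f (map (eval M s) ts)"

fun sat :: "('f, 'r, 'u) struct \<Rightarrow> (nat \<Rightarrow> 'u) \<Rightarrow> ('f, 'r) fm \<Rightarrow> bool" where
  "sat M s (Eq t u) \<longleftrightarrow> eval M s t = eval M s u"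
| "sat M s (Rel r ts) \<longleftrightarrow> rint M r (map (eval M s) ts)"
| "sat M s (Neg \<phi>) \<longleftrightarrow> \<not> sat M s \<phi>"
| "sat M s (And \<phi> \<psi>) \<longleftrightarrow> sat M s \<phi> \<and> sat M s \<psi>"
| "sat M s (Exi i \<phi>) \<longleftrightarrow> (\<exists>a \<in> univ M. sat M (s(i := a)) \<phi>)"

text \<open>\<open>holds M \<phi> a\<close> evaluates \<open>\<phi>\<close> with variable \<open>i\<close> standing for the \<open>i\<close>-th entry of \<open>a\<close>; it is
  only used when \<open>free_vars \<phi> \<subseteq> {..<length a}\<close>. A partitioned formula \<open>\<phi>(x;y)\<close> with \<open>|x| = n\<close> and
  \<open>|y| = m\<close> has its free variables below \<open>n + m\<close>, the first \<open>n\<close> of them being \<open>x\<close>.\<close>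

definition holds :: "('f, 'r, 'u) struct \<Rightarrow> ('f, 'r) fm \<Rightarrow> 'u list \<Rightarrow> bool" where
  "holds M \<phi> a \<longleftrightarrow> sat M (nth a) \<phi>"

definition formulas_in :: "('f, 'r) language \<Rightarrow> nat \<Rightarrow> ('f, 'r) fm set" where
  "formulas_in L n = {\<phi> \<in> formulas L. free_vars \<phi> \<subseteq> {..<n}}"

definition models :: "('f, 'r, 'u) struct \<Rightarrow> ('f, 'r) fm set \<Rightarrow> bool" where
  "models M T \<longleftrightarrow> (\<forall>\<sigma> \<in> T. holds M \<sigma> [])"

text \<open>Semantic consequence. The structures range over those whose universe is a subset of the type
  of formulas. As this type is infinite and at least as large as the language, the downward
  Loewenheim-Skolem theorem shows that this is consequence with respect to all structures.\<close>

definition entails :: "('f, 'r) language \<Rightarrow> ('f, 'r) fm set \<Rightarrow> ('f, 'r) fm \<Rightarrow> bool" where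
  "entails L T \<sigma> \<longleftrightarrow>
     (\<forall>M :: ('f, 'r, ('f, 'r) fm) struct. is_struct L M \<and> models M T \<longrightarrow> holds M \<sigma> [])"

definition consistent :: "('f, 'r) language \<Rightarrow> ('f, 'r) fm set \<Rightarrow> bool" where
  "consistent L T \<longleftrightarrow> \<not> (\<exists>\<sigma> \<in> sentences L. entails L T \<sigma> \<and> entails L T (Neg \<sigma>))"

definition complete_theory :: "('f, 'r) language \<Rightarrow> ('f, 'r) fm set \<Rightarrow> bool" where
  "complete_theory L T \<longleftrightarrow>
     T \<subseteq> sentences L \<and> consistent L T \<and>
     (\<forall>\<sigma> \<in> sentences L. entails L T \<sigma> \<or> entails L T (Neg \<sigma>))"

text \<open>A formula over \<open>A\<close> in the variables \<open>0, \<dots>, n - 1\<close> is a pair \<open>(\<phi>, b)\<close> with \<open>b\<close> a finite tuple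
  from \<open>A\<close>, which is substituted for the variables of \<open>\<phi>\<close> from \<open>n\<close> onwards.\<close>

definition formulas_over ::
  "('f, 'r) language \<Rightarrow> 'u set \<Rightarrow> nat \<Rightarrow> (('f, 'r) fm \<times> 'u list) set" where
  "formulas_over L A n = {(\<phi>, b). set b \<subseteq> A \<and> \<phi> \<in> formulas_in L (n + length b)}"

definition holds_over ::
  "('f, 'r, 'u) struct \<Rightarrow> ('f, 'r) fm \<times> 'u list \<Rightarrow> 'u list \<Rightarrow> bool" where
  "holds_over M \<theta> a \<longleftrightarrow> holds M (fst \<theta>) (a @ snd \<theta>)"

definition solutions ::
  "('f, 'r, 'u) struct \<Rightarrow> nat \<Rightarrow> ('f, 'r) fm \<times> 'u list \<Rightarrow> 'u list set" where
  "solutions M n \<theta> = {a \<in> tuples M n. holds_over M \<theta> a}"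

definition Or_definable ::
  "('f, 'r) language \<Rightarrow> ('f, 'r, 'u) struct \<Rightarrow> 'u set \<Rightarrow> nat \<Rightarrow> 'u list rel \<Rightarrow> bool" where
  "Or_definable L M A n R \<longleftrightarrow>
     (\<exists>\<Psi> \<subseteq> formulas_over L A (n + n).
        R = {(a, c). a \<in> tuples M n \<and> c \<in> tuples M n \<and> (\<exists>\<psi> \<in> \<Psi>. holds_over M \<psi> (a @ c))})"

definition saturated ::
  "('f, 'r) language \<Rightarrow> 'k rel \<Rightarrow> ('f, 'r, 'u) struct \<Rightarrow> bool" where
  "saturated L \<kappa> M \<longleftrightarrow>
     (\<forall>A \<subseteq> univ M. |A| <o \<kappa> \<longrightarrow>
        (\<forall>p \<subseteq> formulas_over L A 1.
           (\<forall>q \<subseteq> p. finite q \<longrightarrow> (\<exists>c \<in> univ M. \<forall>\<phi> \<in> q. holds_over M \<phi> [c])) \<longrightarrow>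
           (\<exists>c \<in> univ M. \<forall>\<phi> \<in> p. holds_over M \<phi> [c])))"

definition partial_elementary ::
  "('f, 'r) language \<Rightarrow> ('f, 'r, 'u) struct \<Rightarrow> 'u set \<Rightarrow> ('u \<Rightarrow> 'u) \<Rightarrow> bool" where
  "partial_elementary L M A h \<longleftrightarrow>
     h ` A \<subseteq> univ M \<and>
     (\<forall>a \<in> lists A. \<forall>\<phi> \<in> formulas_in L (length a). holds M \<phi> a \<longleftrightarrow> holds M \<phi> (map h a))"

definition automorphism ::
  "('f, 'r) language \<Rightarrow> ('f, 'r, 'u) struct \<Rightarrow> ('u \<Rightarrow> 'u) \<Rightarrow> bool" where
  "automorphism L M g \<longleftrightarrow>
     bij_betw g (univ M) (univ M) \<and>
     (\<forall>f \<in> Funs L. \<forall>a \<in> tuples M (farity L f). g (fint M f a) = fint M f (map g a)) \<and>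
     (\<forall>r \<in> Rels L. \<forall>a \<in> tuples M (rarity L r). rint M r a \<longleftrightarrow> rint M r (map g a))"

definition strongly_homogeneous ::
  "('f, 'r) language \<Rightarrow> 'k rel \<Rightarrow> ('f, 'r, 'u) struct \<Rightarrow> bool" where
  "strongly_homogeneous L \<kappa> M \<longleftrightarrow>
     (\<forall>A \<subseteq> univ M. |A| <o \<kappa> \<longrightarrow>
        (\<forall>h. partial_elementary L M A h \<longrightarrow>
           (\<exists>g. automorphism L M g \<and> (\<forall>a \<in> A. g a = h a))))"

text \<open>A monster model, of degree of saturation \<open>\<kappa>\<close>, where \<open>\<kappa>\<close> is any cardinal larger than the number
  of formulas.\<close>

definition monster_model ::
  "('f, 'r) language \<Rightarrow> ('f, 'r) fm set \<Rightarrow> 'k rel \<Rightarrow> ('f, 'r, 'u) struct \<Rightarrow> bool" where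
  "monster_model L T \<kappa> U \<longleftrightarrow>
     is_struct L U \<and> models U T \<and>
     Card_order \<kappa> \<and> |formulas L| <o \<kappa> \<and> saturated L \<kappa> U \<and> strongly_homogeneous L \<kappa> U"

text \<open>As usual, NIP and stability of a complete theory are expressed in its monster model \<open>U\<close>.\<close>

definition shattered ::
  "('f, 'r, 'u) struct \<Rightarrow> ('f, 'r) fm \<Rightarrow> nat \<Rightarrow> 'u list set \<Rightarrow> bool" where
  "shattered U \<phi> m X \<longleftrightarrow>
     (\<forall>I \<subseteq> X. \<exists>b \<in> tuples U m. \<forall>a \<in> X. holds U \<phi> (a @ b) \<longleftrightarrow> a \<in> I)"

definition NIP :: "('f, 'r) language \<Rightarrow> ('f, 'r, 'u) struct \<Rightarrow> bool" where
  "NIP L U \<longleftrightarrow>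
     (\<forall>n m. \<forall>\<phi> \<in> formulas_in L (n + m).
        \<not> (\<exists>X \<subseteq> tuples U n. infinite X \<and> shattered U \<phi> m X))"

definition order_property ::
  "('f, 'r, 'u) struct \<Rightarrow> ('f, 'r) fm \<Rightarrow> nat \<Rightarrow> nat \<Rightarrow> bool" where
  "order_property U \<phi> n m \<longleftrightarrow>
     (\<exists>a b. (\<forall>i :: nat. a i \<in> tuples U n \<and> b i \<in> tuples U m) \<and>
        (\<forall>i j. holds U \<phi> (a i @ b j) \<longleftrightarrow> i < j))"

definition stable :: "('f, 'r) language \<Rightarrow> ('f, 'r, 'u) struct \<Rightarrow> bool" where
  "stable L U \<longleftrightarrow> (\<forall>n m. \<forall>\<phi> \<in> formulas_in L (n + m). \<not> order_property U \<phi> n m)"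

text \<open>\<open>R\<close> need not be contained in \<open>S \<times> S\<close>: only its restriction to \<open>S\<close> matters.\<close>

definition linear_quasi_order_on :: "'a set \<Rightarrow> 'a rel \<Rightarrow> bool" where
  "linear_quasi_order_on S R \<longleftrightarrow> refl_on S R \<and> trans_on S R \<and> total_on S R"

definition strictly_below :: "'a rel \<Rightarrow> 'a \<Rightarrow> 'a \<Rightarrow> bool" where
  "strictly_below R a b \<longleftrightarrow> (a, b) \<in> R \<and> (b, a) \<notin> R"

definition dense_on :: "'a set \<Rightarrow> 'a rel \<Rightarrow> bool" where
  "dense_on S R \<longleftrightarrow>
     (\<forall>a \<in> S. \<forall>b \<in> S. strictly_below R a b \<longrightarrow>
        (\<exists>c \<in> S. strictly_below R a c \<and> strictly_below R c b))"

definition has_increasing_chain :: "'a set \<Rightarrow> 'a rel \<Rightarrow> bool" where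
  "has_increasing_chain S R \<longleftrightarrow>
     (\<exists>c :: nat \<Rightarrow> 'a. range c \<subseteq> S \<and> (\<forall>i j. i < j \<longrightarrow> strictly_below R (c i) (c j)))"

end

theory Submission
  imports Defs "HOL-Library.Ramsey" "HOL-Library.Countable_Set" Complex_Main
begin

text \<open>
  Fix a formula \<open>E\<close> with the order property, on tuples of a fixed length. For a definable family \<open>G\<close>
  of finite chains \<open>(y\<^sub>i, b\<^sub>i)\<close>, meaning \<open>E y\<^sub>i b\<^sub>j\<close> iff \<open>i < j\<close>, let \<open>b < b'\<close> if arbitrarily long chains of
  \<open>G\<close> lie between \<open>b\<close> and \<open>b'\<close>. This is the negation of a \<open>\<Or>\<close>-definable relation, it is always
  negatively transitive and dense, and it is asymmetric unless there is a bad pair: a point \<open>y\<close> and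
  a cut \<open>c\<close> that both see long chains on the same side, while \<open>E y c\<close> says the opposite.

  Suppose that all families have bad pairs. By compactness there are then bad pairs over every
  indiscernible chain. By NIP there is a maximal \<open>d\<close> such that \<open>d\<close> sequences can be cut independently
  by instances of \<open>E\<close>. Take \<open>d\<close> mutually indiscernible such sequences with a leaf, that is, an array of
  realisations of all their cuts. Given a leaf, one looks for a point \<open>z\<close> and two new leaves with the
  same type over the finitely many points chosen so far on which \<open>E z\<close> has different signs. If this
  fails, a finite fragment of the configuration obstructs it. Bad pairs, whose cut is coherent with
  the sequences by maximality of \<open>d\<close>, then allow one to build a point \<open>y\<close> together with arbitrarily many pairs
  of blocks of the sequences such that the obstructed formula holds at \<open>y\<close> for one block and fails for the
  other block of each pair; by indiscernibility that formula has the independence property. So leaves always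
  split, and repeated splitting gives full binary trees of points and leaves. These contain a
  ladder, which is a further sequence that can be cut independently of the others: a contradiction
  to the choice of \<open>d\<close>.
\<close>

section \<open>First-order formulas\<close>

text \<open>Asymmetry is the one property of \<open><\<close> that can fail. If
  \<open>b < b'\<close> and \<open>b' < b\<close>, a single link one way supplies \<open>y\<close>,
  whose signs on the cuts split every long chain the other way; a long half makes a bad pair. A bad
  pair is not absurd in itself, so the work lies in amplifying bad pairs to independence. Coherence
  is where maximality of \<open>d\<close> acts: the cut \<open>c\<close> of a bad pair sees both a
  base sequence and the chain through \<open>y\<close>. If their signs differed at infinitely many
  places of an interval, both could be cut at will along one coordinate, and \<open>d + 1\<close>
  sequences would be independent. Hence \<open>c\<close> cuts the base sequences as a leaf near one
  end of the interval would, but has the sign at \<open>y\<close> opposite to that of the leaves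
  inside the interval. NIP enters twice: it bounds \<open>d\<close>, and it bounds the number of
  pairs of blocks. Rationals serve as indices because a bounded open interval contains a copy of the
  whole order, so that lines, blocks and intervals can be nested without change of type.\<close>

fun ren_tm :: "(nat \<Rightarrow> nat) \<Rightarrow> 'f tm \<Rightarrow> 'f tm" where
  "ren_tm f (Var i) = Var (f i)"
| "ren_tm f (App g ts) = App g (map (ren_tm f) ts)"

text \<open>The bound variable is replaced by one above all images of the free variables. Hence
  renaming along any map, injective or not, captures nothing, and \<open>sat_ren\<close> holds
  without side conditions.\<close>

fun ren :: "(nat \<Rightarrow> nat) \<Rightarrow> ('f, 'r) fm \<Rightarrow> ('f, 'r) fm" where
  "ren f (Eq s t) = Eq (ren_tm f s) (ren_tm f t)"
| "ren f (Rel r ts) = Rel r (map (ren_tm f) ts)"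
| "ren f (Neg \<phi>) = Neg (ren f \<phi>)"
| "ren f (And \<phi> \<psi>) = And (ren f \<phi>) (ren f \<psi>)"
| "ren f (Exi i \<phi>) =
     Exi (Suc (Max (insert 0 (f ` free_vars \<phi>))))
         (ren (f(i := Suc (Max (insert 0 (f ` free_vars \<phi>))))) \<phi>)"

lemma finite_tm_vars: "finite (tm_vars t)"
  by (induction t) auto

lemma finite_free_vars: "finite (free_vars \<phi>)"
  by (induction \<phi>) (auto simp: finite_tm_vars)

lemma eval_cong: "(\<And>i. i \<in> tm_vars t \<Longrightarrow> s i = s' i) \<Longrightarrow> eval M s t = eval M s' t"
proof (induction t)
  case (App f ts)
  then have "map (eval M s) ts = map (eval M s') ts"
    by (intro map_cong) auto
  then show ?case by (metis eval.simps(2))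
qed auto

lemma sat_cong: "(\<And>i. i \<in> free_vars \<phi> \<Longrightarrow> s i = s' i) \<Longrightarrow> sat M s \<phi> = sat M s' \<phi>"
proof (induction \<phi> arbitrary: s s')
  case (Eq t u)
  then have "eval M s t = eval M s' t" "eval M s u = eval M s' u"
    by (auto intro!: eval_cong)
  then show ?case by simp
next
  case (Rel r ts)
  then have "map (eval M s) ts = map (eval M s') ts"
    by (auto intro!: eval_cong)
  then show ?case by (metis sat.simps(2))
next
  case (Exi i \<phi>)
  have "sat M (s(i := a)) \<phi> = sat M (s'(i := a)) \<phi>" for a
    by (rule Exi.IH) (use Exi.prems in auto)
  then show ?case by simp
next
  case (Neg \<phi>)
  then show ?case by (metis free_vars.simps(3) sat.simps(3))
next
  case (And \<phi> \<psi>)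
  have "sat M s \<phi> = sat M s' \<phi>" "sat M s \<psi> = sat M s' \<psi>"
    by (rule And.IH(1), simp add: And.prems) (rule And.IH(2), simp add: And.prems)
  then show ?case by simp
qed

lemma eval_ren: "eval M s (ren_tm f t) = eval M (\<lambda>i. s (f i)) t"
proof (induction t)
  case (App g ts)
  then have "map (eval M s \<circ> ren_tm f) ts = map (eval M (\<lambda>i. s (f i))) ts"
    by simp
  then show ?case by (metis eval.simps(2) map_map ren_tm.simps(2))
qed auto

lemma sat_ren: "sat M s (ren f \<phi>) = sat M (\<lambda>i. s (f i)) \<phi>"
proof (induction \<phi> arbitrary: s f)
  case (Rel r ts)
  have "map (eval M s \<circ> ren_tm f) ts = map (eval M (\<lambda>i. s (f i))) ts"
    by (simp add: eval_ren)
  then show ?case by (metis map_map ren.simps(2) sat.simps(2))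
next
  case (Exi i \<phi>)
  define j where "j = Suc (Max (insert 0 (f ` free_vars \<phi>)))"
  have j: "f k \<noteq> j" if "k \<in> free_vars \<phi>" for k
  proof -
    have "f k \<le> Max (insert 0 (f ` free_vars \<phi>))"
      using that by (intro Max_ge) (auto simp: finite_free_vars)
    then show ?thesis unfolding j_def by simp
  qed
  have "sat M (\<lambda>k. (s(j := a)) ((f(i := j)) k)) \<phi> = sat M ((\<lambda>k. s (f k))(i := a)) \<phi>" for a
    by (rule sat_cong) (auto dest: j)
  then have "(\<exists>a \<in> univ M. sat M (s(j := a)) (ren (f(i := j)) \<phi>)) \<longleftrightarrow>
      (\<exists>a \<in> univ M. sat M ((\<lambda>k. s (f k))(i := a)) \<phi>)"
    by (simp only: Exi.IH)
  then show ?case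
    by (simp only: ren.simps sat.simps flip: j_def)
qed (auto simp: eval_ren)

lemma tm_vars_ren: "tm_vars (ren_tm f t) = f ` tm_vars t"
  by (induction t) auto

lemma free_vars_ren: "free_vars (ren f \<phi>) \<subseteq> f ` free_vars \<phi>"
proof (induction \<phi> arbitrary: f)
  case (Exi i \<phi>)
  define j where "j = Suc (Max (insert 0 (f ` free_vars \<phi>)))"
  have "free_vars (ren (f(i := j)) \<phi>) \<subseteq> (f(i := j)) ` free_vars \<phi>"
    by (rule Exi.IH)
  then show ?case by (auto simp flip: j_def split: if_splits)
next
  case (And \<phi> \<psi>)
  show ?case using And.IH[of f] by (auto simp: image_Un)
qed (auto simp: tm_vars_ren)

lemma wf_tm_ren: "wf_tm L t \<Longrightarrow> wf_tm L (ren_tm f t)"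
  by (induction t) auto

lemma wf_ren: "wf_fm L \<phi> \<Longrightarrow> wf_fm L (ren f \<phi>)"
  by (induction \<phi> arbitrary: f) (auto simp: wf_tm_ren)

lemma ren_formulas: "\<phi> \<in> formulas L \<Longrightarrow> ren f \<phi> \<in> formulas L"
  by (auto simp: formulas_def wf_ren)

definition Exis :: "nat list \<Rightarrow> ('f, 'r) fm \<Rightarrow> ('f, 'r) fm" where
  "Exis xs \<phi> = foldr Exi xs \<phi>"

lemma Exis_formulas: "\<phi> \<in> formulas L \<Longrightarrow> Exis xs \<phi> \<in> formulas L"
  unfolding Exis_def by (induction xs) (auto simp: formulas_def)

lemma sat_Exis:
  "sat M s (Exis xs \<phi>) \<longleftrightarrow> (\<exists>s'. (\<forall>i. i \<notin> set xs \<longrightarrow> s' i = s i) \<and> s' ` set xs \<subseteq> univ M \<and> sat M s' \<phi>)"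
proof (induction xs arbitrary: s)
  case Nil
  have "s' = s" if "\<forall>i. s' i = s i" for s' using that by auto
  then show ?case by (auto simp: Exis_def)
next
  case (Cons x xs)
  have eq: "sat M s (Exis (x # xs) \<phi>) \<longleftrightarrow> (\<exists>a \<in> univ M. sat M (s(x := a)) (Exis xs \<phi>))"
    by (simp add: Exis_def)
  show ?case
  proof
    assume "sat M s (Exis (x # xs) \<phi>)"
    then obtain a s' where a: "a \<in> univ M"
      and s': "\<forall>i. i \<notin> set xs \<longrightarrow> s' i = (s(x := a)) i" "s' ` set xs \<subseteq> univ M" "sat M s' \<phi>"
      unfolding eq Cons.IH by blast
    have "s' x \<in> univ M"
      using s' a by (cases "x \<in> set xs") auto
    then show "\<exists>s'. (\<forall>i. i \<notin> set (x # xs) \<longrightarrow> s' i = s i) \<and> s' ` set (x # xs) \<subseteq> univ M \<and> sat M s' \<phi>"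
      using s' by (intro exI[of _ s']) auto
  next
    assume "\<exists>s'. (\<forall>i. i \<notin> set (x # xs) \<longrightarrow> s' i = s i) \<and> s' ` set (x # xs) \<subseteq> univ M \<and> sat M s' \<phi>"
    then obtain s' where s': "\<forall>i. i \<notin> set (x # xs) \<longrightarrow> s' i = s i" "s' ` set (x # xs) \<subseteq> univ M" "sat M s' \<phi>"
      by blast
    then show "sat M s (Exis (x # xs) \<phi>)"
      unfolding eq Cons.IH by (intro bexI[of _ "s' x"] exI[of _ s']) auto
  qed
qed

text \<open>The empty conjunction has to be a true formula of every language;
  \<open>Eq (Var 0) (Var 0)\<close> is one.\<close>

definition Conjs :: "('f, 'r) fm list \<Rightarrow> ('f, 'r) fm" where
  "Conjs xs = foldr And xs (Eq (Var 0) (Var 0))"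

lemma sat_Conjs: "sat M s (Conjs xs) \<longleftrightarrow> (\<forall>\<phi> \<in> set xs. sat M s \<phi>)"
  unfolding Conjs_def by (induction xs) auto

lemma Conjs_formulas: "set xs \<subseteq> formulas L \<Longrightarrow> Conjs xs \<in> formulas L"
  unfolding Conjs_def by (induction xs) (auto simp: formulas_def)

text \<open>Renaming the variable \<open>i\<close> to \<open>0\<close> and the other free variables to \<open>1, 2, \<dots>\<close> turns a formula
  with an assignment into a formula over a set of parameters.\<close>

lemma formula_over_valuation:
  assumes "\<psi> \<in> formulas L" and "range s \<subseteq> A"
  shows "\<exists>\<theta> \<in> formulas_over L A 1. \<forall>a. holds_over M \<theta> [a] \<longleftrightarrow> sat M (s(i := a)) \<psi>"
proof -
  obtain vs where vs: "set vs = free_vars \<psi> - {i}" "distinct vs"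
    using finite_distinct_list[of "free_vars \<psi> - {i}"] finite_free_vars by blast
  define g where "g v = (if v = i then 0 else Suc (THE k. k < length vs \<and> vs ! k = v))" for v
  have g: "g v \<noteq> 0 \<and> g v - 1 < length vs \<and> vs ! (g v - 1) = v" if "v \<in> free_vars \<psi>" "v \<noteq> i" for v
  proof -
    have "v \<in> set vs" using vs that by simp
    then have "\<exists>!k. k < length vs \<and> vs ! k = v" using vs(2) by (rule distinct_Ex1[rotated])
    from theI'[OF this] show ?thesis using that by (simp add: g_def)
  qed
  have fv: "free_vars (ren g \<psi>) \<subseteq> {..<1 + length vs}"
  proof
    fix k assume "k \<in> free_vars (ren g \<psi>)"
    then obtain v where "v \<in> free_vars \<psi>" "k = g v" using free_vars_ren by blast
    then show "k \<in> {..<1 + length vs}"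
      using g[of v] by (cases "v = i") (auto simp: g_def)
  qed
  have "holds_over M (ren g \<psi>, map s vs) [a] \<longleftrightarrow> sat M (s(i := a)) \<psi>" for a
    unfolding holds_over_def holds_def fst_conv snd_conv sat_ren
  proof (rule sat_cong)
    fix v assume v: "v \<in> free_vars \<psi>"
    show "(([a] @ map s vs) ! g v) = (s(i := a)) v"
    proof (cases "v = i")
      case True
      then show ?thesis by (simp add: g_def)
    next
      case False
      then obtain k where "g v = Suc k" "k < length vs" "vs ! k = v"
        using g[OF v] by (cases "g v") auto
      then show ?thesis using False by simp
    qed
  qed
  moreover have "(ren g \<psi>, map s vs) \<in> formulas_over L A 1"
    using fv assms by (auto simp: formulas_over_def formulas_in_def ren_formulas)
  ultimately show ?thesis by blast
qed

section \<open>Saturation over countable parameter sets and compactness\<close>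

lemma countable_less_card:
  assumes "monster_model L T \<kappa> U" and "countable A"
  shows "|A| <o \<kappa>"
proof -
  \<comment> \<open>Equations between variables already give infinitely many formulas, so \<kappa>
    is uncountable and saturation applies to every countable set.\<close>
  have "infinite (formulas L)"
  proof
    assume "finite (formulas L)"
    moreover have "range (\<lambda>i. Eq (Var i) (Var i)) \<subseteq> formulas L" by (auto simp: formulas_def)
    ultimately have "finite (range (\<lambda>i. Eq (Var i) (Var i) :: ('a, 'b) fm))"
      using finite_subset by blast
    then have "finite (UNIV :: nat set)"
      by (rule finite_imageD) (auto intro: injI)
    then show False by simp
  qed
  then have "|UNIV :: nat set| \<le>o |formulas L|"
    by (simp add: infinite_iff_card_of_nat)
  moreover have "|A| \<le>o |UNIV :: nat set|"
    using assms(2) unfolding countable_def card_of_ordLeq[symmetric] by auto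
  moreover have "|formulas L| <o \<kappa>" using assms(1) by (simp add: monster_model_def)
  ultimately show ?thesis
    using ordLeq_ordLess_trans ordLeq_transitive by blast
qed

lemma one_variable_compactness:
  assumes M: "monster_model L T \<kappa> U" and s: "range s \<subseteq> univ U" and \<Psi>: "\<Psi> \<subseteq> formulas L"
    and fin: "\<And>\<Psi>0. \<Psi>0 \<subseteq> \<Psi> \<Longrightarrow> finite \<Psi>0 \<Longrightarrow> \<exists>a \<in> univ U. \<forall>\<psi> \<in> \<Psi>0. sat U (s(i := a)) \<psi>"
  shows "\<exists>a \<in> univ U. \<forall>\<psi> \<in> \<Psi>. sat U (s(i := a)) \<psi>"
proof -
  have "\<exists>\<theta>. \<forall>\<psi> \<in> formulas L. \<theta> \<psi> \<in> formulas_over L (range s) 1 \<and>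
      (\<forall>a. holds_over U (\<theta> \<psi>) [a] \<longleftrightarrow> sat U (s(i := a)) \<psi>)"
    using formula_over_valuation[of _ L s "range s" U i] by (intro bchoice) blast
  then obtain \<theta> where \<theta>: "\<And>\<psi>. \<psi> \<in> formulas L \<Longrightarrow> \<theta> \<psi> \<in> formulas_over L (range s) 1"
    "\<And>\<psi> a. \<psi> \<in> formulas L \<Longrightarrow> holds_over U (\<theta> \<psi>) [a] \<longleftrightarrow> sat U (s(i := a)) \<psi>"
    by blast
  have "\<exists>c \<in> univ U. \<forall>\<phi> \<in> \<theta> ` \<Psi>. holds_over U \<phi> [c]"
  proof -
    have "saturated L \<kappa> U" using M by (simp add: monster_model_def)
    moreover have "|range s| <o \<kappa>" by (rule countable_less_card[OF M]) simp
    moreover have "\<theta> ` \<Psi> \<subseteq> formulas_over L (range s) 1" using \<theta>(1) \<Psi> by blast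
    moreover have "\<exists>c \<in> univ U. \<forall>\<phi> \<in> q. holds_over U \<phi> [c]" if q: "q \<subseteq> \<theta> ` \<Psi>" "finite q" for q
    proof -
      obtain \<Psi>0 where "\<Psi>0 \<subseteq> \<Psi>" "finite \<Psi>0" "q = \<theta> ` \<Psi>0"
        using finite_subset_image[OF q(2,1)] by blast
      then show ?thesis using fin[of \<Psi>0] \<theta>(2) \<Psi> by (metis (no_types, lifting) image_iff subsetD)
    qed
    ultimately show ?thesis using s unfolding saturated_def by blast
  qed
  then show ?thesis using \<theta>(2) \<Psi> by blast
qed

text \<open>The choice of a value for \<open>i\<close> must preserve finite satisfiability in the
  remaining variables of \<open>V\<close>. For each finite part of \<Phi> this demand is a formula
  about \<open>i\<close>, obtained by quantifying out the other variables of \<open>V\<close>;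
  saturation meets all these demands at once.\<close>

lemma compactness_step:
  assumes M: "monster_model L T \<kappa> U" and s: "range s \<subseteq> univ U" and \<Phi>: "\<Phi> \<subseteq> formulas L" and i: "i \<in> V"
    and fin: "\<And>\<Phi>0. \<Phi>0 \<subseteq> \<Phi> \<Longrightarrow> finite \<Phi>0 \<Longrightarrow>
      \<exists>s'. range s' \<subseteq> univ U \<and> (\<forall>j. j \<notin> V \<longrightarrow> s' j = s j) \<and> (\<forall>\<phi> \<in> \<Phi>0. sat U s' \<phi>)"
  shows "\<exists>a \<in> univ U. \<forall>\<Phi>0 \<subseteq> \<Phi>. finite \<Phi>0 \<longrightarrow>
      (\<exists>s'. range s' \<subseteq> univ U \<and> (\<forall>j. j \<notin> V - {i} \<longrightarrow> s' j = (s(i := a)) j) \<and> (\<forall>\<phi> \<in> \<Phi>0. sat U s' \<phi>))"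
proof -
  let ?I = "{\<Phi>0. \<Phi>0 \<subseteq> \<Phi> \<and> finite \<Phi>0}"
  define good where "good s \<Phi>0 \<longleftrightarrow>
    (\<exists>s'. range s' \<subseteq> univ U \<and> (\<forall>j. j \<notin> V - {i} \<longrightarrow> s' j = s j) \<and> (\<forall>\<phi> \<in> \<Phi>0. sat U s' \<phi>))" for s \<Phi>0
  have "\<exists>\<psi> \<in> formulas L. \<forall>a \<in> univ U. sat U (s(i := a)) \<psi> \<longleftrightarrow> good (s(i := a)) \<Phi>0" if \<Phi>0: "\<Phi>0 \<in> ?I" for \<Phi>0
  proof -
    obtain ps where ps: "set ps = \<Phi>0" using \<Phi>0 finite_list[of \<Phi>0] by auto
    obtain xs where xs: "set xs = free_vars (Conjs ps) \<inter> V - {i}"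
      using finite_list[of "free_vars (Conjs ps) \<inter> V - {i}"] finite_free_vars by blast
    have "sat U (s(i := a)) (Exis xs (Conjs ps)) \<longleftrightarrow> good (s(i := a)) \<Phi>0" if a: "a \<in> univ U" for a
    proof
      assume "sat U (s(i := a)) (Exis xs (Conjs ps))"
      then obtain s' where s': "\<forall>j. j \<notin> set xs \<longrightarrow> s' j = (s(i := a)) j" "s' ` set xs \<subseteq> univ U"
        "sat U s' (Conjs ps)" unfolding sat_Exis by blast
      have "s' j \<in> univ U" for j
        using s' s a by (cases "j \<in> set xs") auto
      then show "good (s(i := a)) \<Phi>0"
        unfolding good_def using s' xs ps by (intro exI[of _ s']) (auto simp: sat_Conjs)
    next
      assume "good (s(i := a)) \<Phi>0"
      then obtain s' where s': "range s' \<subseteq> univ U" "\<forall>j. j \<notin> V - {i} \<longrightarrow> s' j = (s(i := a)) j"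
        "\<forall>\<phi> \<in> \<Phi>0. sat U s' \<phi>" unfolding good_def by blast
      define s2 where "s2 j = (if j \<in> set xs then s' j else (s(i := a)) j)" for j
      have "sat U s2 (Conjs ps) = sat U s' (Conjs ps)"
        by (rule sat_cong) (use s' xs in \<open>auto simp: s2_def\<close>)
      then have "sat U s2 (Conjs ps)" using s' ps by (simp add: sat_Conjs)
      then show "sat U (s(i := a)) (Exis xs (Conjs ps))"
        unfolding sat_Exis using s' by (intro exI[of _ s2]) (auto simp: s2_def)
    qed
    moreover have "Exis xs (Conjs ps) \<in> formulas L"
      using ps \<Phi>0 \<Phi> by (intro Exis_formulas Conjs_formulas) auto
    ultimately show ?thesis by blast
  qed
  then have "\<exists>\<psi>. \<forall>\<Phi>0 \<in> ?I. \<psi> \<Phi>0 \<in> formulas L \<and>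
      (\<forall>a \<in> univ U. sat U (s(i := a)) (\<psi> \<Phi>0) \<longleftrightarrow> good (s(i := a)) \<Phi>0)"
    by (intro bchoice) blast
  then obtain \<psi> where \<psi>: "\<And>\<Phi>0. \<Phi>0 \<in> ?I \<Longrightarrow> \<psi> \<Phi>0 \<in> formulas L"
    "\<And>\<Phi>0 a. \<Phi>0 \<in> ?I \<Longrightarrow> a \<in> univ U \<Longrightarrow> sat U (s(i := a)) (\<psi> \<Phi>0) \<longleftrightarrow> good (s(i := a)) \<Phi>0"
    by blast
  have "\<exists>a \<in> univ U. \<forall>p \<in> \<psi> ` ?I. sat U (s(i := a)) p"
  proof (rule one_variable_compactness[OF M s])
    fix \<Psi>0 assume "\<Psi>0 \<subseteq> \<psi> ` ?I" "finite \<Psi>0"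
    then obtain J where J: "J \<subseteq> ?I" "finite J" "\<Psi>0 = \<psi> ` J"
      using finite_subset_image[of \<Psi>0 \<psi> ?I] by auto
    \<comment> \<open>Finitely many demands come from finitely many finite parts. A witness for the
      union of these parts meets all of the demands.\<close>
    obtain s' where s': "range s' \<subseteq> univ U" "\<forall>j. j \<notin> V \<longrightarrow> s' j = s j" "\<forall>\<phi> \<in> \<Union>J. sat U s' \<phi>"
    proof -
      have "\<Union>J \<subseteq> \<Phi>" "finite (\<Union>J)" using J by auto
      then show ?thesis using fin[of "\<Union>J"] that by blast
    qed
    have "good (s(i := s' i)) \<Phi>0" if "\<Phi>0 \<in> J" for \<Phi>0
      unfolding good_def using s' that by (intro exI[of _ s']) auto
    moreover have "s' i \<in> univ U" using s' by auto
    ultimately show "\<exists>a \<in> univ U. \<forall>p \<in> \<Psi>0. sat U (s(i := a)) p"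
      unfolding J(3) ball_simps using J(1) \<psi>(2) by (intro bexI[of _ "s' i"] ballI) (auto simp: subset_iff)
  qed (use \<psi>(1) in auto)
  then obtain a where a: "a \<in> univ U" "\<forall>\<Phi>0 \<in> ?I. sat U (s(i := a)) (\<psi> \<Phi>0)"
    unfolding ball_simps by blast
  then have "\<forall>\<Phi>0 \<in> ?I. good (s(i := a)) \<Phi>0" using \<psi>(2) by blast
  then have "\<forall>\<Phi>0 \<subseteq> \<Phi>. finite \<Phi>0 \<longrightarrow> good (s(i := a)) \<Phi>0" by simp
  then show ?thesis unfolding good_def by (rule bexI[OF _ a(1)])
qed

text \<open>Saturation speaks of one variable, so the variables in \<open>V\<close> are fixed one
  after the other, each time preserving finite satisfiability. The limit assignment satisfies every
  formula, as a formula sees only finitely many variables, all of which are final from some stage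
  on. Variables outside \<open>V\<close> act as parameters.\<close>

lemma compactness:
  assumes M: "monster_model L T \<kappa> U" and s: "range s \<subseteq> univ U" and \<Phi>: "\<Phi> \<subseteq> formulas L"
    and fin: "\<And>\<Phi>0. \<Phi>0 \<subseteq> \<Phi> \<Longrightarrow> finite \<Phi>0 \<Longrightarrow>
      \<exists>s'. range s' \<subseteq> univ U \<and> (\<forall>j. j \<notin> V \<longrightarrow> s' j = s j) \<and> (\<forall>\<phi> \<in> \<Phi>0. sat U s' \<phi>)"
  shows "\<exists>s'. range s' \<subseteq> univ U \<and> (\<forall>j. j \<notin> V \<longrightarrow> s' j = s j) \<and> (\<forall>\<phi> \<in> \<Phi>. sat U s' \<phi>)"
proof -
  define fs where "fs V s \<longleftrightarrow> (\<forall>\<Phi>0 \<subseteq> \<Phi>. finite \<Phi>0 \<longrightarrow>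
      (\<exists>s'. range s' \<subseteq> univ U \<and> (\<forall>j. j \<notin> V \<longrightarrow> s' j = s j) \<and> (\<forall>\<phi> \<in> \<Phi>0. sat U s' \<phi>)))" for V s
  have fs_step: "\<exists>a \<in> univ U. fs (V - {i}) (s(i := a))" if "fs V s" "range s \<subseteq> univ U" "i \<in> V" for V s i
    unfolding fs_def
  proof (rule compactness_step[OF M that(2) \<Phi> that(3)])
    fix \<Phi>0 assume "\<Phi>0 \<subseteq> \<Phi>" "finite \<Phi>0"
    then show "\<exists>s'. range s' \<subseteq> univ U \<and> (\<forall>j. j \<notin> V \<longrightarrow> s' j = s j) \<and> (\<forall>\<phi> \<in> \<Phi>0. sat U s' \<phi>)"
      using that(1) unfolding fs_def by simp
  qed
  have fs0: "fs V s" unfolding fs_def using fin by simp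
  have step: "\<exists>s'. (fs (V \<inter> {Suc n..}) s' \<and> range s' \<subseteq> univ U) \<and> (\<forall>j. j \<notin> V \<or> j \<noteq> n \<longrightarrow> s' j = s j)"
    if fsn: "fs (V \<inter> {n..}) s" "range s \<subseteq> univ U" for n s
  proof (cases "n \<in> V")
    case True
    have eq: "V \<inter> {n..} - {n} = V \<inter> {Suc n..}" by auto
    obtain a where a: "a \<in> univ U" "fs (V \<inter> {Suc n..}) (s(n := a))"
      using fs_step[OF fsn, of n] True unfolding eq by auto
    moreover have "range (s(n := a)) \<subseteq> univ U" using fsn a(1) by auto
    ultimately show ?thesis using True by (intro exI[of _ "s(n := a)"]) simp
  next
    case False
    then have "V \<inter> {n..} = V \<inter> {Suc n..}" by (auto simp: Suc_le_eq order_le_less)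
    then show ?thesis using fsn by (intro exI[of _ s]) simp
  qed
  have "\<exists>S. \<forall>n. ((fs (V \<inter> {n..}) (S n) \<and> range (S n) \<subseteq> univ U) \<and> (n = 0 \<longrightarrow> S n = s)) \<and>
      (\<forall>j. j \<notin> V \<or> j \<noteq> n \<longrightarrow> S (Suc n) j = S n j)"
  proof (rule dependent_nat_choice[where
        P="\<lambda>n x. (fs (V \<inter> {n..}) x \<and> range x \<subseteq> univ U) \<and> (n = 0 \<longrightarrow> x = s)"
        and Q="\<lambda>n x y. \<forall>j. j \<notin> V \<or> j \<noteq> n \<longrightarrow> y j = x j"])
    show "\<exists>x. (fs (V \<inter> {0..}) x \<and> range x \<subseteq> univ U) \<and> ((0::nat) = 0 \<longrightarrow> x = s)" using fs0 s by simp
  qed (use step in simp)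
  then obtain S where S': "\<forall>n. ((fs (V \<inter> {n..}) (S n) \<and> range (S n) \<subseteq> univ U) \<and> (n = 0 \<longrightarrow> S n = s)) \<and>
      (\<forall>j. j \<notin> V \<or> j \<noteq> n \<longrightarrow> S (Suc n) j = S n j)" ..
  have S0: "S 0 = s" and S: "\<And>n. fs (V \<inter> {n..}) (S n)" and Su: "\<And>n. range (S n) \<subseteq> univ U"
    and SS: "\<And>n j. j \<notin> V \<or> j \<noteq> n \<Longrightarrow> S (Suc n) j = S n j"
    using S' by simp_all
  define s' where "s' j = S (Suc j) j" for j
  have later: "S n j = s' j" if "j < n" for n j
    using that by (induction n) (auto simp: less_Suc_eq s'_def SS)
  have outside: "S n j = s j" if "j \<notin> V" for n j
    using that by (induction n) (auto simp: SS S0)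
  have "sat U s' \<phi>" if \<phi>: "\<phi> \<in> \<Phi>" for \<phi>
  proof -
    obtain n where n: "\<forall>j \<in> free_vars \<phi>. j < n"
      using finite_free_vars finite_nat_set_iff_bounded by metis
    obtain s2 where s2: "\<forall>j. j \<notin> V \<inter> {n..} \<longrightarrow> s2 j = S n j" "sat U s2 \<phi>"
      using S[of n, unfolded fs_def, rule_format, of "{\<phi>}"] \<phi> by auto
    have "sat U s' \<phi> = sat U s2 \<phi>"
      by (rule sat_cong) (use n s2 later in auto)
    then show ?thesis using s2 by simp
  qed
  moreover have "range s' \<subseteq> univ U"
    using Su unfolding s'_def by blast
  moreover have "s' j = s j" if "j \<notin> V" for j using that outside by (simp add: s'_def)
  ultimately show ?thesis by blast
qed

section \<open>Automorphisms and homogeneity for sequences\<close>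

lemma automorphism_eval:
  assumes "is_struct L U" "automorphism L U g" "range s \<subseteq> univ U" "wf_tm L t"
  shows "eval U s t \<in> univ U \<and> eval U (\<lambda>j. g (s j)) t = g (eval U s t)"
  using assms(4)
proof (induction t)
  case (Var i)
  then show ?case using assms by auto
next
  case (App f ts)
  have tup: "map (eval U s) ts \<in> tuples U (farity L f)"
    using App by (auto simp: tuples_def)
  have "map (eval U (\<lambda>j. g (s j))) ts = map g (map (eval U s) ts)"
    using App by auto
  then have "eval U (\<lambda>j. g (s j)) (App f ts) = fint U f (map g (map (eval U s) ts))"
    by (metis eval.simps(2))
  then show ?case using tup App.prems assms(1,2)
    by (simp add: is_struct_def automorphism_def del: map_map)
qed

lemma automorphism_sat:
  assumes "is_struct L U" "automorphism L U g" "range s \<subseteq> univ U" "wf_fm L \<phi>"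
  shows "sat U (\<lambda>j. g (s j)) \<phi> \<longleftrightarrow> sat U s \<phi>"
  using assms(3,4)
proof (induction \<phi> arbitrary: s)
  case (Eq t u)
  have "inj_on g (univ U)" using assms(2) by (simp add: automorphism_def bij_betw_def)
  moreover have "eval U s t \<in> univ U" "eval U (\<lambda>j. g (s j)) t = g (eval U s t)"
    "eval U s u \<in> univ U" "eval U (\<lambda>j. g (s j)) u = g (eval U s u)"
    using automorphism_eval[OF assms(1,2) Eq(1)] Eq(2) by auto
  ultimately show ?case by (simp only: sat.simps inj_on_eq_iff)
next
  case (Rel r ts)
  have tup: "map (eval U s) ts \<in> tuples U (rarity L r)"
    using Rel automorphism_eval[OF assms(1,2)] by (auto simp: tuples_def)
  have "map (eval U (\<lambda>j. g (s j))) ts = map g (map (eval U s) ts)"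
    using Rel automorphism_eval[OF assms(1,2)] by auto
  then have "sat U (\<lambda>j. g (s j)) (Rel r ts) = rint U r (map g (map (eval U s) ts))"
    by (metis sat.simps(2))
  then show ?case using tup Rel.prems assms(2) by (simp add: automorphism_def del: map_map)
next
  case (Exi i \<phi>)
  have "g ` univ U = univ U" using assms(2) by (simp add: automorphism_def bij_betw_def)
  have "sat U ((\<lambda>j. g (s j))(i := g a)) \<phi> \<longleftrightarrow> sat U (s(i := a)) \<phi>" if "a \<in> univ U" for a
  proof -
    have "(\<lambda>j. g (s j))(i := g a) = (\<lambda>j. g ((s(i := a)) j))" by auto
    moreover have "range (s(i := a)) \<subseteq> univ U" using Exi.prems that by auto
    ultimately show ?thesis using Exi.IH[of "s(i := a)"] Exi.prems by (simp only: wf_fm.simps)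
  qed
  then have "(\<exists>b \<in> g ` univ U. sat U ((\<lambda>j. g (s j))(i := b)) \<phi>) \<longleftrightarrow> (\<exists>a \<in> univ U. sat U (s(i := a)) \<phi>)"
    by (simp only: bex_simps) blast
  then show ?case using \<open>g ` univ U = univ U\<close> by (simp only: sat.simps)
qed auto

lemma homogeneity:
  assumes M: "monster_model L T \<kappa> U" and s: "range s \<subseteq> univ U" "range s' \<subseteq> univ U"
    and eq: "\<And>\<phi>. \<phi> \<in> formulas L \<Longrightarrow> sat U s \<phi> \<longleftrightarrow> sat U s' \<phi>"
  shows "\<exists>g. automorphism L U g \<and> (\<forall>i. g (s i) = s' i)"
proof -
  \<comment> \<open>\<open>h\<close> sends \<open>s i\<close> to \<open>s' i\<close>. This is well
    defined because the two assignments agree on the formulas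
    \<open>Eq (Var j) (Var i)\<close>.\<close>
  define h where "h x = s' (SOME i. s i = x)" for x
  have h: "h (s i) = s' i" for i
  proof -
    have "s (SOME j. s j = s i) = s i" by (rule someI) simp
    then have "sat U s (Eq (Var (SOME j. s j = s i)) (Var i))" by simp
    moreover have "Eq (Var (SOME j. s j = s i)) (Var i) \<in> formulas L" by (simp add: formulas_def)
    ultimately show ?thesis unfolding h_def using eq by fastforce
  qed
  have "partial_elementary L U (range s) h"
    unfolding partial_elementary_def
  proof (intro conjI ballI)
    show "h ` range s \<subseteq> univ U" using h s by auto
    fix a \<phi> assume a: "a \<in> lists (range s)" and \<phi>: "\<phi> \<in> formulas_in L (length a)"
    have "\<forall>k<length a. \<exists>i. a ! k = s i" using a by (force simp: lists_eq_set dest: nth_mem)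
    then obtain f where f: "\<And>k. k < length a \<Longrightarrow> a ! k = s (f k)" by metis
    have fv: "free_vars \<phi> \<subseteq> {..<length a}" and fm: "\<phi> \<in> formulas L"
      using \<phi> by (auto simp: formulas_in_def)
    have "holds U \<phi> a = sat U s (ren f \<phi>)"
      unfolding holds_def sat_ren by (rule sat_cong) (use fv f in auto)
    also have "\<dots> = sat U s' (ren f \<phi>)" by (rule eq) (rule ren_formulas[OF fm])
    also have "\<dots> = holds U \<phi> (map h a)"
      unfolding holds_def sat_ren by (rule sat_cong) (use fv f h in auto)
    finally show "holds U \<phi> a \<longleftrightarrow> holds U \<phi> (map h a)" .
  qed
  moreover have "|range s| <o \<kappa>" by (rule countable_less_card[OF M]) simp
  ultimately obtain g where "automorphism L U g" "\<forall>a \<in> range s. g a = h a"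
    using M s unfolding monster_model_def strongly_homogeneous_def by blast
  then show ?thesis using h by auto
qed

section \<open>Definable predicates on tuples\<close>

text \<open>Interleaving lets one sequence of points serve two predicates at once, or carry
  parameters next to unknowns.\<close>

definition weave :: "(nat \<Rightarrow> 'p) \<Rightarrow> (nat \<Rightarrow> 'p) \<Rightarrow> nat \<Rightarrow> 'p" where
  "weave u v j = (if even j then u (j div 2) else v (j div 2))"

definition vl :: "('l \<Rightarrow> 'p) \<Rightarrow> 'p + 'l \<Rightarrow> 'p" where
  "vl f a = (case a of Inl p \<Rightarrow> p | Inr l \<Rightarrow> f l)"

lemma vl_simps [simp]: "vl f (Inl p) = p" "vl f (Inr l) = f l"
  by (simp_all add: vl_def)

text \<open>The points are tuples of a fixed length of a monster model, \<open>D\<close> consists of the predicates on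
  sequences of points that are definable without parameters, and \<open>E\<close> is a formula with the order
  property.\<close>

locale tuple_geometry =
  fixes P :: "'p set" and D :: "((nat \<Rightarrow> 'p) \<Rightarrow> bool) set" and E :: "'p \<Rightarrow> 'p \<Rightarrow> bool"
  assumes P_nonempty: "P \<noteq> {}"
    and D_neg: "Q \<in> D \<Longrightarrow> (\<lambda>v. \<not> Q v) \<in> D"
    and D_conj: "Q \<in> D \<Longrightarrow> Q' \<in> D \<Longrightarrow> (\<lambda>v. Q v \<and> Q' v) \<in> D"
    and D_ex: "Q \<in> D \<Longrightarrow> (\<lambda>v. \<exists>a \<in> P. Q (case_nat a v)) \<in> D"
    and D_ren: "Q \<in> D \<Longrightarrow> (\<lambda>v. Q (\<lambda>j. v (f j))) \<in> D"
    and D_eq: "(\<lambda>v. v 0 = v 1) \<in> D"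
    and D_E: "(\<lambda>v. E (v 0) (v 1)) \<in> D"
    and D_support: "Q \<in> D \<Longrightarrow>
      \<exists>n. \<forall>v w. range v \<subseteq> P \<longrightarrow> range w \<subseteq> P \<longrightarrow> (\<forall>i<n. v i = w i) \<longrightarrow> Q v = Q w"
    and D_compact: "S \<subseteq> D \<Longrightarrow> range v \<subseteq> P \<Longrightarrow>
      (\<And>S0. S0 \<subseteq> S \<Longrightarrow> finite S0 \<Longrightarrow>
         \<exists>w. range w \<subseteq> P \<and> (\<forall>j. j \<notin> V \<longrightarrow> w j = v j) \<and> (\<forall>Q \<in> S0. Q w)) \<Longrightarrow>
      \<exists>w. range w \<subseteq> P \<and> (\<forall>j. j \<notin> V \<longrightarrow> w j = v j) \<and> (\<forall>Q \<in> S. Q w)"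
    and D_homog: "range v \<subseteq> P \<Longrightarrow> range w \<subseteq> P \<Longrightarrow> (\<And>Q. Q \<in> D \<Longrightarrow> Q v = Q w) \<Longrightarrow>
      \<exists>\<sigma>. bij_betw \<sigma> P P \<and> (\<forall>Q \<in> D. \<forall>u. range u \<subseteq> P \<longrightarrow> Q (\<lambda>j. \<sigma> (u j)) = Q u) \<and> (\<forall>j. \<sigma> (v j) = w j)"
    and D_nip: "Q \<in> D \<Longrightarrow>
      \<not> (\<exists>w. (\<forall>i. range (w i) \<subseteq> P) \<and>
           (\<forall>I :: nat set. \<exists>u. range u \<subseteq> P \<and> (\<forall>i. Q (weave u (w i)) \<longleftrightarrow> i \<in> I)))"
    and order_chain: "\<exists>t. range t \<subseteq> P \<and> (\<forall>i j :: nat. E (t i) (t j) \<longleftrightarrow> i < j)"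
begin

text \<open>Definability over \<open>A\<close> for predicates of points that are named by labels of
  any type. For each argument place of \<open>Q\<close> the sequence \<open>a\<close> says whether
  it holds a parameter or the point with a given label; this keeps arithmetic with variable indices
  out of the later arguments. Only assignments into \<open>P\<close> are described.\<close>

definition dfn :: "'p set \<Rightarrow> (('l \<Rightarrow> 'p) \<Rightarrow> bool) \<Rightarrow> bool" where
  "dfn A X \<longleftrightarrow> (\<exists>Q \<in> D. \<exists>a. (\<forall>j. a j \<in> Inl ` (A \<inter> P) \<union> range Inr) \<and>
     (\<forall>f. range f \<subseteq> P \<longrightarrow> X f = Q (\<lambda>j. vl f (a j))))"

section \<open>Closure properties of definability\<close>

lemma range_into: "range f \<subseteq> P \<Longrightarrow> f x \<in> P"
  by blast

lemma dfnI:
  assumes "Q \<in> D" "\<And>j. a j \<in> Inl ` (A \<inter> P) \<union> range Inr"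
    "\<And>f. range f \<subseteq> P \<Longrightarrow> X f = Q (\<lambda>j. vl f (a j))"
  shows "dfn A X"
  unfolding dfn_def using assms by blast

lemma dfnE:
  assumes "dfn A X"
  obtains Q a where "Q \<in> D" "\<And>j. a j \<in> Inl ` (A \<inter> P) \<union> range Inr"
    "\<And>f. range f \<subseteq> P \<Longrightarrow> X f = Q (\<lambda>j. vl f (a j))"
  using assms unfolding dfn_def by blast

lemma vl_in_P: "range f \<subseteq> P \<Longrightarrow> a \<in> Inl ` (A \<inter> P) \<union> range Inr \<Longrightarrow> vl f a \<in> P"
  by (auto simp: vl_def split: sum.splits)

lemma dfn_mono:
  assumes "dfn A X" "A \<subseteq> B"
  shows "dfn B X"
proof -
  obtain Q a where Q: "Q \<in> D" and a: "\<And>j. a j \<in> Inl ` (A \<inter> P) \<union> range Inr"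
    and X: "\<And>f. range f \<subseteq> P \<Longrightarrow> X f = Q (\<lambda>j. vl f (a j))"
    using assms(1) by (rule dfnE) blast
  have "a j \<in> Inl ` (B \<inter> P) \<union> range Inr" for j using a[of j] assms(2) by blast
  then show ?thesis by (rule dfnI[OF Q]) (rule X)
qed

lemma dfn_cong: "dfn A X \<Longrightarrow> (\<And>f. range f \<subseteq> P \<Longrightarrow> X f = Y f) \<Longrightarrow> dfn A Y"
  unfolding dfn_def by simp

lemma dfn_neg:
  assumes "dfn A X"
  shows "dfn A (\<lambda>f. \<not> X f)"
proof -
  obtain Q a where Q: "Q \<in> D" and a: "\<And>j. a j \<in> Inl ` (A \<inter> P) \<union> range Inr"
    and X: "\<And>f. range f \<subseteq> P \<Longrightarrow> X f = Q (\<lambda>j. vl f (a j))"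
    using assms(1) by (rule dfnE) blast
  show ?thesis by (rule dfnI[OF D_neg[OF Q] a]) (simp add: X)
qed

lemma dfn_conj:
  assumes "dfn A X" "dfn A Y"
  shows "dfn A (\<lambda>f. X f \<and> Y f)"
proof -
  obtain Q a where Q: "Q \<in> D" and a: "\<And>j. a j \<in> Inl ` (A \<inter> P) \<union> range Inr"
    and X: "\<And>f. range f \<subseteq> P \<Longrightarrow> X f = Q (\<lambda>j. vl f (a j))"
    using assms(1) by (rule dfnE) blast
  obtain Q' a' where Q': "Q' \<in> D" and a': "\<And>j. a' j \<in> Inl ` (A \<inter> P) \<union> range Inr"
    and Y: "\<And>f. range f \<subseteq> P \<Longrightarrow> Y f = Q' (\<lambda>j. vl f (a' j))"
    using assms(2) by (rule dfnE) blast
  have "(\<lambda>v. Q (\<lambda>j. v (2 * j)) \<and> Q' (\<lambda>j. v (2 * j + 1))) \<in> D"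
    using D_ren[OF Q, of "\<lambda>j. 2 * j"] D_ren[OF Q', of "\<lambda>j. 2 * j + 1"] by (rule D_conj)
  then show ?thesis
  proof (rule dfnI[where a="weave a a'"])
    show "weave a a' j \<in> Inl ` (A \<inter> P) \<union> range Inr" for j
      unfolding weave_def using a a' by simp
  qed (simp add: X Y weave_def)
qed

lemma dfn_E:
  assumes "s \<in> Inl ` (A \<inter> P) \<union> range Inr" "t \<in> Inl ` (A \<inter> P) \<union> range Inr"
  shows "dfn A (\<lambda>f. E (vl f s) (vl f t))"
  by (rule dfnI[OF D_E, of "\<lambda>j. if j = 0 then s else t"]) (use assms in auto)

lemma dfn_eq:
  assumes "s \<in> Inl ` (A \<inter> P) \<union> range Inr" "t \<in> Inl ` (A \<inter> P) \<union> range Inr"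
  shows "dfn A (\<lambda>f. vl f s = vl f t)"
  by (rule dfnI[OF D_eq, of "\<lambda>j. if j = 0 then s else t"]) (use assms in auto)

lemma dfn_True: "dfn A (\<lambda>f. True)"
  by (rule dfn_cong[OF dfn_eq[of "Inr undefined" A "Inr undefined"]]) auto

lemma dfn_const: "dfn A (\<lambda>f. b)"
  using dfn_True dfn_neg[OF dfn_True] by (cases b) auto

lemma dfn_disj: "dfn A X \<Longrightarrow> dfn A Y \<Longrightarrow> dfn A (\<lambda>f. X f \<or> Y f)"
  by (rule dfn_cong[OF dfn_neg[OF dfn_conj[OF dfn_neg dfn_neg]]]) auto

lemma dfn_imp: "dfn A X \<Longrightarrow> dfn A Y \<Longrightarrow> dfn A (\<lambda>f. X f \<longrightarrow> Y f)"
  by (rule dfn_cong[OF dfn_disj[OF dfn_neg]]) auto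

lemma dfn_iff: "dfn A X \<Longrightarrow> dfn A Y \<Longrightarrow> dfn A (\<lambda>f. X f \<longleftrightarrow> Y f)"
  by (rule dfn_cong[OF dfn_conj[OF dfn_imp[of A X Y] dfn_imp[of A Y X]]]) auto

lemma dfn_ball:
  assumes "finite I" "\<And>i. i \<in> I \<Longrightarrow> dfn A (X i)"
  shows "dfn A (\<lambda>f. \<forall>i \<in> I. X i f)"
  using assms by (induction I rule: finite_induct) (auto intro: dfn_conj dfn_True)

lemma dfn_ex:
  assumes "dfn A X"
  shows "dfn A (\<lambda>f. \<exists>p \<in> P. X (f(l := p)))"
proof -
  obtain Q a where Q: "Q \<in> D" and a: "\<And>j. a j \<in> Inl ` (A \<inter> P) \<union> range Inr"
    and X: "\<And>f. range f \<subseteq> P \<Longrightarrow> X f = Q (\<lambda>j. vl f (a j))"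
    using assms(1) by (rule dfnE) blast
  \<comment> \<open>Places that hold the label \<open>l\<close> read the quantified point, which
    \<open>case_nat\<close> puts in front; all other places are shifted past it.\<close>
  define g where "g j = (if a j = Inr l then 0 else Suc j)" for j
  show ?thesis
  proof (rule dfnI[OF D_ex[OF D_ren[OF Q, of g]], of a])
    fix f :: "'a \<Rightarrow> 'p" assume f: "range f \<subseteq> P"
    have "vl (f(l := p)) (a j) = case_nat p (\<lambda>j. vl f (a j)) (g j)" for p j
      by (auto simp: g_def vl_def split: sum.splits)
    moreover have "X (f(l := p)) = Q (\<lambda>j. vl (f(l := p)) (a j))" if "p \<in> P" for p
      using f that by (intro X) auto
    ultimately show "(\<exists>p \<in> P. X (f(l := p))) = (\<exists>p \<in> P. Q (\<lambda>j. case_nat p (\<lambda>j. vl f (a j)) (g j)))"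
      by simp
  qed (rule a)
qed

lemma dfn_Ex_finite:
  assumes "finite S" "dfn A X"
  shows "dfn A (\<lambda>f. \<exists>g. range g \<subseteq> P \<and> (\<forall>l. l \<notin> S \<longrightarrow> g l = f l) \<and> X g)"
  using assms(1)
proof (induction S rule: finite_induct)
  case empty
  show ?case
  proof (rule dfn_cong[OF assms(2)])
    fix f :: "'a \<Rightarrow> 'p" assume "range f \<subseteq> P"
    moreover have "g = f" if "\<forall>l. g l = f l" for g using that by auto
    ultimately show "X f = (\<exists>g. range g \<subseteq> P \<and> (\<forall>l. l \<notin> {} \<longrightarrow> g l = f l) \<and> X g)" by auto
  qed
next
  case (insert x S)
  show ?case
  proof (rule dfn_cong[OF dfn_ex[OF insert.IH, of x]])
    fix f :: "'a \<Rightarrow> 'p" assume f: "range f \<subseteq> P"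
    show "(\<exists>p \<in> P. \<exists>g. range g \<subseteq> P \<and> (\<forall>l. l \<notin> S \<longrightarrow> g l = (f(x := p)) l) \<and> X g) \<longleftrightarrow>
        (\<exists>g. range g \<subseteq> P \<and> (\<forall>l. l \<notin> insert x S \<longrightarrow> g l = f l) \<and> X g)" (is "?l \<longleftrightarrow> ?r")
    proof
      assume ?l
      then show ?r by (metis fun_upd_apply insert_iff)
    next
      assume ?r
      then obtain g where g: "range g \<subseteq> P" "\<forall>l. l \<notin> insert x S \<longrightarrow> g l = f l" "X g" by blast
      then show ?l by (intro bexI[of _ "g x"] exI[of _ g]) auto
    qed
  qed
qed

lemma dfn_subst:
  assumes "dfn A X" "\<And>l. h l \<in> Inl ` (A \<inter> P) \<union> range Inr"
  shows "dfn A (\<lambda>f. X (\<lambda>l. vl f (h l)))"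
proof -
  obtain Q a where Q: "Q \<in> D" and a: "\<And>j. a j \<in> Inl ` (A \<inter> P) \<union> range Inr"
    and X: "\<And>f. range f \<subseteq> P \<Longrightarrow> X f = Q (\<lambda>j. vl f (a j))"
    using assms(1) by (rule dfnE) blast
  define a' where "a' j = (case a j of Inl p \<Rightarrow> Inl p | Inr l \<Rightarrow> h l)" for j
  show ?thesis
  proof (rule dfnI[OF Q, of a'])
    show "a' j \<in> Inl ` (A \<inter> P) \<union> range Inr" for j
      unfolding a'_def using a[of j] assms(2) by (auto split: sum.splits)
    fix f :: "'b \<Rightarrow> 'p" assume f: "range f \<subseteq> P"
    have "range (\<lambda>l. vl f (h l)) \<subseteq> P" using vl_in_P[OF f assms(2)] by blast
    moreover have "vl (\<lambda>l. vl f (h l)) (a j) = vl f (a' j)" for j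
      by (auto simp: a'_def vl_def split: sum.splits)
    ultimately show "X (\<lambda>l. vl f (h l)) = Q (\<lambda>j. vl f (a' j))" by (simp add: X)
  qed
qed

lemma dfn_reindex: "dfn A X \<Longrightarrow> dfn A (\<lambda>f. X (\<lambda>l. f (h l)))"
  using dfn_subst[of A X "\<lambda>l. Inr (h l)"] by simp

lemma dfn_support:
  assumes "dfn A X"
  shows "\<exists>S. finite S \<and> (\<forall>f g. range f \<subseteq> P \<longrightarrow> range g \<subseteq> P \<longrightarrow> (\<forall>l \<in> S. f l = g l) \<longrightarrow> X f = X g)"
proof -
  obtain Q a where Q: "Q \<in> D" and a: "\<And>j. a j \<in> Inl ` (A \<inter> P) \<union> range Inr"
    and X: "\<And>f. range f \<subseteq> P \<Longrightarrow> X f = Q (\<lambda>j. vl f (a j))"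
    using assms(1) by (rule dfnE) blast
  obtain n where n: "\<And>v w. range v \<subseteq> P \<Longrightarrow> range w \<subseteq> P \<Longrightarrow> (\<forall>i<n. v i = w i) \<Longrightarrow> Q v = Q w"
    using D_support[OF Q] by blast
  define S where "S = {l. \<exists>j<n. a j = Inr l}"
  have "S \<subseteq> (\<lambda>j. projr (a j)) ` {..<n}" unfolding S_def by (force simp: image_iff)
  then have "finite S" using finite_surj by blast
  moreover have "X f = X g" if f: "range f \<subseteq> P" and g: "range g \<subseteq> P" and eq: "\<forall>l \<in> S. f l = g l" for f g
  proof -
    have "Q (\<lambda>j. vl f (a j)) = Q (\<lambda>j. vl g (a j))"
    proof (rule n)
      show "\<forall>i<n. vl f (a i) = vl g (a i)"
        using eq by (auto simp: vl_def S_def split: sum.splits)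
    qed (use vl_in_P[OF f a] vl_in_P[OF g a] in blast)+
    then show ?thesis using X f g by simp
  qed
  ultimately show ?thesis by blast
qed

text \<open>\<open>Q\<close> depends on finitely many argument places, so the parameters at all
  later places can be traded for an arbitrary label.\<close>

lemma dfn_finite_params:
  assumes "dfn A X"
  shows "\<exists>A0. finite A0 \<and> A0 \<subseteq> A \<inter> P \<and> dfn A0 X"
proof -
  obtain Q a where Q: "Q \<in> D" and a: "\<And>j. a j \<in> Inl ` (A \<inter> P) \<union> range Inr"
    and X: "\<And>f. range f \<subseteq> P \<Longrightarrow> X f = Q (\<lambda>j. vl f (a j))"
    using assms(1) by (rule dfnE) blast
  obtain n where n: "\<And>v w. range v \<subseteq> P \<Longrightarrow> range w \<subseteq> P \<Longrightarrow> (\<forall>i<n. v i = w i) \<Longrightarrow> Q v = Q w"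
    using D_support[OF Q] by blast
  define a' where "a' j = (if j < n then a j else Inr undefined)" for j
  define A0 where "A0 = {p. \<exists>j<n. a j = Inl p}"
  have "A0 \<subseteq> (\<lambda>j. projl (a j)) ` {..<n}" unfolding A0_def by (force simp: image_iff)
  then have "finite A0" using finite_surj by blast
  moreover have A0: "A0 \<subseteq> A \<inter> P"
  proof
    fix p assume "p \<in> A0"
    then obtain j where "a j = Inl p" by (auto simp: A0_def)
    then show "p \<in> A \<inter> P" using a[of j] by auto
  qed
  moreover have "dfn A0 X"
  proof (rule dfnI[OF Q, of a'])
    show a'': "a' j \<in> Inl ` (A0 \<inter> P) \<union> range Inr" for j
    proof (cases "j < n \<and> (\<exists>p. a j = Inl p)")
      case True
      then show ?thesis using A0 unfolding a'_def A0_def by auto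
    next
      case False
      then show ?thesis using a[of j] unfolding a'_def by auto
    qed
    fix f :: "'a \<Rightarrow> 'p" assume f: "range f \<subseteq> P"
    have "Q (\<lambda>j. vl f (a j)) = Q (\<lambda>j. vl f (a' j))"
      by (rule n) (use vl_in_P[OF f a] vl_in_P[OF f a''] in \<open>auto simp: a'_def\<close>)
    then show "X f = Q (\<lambda>j. vl f (a' j))" using X f by simp
  qed
  ultimately show ?thesis by blast
qed

section \<open>Automorphisms over a parameter set\<close>

definition Au :: "'p set \<Rightarrow> ('p \<Rightarrow> 'p) set" where
  "Au A = {\<sigma>. bij_betw \<sigma> P P \<and> (\<forall>Q \<in> D. \<forall>u. range u \<subseteq> P \<longrightarrow> Q (\<lambda>j. \<sigma> (u j)) = Q u) \<and> (\<forall>p \<in> A. \<sigma> p = p)}"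

lemma Au_P: "\<sigma> \<in> Au A \<Longrightarrow> p \<in> P \<Longrightarrow> \<sigma> p \<in> P"
  by (auto simp: Au_def bij_betw_def)

lemma Au_fix: "\<sigma> \<in> Au A \<Longrightarrow> p \<in> A \<Longrightarrow> \<sigma> p = p"
  by (auto simp: Au_def)

lemma Au_mono: "\<sigma> \<in> Au B \<Longrightarrow> A \<subseteq> B \<Longrightarrow> \<sigma> \<in> Au A"
  by (auto simp: Au_def)

lemma Au_D: "\<sigma> \<in> Au A \<Longrightarrow> Q \<in> D \<Longrightarrow> range u \<subseteq> P \<Longrightarrow> Q (\<lambda>j. \<sigma> (u j)) = Q u"
  unfolding Au_def by blast

lemma Au_id: "id \<in> Au A"
  by (auto simp: Au_def)

lemma Au_insertI: "\<sigma> \<in> Au A \<Longrightarrow> (\<And>p. p \<in> B \<Longrightarrow> \<sigma> p = p) \<Longrightarrow> \<sigma> \<in> Au (A \<union> B)"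
  by (auto simp: Au_def)

lemma Au_comp:
  assumes "\<sigma> \<in> Au A" "\<tau> \<in> Au A"
  shows "\<sigma> \<circ> \<tau> \<in> Au A"
proof -
  have "Q (\<lambda>j. \<sigma> (\<tau> (u j))) = Q u" if "Q \<in> D" "range u \<subseteq> P" for Q u
  proof -
    have "range (\<lambda>j. \<tau> (u j)) \<subseteq> P" using that Au_P[OF assms(2)] by auto
    then show ?thesis using Au_D[OF assms(1) that(1), of "\<lambda>j. \<tau> (u j)"] Au_D[OF assms(2) that] by simp
  qed
  then show ?thesis using assms bij_betw_trans[of \<tau> P P \<sigma> P] by (auto simp: Au_def)
qed

lemma Au_inv:
  assumes "\<sigma> \<in> Au A" "A \<subseteq> P"
  shows "\<exists>\<tau> \<in> Au A. \<forall>p \<in> P. \<tau> (\<sigma> p) = p \<and> \<sigma> (\<tau> p) = p"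
proof -
  define \<tau> where "\<tau> = inv_into P \<sigma>"
  have bij: "bij_betw \<sigma> P P" using assms by (simp add: Au_def)
  have 1: "\<tau> (\<sigma> p) = p" if "p \<in> P" for p
    unfolding \<tau>_def using bij_betw_inv_into_left[OF bij that] .
  have 2: "\<sigma> (\<tau> p) = p" if "p \<in> P" for p
    unfolding \<tau>_def using bij_betw_inv_into_right[OF bij that] .
  have bij': "bij_betw \<tau> P P" unfolding \<tau>_def by (rule bij_betw_inv_into[OF bij])
  have "Q (\<lambda>j. \<tau> (u j)) = Q u" if "Q \<in> D" "range u \<subseteq> P" for Q u
  proof -
    have "range (\<lambda>j. \<tau> (u j)) \<subseteq> P" using that bij' by (auto simp: bij_betw_def)
    then have "Q (\<lambda>j. \<sigma> (\<tau> (u j))) = Q (\<lambda>j. \<tau> (u j))"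
      using Au_D[OF assms(1) that(1), of "\<lambda>j. \<tau> (u j)"] by simp
    moreover have "\<sigma> (\<tau> (u j)) = u j" for j using 2 that by auto
    then have "(\<lambda>j. \<sigma> (\<tau> (u j))) = u" by (rule ext)
    ultimately show ?thesis by simp
  qed
  moreover have "\<tau> p = p" if "p \<in> A" for p
    using 1[of p] that assms by (auto simp: Au_def)
  ultimately have "\<tau> \<in> Au A" using bij' by (simp add: Au_def)
  then show ?thesis using 1 2 by blast
qed

lemma Au_dfn:
  assumes "\<sigma> \<in> Au A" "dfn A X" "range f \<subseteq> P"
  shows "X (\<lambda>l. \<sigma> (f l)) = X f"
proof -
  obtain Q a where Q: "Q \<in> D" and a: "\<And>j. a j \<in> Inl ` (A \<inter> P) \<union> range Inr"
    and X: "\<And>f. range f \<subseteq> P \<Longrightarrow> X f = Q (\<lambda>j. vl f (a j))"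
    using assms(2) by (rule dfnE) blast
  have "range (\<lambda>l. \<sigma> (f l)) \<subseteq> P" using assms Au_P by blast
  moreover have "vl (\<lambda>l. \<sigma> (f l)) (a j) = \<sigma> (vl f (a j))" for j
    using a[of j] assms(1) by (auto simp: Au_def)
  moreover have "range (\<lambda>j. vl f (a j)) \<subseteq> P" using vl_in_P[OF assms(3) a] by blast
  then have "Q (\<lambda>j. \<sigma> (vl f (a j))) = Q (\<lambda>j. vl f (a j))"
    using Au_D[OF assms(1) Q, of "\<lambda>j. vl f (a j)"] by simp
  ultimately show ?thesis using X assms(3) by simp
qed

lemma Au_E:
  assumes "\<sigma> \<in> Au A" "p \<in> P" "q \<in> P"
  shows "E (\<sigma> p) (\<sigma> q) = E p q"
  using Au_dfn[OF Au_mono[OF assms(1), of "{}"] dfn_E[of "Inr False" "{}" "Inr True"], of "\<lambda>b. if b then q else p"] assms(2,3)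
  by auto

section \<open>Compactness and homogeneity for labelled points\<close>

lemma countable_enumeration:
  assumes "countable A" "A \<subseteq> P"
  shows "\<exists>(u :: nat \<Rightarrow> 'p) e. range u \<subseteq> P \<and> (\<forall>p \<in> A. u (e p) = p) \<and> (range u \<subseteq> A \<or> A = {})"
proof (cases "A = {}")
  case True
  \<comment> \<open>For empty \<open>A\<close> the enumeration still has to consist of points, so it
    is constant at some point outside \<open>A\<close>.\<close>
  obtain p0 where "p0 \<in> P" using P_nonempty by blast
  then show ?thesis using True by (intro exI[of _ "\<lambda>_. p0"]) auto
next
  case False
  have "range (from_nat_into A) \<subseteq> A" using from_nat_into[OF False] by blast
  then show ?thesis
    using assms by (intro exI[of _ "from_nat_into A"] exI[of _ "to_nat_on A"]) auto
qed

lemma compactness_labels: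
  fixes \<X> :: "(('l::countable \<Rightarrow> 'p) \<Rightarrow> bool) set"
  assumes A: "countable A" "A \<subseteq> P" and dfn: "\<And>X. X \<in> \<X> \<Longrightarrow> dfn A X"
    and fin: "\<And>\<X>0. \<X>0 \<subseteq> \<X> \<Longrightarrow> finite \<X>0 \<Longrightarrow> \<exists>f. range f \<subseteq> P \<and> (\<forall>X \<in> \<X>0. X f)"
  shows "\<exists>f. range f \<subseteq> P \<and> (\<forall>X \<in> \<X>. X f)"
proof -
  obtain u :: "nat \<Rightarrow> 'p" and e
    where u': "range u \<subseteq> P \<and> (\<forall>p \<in> A. u (e p) = p) \<and> (range u \<subseteq> A \<or> A = {})"
    using countable_enumeration[OF A] by (elim exE)
  then have u: "range u \<subseteq> P" "range u \<subseteq> A \<or> A = {}" and ue: "\<And>p. p \<in> A \<Longrightarrow> u (e p) = p"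
    by simp_all
  \<comment> \<open>Odd places carry the enumerated parameters and stay fixed, even places carry the
    unknown labelled points. Accordingly \<open>D_compact\<close> is applied with the even places as
    variables.\<close>
  define enc :: "'p + 'l \<Rightarrow> nat" where "enc a = (case a of Inl p \<Rightarrow> 2 * e p + 1 | Inr l \<Rightarrow> 2 * to_nat l)" for a
  have "\<forall>X \<in> \<X>. \<exists>Q \<in> D. \<forall>v. range v \<subseteq> P \<longrightarrow> (\<forall>j. v (2 * j + 1) = u j) \<longrightarrow> Q v = X (\<lambda>l. v (enc (Inr l)))"
  proof
    fix X assume "X \<in> \<X>"
    then have "dfn A X" by (rule dfn)
    then obtain Q a where Q: "Q \<in> D" and a: "\<And>j. a j \<in> Inl ` (A \<inter> P) \<union> range Inr"
      and X: "\<And>f. range f \<subseteq> P \<Longrightarrow> X f = Q (\<lambda>j. vl f (a j))"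
      by (rule dfnE) blast
    have "Q (\<lambda>j. v (enc (a j))) = X (\<lambda>l. v (enc (Inr l)))"
      if v: "range v \<subseteq> P" "\<forall>j. v (2 * j + 1) = u j" for v
    proof -
      have "vl (\<lambda>l. v (enc (Inr l))) (a j) = v (enc (a j))" for j
        using a[of j] v(2) ue by (auto simp: enc_def)
      moreover have "range (\<lambda>l. v (enc (Inr l))) \<subseteq> P" using v(1) by auto
      ultimately show ?thesis using X by simp
    qed
    then show "\<exists>Q \<in> D. \<forall>v. range v \<subseteq> P \<longrightarrow> (\<forall>j. v (2 * j + 1) = u j) \<longrightarrow> Q v = X (\<lambda>l. v (enc (Inr l)))"
      using D_ren[OF Q, of "\<lambda>j. enc (a j)"] by (intro bexI[of _ "\<lambda>v. Q (\<lambda>j. v (enc (a j)))"]) auto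
  qed
  from this[unfolded Bex_def, THEN bchoice] obtain Q where Q: "\<And>X. X \<in> \<X> \<Longrightarrow> Q X \<in> D"
    "\<And>X v. X \<in> \<X> \<Longrightarrow> range v \<subseteq> P \<Longrightarrow> (\<forall>j. v (2 * j + 1) = u j) \<Longrightarrow> Q X v = X (\<lambda>l. v (enc (Inr l)))"
    by blast
  have "\<exists>w. range w \<subseteq> P \<and> (\<forall>j. j \<notin> Collect even \<longrightarrow> w j = weave u u j) \<and> (\<forall>q \<in> Q ` \<X>. q w)"
  proof (rule D_compact)
    show "Q ` \<X> \<subseteq> D" using Q(1) by blast
    show "range (weave u u) \<subseteq> P" using u by (auto simp: weave_def)
    fix S0 assume "S0 \<subseteq> Q ` \<X>" "finite S0"
    then obtain \<X>0 where X0: "\<X>0 \<subseteq> \<X>" "finite \<X>0" "S0 = Q ` \<X>0"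
      using finite_subset_image[of S0 Q \<X>] by blast
    obtain f where f: "range f \<subseteq> P" "\<forall>X \<in> \<X>0. X f" using fin[OF X0(1,2)] by blast
    define w where "w = weave (\<lambda>j. f (from_nat j)) u"
    have w: "range w \<subseteq> P" using f u by (auto simp: w_def weave_def)
    have "Q X w" if "X \<in> \<X>0" for X
    proof -
      have "Q X w = X (\<lambda>l. w (enc (Inr l)))" using X0 that w by (intro Q(2)) (auto simp: w_def weave_def)
      also have "(\<lambda>l. w (enc (Inr l))) = f" by (auto simp: w_def weave_def enc_def)
      finally show ?thesis using bspec[OF f(2) that] by (simp only:)
    qed
    then show "\<exists>w. range w \<subseteq> P \<and> (\<forall>j. j \<notin> Collect even \<longrightarrow> w j = weave u u j) \<and> (\<forall>Q \<in> S0. Q w)"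
      using w X0 by (intro exI[of _ w]) (auto simp: w_def weave_def)
  qed
  then obtain w where w: "range w \<subseteq> P" "\<forall>j. odd j \<longrightarrow> w j = weave u u j" "\<forall>X \<in> \<X>. Q X w" by auto
  have "X (\<lambda>l. w (enc (Inr l)))" if "X \<in> \<X>" for X
  proof -
    have "\<forall>j. w (2 * j + 1) = u j" using w(2) by (simp add: weave_def)
    then show ?thesis using Q(2)[OF that w(1)] w(3) that by simp
  qed
  then show ?thesis using w(1) by (intro exI[of _ "\<lambda>l. w (enc (Inr l))"]) auto
qed

lemma compactness_indexed:
  fixes K :: "'i \<Rightarrow> ('l::countable \<Rightarrow> 'p) \<Rightarrow> bool"
  assumes A: "countable A" "A \<subseteq> P" and dfn: "\<And>i. i \<in> I \<Longrightarrow> dfn A (K i)"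
    and fin: "\<And>J. J \<subseteq> I \<Longrightarrow> finite J \<Longrightarrow> \<exists>f. range f \<subseteq> P \<and> (\<forall>i \<in> J. K i f)"
  shows "\<exists>f. range f \<subseteq> P \<and> (\<forall>i \<in> I. K i f)"
proof -
  have "\<exists>f. range f \<subseteq> P \<and> (\<forall>Y \<in> K ` I. Y f)"
  proof (rule compactness_labels[OF A])
    show "dfn A Y" if "Y \<in> K ` I" for Y using that dfn by auto
    fix \<X>0 assume "\<X>0 \<subseteq> K ` I" "finite \<X>0"
    then obtain J where J: "J \<subseteq> I" "finite J" "\<X>0 = K ` J"
      using finite_subset_image[of \<X>0 K I] by blast
    show "\<exists>f. range f \<subseteq> P \<and> (\<forall>Y \<in> \<X>0. Y f)"
      using fin[OF J(1,2)] unfolding J(3) ball_simps .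
  qed
  then show ?thesis unfolding ball_simps .
qed

lemma homogeneity_labels:
  fixes f g :: "'l::countable \<Rightarrow> 'p"
  assumes A: "countable A" "A \<subseteq> P" and f: "range f \<subseteq> P" and g: "range g \<subseteq> P"
    and eq: "\<And>X. dfn A X \<Longrightarrow> X f \<Longrightarrow> X g"
  shows "\<exists>\<sigma> \<in> Au A. \<forall>l. \<sigma> (f l) = g l"
proof -
  obtain u :: "nat \<Rightarrow> 'p" and e
    where u': "range u \<subseteq> P \<and> (\<forall>p \<in> A. u (e p) = p) \<and> (range u \<subseteq> A \<or> A = {})"
    using countable_enumeration[OF A] by (elim exE)
  then have u: "range u \<subseteq> P" "range u \<subseteq> A \<or> A = {}" and ue: "\<And>p. p \<in> A \<Longrightarrow> u (e p) = p"
    by simp_all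
  define u' :: "nat \<Rightarrow> 'p + 'l" where "u' j = (if A = {} then Inr undefined else Inl (u j))" for j
  define a where "a = weave (\<lambda>j. Inr (from_nat j)) u'"
  have a: "a j \<in> Inl ` (A \<inter> P) \<union> range Inr" for j
  proof (cases "even j \<or> A = {}")
    case False
    then have "u (j div 2) \<in> A \<inter> P" using u by blast
    then show ?thesis using False by (simp add: a_def weave_def u'_def)
  qed (auto simp: a_def weave_def u'_def)
  have eq': "X f = X g" if "dfn A X" for X
    using eq[OF that] eq[OF dfn_neg[OF that]] by blast
  have "Q (\<lambda>j. vl f (a j)) = Q (\<lambda>j. vl g (a j))" if "Q \<in> D" for Q
    by (rule eq'[of "\<lambda>f. Q (\<lambda>j. vl f (a j))"]) (rule dfnI[OF that a], simp)
  moreover have "range (\<lambda>j. vl f (a j)) \<subseteq> P" "range (\<lambda>j. vl g (a j)) \<subseteq> P"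
    using vl_in_P[OF f a] vl_in_P[OF g a] by auto
  ultimately obtain \<sigma> where \<sigma>: "bij_betw \<sigma> P P" "\<forall>Q \<in> D. \<forall>u. range u \<subseteq> P \<longrightarrow> Q (\<lambda>j. \<sigma> (u j)) = Q u"
    and \<sigma>eq: "\<forall>j. \<sigma> (vl f (a j)) = vl g (a j)"
    using D_homog[of "\<lambda>j. vl f (a j)" "\<lambda>j. vl g (a j)"] by blast
  have "\<sigma> p = p" if "p \<in> A" for p
    using \<sigma>eq[rule_format, of "2 * e p + 1"] ue[OF that] that
    by (auto simp: a_def weave_def u'_def split: if_splits)
  then have "\<sigma> \<in> Au A" using \<sigma> by (simp add: Au_def)
  moreover have "\<sigma> (f l) = g l" for l
    using \<sigma>eq[rule_format, of "2 * to_nat l"] by (simp add: a_def weave_def)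
  ultimately show ?thesis by blast
qed

text \<open>\<open>D_nip\<close> excludes only infinite shattered families. If every finite length
  were shattered, compactness would give one infinite sequence \<open>w\<close> with a realisation
  of each finite subset, and a second use of compactness, over the points of \<open>w\<close>, would
  realise arbitrary subsets.\<close>

lemma finite_shattering_bound:
  fixes X :: "(('a::countable + 'b::countable) \<Rightarrow> 'p) \<Rightarrow> bool"
  assumes A: "countable A" "A \<subseteq> P" and X: "dfn A X"
  shows "\<exists>m :: nat. \<not> (\<exists>w y. (\<forall>i. range (w i) \<subseteq> P) \<and> (\<forall>I. range (y I) \<subseteq> P) \<and>
    (\<forall>I \<subseteq> {..<m}. \<forall>i<m. X (case_sum (w i) (y I)) \<longleftrightarrow> i \<in> I))"
proof (rule ccontr)
  assume "\<not> ?thesis"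
  then have ex: "\<exists>w y. (\<forall>i. range (w i) \<subseteq> P) \<and> (\<forall>I. range (y I) \<subseteq> P) \<and>
    (\<forall>I \<subseteq> {..<m}. \<forall>i<m. X (case_sum (w i) (y I)) \<longleftrightarrow> i \<in> I)" for m :: nat by simp
  \<comment> \<open>Finite subsets are coded by lists, which keeps the type of labels
    countable.\<close>
  define C where "C i xs = (\<lambda>f :: (nat \<times> 'a) + (nat list \<times> 'b) \<Rightarrow> 'p.
      X (\<lambda>l. f (case l of Inl a \<Rightarrow> Inl (i, a) | Inr b \<Rightarrow> Inr (xs, b))) \<longleftrightarrow> i \<in> set xs)" for i :: nat and xs
  have "\<exists>f. range f \<subseteq> P \<and> (\<forall>Y \<in> range (case_prod C). Y f)"
  proof (rule compactness_labels[OF A])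
    have "dfn A (C i xs)" for i xs
      unfolding C_def by (rule dfn_iff[OF dfn_reindex[OF X] dfn_const])
    then show "dfn A Y" if "Y \<in> range (case_prod C)" for Y
      using that by auto
    fix \<X>0 assume "\<X>0 \<subseteq> range (case_prod C)" "finite \<X>0"
    then obtain J where J: "finite J" "\<X>0 = case_prod C ` J"
      using finite_subset_image[of \<X>0 "case_prod C" UNIV] by blast
    define m where "m = Suc (Max (fst ` J \<union> (\<Union>x\<in>J. set (snd x))))"
    have m: "i < m" "set xs \<subseteq> {..<m}" if "(i, xs) \<in> J" for i xs
    proof -
      have "k < m" if "k \<in> fst ` J \<union> (\<Union>x\<in>J. set (snd x))" for k
        unfolding m_def using that J(1) by (auto intro!: le_imp_less_Suc Max_ge)
      then show "i < m" "set xs \<subseteq> {..<m}" using \<open>(i, xs) \<in> J\<close> by force+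
    qed
    obtain w y where w: "\<forall>i. range (w i) \<subseteq> P" and y: "\<forall>I. range (y I) \<subseteq> P"
      and wy: "\<forall>I \<subseteq> {..<m}. \<forall>i<m. X (case_sum (w i) (y I)) \<longleftrightarrow> i \<in> I"
      using ex[of m] by blast
    define f where "f l = (case l of Inl (i, a) \<Rightarrow> w i a | Inr (xs, b) \<Rightarrow> y (set xs) b)" for l
    have "w i a \<in> P" "y I b \<in> P" for i a I b using w y by blast+
    then have "range f \<subseteq> P" by (auto simp: f_def split: sum.splits)
    moreover have "C i xs f" if "(i, xs) \<in> J" for i xs
    proof -
      have "(\<lambda>l. f (case l of Inl a \<Rightarrow> Inl (i, a) | Inr b \<Rightarrow> Inr (xs, b))) = case_sum (w i) (y (set xs))"
        by (auto simp: f_def split: sum.splits)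
      then show ?thesis unfolding C_def using wy m[OF that] by auto
    qed
    ultimately show "\<exists>f. range f \<subseteq> P \<and> (\<forall>Y \<in> \<X>0. Y f)" using J by (intro exI[of _ f]) auto
  qed
  then obtain f where f: "range f \<subseteq> P" and fC': "\<forall>Y \<in> range (case_prod C). Y f" by (elim exE conjE)
  have fC: "C i xs f" for i xs using bspec[OF fC' rangeI[of _ "(i, xs)"]] by simp
  define w where "w i a = f (Inl (i, a))" for i a
  have w: "w i a \<in> P" for i a using f by (auto simp: w_def)
  obtain Q a where Q: "Q \<in> D" and a: "\<And>j. a j \<in> Inl ` (A \<inter> P) \<union> range Inr"
    and XQ: "\<And>f. range f \<subseteq> P \<Longrightarrow> X f = Q (\<lambda>j. vl f (a j))"
    using X by (rule dfnE) blast
  obtain u :: "nat \<Rightarrow> 'p" and e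
    where u': "range u \<subseteq> P \<and> (\<forall>p \<in> A. u (e p) = p) \<and> (range u \<subseteq> A \<or> A = {})"
    using countable_enumeration[OF A] by (elim exE)
  then have u: "range u \<subseteq> P" "range u \<subseteq> A \<or> A = {}" and ue: "\<And>p. p \<in> A \<Longrightarrow> u (e p) = p"
    by simp_all
  \<comment> \<open>The places are arranged for \<open>weave\<close>: odd ones read
    \<open>w i\<close>, even ones read \<open>v\<close>, which itself interleaves the parameters
    with the realisation \<open>y\<close>.\<close>
  define enc where "enc l = (case l of Inl p \<Rightarrow> 2 * (2 * e p) | Inr (Inl x) \<Rightarrow> 2 * to_nat x + 1
     | Inr (Inr y) \<Rightarrow> 2 * (2 * to_nat y + 1))" for l :: "'p + ('a + 'b)"
  have "\<exists>v. range v \<subseteq> P \<and> (\<forall>i. Q (\<lambda>j. weave v (\<lambda>n. w i (from_nat n)) (enc (a j))) \<longleftrightarrow> i \<in> I)" for I :: "nat set"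
  proof -
    define B where "B = A \<union> range (case_prod w)"
    have B: "countable B" "B \<subseteq> P" using A w by (auto simp: B_def)
    define K where "K i = (\<lambda>y :: 'b \<Rightarrow> 'p. X (\<lambda>l. vl y (case l of Inl x \<Rightarrow> Inl (w i x) | Inr b \<Rightarrow> Inr b)) \<longleftrightarrow> i \<in> I)" for i
    have "\<exists>y. range y \<subseteq> P \<and> (\<forall>Y \<in> range K. Y y)"
    proof (rule compactness_labels[OF B])
      have "dfn B X" using X by (rule dfn_mono) (simp add: B_def)
      then have "dfn B (K i)" for i
        unfolding K_def
      proof (rule dfn_iff[OF dfn_subst dfn_const])
        show "(case l of Inl x \<Rightarrow> Inl (w i x) | Inr b \<Rightarrow> Inr b) \<in> Inl ` (B \<inter> P) \<union> range Inr" for l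
          using w by (auto simp: B_def split: sum.splits)
      qed
      then show "dfn B Y" if "Y \<in> range K" for Y
        using that by auto
      fix \<X>0 assume "\<X>0 \<subseteq> range K" "finite \<X>0"
      then obtain J where J: "finite J" "\<X>0 = K ` J"
        using finite_subset_image[of \<X>0 K UNIV] by blast
      then obtain xs where xs: "set xs = J \<inter> I" using finite_list[of "J \<inter> I"] by blast
      define y where "y b = f (Inr (xs, b))" for b
      have "K i y" if "i \<in> J" for i
      proof -
        have "(\<lambda>l. vl y (case l of Inl x \<Rightarrow> Inl (w i x) | Inr b \<Rightarrow> Inr b)) =
            (\<lambda>l. f (case l of Inl a \<Rightarrow> Inl (i, a) | Inr b \<Rightarrow> Inr (xs, b)))"
          by (auto simp: y_def w_def split: sum.splits)
        then show ?thesis using fC[of i xs] xs that unfolding K_def C_def by auto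
      qed
      then show "\<exists>y. range y \<subseteq> P \<and> (\<forall>Y \<in> \<X>0. Y y)"
        using f J by (intro exI[of _ y]) (auto simp: y_def)
    qed
    then obtain y where y: "range y \<subseteq> P" "\<forall>Y \<in> range K. Y y" by (elim exE conjE)
    define v where "v = weave u (\<lambda>n. y (from_nat n))"
    have "range v \<subseteq> P" using range_into[OF u(1)] range_into[OF y(1)] by (auto simp: v_def weave_def)
    moreover have "Q (\<lambda>j. weave v (\<lambda>n. w i (from_nat n)) (enc (a j))) \<longleftrightarrow> i \<in> I" for i
    proof -
      have "range (case_sum (w i) y) \<subseteq> P" using w range_into[OF y(1)] by (auto split: sum.splits)
      moreover have "weave v (\<lambda>n. w i (from_nat n)) (enc (a j)) = vl (case_sum (w i) y) (a j)" for j
        using a[of j] ue by (auto simp: enc_def weave_def v_def split: sum.splits)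
      moreover have "(\<lambda>l. vl y (case l of Inl x \<Rightarrow> Inl (w i x) | Inr b \<Rightarrow> Inr b)) = case_sum (w i) y"
        by (auto split: sum.splits)
      ultimately show ?thesis using bspec[OF y(2) rangeI[of K i]] XQ unfolding K_def by simp
    qed
    ultimately show ?thesis by blast
  qed
  moreover have "range (\<lambda>n. w i (from_nat n)) \<subseteq> P" for i using w by auto
  ultimately have "\<exists>w. (\<forall>i. range (w i) \<subseteq> P) \<and> (\<forall>I :: nat set. \<exists>u. range u \<subseteq> P \<and>
      (\<forall>i. Q (\<lambda>j. weave u (w i) (enc (a j))) \<longleftrightarrow> i \<in> I))"
    by (intro exI[of _ "\<lambda>i n. w i (from_nat n)"] conjI allI)
  then show False
    using D_nip[OF D_ren[OF Q, of "\<lambda>j. enc (a j)"]] by blast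
qed

end

section \<open>Configurations without bad pairs\<close>

lemma increasing_selection:
  fixes S :: "nat set"
  assumes "finite S" "M \<le> card S"
  obtains h where "\<And>i j. i < j \<Longrightarrow> j < M \<Longrightarrow> h i < (h j :: nat)" "\<And>i. i < M \<Longrightarrow> h i \<in> S"
proof
  let ?h = "\<lambda>i. sorted_list_of_set S ! i"
  show "?h i < ?h j" if "i < j" "j < M" for i j
    using that assms sorted_wrt_nth_less[OF strict_sorted_list_of_set, of i j S] by simp
  show "?h i \<in> S" if "i < M" for i
    using that assms nth_mem[of i "sorted_list_of_set S"] by auto
qed

section \<open>The quasi-order that belongs to a configuration\<close>

context tuple_geometry
begin

text \<open>All points of the first kind of label are quantified at once. This stays definable
  because the support is finite: only finitely many of these labels need a quantifier.\<close>

lemma dfn_Ex: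
  fixes X :: "('a + 'b \<Rightarrow> 'p) \<Rightarrow> bool"
  assumes "dfn A X"
  shows "dfn A (\<lambda>f. \<exists>g. range g \<subseteq> P \<and> X (case_sum g f))"
proof -
  obtain S where S: "finite S"
    "\<forall>f g. range f \<subseteq> P \<longrightarrow> range g \<subseteq> P \<longrightarrow> (\<forall>l \<in> S. f l = g l) \<longrightarrow> X f = X g"
    using dfn_support[OF assms] by (elim exE conjE)
  let ?S = "S \<inter> range Inl"
  let ?h = "\<lambda>l :: 'a + 'b. case l of Inl _ \<Rightarrow> undefined | Inr b \<Rightarrow> b"
  have "dfn A (\<lambda>f. \<exists>g. range g \<subseteq> P \<and> (\<forall>l. l \<notin> ?S \<longrightarrow> g l = f (?h l)) \<and> X g)"
    using dfn_reindex[OF dfn_Ex_finite[OF _ assms, of ?S], where h="?h"] S(1) by simp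
  then show ?thesis
  proof (rule dfn_cong)
    fix f :: "'b \<Rightarrow> 'p" assume f: "range f \<subseteq> P"
    show "(\<exists>g. range g \<subseteq> P \<and> (\<forall>l. l \<notin> ?S \<longrightarrow> g l = f (?h l)) \<and> X g) \<longleftrightarrow>
      (\<exists>g. range g \<subseteq> P \<and> X (case_sum g f))"
    proof
      assume "\<exists>g. range g \<subseteq> P \<and> (\<forall>l. l \<notin> ?S \<longrightarrow> g l = f (?h l)) \<and> X g"
      then obtain g where g: "range g \<subseteq> P" "\<forall>l. l \<notin> ?S \<longrightarrow> g l = f (?h l)" "X g" by blast
      have "g = case_sum (\<lambda>a. g (Inl a)) f"
        using g(2) by (auto simp: fun_eq_iff split: sum.splits)
      then show "\<exists>g. range g \<subseteq> P \<and> X (case_sum g f)"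
        using g by (intro exI[of _ "\<lambda>a. g (Inl a)"]) auto
    next
      assume "\<exists>g. range g \<subseteq> P \<and> X (case_sum g f)"
      then obtain g where g: "range g \<subseteq> P" "X (case_sum g f)" by blast
      define g' where "g' l = (if l \<in> ?S then case_sum g f l else f (?h l))" for l
      have P: "case_sum g f l \<in> P" for l
        using range_into[OF f] range_into[OF g(1)] by (auto split: sum.splits)
      then have g': "range g' \<subseteq> P" using range_into[OF f] by (auto simp: g'_def)
      have "X g' = X (case_sum g f)"
      proof (rule S(2)[rule_format, OF g'])
        show "range (case_sum g f) \<subseteq> P" using P by blast
        show "g' l = case_sum g f l" if "l \<in> S" for l
          using that by (auto simp: g'_def split: sum.splits)
      qed
      then show "\<exists>g. range g \<subseteq> P \<and> (\<forall>l. l \<notin> ?S \<longrightarrow> g l = f (?h l)) \<and> X g"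
        using g g' by (intro exI[of _ g']) (auto simp: g'_def)
    qed
  qed
qed

lemma dfn_E_labels: "dfn A (\<lambda>f. E (f l) (f l'))"
  using dfn_E[of "Inr l" A "Inr l'"] by simp

lemma dfn_E_left: "p \<in> A \<Longrightarrow> p \<in> P \<Longrightarrow> dfn A (\<lambda>f. E p (f l))"
  using dfn_E[of "Inl p" A "Inr l"] by simp

lemma dfn_eq_labels: "dfn A (\<lambda>f. f l = f l')"
  using dfn_eq[of "Inr l" A "Inr l'"] by simp

text \<open>The theorem expressed inside the geometry. The relation is a union over \<open>N\<close>
  of definable relations, hence \<Or>-definable, and one finite \<open>A0\<close> has to serve for
  all \<open>N\<close>.\<close>

definition concl :: bool where
  "concl \<longleftrightarrow> (\<exists>A0 \<Theta> W. finite A0 \<and> A0 \<subseteq> P \<and> dfn A0 (\<lambda>f :: unit \<Rightarrow> 'p. \<Theta> (f ())) \<and>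
     (\<forall>N :: nat. dfn A0 (\<lambda>f :: bool \<Rightarrow> 'p. W N (f False) (f True))) \<and>
     (let S = {p \<in> P. \<Theta> p}; R = {(a, b). a \<in> P \<and> b \<in> P \<and> (\<exists>N. W N a b)}
      in linear_quasi_order_on S R \<and> dense_on S R \<and> has_increasing_chain S R))"

text \<open>The chain pattern is demanded off the diagonal only, since \<open>E\<close> between
  entries of equal index is left open for the sequences to which this is applied. Closure under
  increasing selections allows long chains to be thinned out by the pigeonhole principle.\<close>

definition config :: "'p set \<Rightarrow> (nat \<Rightarrow> (nat \<Rightarrow> 'p) \<Rightarrow> (nat \<Rightarrow> 'p) \<Rightarrow> bool) \<Rightarrow> bool" where
  "config A0 G \<longleftrightarrow> finite A0 \<and> A0 \<subseteq> P \<and>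
     (\<forall>N. dfn A0 (\<lambda>f :: nat \<times> bool \<Rightarrow> 'p. G N (\<lambda>i. f (i, False)) (\<lambda>i. f (i, True)))) \<and>
     (\<forall>N M y b h. range y \<subseteq> P \<longrightarrow> range b \<subseteq> P \<longrightarrow> G N y b \<longrightarrow>
        (\<forall>i j. i < j \<longrightarrow> j < M \<longrightarrow> h i < h j) \<longrightarrow> (\<forall>i<M. h i < N) \<longrightarrow>
        G M (\<lambda>i. y (h i)) (\<lambda>i. b (h i))) \<and>
     (\<forall>N y b i j. G N y b \<longrightarrow> i < N \<longrightarrow> j < N \<longrightarrow> i \<noteq> j \<longrightarrow> (E (y i) (b j) \<longleftrightarrow> i < j)) \<and>
     (\<forall>N. \<exists>y b. range y \<subseteq> P \<and> range b \<subseteq> P \<and> G N y b)"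

definition zone where
  "zone G N y b \<longleftrightarrow> range y \<subseteq> P \<and> range b \<subseteq> P \<and> G N y b"

text \<open>A bad pair is a point and a cut that both see a long zone on the wrong side, although they
  are not related to each other accordingly.\<close>

definition badI where
  "badI G y c \<longleftrightarrow> \<not> E y c \<and> (\<forall>N. \<exists>Y B. zone G N Y B \<and> (\<forall>i<N. E (Y i) c \<and> E y (B i)))"

definition badII where
  "badII G y c \<longleftrightarrow> E y c \<and> (\<forall>N. \<exists>Y B. zone G N Y B \<and> (\<forall>i<N. \<not> E (Y i) c \<and> \<not> E y (B i)))"

lemma config_sub:
  assumes "config A0 G" "zone G N y b" "\<And>i j. i < j \<Longrightarrow> j < M \<Longrightarrow> h i < h j" "\<And>i. i < M \<Longrightarrow> h i < N"
  shows "zone G M (\<lambda>i. y (h i)) (\<lambda>i. b (h i))"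
proof -
  have "\<forall>N M y b h. range y \<subseteq> P \<longrightarrow> range b \<subseteq> P \<longrightarrow> G N y b \<longrightarrow>
        (\<forall>i j. i < j \<longrightarrow> j < M \<longrightarrow> h i < h j) \<longrightarrow> (\<forall>i<M. h i < N) \<longrightarrow>
        G M (\<lambda>i. y (h i)) (\<lambda>i. b (h i))" using assms(1) unfolding config_def by (elim conjE)
  from this[rule_format, of y b N M h] have "G M (\<lambda>i. y (h i)) (\<lambda>i. b (h i))"
    using assms(2-) unfolding zone_def by blast
  then show ?thesis using assms(2) unfolding zone_def by blast
qed

lemma config_subset:
  assumes "config A0 G" "zone G N y b" "S \<subseteq> {..<N}" "M \<le> card S"
  shows "\<exists>h. zone G M (\<lambda>i. y (h i)) (\<lambda>i. b (h i)) \<and> (\<forall>i<M. h i \<in> S)"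
proof -
  obtain h where h: "\<And>i j. i < j \<Longrightarrow> j < M \<Longrightarrow> h i < h j" "\<And>i. i < M \<Longrightarrow> h i \<in> S"
    by (rule increasing_selection[of S M]) (use assms(3,4) finite_subset[of S "{..<N}"] in auto)
  have "zone G M (\<lambda>i. y (h i)) (\<lambda>i. b (h i))"
    by (rule config_sub[OF assms(1,2)]) (use h assms(3) in auto)
  then show ?thesis using h(2) by blast
qed

text \<open>Two colours on \<open>M + N\<close> indices leave \<open>M\<close> of the one or
  \<open>N\<close> of the other, and the selected subchain belongs to \<open>G\<close>
  again.\<close>

lemma split_zone:
  assumes "config A0 G" "zone G (M + N) y b"
  shows "(\<exists>h. zone G M (\<lambda>i. y (h i)) (\<lambda>i. b (h i)) \<and> (\<forall>i<M. h i < M + N \<and> Q (h i))) \<or>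
    (\<exists>h. zone G N (\<lambda>i. y (h i)) (\<lambda>i. b (h i)) \<and> (\<forall>i<N. h i < M + N \<and> \<not> Q (h i)))"
proof -
  let ?S = "{i. i < M + N \<and> Q i}" and ?T = "{i. i < M + N \<and> \<not> Q i}"
  have "card (?S \<union> ?T) = card ?S + card ?T" by (rule card_Un_disjoint) auto
  moreover have "?S \<union> ?T = {..<M + N}" by auto
  ultimately have "card ?S + card ?T = M + N" by (metis card_lessThan)
  then have "M \<le> card ?S \<or> N \<le> card ?T" by linarith
  then show ?thesis
  proof
    assume "M \<le> card ?S"
    then have "\<exists>h. zone G M (\<lambda>i. y (h i)) (\<lambda>i. b (h i)) \<and> (\<forall>i<M. h i \<in> ?S)"
      by (intro config_subset[OF assms]) auto
    then show ?thesis by simp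
  next
    assume "N \<le> card ?T"
    then have "\<exists>h. zone G N (\<lambda>i. y (h i)) (\<lambda>i. b (h i)) \<and> (\<forall>i<N. h i \<in> ?T)"
      by (intro config_subset[OF assms]) auto
    then show ?thesis by simp
  qed
qed

lemma concl_if_no_bad_pair:
  assumes G: "config A0 G"
    and nobad: "\<And>y c Y B Y' B'. zone G 1 Y B \<Longrightarrow> Y 0 = y \<Longrightarrow> zone G 1 Y' B' \<Longrightarrow> B' 0 = c \<Longrightarrow>
      \<not> badI G y c \<and> \<not> badII G y c"
  shows concl
proof -
  define \<Theta> where "\<Theta> c \<longleftrightarrow> (\<exists>Y B. zone G 1 Y B \<and> B 0 = c)" for c
  define W where "W N b b' \<longleftrightarrow> (\<exists>Y B. zone G N Y B \<and> (\<forall>i<N. \<not> E (Y i) b \<and> E (Y i) b'))" for N b b'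
  \<comment> \<open>\<open>V\<close> is the strict relation. The quasi-order will be the negation of
    its converse, thus a disjunction over \<open>N\<close> of negated \<open>W N\<close>.\<close>
  define V where "V b b' \<longleftrightarrow> (\<forall>N. W N b b')" for b b'
  have A0: "finite A0" "A0 \<subseteq> P"
    and dG: "\<And>N. dfn A0 (\<lambda>f :: nat \<times> bool \<Rightarrow> 'p. G N (\<lambda>i. f (i, False)) (\<lambda>i. f (i, True)))"
    and exG: "\<And>N. \<exists>y b. zone G N y b"
    and chain': "\<forall>N y b i j. G N y b \<longrightarrow> i < N \<longrightarrow> j < N \<longrightarrow> i \<noteq> j \<longrightarrow> (E (y i) (b j) \<longleftrightarrow> i < j)"
    using G unfolding config_def zone_def by (elim conjE, simp)+
  have chain: "E (y i) (b j) \<longleftrightarrow> i < j" if "zone G N y b" "i < N" "j < N" "i \<noteq> j" for N y b i j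
    using chain'[rule_format, of N y b i j] that unfolding zone_def by simp
  have W_mono: "W M b b'" if W: "W N b b'" and MN: "M \<le> N" for M N b b'
  proof -
    obtain Y B where YB: "zone G N Y B" "\<forall>i<N. \<not> E (Y i) b \<and> E (Y i) b'" using W unfolding W_def by blast
    have "zone G M Y B" using config_sub[OF G YB(1), of M "\<lambda>i. i"] MN by simp
    then show ?thesis unfolding W_def using YB(2) MN by (intro exI[of _ Y] exI[of _ B]) auto
  qed
  have irrefl: "\<not> W 1 a a" for a unfolding W_def by blast
  have negtrans: "V a c \<or> V c b" if ab: "V a b" for a b c
  proof (rule ccontr)
    assume "\<not> (V a c \<or> V c b)"
    then obtain M N where MN: "\<not> W M a c" "\<not> W N c b" unfolding V_def by blast
    obtain Y B where YB: "zone G (M + N) Y B" "\<forall>i<M+N. \<not> E (Y i) a \<and> E (Y i) b"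
      using ab unfolding V_def W_def by blast
    from split_zone[OF G YB(1), of "\<lambda>i. E (Y i) c"] show False
    proof (elim disjE exE conjE)
      fix h assume "zone G M (\<lambda>i. Y (h i)) (\<lambda>i. B (h i))" "\<forall>i<M. h i < M + N \<and> E (Y (h i)) c"
      then have "W M a c" unfolding W_def
        using YB(2) by (intro exI[of _ "\<lambda>i. Y (h i)"] exI[of _ "\<lambda>i. B (h i)"]) simp
      then show False using MN by simp
    next
      fix h assume "zone G N (\<lambda>i. Y (h i)) (\<lambda>i. B (h i))" "\<forall>i<N. h i < M + N \<and> \<not> E (Y (h i)) c"
      then have "W N c b" unfolding W_def
        using YB(2) by (intro exI[of _ "\<lambda>i. Y (h i)"] exI[of _ "\<lambda>i. B (h i)"]) simp
      then show False using MN by simp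
    qed
  qed
  have asym: "False" if bb: "\<Theta> b" "\<Theta> b'" "V b b'" "V b' b" for b b'
  proof -
    \<comment> \<open>One link from \<open>b'\<close> to \<open>b\<close> supplies the point
      \<open>y\<close>. The signs of \<open>y\<close> on the cuts of a long chain from
      \<open>b\<close> to \<open>b'\<close> split that chain: a long true part makes
      \<open>y\<close> bad with \<open>b'\<close>, a long false part makes it bad with
      \<open>b\<close>.\<close>
    have "W 1 b' b" using bb(4) unfolding V_def by blast
    then obtain Y0 B0 where YB0: "zone G 1 Y0 B0" "\<not> E (Y0 0) b'" "E (Y0 0) b"
      unfolding W_def by auto
    define y where "y = Y0 0"
    obtain Y1 B1 where 1: "zone G 1 Y1 B1" "B1 0 = b" using bb(1) unfolding \<Theta>_def by blast
    obtain Y2 B2 where 2: "zone G 1 Y2 B2" "B2 0 = b'" using bb(2) unfolding \<Theta>_def by blast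
    have nb: "\<not> badI G y b'" "\<not> badII G y b"
      using nobad[OF YB0(1) y_def[symmetric] 2] nobad[OF YB0(1) y_def[symmetric] 1] by simp_all
    have "\<not> (\<forall>M. \<exists>Y B. zone G M Y B \<and> (\<forall>i<M. E (Y i) b' \<and> E y (B i)))"
      using nb(1) YB0(2) unfolding badI_def y_def[symmetric] by simp
    then obtain M where M: "\<not> (\<exists>Y B. zone G M Y B \<and> (\<forall>i<M. E (Y i) b' \<and> E y (B i)))"
      unfolding not_all by (elim exE)
    have "\<not> (\<forall>N. \<exists>Y B. zone G N Y B \<and> (\<forall>i<N. \<not> E (Y i) b \<and> \<not> E y (B i)))"
      using nb(2) YB0(3) unfolding badII_def y_def[symmetric] by simp
    then obtain N where N: "\<not> (\<exists>Y B. zone G N Y B \<and> (\<forall>i<N. \<not> E (Y i) b \<and> \<not> E y (B i)))"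
      unfolding not_all by (elim exE)
    obtain Y B where YB: "zone G (M + N) Y B" "\<forall>i<M+N. \<not> E (Y i) b \<and> E (Y i) b'"
      using bb(3) unfolding V_def W_def by blast
    from split_zone[OF G YB(1), of "\<lambda>i. E y (B i)"] show False
    proof (elim disjE exE conjE)
      fix h assume "zone G M (\<lambda>i. Y (h i)) (\<lambda>i. B (h i))" "\<forall>i<M. h i < M + N \<and> E y (B (h i))"
      then have "\<exists>Y B. zone G M Y B \<and> (\<forall>i<M. E (Y i) b' \<and> E y (B i))"
        using YB(2) by (intro exI[of _ "\<lambda>i. Y (h i)"] exI[of _ "\<lambda>i. B (h i)"]) simp
      then show False using M by simp
    next
      fix h assume "zone G N (\<lambda>i. Y (h i)) (\<lambda>i. B (h i))" "\<forall>i<N. h i < M + N \<and> \<not> E y (B (h i))"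
      then have "\<exists>Y B. zone G N Y B \<and> (\<forall>i<N. \<not> E (Y i) b \<and> \<not> E y (B i))"
        using YB(2) by (intro exI[of _ "\<lambda>i. Y (h i)"] exI[of _ "\<lambda>i. B (h i)"]) simp
      then show False using N by simp
    qed
  qed
  have \<Theta>P: "c \<in> P" if "\<Theta> c" for c using that unfolding \<Theta>_def zone_def by blast
  have \<Theta>I: "\<Theta> (B j)" if "zone G N Y B" "j < N" for N Y B j
    using config_sub[OF G that(1), of 1 "\<lambda>i. j"] that(2) unfolding \<Theta>_def by auto
  have zone_pair: "(\<exists>Y B. zone G N Y B \<and> Q Y B) \<longleftrightarrow>
      (\<exists>g :: nat \<times> bool \<Rightarrow> 'p. range g \<subseteq> P \<and> G N (\<lambda>i. g (i, False)) (\<lambda>i. g (i, True)) \<and>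
        Q (\<lambda>i. g (i, False)) (\<lambda>i. g (i, True)))" (is "?l \<longleftrightarrow> ?r") for N Q
  proof
    assume ?l
    then obtain Y B where YB: "zone G N Y B" "Q Y B" by blast
    define g where "g x = (if snd x then B (fst x) else Y (fst x))" for x
    have "range g \<subseteq> P" using YB(1) by (auto simp: g_def zone_def)
    then show ?r using YB by (intro exI[of _ g]) (simp add: g_def zone_def)
  next
    assume ?r
    then obtain g :: "nat \<times> bool \<Rightarrow> 'p" where g: "range g \<subseteq> P" "G N (\<lambda>i. g (i, False)) (\<lambda>i. g (i, True))"
      "Q (\<lambda>i. g (i, False)) (\<lambda>i. g (i, True))" by blast
    then have "zone G N (\<lambda>i. g (i, False)) (\<lambda>i. g (i, True))" unfolding zone_def by blast
    then show ?l using g(3) by blast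
  qed
  have d\<Theta>: "dfn A0 (\<lambda>f :: unit \<Rightarrow> 'p. \<Theta> (f ()))"
  proof -
    have "dfn A0 (\<lambda>f :: (nat \<times> bool) + unit \<Rightarrow> 'p. G 1 (\<lambda>i. f (Inl (i, False))) (\<lambda>i. f (Inl (i, True)))
        \<and> f (Inl (0, True)) = f (Inr ()))"
      by (rule dfn_conj[OF dfn_reindex[OF dG, where h=Inl] dfn_eq_labels])
    from dfn_Ex[OF this] show ?thesis unfolding \<Theta>_def zone_pair by simp
  qed
  have dW: "dfn A0 (\<lambda>f :: bool \<Rightarrow> 'p. W N (f False) (f True))" for N
  proof -
    have "dfn A0 (\<lambda>f :: (nat \<times> bool) + bool \<Rightarrow> 'p. G N (\<lambda>i. f (Inl (i, False))) (\<lambda>i. f (Inl (i, True)))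
        \<and> (\<forall>i \<in> {..<N}. \<not> E (f (Inl (i, False))) (f (Inr False)) \<and> E (f (Inl (i, False))) (f (Inr True))))"
      by (intro dfn_conj[OF dfn_reindex[OF dG, where h=Inl]] dfn_ball dfn_conj dfn_neg dfn_E_labels) simp
    from dfn_Ex[OF this] show ?thesis unfolding W_def zone_pair by (simp add: Ball_def)
  qed
  have ex_between: "\<exists>c. \<Theta> c \<and> V a c \<and> V c b" if ab: "\<Theta> a" "\<Theta> b" "V a b" for a b
  proof -
    let ?A = "A0 \<union> {a, b}"
    have A: "countable ?A" "?A \<subseteq> P" using A0 \<Theta>P ab by (auto intro: countable_finite)
    define K where "K N = (\<lambda>f :: unit \<Rightarrow> 'p. \<Theta> (f ()) \<and> W N a (f ()) \<and> W N (f ()) b)" for N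
    have "\<exists>f. range f \<subseteq> P \<and> (\<forall>N \<in> UNIV. K N f)"
    proof (rule compactness_indexed[OF A, of UNIV K])
      fix N
      have d: "dfn ?A (\<lambda>f :: bool \<Rightarrow> 'p. W N (f False) (f True))" using dW by (rule dfn_mono) blast
      have "dfn ?A (\<lambda>f :: unit \<Rightarrow> 'p. W N a (f ()))"
        using dfn_subst[OF d, of "\<lambda>t. if t then Inr () else Inl a"] A(2) by auto
      moreover have "dfn ?A (\<lambda>f :: unit \<Rightarrow> 'p. W N (f ()) b)"
        using dfn_subst[OF d, of "\<lambda>t. if t then Inl b else Inr ()"] A(2) by auto
      moreover have "dfn ?A (\<lambda>f :: unit \<Rightarrow> 'p. \<Theta> (f ()))" using d\<Theta> by (rule dfn_mono) blast
      ultimately show "dfn ?A (K N)" unfolding K_def by (intro dfn_conj)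
    next
      fix J :: "nat set" assume "finite J"
      then obtain N where N: "\<And>n. n \<in> J \<Longrightarrow> n \<le> N" using finite_nat_set_iff_bounded_le by auto
      \<comment> \<open>The middle cut \<open>B N\<close> leaves \<open>N\<close> links on either
        side. The link number \<open>N\<close> itself is dropped, as the sign of
        \<open>E (Y N) (B N)\<close> is unknown.\<close>
      obtain Y B where YB: "zone G (Suc N + N) Y B" "\<forall>i<Suc N + N. \<not> E (Y i) a \<and> E (Y i) b"
        using ab(3) unfolding V_def W_def by blast
      have "zone G N Y B" using config_sub[OF G YB(1), of N "\<lambda>i. i"] by simp
      then have 1: "W N a (B N)" unfolding W_def
        using YB(2) chain[OF YB(1)] by (intro exI[of _ Y] exI[of _ B]) auto
      have "zone G N (\<lambda>i. Y (Suc N + i)) (\<lambda>i. B (Suc N + i))"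
        by (rule config_sub[OF G YB(1)]) auto
      then have 2: "W N (B N) b" unfolding W_def
        using YB(2) chain[OF YB(1), of _ N]
        by (intro exI[of _ "\<lambda>i. Y (Suc N + i)"] exI[of _ "\<lambda>i. B (Suc N + i)"]) auto
      have "\<Theta> (B N)" by (rule \<Theta>I[OF YB(1)]) simp
      moreover have "B N \<in> P" using calculation \<Theta>P by simp
      ultimately show "\<exists>f. range f \<subseteq> P \<and> (\<forall>i \<in> J. K i f)"
        using W_mono[OF 1 N] W_mono[OF 2 N] unfolding K_def by (intro exI[of _ "\<lambda>_. B N"]) auto
    qed
    then obtain f where "\<And>N. K N f" by auto
    then have "\<Theta> (f ())" "\<And>N. W N a (f ())" "\<And>N. W N (f ()) b" unfolding K_def by simp_all
    then show ?thesis unfolding V_def by (intro exI[of _ "f ()"]) simp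
  qed
  have ex_pair: "\<exists>a b. \<Theta> a \<and> \<Theta> b \<and> V a b"
  proof -
    have A: "countable A0" "A0 \<subseteq> P" using A0 by (auto intro: countable_finite)
    define K where "K N = (\<lambda>f :: bool \<Rightarrow> 'p. \<Theta> (f False) \<and> \<Theta> (f True) \<and> W N (f False) (f True))" for N
    have "\<exists>f. range f \<subseteq> P \<and> (\<forall>N \<in> UNIV. K N f)"
    proof (rule compactness_indexed[OF A, of UNIV K])
      show "dfn A0 (K N)" for N
        unfolding K_def using dfn_reindex[OF d\<Theta>, where h="\<lambda>_. False"] dfn_reindex[OF d\<Theta>, where h="\<lambda>_. True"] dW
        by (intro dfn_conj) simp_all
    next
      fix J :: "nat set" assume "finite J"
      then obtain N where N: "\<And>n. n \<in> J \<Longrightarrow> n \<le> N" using finite_nat_set_iff_bounded_le by auto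
      \<comment> \<open>Two extra links provide the end cuts \<open>B 0\<close> and
        \<open>B (Suc N)\<close>, with \<open>N\<close> links strictly in between.\<close>
      obtain Y B where YB: "zone G (Suc (Suc N)) Y B" using exG by blast
      have "zone G N (\<lambda>i. Y (Suc i)) (\<lambda>i. B (Suc i))"
        by (rule config_sub[OF G YB(1)]) auto
      then have 1: "W N (B 0) (B (Suc N))" unfolding W_def
        using chain[OF YB(1)]
        by (intro exI[of _ "\<lambda>i. Y (Suc i)"] exI[of _ "\<lambda>i. B (Suc i)"]) auto
      have "\<Theta> (B 0)" "\<Theta> (B (Suc N))" by (rule \<Theta>I[OF YB(1)]; simp)+
      then show "\<exists>f. range f \<subseteq> P \<and> (\<forall>i \<in> J. K i f)"
        using W_mono[OF 1 N] \<Theta>P unfolding K_def by (intro exI[of _ "\<lambda>t. if t then B (Suc N) else B 0"]) auto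
    qed
    then obtain f where "\<And>N. K N f" by auto
    then have "\<Theta> (f False)" "\<Theta> (f True)" "\<And>N. W N (f False) (f True)" unfolding K_def by simp_all
    then show ?thesis unfolding V_def by (intro exI[of _ "f False"] exI[of _ "f True"]) simp
  qed
  define S where "S = {p \<in> P. \<Theta> p}"
  define R where "R = {(a, b). a \<in> P \<and> b \<in> P \<and> (\<exists>N. \<not> W N b a)}"
  have S: "a \<in> S \<longleftrightarrow> \<Theta> a" for a using \<Theta>P by (auto simp: S_def)
  have R: "(a, b) \<in> R \<longleftrightarrow> \<not> V b a" if "\<Theta> a" "\<Theta> b" for a b
    using that \<Theta>P by (auto simp: R_def V_def)
  have below: "strictly_below R a b \<longleftrightarrow> V a b" if "\<Theta> a" "\<Theta> b" for a b
    using asym[OF that] R that by (auto simp: strictly_below_def)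
  have "linear_quasi_order_on S R"
    unfolding linear_quasi_order_on_def
  proof (intro conjI)
    show "refl_on S R" unfolding refl_on_def Ball_def S using R irrefl V_def by blast
    show "trans_on S R"
      unfolding trans_on_def Ball_def S using R negtrans by blast
    show "total_on S R"
      unfolding total_on_def Ball_def S using R asym by blast
  qed
  moreover have "dense_on S R"
    unfolding dense_on_def Ball_def Bex_def S using below ex_between by blast
  moreover have "has_increasing_chain S R"
  proof -
    obtain a b where ab: "\<Theta> a" "\<Theta> b" "V a b" using ex_pair by blast
    have "\<exists>c. \<forall>n. (\<Theta> (c n) \<and> V (c n) b) \<and> V (c n) (c (Suc n))"
    proof (rule dependent_nat_choice[where P="\<lambda>n c. \<Theta> c \<and> V c b" and Q="\<lambda>n c c'. V c c'"])
      show "\<exists>c. \<Theta> c \<and> V c b" using ab by blast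
      show "\<exists>c'. (\<Theta> c' \<and> V c' b) \<and> V c c'" if "\<Theta> c \<and> V c b" for c
        using ex_between[of c b] that ab(2) by blast
    qed
    then obtain c where c: "\<And>n. \<Theta> (c n) \<and> V (c n) b" "\<And>n. V (c n) (c (Suc n))" by blast
    have "V (c i) (c j)" if "i < j" for i j
      using that
    proof (induction j)
      case (Suc j)
      show ?case
      proof (cases "i = j")
        case False
        then have "V (c i) (c j)" using Suc by simp
        \<comment> \<open>Negative transitivity together with asymmetry gives transitivity.\<close>
        then show ?thesis using negtrans[of "c i" "c j" "c (Suc j)"] asym[of "c j" "c (Suc j)"] c by blast
      qed (use c in simp)
    qed simp
    then show ?thesis unfolding has_increasing_chain_def using c(1) below S by (intro exI[of _ c]) auto
  qed
  ultimately show concl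
    unfolding concl_def Let_def
    using A0 d\<Theta> dfn_neg[OF dfn_reindex[OF dW, where h=Not]]
    by (intro exI[of _ A0] exI[of _ \<Theta>] exI[of _ "\<lambda>N a b. \<not> W N b a"]) (simp add: S_def R_def)
qed

end

section \<open>Extracting indiscernible arrays\<close>

lemma strict_mono_on_image_unique:
  fixes f g :: "'a::linorder \<Rightarrow> 'b::linorder"
  assumes C: "finite C" and f: "strict_mono_on C f" and g: "strict_mono_on C g" and im: "f ` C = g ` C"
    and c: "c \<in> C"
  shows "f c = g c"
proof (rule ccontr)
  assume "f c \<noteq> g c"
  let ?B = "{c \<in> C. f c \<noteq> g c}"
  define m where "m = Min ?B"
  have "m \<in> ?B" unfolding m_def using C c \<open>f c \<noteq> g c\<close> by (intro Min_in) auto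
  then have m: "m \<in> C" "f m \<noteq> g m" by auto
  have below: "f x = g x" if "x \<in> C" "x < m" for x
  proof (rule ccontr)
    assume "f x \<noteq> g x"
    then have "m \<le> x" unfolding m_def using C that(1) by (intro Min_le) auto
    then show False using that(2) by simp
  qed
  have one: False if fg: "strict_mono_on C p" "strict_mono_on C q" "p ` C = q ` C" "p m < q m"
    and eq: "\<And>x. x \<in> C \<Longrightarrow> x < m \<Longrightarrow> p x = q x" for p q :: "'a \<Rightarrow> 'b"
  proof -
    obtain x where x: "x \<in> C" "p m = q x" using fg(3) m(1) by (metis imageE imageI)
    have "x < m"
    proof (rule ccontr)
      assume "\<not> x < m"
      then have "x = m \<or> m < x" by auto
      then have "q m \<le> q x" using strict_mono_onD[OF fg(2) m(1) x(1)] by auto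
      then show False using fg(4) x by simp
    qed
    then have "p x < p m" using strict_mono_onD[OF fg(1) x(1) m(1)] by simp
    then show False using eq[OF x(1) \<open>x < m\<close>] x(2) by simp
  qed
  show False
  proof (cases "f m < g m")
    case True
    then show False using one[OF f g im] below by blast
  next
    case False
    then have "g m < f m" using m(2) by simp
    then show False using one[OF g f im[symmetric]] below by force
  qed
qed

text \<open>Homogeneity passes to subsets, so the colourings can be treated one after the
  other.\<close>

lemma Ramsey_finitely_many:
  fixes f :: "'i \<Rightarrow> nat set \<Rightarrow> bool"
  assumes "finite I" "infinite (Z :: nat set)"
  shows "\<exists>H \<subseteq> Z. infinite H \<and>
    (\<forall>i \<in> I. \<exists>t. \<forall>B. B \<subseteq> H \<longrightarrow> finite B \<longrightarrow> card B = r i \<longrightarrow> f i B = t)"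
  using assms(1)
proof (induction I rule: finite_induct)
  case empty
  then show ?case using assms(2) by blast
next
  case (insert i I)
  then obtain H where H: "H \<subseteq> Z" "infinite H"
    "\<forall>i \<in> I. \<exists>t. \<forall>B. B \<subseteq> H \<longrightarrow> finite B \<longrightarrow> card B = r i \<longrightarrow> f i B = t" by blast
  have "\<forall>B. B \<subseteq> H \<and> finite B \<and> card B = r i \<longrightarrow> (if f i B then 1 else 0) < (2 :: nat)" by simp
  from Ramsey[OF H(2) this] obtain Y t where Y: "Y \<subseteq> H" "infinite Y"
    "\<forall>B. B \<subseteq> Y \<and> finite B \<and> card B = r i \<longrightarrow> (if f i B then 1 else 0) = (t :: nat)" by blast
  have "f i B = (t = 1)" if "B \<subseteq> Y" "finite B" "card B = r i" for B
    using Y(3)[rule_format, of B] that by (auto split: if_splits)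
  then have "\<exists>t. \<forall>B. B \<subseteq> Y \<longrightarrow> finite B \<longrightarrow> card B = r i \<longrightarrow> f i B = t" by blast
  moreover have "\<exists>t. \<forall>B. B \<subseteq> Y \<longrightarrow> finite B \<longrightarrow> card B = r j \<longrightarrow> f j B = t" if "j \<in> I" for j
    using H(3)[rule_format, OF that] Y(1) by (meson order_trans)
  ultimately show ?case using Y H(1) by (intro exI[of _ Y]) auto
qed

lemma strict_mono_rank:
  fixes T :: "rat set"
  assumes "finite T"
  shows "strict_mono_on T (\<lambda>r. card {t \<in> T. t < r})"
proof (rule strict_mono_onI)
  fix r s assume "r \<in> T" "s \<in> T" "r < s"
  then have "{t \<in> T. t < r} \<subset> {t \<in> T. t < s}" by force
  then show "card {t \<in> T. t < r} < card {t \<in> T. t < s}"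
    using assms by (intro psubset_card_mono) auto
qed

text \<open>An order embedding of the rationals into the interval between -1 and 1. It makes room:
  whole lines can be placed between prescribed positions.\<close>

definition hs :: "rat \<Rightarrow> rat" where
  "hs r = r / (1 + \<bar>r\<bar>)"

lemma hs_less_iff [simp]: "hs r < hs s \<longleftrightarrow> r < s"
proof -
  have "hs r < hs s" if "r < s" for r s
  proof -
    have pos: "0 < 1 + \<bar>r\<bar>" "0 < 1 + \<bar>s\<bar>" by auto
    have "r * (1 + \<bar>s\<bar>) < s * (1 + \<bar>r\<bar>)"
    proof (cases "r \<ge> 0 \<or> s \<le> 0")
      case True
      then have "r * \<bar>s\<bar> = s * \<bar>r\<bar>" using that by (auto simp: abs_if)
      then show ?thesis using that by (simp add: algebra_simps)
    next
      case False
      then have "r * \<bar>s\<bar> \<le> 0" "0 \<le> s * \<bar>r\<bar>" by (simp_all add: mult_le_0_iff zero_le_mult_iff)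
      then show ?thesis using that by (simp add: algebra_simps)
    qed
    then show ?thesis unfolding hs_def using pos by (simp add: divide_less_eq less_divide_eq mult.commute field_simps)
  qed
  then show ?thesis by (metis less_asym linorder_neqE_linordered_idom less_irrefl)
qed

lemma hs_bounds: "- 1 < hs r" "hs r < 1"
  unfolding hs_def by (auto simp: less_divide_eq divide_less_eq abs_if)

text \<open>Entries are compared within the same coordinate only, so invariance under such maps is
  mutual indiscernibility of the coordinates. As strict order is both preserved and reflected, equal
  entries go to equal entries.\<close>

definition cmono :: "nat \<Rightarrow> rat list set \<Rightarrow> (rat list \<Rightarrow> rat list) \<Rightarrow> bool" where
  "cmono d \<Xi> f \<longleftrightarrow> (\<forall>\<xi> \<in> \<Xi>. length \<xi> = d \<and> length (f \<xi>) = d) \<and>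
     (\<forall>\<xi> \<in> \<Xi>. \<forall>\<xi>' \<in> \<Xi>. \<forall>i<d. \<xi> ! i < \<xi>' ! i \<longleftrightarrow> f \<xi> ! i < f \<xi>' ! i)"

text \<open>Coordinate \<open>i\<close> moves into the interval from \<open>i\<close> to
  \<open>i + 1\<close>. All coordinates then lie on one line without interfering, and extraction
  along a single line yields mutual indiscernibility.\<close>

definition spread :: "nat \<Rightarrow> rat \<Rightarrow> rat" where
  "spread i r = of_nat i + (1 + hs r) / 2"

lemma spread_less_iff: "spread i r < spread j s \<longleftrightarrow> i < j \<or> i = j \<and> r < s"
proof -
  have b: "of_nat i < spread i r" "spread i r < of_nat i + 1" for i r
  proof -
    have "0 < 1 + hs r" using hs_bounds(1)[of r] by (metis less_add_same_cancel1 neg_less_iff_less add.commute diff_gt_0_iff_gt diff_minus_eq_add)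
    moreover have "hs r < 1" by (rule hs_bounds)
    ultimately have "0 < (1 + hs r) / 2" "(1 + hs r) / 2 < 1" by auto
    then show "of_nat i < spread i r" "spread i r < of_nat i + 1" unfolding spread_def by auto
  qed
  consider "i < j" | "i = j" | "j < i" by linarith
  then show ?thesis
  proof cases
    case 1
    then have "(of_nat i :: rat) + 1 \<le> of_nat j" by (metis of_nat_1 of_nat_add of_nat_le_iff Suc_eq_plus1 Suc_leI)
    then show ?thesis using b[of i r] b[of j s] 1 by linarith
  next
    case 2
    then show ?thesis by (simp add: spread_def)
  next
    case 3
    then have "(of_nat j :: rat) + 1 \<le> of_nat i" by (metis of_nat_1 of_nat_add of_nat_le_iff Suc_eq_plus1 Suc_leI)
    then show ?thesis using b[of i r] b[of j s] 3 by linarith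
  qed
qed

lemma spread_eq_iff: "spread i r = spread j s \<longleftrightarrow> i = j \<and> r = s"
  using spread_less_iff[of i r j s] spread_less_iff[of j s i r] by (metis less_irrefl linorder_neqE)

definition spread_list :: "rat list \<Rightarrow> rat list" where
  "spread_list \<xi> = map (\<lambda>i. spread i (\<xi> ! i)) [0..<length \<xi>]"

lemma spread_list_simps [simp]: "length (spread_list \<xi>) = length \<xi>"
  "i < length \<xi> \<Longrightarrow> spread_list \<xi> ! i = spread i (\<xi> ! i)"
  by (auto simp: spread_list_def)

lemma set_spread_list: "set (spread_list \<xi>) = (\<lambda>i. spread i (\<xi> ! i)) ` {..<length \<xi>}"
  by (auto simp: spread_list_def)

section \<open>Ehrenfeucht-Mostowski extraction for lines and for products of lines\<close>

context tuple_geometry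
begin

definition supported :: "'l set \<Rightarrow> (('l \<Rightarrow> 'p) \<Rightarrow> bool) \<Rightarrow> bool" where
  "supported S X \<longleftrightarrow> (\<forall>f g. range f \<subseteq> P \<longrightarrow> range g \<subseteq> P \<longrightarrow> (\<forall>l \<in> S. f l = g l) \<longrightarrow> X f = X g)"

lemma supportedD:
  assumes "supported S X" "\<And>l. f l \<in> P" "\<And>l. g l \<in> P" "\<And>l. l \<in> S \<Longrightarrow> f l = g l"
  shows "X f = X g"
proof -
  have "range f \<subseteq> P" "range g \<subseteq> P" using assms(2,3) by blast+
  moreover have "\<forall>l \<in> S. f l = g l" using assms(4) by blast
  ultimately show ?thesis by (rule assms(1)[unfolded supported_def, THEN spec, THEN spec, THEN mp, THEN mp, THEN mp])
qed

lemma dfn_supported: "dfn A X \<Longrightarrow> \<exists>S. finite S \<and> supported S X"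
  unfolding supported_def by (rule dfn_support)

text \<open>\<open>V\<close> is found by compactness from two sorts of demand, told apart by the
  flag \<open>b\<close>: invariance under increasing substitutions, and all properties that
  \<open>F\<close> has under every such substitution. Finitely many demands are met by
  \<open>F\<close> itself along an increasing map of the relevant rationals into a homogeneous
  set.\<close>

lemma extraction_line:
  fixes F :: "'k::countable \<Rightarrow> rat list \<Rightarrow> 'p"
  assumes A: "countable A" "A \<subseteq> P" and F: "\<And>k \<eta>. F k \<eta> \<in> P"
  shows "\<exists>V :: 'k \<times> rat list \<Rightarrow> 'p. range V \<subseteq> P \<and>
    (\<forall>X C u. dfn A X \<longrightarrow> finite C \<longrightarrow> supported {l. set (snd l) \<subseteq> C} X \<longrightarrow> strict_mono_on C u \<longrightarrow>
       X (\<lambda>l. V (fst l, map u (snd l))) = X V) \<and>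
    (\<forall>X C. dfn A X \<longrightarrow> finite C \<longrightarrow> supported {l. set (snd l) \<subseteq> C} X \<longrightarrow>
       (\<forall>w. strict_mono_on C w \<longrightarrow> X (\<lambda>l. F (fst l) (map w (snd l)))) \<longrightarrow> X V)"
proof -
  define I where "I = {(X :: ('k \<times> rat list \<Rightarrow> 'p) \<Rightarrow> bool, C, u :: rat \<Rightarrow> rat, b). dfn A X \<and> finite C \<and>
     supported {l. set (snd l) \<subseteq> C} X \<and> strict_mono_on C u \<and>
     (b \<or> (\<forall>w. strict_mono_on C w \<longrightarrow> X (\<lambda>l. F (fst l) (map w (snd l)))))}"
  define K where "K = (\<lambda>(X :: ('k \<times> rat list \<Rightarrow> 'p) \<Rightarrow> bool, C :: rat set, u, b) f.
     if b then X (\<lambda>l. f (fst l, map u (snd l))) = X f else X f)"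
  have "\<exists>f. range f \<subseteq> P \<and> (\<forall>i \<in> I. K i f)"
  proof (rule compactness_indexed[OF A])
    fix i assume "i \<in> I"
    then obtain X C u b where i: "i = (X, C, u, b)" and X: "dfn A X" unfolding I_def by auto
    show "dfn A (K i)"
    proof (cases b)
      case True
      show ?thesis unfolding K_def i using True dfn_iff[OF dfn_reindex[OF X] X] by simp
    next
      case False
      then show ?thesis unfolding K_def i using X by simp
    qed
  next
    fix J assume J: "J \<subseteq> I" "finite J"
    define T where "T = (\<Union>(X, C, u, b) \<in> J. C \<union> u ` C)"
    have T: "finite T" unfolding T_def using J by (auto simp: I_def)
    \<comment> \<open>A set of naturals is coloured by the truth of \<open>X\<close> along the
      increasing map from \<open>C\<close> onto it. There is only one such map, so the colour
      determines the truth value.\<close>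
    define col where "col i B = (case i of (X :: ('k \<times> rat list \<Rightarrow> 'p) \<Rightarrow> bool, C, u :: rat \<Rightarrow> rat, b :: bool) \<Rightarrow>
       \<exists>e. strict_mono_on C e \<and> e ` C = of_nat ` B \<and> X (\<lambda>l. F (fst l) (map e (snd l))))" for i and B :: "nat set"
    define ar where "ar = (\<lambda>(X :: ('k \<times> rat list \<Rightarrow> 'p) \<Rightarrow> bool, C :: rat set, u :: rat \<Rightarrow> rat, b :: bool). card C)"
    from Ramsey_finitely_many[OF J(2) infinite_UNIV_nat, of ar col]
    obtain H where H: "infinite H"
      "\<forall>i \<in> J. \<exists>t. \<forall>B. B \<subseteq> H \<longrightarrow> finite B \<longrightarrow> card B = ar i \<longrightarrow> col i B = t" by auto
    define w :: "rat \<Rightarrow> rat" where "w r = of_nat (enumerate H (card {t \<in> T. t < r}))" for r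
    have w: "strict_mono_on T w"
    proof (rule strict_mono_onI)
      fix r s assume "r \<in> T" "s \<in> T" "r < s"
      then have "card {t \<in> T. t < r} < card {t \<in> T. t < s}"
        using strict_mono_onD[OF strict_mono_rank[OF T]] by blast
      then show "w r < w s" unfolding w_def using enumerate_mono[OF _ H(1)] by simp
    qed
    have wH: "w r \<in> of_nat ` H" for r unfolding w_def using enumerate_in_set[OF H(1)] by blast
    have const: "X (\<lambda>l. F (fst l) (map p (snd l))) = X (\<lambda>l. F (fst l) (map q (snd l)))"
      if i: "(X, C, u, b) \<in> J" and p: "strict_mono_on C p" "p ` C \<subseteq> of_nat ` H"
        and q: "strict_mono_on C q" "q ` C \<subseteq> of_nat ` H" for X C u b p q
    proof -
      have X: "finite C" "supported {l. set (snd l) \<subseteq> C} X" using i J(1) by (auto simp: I_def)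
      obtain t where t: "\<forall>B. B \<subseteq> H \<longrightarrow> finite B \<longrightarrow> card B = card C \<longrightarrow> col (X, C, u, b) B = t"
        using bspec[OF H(2) i] unfolding ar_def by auto
      have "X (\<lambda>l. F (fst l) (map p (snd l))) = t" if p: "strict_mono_on C p" "p ` C \<subseteq> of_nat ` H" for p
      proof -
        obtain B where B: "B \<subseteq> H" "p ` C = of_nat ` B" using p(2) by (meson subset_image_iff)
        have "card (of_nat ` B :: rat set) = card B" by (intro card_image inj_on_of_nat)
        moreover have "card (p ` C) = card C"
          by (intro card_image strict_mono_on_imp_inj_on p(1))
        moreover have "finite (of_nat ` B :: rat set)" using X(1) B(2) by (metis finite_imageI)
        then have "finite B" by (rule finite_imageD) (rule inj_on_of_nat)
        ultimately have "col (X, C, u, b) B = t" using t B by simp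
        moreover have "col (X, C, u, b) B = X (\<lambda>l. F (fst l) (map p (snd l)))"
        proof
          assume "X (\<lambda>l. F (fst l) (map p (snd l)))"
          then show "col (X, C, u, b) B" unfolding col_def using p(1) B(2) by auto
        next
          assume "col (X, C, u, b) B"
          then obtain e where e: "strict_mono_on C e" "e ` C = of_nat ` B" "X (\<lambda>l. F (fst l) (map e (snd l)))"
            unfolding col_def by auto
          have eq: "e c = p c" if "c \<in> C" for c
            by (rule strict_mono_on_image_unique[OF X(1) e(1) p(1) _ that]) (simp add: e(2) B(2))
          have "X (\<lambda>l. F (fst l) (map e (snd l))) = X (\<lambda>l. F (fst l) (map p (snd l)))"
          proof (rule supportedD[OF X(2)])
            fix l assume "l \<in> {l :: 'k \<times> rat list. set (snd l) \<subseteq> C}"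
            then have "map e (snd l) = map p (snd l)" using eq by auto
            then show "F (fst l) (map e (snd l)) = F (fst l) (map p (snd l))" by (simp only:)
          qed (auto simp: F)
          then show "X (\<lambda>l. F (fst l) (map p (snd l)))" using e(3) by simp
        qed
        ultimately show ?thesis by simp
      qed
      from this[OF p] this[OF q] show ?thesis by simp
    qed
    define f where "f l = F (fst l) (map w (snd l))" for l :: "'k \<times> rat list"
    have "K i f" if i: "i \<in> J" for i
    proof -
      obtain X C u b where eq: "i = (X, C, u, b)" by (metis prod_cases4)
      have iI: "dfn A X" "finite C" "strict_mono_on C u"
        "b \<or> (\<forall>w. strict_mono_on C w \<longrightarrow> X (\<lambda>l. F (fst l) (map w (snd l))))"
        using i J(1) unfolding eq I_def by auto
      have "C \<union> u ` C \<subseteq> T" unfolding T_def using i eq by blast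
      then have CT: "C \<subseteq> T" "u ` C \<subseteq> T" by auto
      have wC: "strict_mono_on C w" using w CT(1) by (rule monotone_on_subset)
      show ?thesis
      proof (cases b)
        case True
        have wu: "strict_mono_on C (w \<circ> u)"
        proof (rule strict_mono_onI)
          fix r s assume "r \<in> C" "s \<in> C" "r < s"
          then have "u r < u s" "u r \<in> T" "u s \<in> T" using strict_mono_onD[OF iI(3)] CT by auto
          then show "(w \<circ> u) r < (w \<circ> u) s" using strict_mono_onD[OF w] by simp
        qed
        have "X (\<lambda>l. F (fst l) (map (w \<circ> u) (snd l))) = X (\<lambda>l. F (fst l) (map w (snd l)))"
          using wH by (intro const[OF i[unfolded eq] wu _ wC]) auto
        then show ?thesis unfolding K_def eq f_def using True by (simp add: o_def)
      next
        case False
        then have "X (\<lambda>l. F (fst l) (map w (snd l)))" using iI(4) wC by simp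
        then have "X f" unfolding f_def by simp
        then show ?thesis unfolding K_def eq using False by simp
      qed
    qed
    moreover have "range f \<subseteq> P" using F by (auto simp: f_def)
    ultimately show "\<exists>f. range f \<subseteq> P \<and> (\<forall>i \<in> J. K i f)" by blast
  qed
  then obtain V where V: "range V \<subseteq> P" "\<forall>i \<in> I. K i V" by blast
  show ?thesis
  proof (intro exI[of _ V] conjI allI impI)
    fix X :: "('k \<times> rat list \<Rightarrow> 'p) \<Rightarrow> bool" and C :: "rat set" and u :: "rat \<Rightarrow> rat"
    assume *: "dfn A X" "finite C" "supported {l. set (snd l) \<subseteq> C} X" "strict_mono_on C u"
    then have "(X, C, u, True) \<in> I" unfolding I_def by simp
    then show "X (\<lambda>l. V (fst l, map u (snd l))) = X V" using V(2) unfolding K_def by fastforce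
  next
    fix X :: "('k \<times> rat list \<Rightarrow> 'p) \<Rightarrow> bool" and C :: "rat set"
    assume *: "dfn A X" "finite C" "supported {l. set (snd l) \<subseteq> C} X"
      "\<forall>w. strict_mono_on C w \<longrightarrow> X (\<lambda>l. F (fst l) (map w (snd l)))"
    moreover have "strict_mono_on C (\<lambda>r. r)" by (rule strict_mono_onI)
    ultimately have "(X, C, \<lambda>r. r, False) \<in> I" unfolding I_def by simp
    then show "X V" using V(2) unfolding K_def by fastforce
  qed (rule V(1))
qed

text \<open>Indiscernibility through automorphisms, also for infinite \<Xi>; homogeneity makes this
  equivalent to equality of types. All kinds in \<open>K\<close> are moved by the same
  automorphism.\<close>

definition ind_on :: "'k set \<Rightarrow> nat \<Rightarrow> 'p set \<Rightarrow> ('k \<Rightarrow> rat list \<Rightarrow> 'p) \<Rightarrow> bool" where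
  "ind_on K d A F \<longleftrightarrow>
     (\<forall>\<Xi> f. cmono d \<Xi> f \<longrightarrow> (\<exists>\<sigma> \<in> Au A. \<forall>k \<in> K. \<forall>\<xi> \<in> \<Xi>. \<sigma> (F k \<xi>) = F k (f \<xi>)))"

text \<open>\<open>F'\<close> realises the Ehrenfeucht-Mostowski type of \<open>F\<close> in its
  product form: it inherits what is true of \<open>F\<close> at all tuples of the same
  coordinatewise order type.\<close>

definition EM :: "nat \<Rightarrow> 'p set \<Rightarrow> ('k \<Rightarrow> rat list \<Rightarrow> 'p) \<Rightarrow> ('k \<Rightarrow> rat list \<Rightarrow> 'p) \<Rightarrow> bool" where
  "EM d A F F' \<longleftrightarrow>
     (\<forall>X \<Xi>. dfn A X \<longrightarrow> finite \<Xi> \<longrightarrow> (\<forall>\<xi> \<in> \<Xi>. length \<xi> = d) \<longrightarrow> supported {l. snd l \<in> \<Xi>} X \<longrightarrow>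
       (\<forall>f. cmono d \<Xi> f \<longrightarrow> X (\<lambda>l. F (fst l) (f (snd l)))) \<longrightarrow> X (\<lambda>l. F' (fst l) (snd l)))"

lemma EM_D:
  assumes "EM d A F F'" "dfn A X" "finite \<Xi>" "\<forall>\<xi> \<in> \<Xi>. length \<xi> = d" "supported {l. snd l \<in> \<Xi>} X"
    "\<forall>f. cmono d \<Xi> f \<longrightarrow> X (\<lambda>l. F (fst l) (f (snd l)))"
  shows "X (\<lambda>l. F' (fst l) (snd l))"
  using assms(1)[unfolded EM_def, THEN spec, THEN spec, THEN mp, THEN mp, THEN mp, THEN mp, THEN mp] assms(2-) .

lemma extraction_product:
  fixes F :: "'k::countable \<Rightarrow> rat list \<Rightarrow> 'p"
  assumes A: "countable A" "A \<subseteq> P" and F: "\<And>k \<eta>. F k \<eta> \<in> P"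
  shows "\<exists>F'. (\<forall>k \<eta>. F' k \<eta> \<in> P) \<and> EM d A F F' \<and> ind_on UNIV d A F'"
proof -
  obtain V :: "'k \<times> rat list \<Rightarrow> 'p" where V: "range V \<subseteq> P"
    and V_ind: "\<forall>X C u. dfn A X \<longrightarrow> finite C \<longrightarrow> supported {l. set (snd l) \<subseteq> C} X \<longrightarrow> strict_mono_on C u \<longrightarrow>
       X (\<lambda>l. V (fst l, map u (snd l))) = X V"
    and V_EM: "\<forall>X C. dfn A X \<longrightarrow> finite C \<longrightarrow> supported {l. set (snd l) \<subseteq> C} X \<longrightarrow>
       (\<forall>w. strict_mono_on C w \<longrightarrow> X (\<lambda>l. F (fst l) (map w (snd l)))) \<longrightarrow> X V"
    using extraction_line[OF A, of F, OF F] by (elim exE conjE)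
  define F' where "F' k \<eta> = V (k, spread_list \<eta>)" for k \<eta>
  have F'P: "F' k \<eta> \<in> P" for k \<eta> unfolding F'_def using V by blast
  define sp where "sp X g = X (\<lambda>l. g (fst l, spread_list (snd l)))" for X :: "('k \<times> rat list \<Rightarrow> 'p) \<Rightarrow> bool" and g
  define CC where "CC \<Xi> = (\<Union>\<xi> \<in> \<Xi>. set (spread_list \<xi>))" for \<Xi>
  have sp_dfn: "dfn A (sp X)" if "dfn A X" for X
    unfolding sp_def using dfn_reindex[OF that] .
  have CC_fin: "finite (CC \<Xi>)" if "finite \<Xi>" for \<Xi> using that by (auto simp: CC_def)
  have sp_supp: "supported {l. set (snd l) \<subseteq> CC \<Xi>} (sp X)" if X: "supported {l. snd l \<in> \<Xi>} X" for X \<Xi>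
    unfolding supported_def sp_def
  proof (intro allI impI)
    fix f g :: "'k \<times> rat list \<Rightarrow> 'p"
    assume fg: "range f \<subseteq> P" "range g \<subseteq> P" "\<forall>l \<in> {l. set (snd l) \<subseteq> CC \<Xi>}. f l = g l"
    show "X (\<lambda>l. f (fst l, spread_list (snd l))) = X (\<lambda>l. g (fst l, spread_list (snd l)))"
    proof (rule supportedD[OF X])
      fix l assume "l \<in> {l :: 'k \<times> rat list. snd l \<in> \<Xi>}"
      then have "set (spread_list (snd l)) \<subseteq> CC \<Xi>" unfolding CC_def by blast
      then show "f (fst l, spread_list (snd l)) = g (fst l, spread_list (snd l))" using fg(3) by simp
    qed (use fg in blast)+
  qed
  have CC_elem: "\<exists>i \<xi>. \<xi> \<in> \<Xi> \<and> i < length \<xi> \<and> c = spread i (\<xi> ! i)" if "c \<in> CC \<Xi>" for c \<Xi>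
    using that unfolding CC_def set_spread_list by blast
  have CC_I: "spread i (\<xi> ! i) \<in> CC \<Xi>" if "\<xi> \<in> \<Xi>" "i < length \<xi>" for i \<xi> \<Xi>
    unfolding CC_def using that nth_mem[of i "spread_list \<xi>"] by (intro UN_I[OF that(1)]) simp
  have EM: "EM d A F F'"
    unfolding EM_def
  proof (intro allI impI)
    fix X :: "('k \<times> rat list \<Rightarrow> 'p) \<Rightarrow> bool" and \<Xi>
    assume X: "dfn A X" and fin: "finite \<Xi>" and len: "\<forall>\<xi> \<in> \<Xi>. length \<xi> = d"
      and supp: "supported {l. snd l \<in> \<Xi>} X"
      and all: "\<forall>f. cmono d \<Xi> f \<longrightarrow> X (\<lambda>l. F (fst l) (f (snd l)))"
    have "sp X V"
    proof (rule V_EM[rule_format, OF sp_dfn[OF X] CC_fin[OF fin] sp_supp[OF supp]])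
      fix w :: "rat \<Rightarrow> rat" assume w: "strict_mono_on (CC \<Xi>) w"
      have "cmono d \<Xi> (\<lambda>\<xi>. map w (spread_list \<xi>))"
        unfolding cmono_def
      proof (intro conjI ballI allI impI)
        fix \<xi> \<xi>' i assume \<xi>: "\<xi> \<in> \<Xi>" "\<xi>' \<in> \<Xi>" "i < d"
        then have l: "length \<xi> = d" "length \<xi>' = d" using len by auto
        have "spread i (\<xi> ! i) \<in> CC \<Xi>" "spread i (\<xi>' ! i) \<in> CC \<Xi>"
          using CC_I \<xi> l by simp_all
        then have "w (spread i (\<xi> ! i)) < w (spread i (\<xi>' ! i)) \<longleftrightarrow> spread i (\<xi> ! i) < spread i (\<xi>' ! i)"
          by (rule strict_mono_on_less[OF w])
        then show "\<xi> ! i < \<xi>' ! i \<longleftrightarrow> map w (spread_list \<xi>) ! i < map w (spread_list \<xi>') ! i"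
          using \<xi> l by (simp add: spread_less_iff)
      qed (use len in auto)
      then show "sp X (\<lambda>l. F (fst l) (map w (snd l)))"
        unfolding sp_def using all[rule_format, of "\<lambda>\<xi>. map w (spread_list \<xi>)"] by simp
    qed
    then show "X (\<lambda>l. F' (fst l) (snd l))" unfolding sp_def F'_def .
  qed
  have inv: "X (\<lambda>l. F' (fst l) (f (snd l))) = X (\<lambda>l. F' (fst l) (snd l))"
    if X: "dfn A X" and fin: "finite \<Xi>" and supp: "supported {l. snd l \<in> \<Xi>} X" and f: "cmono d \<Xi> f" for X \<Xi> f
  proof -
    \<comment> \<open>The coordinatewise map \<open>f\<close> turns into one increasing map of the
      line. The spread intervals are disjoint, so a point of \<open>CC \<Xi>\<close> determines its
      coordinate, and \<open>f\<close> respects equality of entries, so the choice of the tuple does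
      not matter.\<close>
    define u where "u c = (case (SOME p. snd p \<in> \<Xi> \<and> fst p < d \<and> c = spread (fst p) (snd p ! fst p)) of
       (i, \<xi>) \<Rightarrow> spread i (f \<xi> ! i))" for c
    have len: "length \<xi> = d" "length (f \<xi>) = d" if "\<xi> \<in> \<Xi>" for \<xi> using f that by (auto simp: cmono_def)
    have f_eq: "f \<xi> ! i = f \<xi>' ! i" if "\<xi> \<in> \<Xi>" "\<xi>' \<in> \<Xi>" "i < d" "\<xi> ! i = \<xi>' ! i" for \<xi> \<xi>' i
      using f that unfolding cmono_def by (metis less_irrefl linorder_neqE)
    have u: "u (spread i (\<xi> ! i)) = spread i (f \<xi> ! i)" if "\<xi> \<in> \<Xi>" "i < d" for i \<xi>
    proof -
      let ?Q = "\<lambda>p. snd p \<in> \<Xi> \<and> fst p < d \<and> spread i (\<xi> ! i) = spread (fst p) (snd p ! fst p)"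
      have "?Q (SOME p. ?Q p)" by (rule someI[of ?Q "(i, \<xi>)"]) (use that in simp)
      moreover obtain j \<xi>' where p: "(SOME p. ?Q p) = (j, \<xi>')" by fastforce
      ultimately have "\<xi>' \<in> \<Xi>" "j = i" "\<xi>' ! i = \<xi> ! i" by (auto simp: spread_eq_iff)
      then show ?thesis unfolding u_def p using f_eq[OF that(1) _ that(2), of \<xi>'] by simp
    qed
    have "strict_mono_on (CC \<Xi>) u"
    proof (rule strict_mono_onI)
      fix r s assume "r \<in> CC \<Xi>" "s \<in> CC \<Xi>" and rs: "r < s"
      then obtain i \<xi> j \<xi>' where r: "\<xi> \<in> \<Xi>" "i < length \<xi>" "r = spread i (\<xi> ! i)"
        and s: "\<xi>' \<in> \<Xi>" "j < length \<xi>'" "s = spread j (\<xi>' ! j)" using CC_elem by metis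
      have id: "i < d" "j < d" using r s len by auto
      have "i < j \<or> i = j \<and> \<xi> ! i < \<xi>' ! i" using rs r s by (auto simp: spread_less_iff)
      then have "i < j \<or> i = j \<and> f \<xi> ! i < f \<xi>' ! i" using f r s id unfolding cmono_def by blast
      then show "u r < u s" using u[OF r(1) id(1)] u[OF s(1) id(2)] r(3) s(3) by (auto simp: spread_less_iff)
    qed
    from V_ind[rule_format, OF sp_dfn[OF X] CC_fin[OF fin] sp_supp[OF supp] this]
    have "X (\<lambda>l. V (fst l, map u (spread_list (snd l)))) = X (\<lambda>l. F' (fst l) (snd l))"
      unfolding sp_def F'_def by simp
    moreover have "X (\<lambda>l. V (fst l, map u (spread_list (snd l)))) = X (\<lambda>l. F' (fst l) (f (snd l)))"
    proof (rule supportedD[OF supp])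
      fix l assume "l \<in> {l :: 'k \<times> rat list. snd l \<in> \<Xi>}"
      then have l: "snd l \<in> \<Xi>" by simp
      have "map u (spread_list (snd l)) = spread_list (f (snd l))"
        by (rule nth_equalityI) (use len[OF l] u[OF l] in auto)
      then show "V (fst l, map u (spread_list (snd l))) = F' (fst l) (f (snd l))" unfolding F'_def by simp
    qed (use V F'P in blast)+
    ultimately show ?thesis by simp
  qed
  have "ind_on UNIV d A F'"
    unfolding ind_on_def
  proof (intro allI impI)
    fix \<Xi> f assume f: "cmono d \<Xi> f"
    show "\<exists>\<sigma> \<in> Au A. \<forall>k \<in> UNIV. \<forall>\<xi> \<in> \<Xi>. \<sigma> (F' k \<xi>) = F' k (f \<xi>)"
    proof (cases "\<Xi> = {}")
      case True
      then show ?thesis using Au_id by blast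
    next
      case False
      then obtain \<xi>0 where \<xi>0: "\<xi>0 \<in> \<Xi>" by blast
      \<comment> \<open>Homogeneity is stated for total assignments; labels outside \<Xi> are
        therefore sent to one fixed element of \<Xi>.\<close>
      define r where "r \<xi> = (if \<xi> \<in> \<Xi> then \<xi> else \<xi>0)" for \<xi>
      have r\<Xi>: "r \<xi> \<in> \<Xi>" for \<xi> using \<xi>0 by (simp add: r_def)
      have "\<exists>\<sigma> \<in> Au A. \<forall>l :: 'k \<times> rat list. \<sigma> (F' (fst l) (r (snd l))) = F' (fst l) (f (r (snd l)))"
      proof (rule homogeneity_labels[OF A])
        fix X :: "('k \<times> rat list \<Rightarrow> 'p) \<Rightarrow> bool"
        assume X: "dfn A X" and Xf: "X (\<lambda>l. F' (fst l) (r (snd l)))"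
        obtain S where S: "finite S" "supported S X" using dfn_supported[OF X] by blast
        define Y where "Y g = X (\<lambda>l. g (fst l, r (snd l)))" for g
        define \<Xi>0 where "\<Xi>0 = r ` snd ` S"
        have "dfn A Y" unfolding Y_def by (rule dfn_reindex[OF X])
        moreover have "finite \<Xi>0" using S(1) unfolding \<Xi>0_def by simp
        moreover have "supported {l. snd l \<in> \<Xi>0} Y"
          unfolding supported_def Y_def
        proof (intro allI impI)
          fix g g' :: "'k \<times> rat list \<Rightarrow> 'p"
          assume g: "range g \<subseteq> P" "range g' \<subseteq> P" "\<forall>l \<in> {l. snd l \<in> \<Xi>0}. g l = g' l"
          show "X (\<lambda>l. g (fst l, r (snd l))) = X (\<lambda>l. g' (fst l, r (snd l)))"
          proof (rule supportedD[OF S(2)])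
            fix l assume "l \<in> S"
            then have "r (snd l) \<in> \<Xi>0" unfolding \<Xi>0_def by blast
            then show "g (fst l, r (snd l)) = g' (fst l, r (snd l))" using g(3) by simp
          qed (use g in blast)+
        qed
        moreover have "\<Xi>0 \<subseteq> \<Xi>" using r\<Xi> unfolding \<Xi>0_def by auto
        then have "cmono d \<Xi>0 f" using f unfolding cmono_def by blast
        ultimately have "Y (\<lambda>l. F' (fst l) (f (snd l))) = Y (\<lambda>l. F' (fst l) (snd l))"
          by (rule inv)
        then show "X (\<lambda>l. F' (fst l) (f (r (snd l))))" using Xf unfolding Y_def by simp
      qed (use F'P in auto)
      then obtain \<sigma> where \<sigma>: "\<sigma> \<in> Au A" "\<forall>l :: 'k \<times> rat list. \<sigma> (F' (fst l) (r (snd l))) = F' (fst l) (f (r (snd l)))"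
        by blast
      have "\<sigma> (F' k \<xi>) = F' k (f \<xi>)" if "\<xi> \<in> \<Xi>" for k \<xi>
        using \<sigma>(2)[rule_format, of "(k, \<xi>)"] that by (simp add: r_def)
      then show ?thesis using \<sigma>(1) by blast
    qed
  qed
  then show ?thesis using F'P EM by blast
qed

text \<open>The kinds that are already indiscernible can be kept: by EM their new copies have the same
  type over \<open>A\<close>, so an automorphism moves them back.\<close>

lemma extraction:
  fixes F :: "'k::countable \<Rightarrow> rat list \<Rightarrow> 'p"
  assumes A: "countable A" "A \<subseteq> P" and F: "\<And>k \<eta>. F k \<eta> \<in> P" and K: "ind_on K d A F"
  shows "\<exists>F'. (\<forall>k \<eta>. F' k \<eta> \<in> P) \<and> EM d A F F' \<and> ind_on UNIV d A F' \<and>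
    (\<forall>k \<in> K. \<forall>\<xi>. length \<xi> = d \<longrightarrow> F' k \<xi> = F k \<xi>)"
proof -
  obtain F2 where F2: "\<forall>k \<eta>. F2 k \<eta> \<in> P" "EM d A F F2" "ind_on UNIV d A F2"
    using extraction_product[OF A, of F d, OF F] by (elim exE conjE)
  have "\<exists>\<tau> \<in> Au A. \<forall>k \<in> K. \<forall>\<xi>. length \<xi> = d \<longrightarrow> \<tau> (F2 k \<xi>) = F k \<xi>"
  proof (cases "K = {}")
    case True
    then show ?thesis using Au_id by blast
  next
    case False
    then obtain k0 where k0: "k0 \<in> K" by blast
    define rk where "rk k = (if k \<in> K then k else k0)" for k
    define rl where "rl \<xi> = (if length \<xi> = d then \<xi> else replicate d 0)" for \<xi> :: "rat list"
    have rk: "rk k \<in> K" and rl: "length (rl \<xi>) = d" for k \<xi> using k0 by (auto simp: rk_def rl_def)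
    have "\<exists>\<tau> \<in> Au A. \<forall>l :: 'k \<times> rat list. \<tau> (F2 (rk (fst l)) (rl (snd l))) = F (rk (fst l)) (rl (snd l))"
    proof (rule homogeneity_labels[OF A])
      fix X :: "('k \<times> rat list \<Rightarrow> 'p) \<Rightarrow> bool"
      assume X: "dfn A X" and XF2: "X (\<lambda>l. F2 (rk (fst l)) (rl (snd l)))"
      obtain S where S: "finite S" "supported S X" using dfn_supported[OF X] by blast
      \<comment> \<open>Were the two arrays separated by \<open>X\<close>, its negation would hold
        in \<open>F\<close> at all tuples of the same order type, because \<open>F\<close> is
        indiscernible on \<open>K\<close>; extraction would carry the negation over to
        \<open>F2\<close>.\<close>
      define Y where "Y g = (\<not> X (\<lambda>l. g (rk (fst l), rl (snd l))))" for g
      define \<Xi> where "\<Xi> = rl ` snd ` S"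
      have Y: "dfn A Y" unfolding Y_def by (rule dfn_neg[OF dfn_reindex[OF X]])
      have supp: "supported {l. snd l \<in> \<Xi>} Y"
        unfolding supported_def Y_def
      proof (intro allI impI)
        fix g g' :: "'k \<times> rat list \<Rightarrow> 'p"
        assume g: "range g \<subseteq> P" "range g' \<subseteq> P" "\<forall>l \<in> {l. snd l \<in> \<Xi>}. g l = g' l"
        have "X (\<lambda>l. g (rk (fst l), rl (snd l))) = X (\<lambda>l. g' (rk (fst l), rl (snd l)))"
        proof (rule supportedD[OF S(2)])
          fix l assume "l \<in> S"
          then have "rl (snd l) \<in> \<Xi>" unfolding \<Xi>_def by blast
          then show "g (rk (fst l), rl (snd l)) = g' (rk (fst l), rl (snd l))" using g(3) by simp
        qed (use g in blast)+
        then show "(\<not> X (\<lambda>l. g (rk (fst l), rl (snd l)))) = (\<not> X (\<lambda>l. g' (rk (fst l), rl (snd l))))" by simp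
      qed
      show "X (\<lambda>l. F (rk (fst l)) (rl (snd l)))"
      proof (rule ccontr)
        assume neg: "\<not> X (\<lambda>l. F (rk (fst l)) (rl (snd l)))"
        have "Y (\<lambda>l. F (fst l) (f (snd l)))" if f: "cmono d \<Xi> f" for f
        proof -
          obtain \<sigma> where \<sigma>: "\<sigma> \<in> Au A" "\<forall>k \<in> K. \<forall>\<xi> \<in> \<Xi>. \<sigma> (F k \<xi>) = F k (f \<xi>)"
            using K[unfolded ind_on_def, rule_format, OF f] by blast
          have "X (\<lambda>l. F (rk (fst l)) (f (rl (snd l)))) = X (\<lambda>l. \<sigma> (F (rk (fst l)) (rl (snd l))))"
          proof (rule supportedD[OF S(2)])
            fix l assume "l \<in> S"
            then have "rl (snd l) \<in> \<Xi>" unfolding \<Xi>_def by blast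
            then show "F (rk (fst l)) (f (rl (snd l))) = \<sigma> (F (rk (fst l)) (rl (snd l)))" using \<sigma>(2) rk by simp
          qed (use F Au_P[OF \<sigma>(1)] in auto)
          also have "\<dots> = X (\<lambda>l. F (rk (fst l)) (rl (snd l)))"
            using Au_dfn[OF \<sigma>(1) X, of "\<lambda>l. F (rk (fst l)) (rl (snd l))"] F by auto
          finally show ?thesis unfolding Y_def using neg by simp
        qed
        then have all: "\<forall>f. cmono d \<Xi> f \<longrightarrow> Y (\<lambda>l. F (fst l) (f (snd l)))" by blast
        have \<Xi>: "finite \<Xi>" "\<forall>\<xi> \<in> \<Xi>. length \<xi> = d" using S(1) rl by (auto simp: \<Xi>_def)
        have "Y (\<lambda>l. F2 (fst l) (snd l))" by (rule EM_D[OF F2(2) Y \<Xi> supp all])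
        then show False using XF2 unfolding Y_def by simp
      qed
    qed (use F F2(1) in auto)
    then obtain \<tau> where \<tau>: "\<tau> \<in> Au A" "\<forall>l :: 'k \<times> rat list. \<tau> (F2 (rk (fst l)) (rl (snd l))) = F (rk (fst l)) (rl (snd l))"
      by blast
    have "\<tau> (F2 k \<xi>) = F k \<xi>" if "k \<in> K" "length \<xi> = d" for k \<xi>
      using \<tau>(2)[rule_format, of "(k, \<xi>)"] that by (simp add: rk_def rl_def)
    then show ?thesis using \<tau>(1) by blast
  qed
  then obtain \<tau> where \<tau>: "\<tau> \<in> Au A" "\<forall>k \<in> K. \<forall>\<xi>. length \<xi> = d \<longrightarrow> \<tau> (F2 k \<xi>) = F k \<xi>" by blast
  obtain \<tau>' where \<tau>': "\<tau>' \<in> Au A" "\<forall>p \<in> P. \<tau>' (\<tau> p) = p \<and> \<tau> (\<tau>' p) = p"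
    using Au_inv[OF \<tau>(1) A(2)] by blast
  define F' where "F' k \<xi> = \<tau> (F2 k \<xi>)" for k \<xi>
  have "EM d A F F'"
    unfolding EM_def
  proof (intro allI impI)
    fix X :: "('k \<times> rat list \<Rightarrow> 'p) \<Rightarrow> bool" and \<Xi>
    assume X: "dfn A X" "finite \<Xi>" "\<forall>\<xi> \<in> \<Xi>. length \<xi> = d" "supported {l. snd l \<in> \<Xi>} X"
      "\<forall>f. cmono d \<Xi> f \<longrightarrow> X (\<lambda>l. F (fst l) (f (snd l)))"
    have "X (\<lambda>l. F2 (fst l) (snd l))"
      by (rule EM_D[OF F2(2) X])
    then show "X (\<lambda>l. F' (fst l) (snd l))"
      unfolding F'_def using Au_dfn[OF \<tau>(1) X(1), of "\<lambda>l. F2 (fst l) (snd l)"] F2(1) by auto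
  qed
  moreover have "ind_on UNIV d A F'"
    unfolding ind_on_def
  proof (intro allI impI)
    fix \<Xi> f assume f: "cmono d \<Xi> f"
    obtain \<sigma> where \<sigma>: "\<sigma> \<in> Au A" "\<forall>k \<in> UNIV. \<forall>\<xi> \<in> \<Xi>. \<sigma> (F2 k \<xi>) = F2 k (f \<xi>)"
      using F2(3)[unfolded ind_on_def, rule_format, OF f] by blast
    have "(\<tau> \<circ> \<sigma> \<circ> \<tau>') (F' k \<xi>) = F' k (f \<xi>)" if "\<xi> \<in> \<Xi>" for k \<xi>
      using \<sigma>(2) \<tau>'(2) F2(1) that unfolding F'_def by simp
    moreover have "\<tau> \<circ> \<sigma> \<circ> \<tau>' \<in> Au A" by (intro Au_comp \<tau>(1) \<tau>'(1) \<sigma>(1))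
    ultimately show "\<exists>\<sigma> \<in> Au A. \<forall>k \<in> UNIV. \<forall>\<xi> \<in> \<Xi>. \<sigma> (F' k \<xi>) = F' k (f \<xi>)" by blast
  qed
  moreover have "F' k \<xi> \<in> P" for k \<xi> unfolding F'_def using Au_P[OF \<tau>(1)] F2(1) by simp
  moreover have "\<forall>k \<in> K. \<forall>\<xi>. length \<xi> = d \<longrightarrow> F' k \<xi> = F k \<xi>" using \<tau>(2) unfolding F'_def .
  ultimately show ?thesis by (intro exI[of _ F']) simp
qed

end

section \<open>Bad pairs on indiscernible lines\<close>

lemma increasing_enumeration:
  fixes Q :: "rat set"
  assumes "finite Q"
  shows "\<exists>(h :: nat \<Rightarrow> rat) idx. (\<forall>i j. i < j \<longrightarrow> j < card Q \<longrightarrow> h i < h j) \<and>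
    (\<forall>q \<in> Q. idx q < card Q \<and> h (idx q) = q) \<and> (\<forall>q \<in> Q. \<forall>q' \<in> Q. q < q' \<longrightarrow> idx q < idx q')"
proof -
  define h where "h i = sorted_list_of_set Q ! i" for i
  have h: "h i < h j" if "i < j" "j < card Q" for i j
    unfolding h_def using that assms sorted_wrt_nth_less[OF strict_sorted_list_of_set, of i j Q] by simp
  have "\<forall>q \<in> Q. \<exists>i. i < card Q \<and> h i = q"
    using assms set_sorted_list_of_set[OF assms] unfolding h_def by (metis in_set_conv_nth length_sorted_list_of_set)
  then obtain idx where idx: "\<forall>q \<in> Q. idx q < card Q \<and> h (idx q) = q" by (metis bchoice)
  have "idx q < idx q'" if q: "q \<in> Q" "q' \<in> Q" "q < q'" for q q'
  proof (rule ccontr)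
    assume "\<not> idx q < idx q'"
    then have "idx q' = idx q \<or> idx q' < idx q" by auto
    moreover have "idx q < card Q" using idx q by simp
    ultimately have "h (idx q') \<le> h (idx q)" using h[of "idx q'" "idx q"] by fastforce
    moreover have "h (idx q) = q" "h (idx q') = q'" using idx q by simp_all
    ultimately show False using q(3) by simp
  qed
  then show ?thesis using h idx by blast
qed

section \<open>Finite approximations to a line, and their bad pairs\<close>

context tuple_geometry
begin

definition ind_line :: "'p set \<Rightarrow> ('k \<Rightarrow> rat \<Rightarrow> 'p) \<Rightarrow> bool" where
  "ind_line A S \<longleftrightarrow>
     (\<forall>X f. strict_mono_on X f \<longrightarrow> (\<exists>\<sigma> \<in> Au A. \<forall>k. \<forall>r \<in> X. \<sigma> (S k r) = S k (f r)))"

lemma ind_lineD: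
  "ind_line A S \<Longrightarrow> strict_mono_on X f \<Longrightarrow> \<exists>\<sigma> \<in> Au A. \<forall>k. \<forall>r \<in> X. \<sigma> (S k r) = S k (f r)"
  unfolding ind_line_def by simp

text \<open>A formula in the Ehrenfeucht-Mostowski type of the line \<open>S\<close> over
  \<open>A\<close>, written for the positions below \<open>n\<close>.\<close>

definition cond :: "'p set \<Rightarrow> ('k \<Rightarrow> rat \<Rightarrow> 'p) \<Rightarrow> (('k \<times> nat \<Rightarrow> 'p) \<Rightarrow> bool) \<Rightarrow> nat \<Rightarrow> bool" where
  "cond A S X n \<longleftrightarrow> dfn A X \<and> supported {l. snd l < n} X \<and>
     (\<forall>h. (\<forall>i j. i < j \<longrightarrow> j < n \<longrightarrow> h i < h j) \<longrightarrow> X (\<lambda>l. S (fst l) (h (snd l))))"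

definition incr :: "nat \<Rightarrow> nat \<Rightarrow> (nat \<Rightarrow> nat) \<Rightarrow> bool" where
  "incr n N h \<longleftrightarrow> (\<forall>i j. i < j \<longrightarrow> j < n \<longrightarrow> h i < h j) \<and> (\<forall>i<n. h i < N)"

text \<open>Finite chains that look like the sequences \<open>k0\<close> and \<open>k1\<close> of
  \<open>S\<close> as far as the finite set \<Delta> can tell. The other kinds of points are
  quantified away through \<open>V\<close>, since a configuration consists of two sequences
  only.\<close>

definition seqs :: "'k \<Rightarrow> 'k \<Rightarrow> ((('k \<times> nat \<Rightarrow> 'p) \<Rightarrow> bool) \<times> nat) set \<Rightarrow> nat \<Rightarrow> (nat \<Rightarrow> 'p) \<Rightarrow> (nat \<Rightarrow> 'p) \<Rightarrow> bool" where
  "seqs k0 k1 \<Delta> N y b \<longleftrightarrow> (\<exists>V. range V \<subseteq> P \<and> (\<forall>i \<in> {..<N}. V (k0, i) = y i \<and> V (k1, i) = b i) \<and>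
     (\<forall>x \<in> \<Delta>. \<forall>h. incr (snd x) N h \<longrightarrow> fst x (\<lambda>l. V (fst l, h (snd l)))) \<and>
     (\<forall>i \<in> {..<N}. \<forall>j \<in> {..<N}. i \<noteq> j \<longrightarrow> (E (V (k0, i)) (V (k1, j)) \<longleftrightarrow> i < j)))"

lemma seqs_config:
  fixes S :: "'k::countable \<Rightarrow> rat \<Rightarrow> 'p"
  assumes S: "\<And>k r. S k r \<in> P"
    and chain: "\<And>p q. p \<noteq> q \<Longrightarrow> E (S k0 p) (S k1 q) \<longleftrightarrow> p < q"
    and \<Delta>: "finite \<Delta>" "\<And>x. x \<in> \<Delta> \<Longrightarrow> cond A S (fst x) (snd x)"
  shows "\<exists>A0. config A0 (seqs k0 k1 \<Delta>)"
proof -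
  have "\<forall>x \<in> \<Delta>. \<exists>A0. finite A0 \<and> A0 \<subseteq> A \<inter> P \<and> dfn A0 (fst x)"
    using \<Delta>(2) dfn_finite_params unfolding cond_def by blast
  then obtain B where B: "\<forall>x \<in> \<Delta>. finite (B x) \<and> B x \<subseteq> A \<inter> P \<and> dfn (B x) (fst x)"
    using bchoice by metis
  define A0 where "A0 = (\<Union>x \<in> \<Delta>. B x)"
  have A0: "finite A0" "A0 \<subseteq> P" unfolding A0_def using B \<Delta>(1) by auto
  have dA0: "dfn A0 (fst x)" if x: "x \<in> \<Delta>" for x
  proof -
    have "B x \<subseteq> A0" unfolding A0_def using x by blast
    then show ?thesis using B x dfn_mono by blast
  qed
  have "dfn A0 (\<lambda>f :: nat \<times> bool \<Rightarrow> 'p. seqs k0 k1 \<Delta> N (\<lambda>i. f (i, False)) (\<lambda>i. f (i, True)))" for N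
  proof -
    \<comment> \<open>Choices are cut down to functions on \<open>{..<n}\<close>, of which there are
      finitely many; the demand for all increasing choices then is a finite conjunction.\<close>
    define H where "H n = {h \<in> {..<n} \<rightarrow>\<^sub>E {..<N}. incr n N h}" for n
    have H: "finite (H n)" for n unfolding H_def by (simp add: finite_PiE)
    have all_H: "(\<forall>h. incr (snd x) N h \<longrightarrow> fst x (\<lambda>l. V (fst l, h (snd l)))) \<longleftrightarrow>
        (\<forall>h \<in> H (snd x). fst x (\<lambda>l. V (fst l, h (snd l))))" if x: "x \<in> \<Delta>" and V: "range V \<subseteq> P" for x V
    proof
      assume r: "\<forall>h \<in> H (snd x). fst x (\<lambda>l. V (fst l, h (snd l)))"
      show "\<forall>h. incr (snd x) N h \<longrightarrow> fst x (\<lambda>l. V (fst l, h (snd l)))"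
      proof (intro allI impI)
        fix h assume h: "incr (snd x) N h"
        let ?h = "restrict h {..<snd x}"
        have "?h \<in> H (snd x)" using h unfolding H_def incr_def by auto
        then have "fst x (\<lambda>l. V (fst l, ?h (snd l)))" using r by blast
        moreover have "fst x (\<lambda>l. V (fst l, ?h (snd l))) = fst x (\<lambda>l. V (fst l, h (snd l)))"
        proof (rule supportedD[of "{l. snd l < snd x}"])
          show "supported {l. snd l < snd x} (fst x)" using \<Delta>(2)[OF x] unfolding cond_def by simp
        qed (use V in auto)
        ultimately show "fst x (\<lambda>l. V (fst l, h (snd l)))" by simp
      qed
    qed (simp add: H_def)
    have "dfn A0 (\<lambda>g :: ('k \<times> nat) + (nat \<times> bool) \<Rightarrow> 'p.
        (\<forall>i \<in> {..<N}. g (Inl (k0, i)) = g (Inr (i, False)) \<and> g (Inl (k1, i)) = g (Inr (i, True))) \<and>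
        (\<forall>x \<in> \<Delta>. \<forall>h \<in> H (snd x). fst x (\<lambda>l. g (Inl (fst l, h (snd l))))) \<and>
        (\<forall>i \<in> {..<N}. \<forall>j \<in> {..<N}. i \<noteq> j \<longrightarrow> (E (g (Inl (k0, i))) (g (Inl (k1, j))) \<longleftrightarrow> i < j)))"
    proof (intro dfn_conj dfn_ball dfn_imp dfn_iff dfn_const dfn_eq_labels dfn_E_labels)
      fix x h assume "x \<in> \<Delta>"
      show "dfn A0 (\<lambda>g :: ('k \<times> nat) + (nat \<times> bool) \<Rightarrow> 'p. fst x (\<lambda>l. g (Inl (fst l, h (snd l)))))"
        by (rule dfn_reindex[OF dA0[OF \<open>x \<in> \<Delta>\<close>]])
    qed (use \<Delta>(1) H in auto)
    from dfn_Ex[OF this] show ?thesis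
    proof (rule dfn_cong)
      fix f :: "nat \<times> bool \<Rightarrow> 'p" assume "range f \<subseteq> P"
      show "(\<exists>g. range g \<subseteq> P \<and>
           (\<forall>i \<in> {..<N}. case_sum g f (Inl (k0, i)) = case_sum g f (Inr (i, False)) \<and>
              case_sum g f (Inl (k1, i)) = case_sum g f (Inr (i, True))) \<and>
           (\<forall>x \<in> \<Delta>. \<forall>h \<in> H (snd x). fst x (\<lambda>l. case_sum g f (Inl (fst l, h (snd l))))) \<and>
           (\<forall>i \<in> {..<N}. \<forall>j \<in> {..<N}. i \<noteq> j \<longrightarrow>
              (E (case_sum g f (Inl (k0, i))) (case_sum g f (Inl (k1, j))) \<longleftrightarrow> i < j))) \<longleftrightarrow>
          seqs k0 k1 \<Delta> N (\<lambda>i. f (i, False)) (\<lambda>i. f (i, True))"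
        unfolding seqs_def sum.case
      proof (rule ex_cong1)
        fix V :: "'k \<times> nat \<Rightarrow> 'p"
        show "(range V \<subseteq> P \<and> (\<forall>i \<in> {..<N}. V (k0, i) = f (i, False) \<and> V (k1, i) = f (i, True)) \<and>
            (\<forall>x \<in> \<Delta>. \<forall>h \<in> H (snd x). fst x (\<lambda>l. V (fst l, h (snd l)))) \<and>
            (\<forall>i \<in> {..<N}. \<forall>j \<in> {..<N}. i \<noteq> j \<longrightarrow> (E (V (k0, i)) (V (k1, j)) \<longleftrightarrow> i < j))) \<longleftrightarrow>
          (range V \<subseteq> P \<and> (\<forall>i \<in> {..<N}. V (k0, i) = f (i, False) \<and> V (k1, i) = f (i, True)) \<and>
            (\<forall>x \<in> \<Delta>. \<forall>h. incr (snd x) N h \<longrightarrow> fst x (\<lambda>l. V (fst l, h (snd l)))) \<and>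
            (\<forall>i \<in> {..<N}. \<forall>j \<in> {..<N}. i \<noteq> j \<longrightarrow> (E (V (k0, i)) (V (k1, j)) \<longleftrightarrow> i < j)))"
          using all_H[of _ V] by (cases "range V \<subseteq> P") auto
      qed
    qed
  qed
  moreover have "seqs k0 k1 \<Delta> M (\<lambda>i. y (h i)) (\<lambda>i. b (h i))"
    if G: "seqs k0 k1 \<Delta> N y b" and h: "\<forall>i j. i < j \<longrightarrow> j < M \<longrightarrow> h i < h j" "\<forall>i<M. h i < N" for N M y b h
  proof -
    obtain V where V: "range V \<subseteq> P" "\<forall>i \<in> {..<N}. V (k0, i) = y i \<and> V (k1, i) = b i"
      "\<forall>x \<in> \<Delta>. \<forall>h. incr (snd x) N h \<longrightarrow> fst x (\<lambda>l. V (fst l, h (snd l)))"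
      "\<forall>i \<in> {..<N}. \<forall>j \<in> {..<N}. i \<noteq> j \<longrightarrow> (E (V (k0, i)) (V (k1, j)) \<longleftrightarrow> i < j)"
      using G unfolding seqs_def by (elim exE conjE)
    have h_iff: "h i < h j \<longleftrightarrow> i < j" "h i = h j \<longleftrightarrow> i = j" if "i < M" "j < M" for i j
      using h(1)[rule_format, of i j] h(1)[rule_format, of j i] that by (metis less_asym linorder_neqE_nat less_irrefl)+
    show ?thesis unfolding seqs_def
    proof (intro exI[of _ "\<lambda>l. V (fst l, h (snd l))"] conjI ballI allI impI)
      fix x h' assume x: "x \<in> \<Delta>" and h': "incr (snd x) M h'"
      have "incr (snd x) N (\<lambda>i. h (h' i))" using h' h unfolding incr_def by auto
      from V(3)[rule_format, OF x this]
      show "fst x (\<lambda>l. V (fst (fst l, h' (snd l)), h (snd (fst l, h' (snd l)))))" by simp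
    next
      fix i j assume "i \<in> {..<M}" "j \<in> {..<M}" "i \<noteq> j"
      then show "E (V (fst (k0, i), h (snd (k0, i)))) (V (fst (k1, j), h (snd (k1, j)))) \<longleftrightarrow> i < j"
        using V(4)[rule_format, of "h i" "h j"] h(2) h_iff[of i j] by simp
    qed (use V h(2) in auto)
  qed
  moreover have "E (y i) (b j) \<longleftrightarrow> i < j" if "seqs k0 k1 \<Delta> N y b" "i < N" "j < N" "i \<noteq> j" for N y b i j
    using that unfolding seqs_def by auto
  moreover have "\<exists>y b. range y \<subseteq> P \<and> range b \<subseteq> P \<and> seqs k0 k1 \<Delta> N y b" for N
  proof (intro exI conjI)
    show "seqs k0 k1 \<Delta> N (\<lambda>i. S k0 (of_nat i)) (\<lambda>i. S k1 (of_nat i))"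
      unfolding seqs_def
    proof (intro exI[of _ "\<lambda>l. S (fst l) (of_nat (snd l))"] conjI ballI allI impI)
      fix x h assume x: "x \<in> \<Delta>" and h: "incr (snd x) N h"
      have "\<forall>h :: nat \<Rightarrow> rat. (\<forall>i j. i < j \<longrightarrow> j < snd x \<longrightarrow> h i < h j) \<longrightarrow> fst x (\<lambda>l. S (fst l) (h (snd l)))"
        using \<Delta>(2)[OF x] unfolding cond_def by blast
      from this[rule_format, of "\<lambda>i. of_nat (h i)"]
      show "fst x (\<lambda>l. S (fst (fst l, h (snd l))) (of_nat (snd (fst l, h (snd l)))))"
        using h unfolding incr_def by simp
    qed (use S chain in auto)
  qed (use S in auto)
  ultimately have "config A0 (seqs k0 k1 \<Delta>)"
    unfolding config_def using A0 by (intro conjI allI impI) simp_all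
  then show ?thesis ..
qed

lemma seqs_mono:
  assumes "\<Delta> \<subseteq> \<Delta>'" "seqs k0 k1 \<Delta>' N y b"
  shows "seqs k0 k1 \<Delta> N y b"
proof -
  obtain V where V: "range V \<subseteq> P" "\<forall>i \<in> {..<N}. V (k0, i) = y i \<and> V (k1, i) = b i"
    "\<forall>x \<in> \<Delta>'. \<forall>h. incr (snd x) N h \<longrightarrow> fst x (\<lambda>l. V (fst l, h (snd l)))"
    "\<forall>i \<in> {..<N}. \<forall>j \<in> {..<N}. i \<noteq> j \<longrightarrow> (E (V (k0, i)) (V (k1, j)) \<longleftrightarrow> i < j)"
    using assms(2) unfolding seqs_def by (elim exE conjE)
  have "\<forall>x \<in> \<Delta>. \<forall>h. incr (snd x) N h \<longrightarrow> fst x (\<lambda>l. V (fst l, h (snd l)))"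
    using V(3) assms(1) by blast
  then show ?thesis unfolding seqs_def using V by (intro exI[of _ V] conjI)
qed

text \<open>Both sorts of bad pair, distinguished by the sign \<open>t\<close>. In addition
  \<open>y\<close> and \<open>c\<close> occur in zones of length one, through which they inherit the
  unary properties listed in \<Delta>.\<close>

definition bad :: "(nat \<Rightarrow> (nat \<Rightarrow> 'p) \<Rightarrow> (nat \<Rightarrow> 'p) \<Rightarrow> bool) \<Rightarrow> bool \<Rightarrow> 'p \<Rightarrow> 'p \<Rightarrow> bool" where
  "bad G t y c \<longleftrightarrow> (\<exists>Y B. zone G 1 Y B \<and> Y 0 = y) \<and> (\<exists>Y B. zone G 1 Y B \<and> B 0 = c) \<and> E y c = (\<not> t) \<and>
     (\<forall>N. \<exists>Y B. zone G N Y B \<and> (\<forall>i<N. E (Y i) c = t \<and> E y (B i) = t))"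

lemma ex_bad:
  assumes "\<not> concl" "config A0 G"
  shows "\<exists>t y c. bad G t y c"
proof (rule ccontr)
  assume *: "\<not> ?thesis"
  have "concl"
  proof (rule concl_if_no_bad_pair[OF assms(2)])
    fix y c Y B Y' B'
    assume z: "zone G 1 Y B" "Y 0 = y" "zone G 1 Y' B'" "B' 0 = c"
    have "\<not> badI G y c"
    proof
      assume "badI G y c"
      then have "bad G True y c" unfolding bad_def badI_def using z by (simp; blast)
      then show False using * by blast
    qed
    moreover have "\<not> badII G y c"
    proof
      assume "badII G y c"
      then have "bad G False y c" unfolding bad_def badII_def using z by (simp; blast)
      then show False using * by blast
    qed
    ultimately show "\<not> badI G y c \<and> \<not> badII G y c" by blast
  qed
  then show False using assms(1) by simp
qed

lemma bad_mono:
  assumes "\<And>N y b. G' N y b \<Longrightarrow> G N y b" "bad G' t y c"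
  shows "bad G t y c"
proof -
  have z: "zone G N y b" if "zone G' N y b" for N y b using that assms(1) unfolding zone_def by blast
  have "(\<exists>Y B. zone G' 1 Y B \<and> Y 0 = y)" "(\<exists>Y B. zone G' 1 Y B \<and> B 0 = c)" and e: "E y c = (\<not> t)"
    and a: "\<forall>N. \<exists>Y B. zone G' N Y B \<and> (\<forall>i<N. E (Y i) c = t \<and> E y (B i) = t)"
    using assms(2) unfolding bad_def by blast+
  then have "(\<exists>Y B. zone G 1 Y B \<and> Y 0 = y)" "(\<exists>Y B. zone G 1 Y B \<and> B 0 = c)" using z by blast+
  moreover have "\<exists>Y B. zone G N Y B \<and> (\<forall>i<N. E (Y i) c = t \<and> E y (B i) = t)" for N
    using a[rule_format, of N] z by blast
  ultimately show ?thesis unfolding bad_def using e by (intro conjI allI)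
qed

lemma cond_unary:
  assumes "dfn A (X :: (unit \<Rightarrow> 'p) \<Rightarrow> bool)" "\<And>r. X (\<lambda>_. S k r)"
  shows "cond A S (\<lambda>V. X (\<lambda>_. V (k, 0))) 1"
  unfolding cond_def
proof (intro conjI allI impI)
  show "dfn A (\<lambda>V. X (\<lambda>_. V (k, 0 :: nat)))" by (rule dfn_reindex[OF assms(1)])
  show "supported {l. snd l < (1 :: nat)} (\<lambda>V. X (\<lambda>_. V (k, 0)))"
    unfolding supported_def
  proof (intro allI impI)
    fix f g :: "'a \<times> nat \<Rightarrow> 'p" assume "range f \<subseteq> P" "range g \<subseteq> P" and "\<forall>l \<in> {l. snd l < 1}. f l = g l"
    then have "f (k, 0) = g (k, 0)" by auto
    then show "X (\<lambda>_. f (k, 0)) = X (\<lambda>_. g (k, 0))" by (simp only:)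
  qed
qed (use assms(2) in simp)

text \<open>Each finite part of the type of \<open>S\<close> has a bad pair; compactness joins them
  into one pair over a complete line, and homogeneity moves this line back to \<open>S\<close>.
  Since \<open>y\<close> and \<open>c\<close> have over \<open>A\<close> the types of single points
  of the line, they are images of \<open>S k0 0\<close> and \<open>S k1 0\<close>.\<close>

lemma bad_pair_on_line:
  fixes S :: "'k::countable \<Rightarrow> rat \<Rightarrow> 'p"
  assumes nc: "\<not> concl" and A: "countable A" "A \<subseteq> P" and S: "\<And>k r. S k r \<in> P" and ind: "ind_line A S"
    and chain: "\<And>p q. p \<noteq> q \<Longrightarrow> E (S k0 p) (S k1 q) \<longleftrightarrow> p < q"
  shows "\<exists>\<sigma> \<in> Au A. \<exists>\<rho> \<in> Au A. \<exists>t. (\<forall>r. E (\<sigma> (S k0 0)) (S k1 r) = t \<and> E (S k0 r) (\<rho> (S k1 0)) = t) \<and>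
    E (\<sigma> (S k0 0)) (\<rho> (S k1 0)) = (\<not> t)"
proof -
  let ?ok = "\<lambda>\<Delta>. finite \<Delta> \<and> (\<forall>x \<in> \<Delta>. cond A S (fst x) (snd x))"
  have ex: "\<exists>t y c. bad (seqs k0 k1 \<Delta>) t y c" if "?ok \<Delta>" for \<Delta>
    using seqs_config[of S k0 k1 \<Delta> A] S chain that ex_bad[OF nc, of _ "seqs k0 k1 \<Delta>"] by blast
  \<comment> \<open>The sign can be fixed beforehand: if \<Delta>1 excluded one sign and \<Delta>2
    the other, their union would have no bad pair at all.\<close>
  have "\<exists>t. \<forall>\<Delta>. ?ok \<Delta> \<longrightarrow> (\<exists>y c. bad (seqs k0 k1 \<Delta>) t y c)"
  proof (rule ccontr)
    assume "\<not> ?thesis"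
    then obtain \<Delta>1 \<Delta>2 where \<Delta>: "?ok \<Delta>1" "\<not> (\<exists>y c. bad (seqs k0 k1 \<Delta>1) True y c)"
      "?ok \<Delta>2" "\<not> (\<exists>y c. bad (seqs k0 k1 \<Delta>2) False y c)" by metis
    have "?ok (\<Delta>1 \<union> \<Delta>2)" using \<Delta>(1,3) by auto
    then obtain t y c where b: "bad (seqs k0 k1 (\<Delta>1 \<union> \<Delta>2)) t y c" using ex by blast
    have "bad (seqs k0 k1 \<Delta>1) t y c" "bad (seqs k0 k1 \<Delta>2) t y c"
      by (rule bad_mono[OF _ b], rule seqs_mono[rotated], assumption, simp)+
    then show False using \<Delta>(2,4) by (cases t) auto
  qed
  then obtain t where t: "\<And>\<Delta>. ?ok \<Delta> \<Longrightarrow> \<exists>y c. bad (seqs k0 k1 \<Delta>) t y c" by blast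
  \<comment> \<open>The demands: \<open>Inl\<close> copies the type of the line,
    \<open>Inr (Inl _)\<close> gives \<open>y\<close> or \<open>c\<close> the unary properties
    shared by the whole line, and \<open>Inr (Inr q)\<close> fixes the signs at position
    \<open>q\<close>.\<close>
  define I where "I = {i :: ((('k \<times> nat \<Rightarrow> 'p) \<Rightarrow> bool) \<times> nat \<times> (nat \<Rightarrow> rat)) + ((bool \<times> ((unit \<Rightarrow> 'p) \<Rightarrow> bool)) + rat). case i of
      Inl x \<Rightarrow> cond A S (fst x) (fst (snd x)) \<and> (\<forall>i j. i < j \<longrightarrow> j < fst (snd x) \<longrightarrow> snd (snd x) i < snd (snd x) j)
    | Inr j \<Rightarrow> (case j of Inl x \<Rightarrow> dfn A (snd x) \<and> (\<forall>r. snd x (\<lambda>_. S (if fst x then k1 else k0) r)) | Inr (q :: rat) \<Rightarrow> True)}"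
  define K where "K i = (\<lambda>g :: ('k \<times> rat) + bool \<Rightarrow> 'p. case i of
      Inl x \<Rightarrow> fst x (\<lambda>l :: 'k \<times> nat. g (Inl (fst l, snd (snd x) (snd l))))
    | Inr j \<Rightarrow> (case j of Inl x \<Rightarrow> snd x (\<lambda>_ :: unit. g (Inr (fst x)))
        | Inr q \<Rightarrow> E (g (Inr False)) (g (Inl (k1, q))) = t \<and> E (g (Inl (k0, q))) (g (Inr True)) = t \<and>
            E (g (Inr False)) (g (Inr True)) = (\<not> t)))"
    for i :: "((('k \<times> nat \<Rightarrow> 'p) \<Rightarrow> bool) \<times> nat \<times> (nat \<Rightarrow> rat)) + ((bool \<times> ((unit \<Rightarrow> 'p) \<Rightarrow> bool)) + rat)"
  have "\<exists>g. range g \<subseteq> P \<and> (\<forall>i \<in> I. K i g)"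
  proof (rule compactness_indexed[OF A])
    fix i assume i: "i \<in> I"
    show "dfn A (K i)"
    proof (cases i)
      case (Inl x)
      then have "dfn A (fst x)" using i unfolding I_def cond_def by simp
      then show ?thesis unfolding K_def Inl sum.case by (rule dfn_reindex)
    next
      case (Inr j)
      show ?thesis
      proof (cases j)
        case (Inl x)
        then have "dfn A (snd x)" using i Inr unfolding I_def by simp
        then show ?thesis unfolding K_def Inr Inl sum.case by (rule dfn_reindex)
      next
        case (Inr q)
        show ?thesis unfolding K_def \<open>i = Inr j\<close> Inr sum.case
          by (intro dfn_conj dfn_iff dfn_const dfn_E_labels)
      qed
    qed
  next
    fix J assume J: "J \<subseteq> I" "finite J"
    define J1 where "J1 = Inl -` J"
    define J2 where "J2 = (\<lambda>x. Inr (Inl x)) -` J"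
    define J3 where "J3 = (\<lambda>x. Inr (Inr x)) -` J"
    have fin: "finite J1" "finite J2" "finite J3"
      unfolding J1_def J2_def J3_def using J(2) by (auto intro!: finite_vimageI injI)
    define T where "T = (\<Union>x \<in> J1. snd (snd x) ` {..<fst (snd x)}) \<union> J3"
    have T: "finite T" unfolding T_def using fin by simp
    define \<Delta> where "\<Delta> = (\<lambda>x. (fst x, fst (snd x))) ` J1 \<union>
      (\<lambda>x. (\<lambda>V. snd x (\<lambda>_. V (if fst x then k1 else k0, 0)), 1)) ` J2"
    have "?ok \<Delta>"
    proof (intro conjI ballI)
      show "finite \<Delta>" unfolding \<Delta>_def using fin by simp
      fix x assume "x \<in> \<Delta>"
      then consider z where "z \<in> J1" "x = (fst z, fst (snd z))"
        | z where "z \<in> J2" "x = (\<lambda>V. snd z (\<lambda>_. V (if fst z then k1 else k0, 0)), 1)"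
        unfolding \<Delta>_def by blast
      then show "cond A S (fst x) (snd x)"
      proof cases
        case 1
        then show ?thesis using J(1) unfolding J1_def I_def by auto
      next
        case 2
        then have "Inr (Inl z) \<in> I" using J(1) unfolding J2_def by blast
        then have "dfn A (snd z)" "\<And>r. snd z (\<lambda>_. S (if fst z then k1 else k0) r)"
          unfolding I_def by simp_all
        then show ?thesis unfolding 2(2) fst_conv snd_conv by (rule cond_unary)
      qed
    qed
    then obtain y c where yc: "bad (seqs k0 k1 \<Delta>) t y c" using t by blast
    obtain Y0 B0 where y: "zone (seqs k0 k1 \<Delta>) 1 Y0 B0" "Y0 0 = y" using yc unfolding bad_def by blast
    obtain Y1 B1 where c: "zone (seqs k0 k1 \<Delta>) 1 Y1 B1" "B1 0 = c" using yc unfolding bad_def by blast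
    obtain Y B where YB: "zone (seqs k0 k1 \<Delta>) (card T) Y B"
      "\<forall>i<card T. E (Y i) c = t \<and> E y (B i) = t" using yc unfolding bad_def by blast
    obtain V where V: "range V \<subseteq> P" "\<forall>i \<in> {..<card T}. V (k0, i) = Y i \<and> V (k1, i) = B i"
      "\<forall>x \<in> \<Delta>. \<forall>h. incr (snd x) (card T) h \<longrightarrow> fst x (\<lambda>l. V (fst l, h (snd l)))"
      using YB(1) unfolding zone_def seqs_def by (elim exE conjE)
    have yP: "y \<in> P" and cP: "c \<in> P" using y c unfolding zone_def by auto
    define rk where "rk q = card {s \<in> T. s < q}" for q
    have rk: "rk p < rk q" if "p \<in> T" "q \<in> T" "p < q" for p q
      using strict_mono_onD[OF strict_mono_rank[OF T]] that unfolding rk_def by blast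
    have rkT: "rk q < card T" if "q \<in> T" for q
      unfolding rk_def using T that by (intro psubset_card_mono) auto
    \<comment> \<open>The finitely many rationals in question are placed on the zone by their rank;
      the label \<open>False\<close> stands for \<open>y\<close> and \<open>True\<close> for
      \<open>c\<close>.\<close>
    define g where "g l = (case l of Inl (k, q) \<Rightarrow> V (k, rk q) | Inr b \<Rightarrow> if b then c else y)" for l
    have gP: "range g \<subseteq> P" using range_into[OF V(1)] yP cP by (auto simp: g_def split: sum.splits)
    have unary: "x (\<lambda>_. y)" if "(False, x) \<in> J2" for x
    proof -
      have m: "(\<lambda>V. x (\<lambda>_. V (k0, 0)), 1) \<in> \<Delta>" unfolding \<Delta>_def using that by force
      obtain V where V: "\<forall>i \<in> {..<1}. V (k0, i) = Y0 i \<and> V (k1, i) = B0 i"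
        "\<forall>x \<in> \<Delta>. \<forall>h. incr (snd x) 1 h \<longrightarrow> fst x (\<lambda>l. V (fst l, h (snd l)))"
        using y(1) unfolding zone_def seqs_def by (elim exE conjE)
      from V(2)[rule_format, OF m, of "\<lambda>i. i"] show ?thesis using V(1) y(2) by (simp add: incr_def)
    qed
    have unary': "x (\<lambda>_. c)" if "(True, x) \<in> J2" for x
    proof -
      have m: "(\<lambda>V. x (\<lambda>_. V (k1, 0)), 1) \<in> \<Delta>" unfolding \<Delta>_def using that by force
      obtain V where V: "\<forall>i \<in> {..<1}. V (k0, i) = Y1 i \<and> V (k1, i) = B1 i"
        "\<forall>x \<in> \<Delta>. \<forall>h. incr (snd x) 1 h \<longrightarrow> fst x (\<lambda>l. V (fst l, h (snd l)))"
        using c(1) unfolding zone_def seqs_def by (elim exE conjE)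
      from V(2)[rule_format, OF m, of "\<lambda>i. i"] show ?thesis using V(1) c(2) by (simp add: incr_def)
    qed
    have "K i g" if iJ: "i \<in> J" for i
    proof (cases i)
      case (Inl x)
      then have x: "x \<in> J1" using iJ unfolding J1_def by simp
      then have m: "(fst x, fst (snd x)) \<in> \<Delta>" unfolding \<Delta>_def by blast
      have inc: "\<forall>i j. i < j \<longrightarrow> j < fst (snd x) \<longrightarrow> snd (snd x) i < snd (snd x) j"
        using iJ J(1) Inl unfolding I_def by auto
      have xT: "snd (snd x) i \<in> T" if "i < fst (snd x)" for i
        unfolding T_def using x that by blast
      have "incr (fst (snd x)) (card T) (\<lambda>i. rk (snd (snd x) i))"
        unfolding incr_def using rk rkT xT inc by simp
      from V(3)[rule_format, OF m, unfolded snd_conv, OF this] show ?thesis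
        unfolding K_def Inl g_def by simp
    next
      case (Inr j)
      show ?thesis
      proof (cases j)
        case (Inl x)
        then have "(fst x, snd x) \<in> J2" using iJ Inr unfolding J2_def by simp
        then show ?thesis using unary[of "snd x"] unary'[of "snd x"]
          unfolding K_def \<open>i = Inr j\<close> Inl g_def by (cases "fst x") auto
      next
        case (Inr q)
        then have "q \<in> T" using iJ \<open>i = Inr j\<close> unfolding T_def J3_def by simp
        then have "rk q < card T" by (rule rkT)
        moreover have "E y c = (\<not> t)" using yc unfolding bad_def by blast
        ultimately show ?thesis unfolding K_def \<open>i = Inr j\<close> Inr g_def using YB(2) V(2) by simp
      qed
    qed
    then show "\<exists>g. range g \<subseteq> P \<and> (\<forall>i \<in> J. K i g)" using gP by blast
  qed
  then obtain g where g: "range g \<subseteq> P" and gK: "\<forall>i \<in> I. K i g" by blast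
  define y c where "y = g (Inr False)" and "c = g (Inr True)"
  have yP: "y \<in> P" and cP: "c \<in> P" unfolding y_def c_def using g by auto
  have "\<exists>\<tau> \<in> Au A. \<forall>l :: 'k \<times> rat. \<tau> (g (Inl l)) = S (fst l) (snd l)"
  proof (rule homogeneity_labels[OF A])
    fix X :: "('k \<times> rat \<Rightarrow> 'p) \<Rightarrow> bool"
    assume X: "dfn A X" and Xg: "X (\<lambda>l. g (Inl l))"
    show "X (\<lambda>l. S (fst l) (snd l))"
    proof (rule ccontr)
      assume neg: "\<not> X (\<lambda>l. S (fst l) (snd l))"
      obtain Z where Z: "finite Z" "supported Z X" using dfn_supported[OF X] by blast
      define Q where "Q = snd ` Z"
      have "finite Q" using Z(1) unfolding Q_def by simp
      from increasing_enumeration[OF this] obtain h idx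
        where hi: "(\<forall>i j. i < j \<longrightarrow> j < card Q \<longrightarrow> h i < (h j :: rat)) \<and>
          (\<forall>q \<in> Q. idx q < card Q \<and> h (idx q) = q) \<and> (\<forall>q \<in> Q. \<forall>q' \<in> Q. q < q' \<longrightarrow> idx q < idx q')"
        by (elim exE)
      then have h: "\<forall>i j. i < j \<longrightarrow> j < card Q \<longrightarrow> h i < (h j :: rat)"
        and idx: "\<forall>q \<in> Q. idx q < card Q \<and> h (idx q) = q" "\<forall>q \<in> Q. \<forall>q' \<in> Q. q < q' \<longrightarrow> idx q < idx q'"
        by blast+
      define X' where "X' V = (\<not> X (\<lambda>l. V (fst l, idx (snd l))))" for V :: "'k \<times> nat \<Rightarrow> 'p"
      have "cond A S X' (card Q)"
        unfolding cond_def
      proof (intro conjI allI impI)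
        show "dfn A X'" unfolding X'_def by (rule dfn_neg[OF dfn_reindex[OF X]])
        show "supported {l. snd l < card Q} X'"
          unfolding supported_def X'_def
        proof (intro allI impI)
          fix f f' :: "'k \<times> nat \<Rightarrow> 'p"
          assume f: "range f \<subseteq> P" "range f' \<subseteq> P" "\<forall>l \<in> {l. snd l < card Q}. f l = f' l"
          have "X (\<lambda>l. f (fst l, idx (snd l))) = X (\<lambda>l. f' (fst l, idx (snd l)))"
          proof (rule supportedD[OF Z(2)])
            fix l assume "l \<in> Z"
            then have "idx (snd l) < card Q" using idx(1) unfolding Q_def by simp
            then show "f (fst l, idx (snd l)) = f' (fst l, idx (snd l))" using f(3) by simp
          qed (use f in blast)+
          then show "(\<not> X (\<lambda>l. f (fst l, idx (snd l)))) = (\<not> X (\<lambda>l. f' (fst l, idx (snd l))))" by simp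
        qed
        fix h' :: "nat \<Rightarrow> rat" assume h': "\<forall>i j. i < j \<longrightarrow> j < card Q \<longrightarrow> h' i < h' j"
        have "strict_mono_on Q (\<lambda>q. h' (idx q))"
          by (rule strict_mono_onI) (use h' idx in simp)
        then obtain \<sigma> where \<sigma>: "\<sigma> \<in> Au A" "\<forall>k. \<forall>r \<in> Q. \<sigma> (S k r) = S k (h' (idx r))"
          using ind_lineD[OF ind] by blast
        have "X (\<lambda>l. S (fst l) (h' (idx (snd l)))) = X (\<lambda>l. \<sigma> (S (fst l) (snd l)))"
          by (rule supportedD[OF Z(2)]) (use S Au_P[OF \<sigma>(1)] \<sigma>(2) in \<open>auto simp: Q_def\<close>)
        also have "\<dots> = X (\<lambda>l. S (fst l) (snd l))"
          using Au_dfn[OF \<sigma>(1) X, of "\<lambda>l. S (fst l) (snd l)"] S by auto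
        finally show "X' (\<lambda>l. S (fst l) (h' (snd l)))" unfolding X'_def using neg by simp
      qed
      then have "Inl (X', card Q, h) \<in> I" unfolding I_def using h by simp
      then have "X' (\<lambda>l. g (Inl (fst l, h (snd l))))" using bspec[OF gK] unfolding K_def by (fastforce simp only: sum.case fst_conv snd_conv)
      moreover have "X (\<lambda>l. g (Inl (fst l, h (idx (snd l))))) = X (\<lambda>l. g (Inl l))"
        by (rule supportedD[OF Z(2)]) (use g idx(1) in \<open>auto simp: Q_def\<close>)
      ultimately show False unfolding X'_def using Xg by simp
    qed
  qed (use g S in auto)
  then obtain \<tau> where \<tau>: "\<tau> \<in> Au A" "\<forall>l :: 'k \<times> rat. \<tau> (g (Inl l)) = S (fst l) (snd l)" by blast
  have conj: "\<exists>\<sigma> \<in> Au A. \<sigma> (S (if b then k1 else k0) 0) = g (Inr b)" for b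
  proof -
    have "\<exists>\<sigma> \<in> Au A. \<forall>l :: unit. \<sigma> ((\<lambda>_. S (if b then k1 else k0) 0) l) = (\<lambda>_. g (Inr b)) l"
    proof (rule homogeneity_labels[OF A])
      fix X :: "(unit \<Rightarrow> 'p) \<Rightarrow> bool"
      assume X: "dfn A X" and XS: "X (\<lambda>_. S (if b then k1 else k0) 0)"
      have "X (\<lambda>_. S (if b then k1 else k0) r)" for r
      proof -
        have "strict_mono_on {0 :: rat} (\<lambda>_. r)" by (rule strict_mono_onI) simp
        then obtain \<sigma> where \<sigma>: "\<sigma> \<in> Au A" "\<forall>k. \<forall>s \<in> {0}. \<sigma> (S k s) = S k r"
          using ind_lineD[OF ind] by blast
        show ?thesis
          using Au_dfn[OF \<sigma>(1) X, of "\<lambda>_. S (if b then k1 else k0) 0"] \<sigma>(2) S XS by auto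
      qed
      then have "Inr (Inl (b, X)) \<in> I" unfolding I_def using X by simp
      then show "X (\<lambda>_. g (Inr b))" using bspec[OF gK] unfolding K_def by (fastforce simp only: sum.case fst_conv snd_conv)
    qed (use g S in auto)
    then show ?thesis by simp
  qed
  obtain \<sigma> where \<sigma>: "\<sigma> \<in> Au A" "\<sigma> (S k0 0) = y" using conj[of False] unfolding y_def by auto
  obtain \<rho> where \<rho>: "\<rho> \<in> Au A" "\<rho> (S k1 0) = c" using conj[of True] unfolding c_def by auto
  have Kq: "E y (g (Inl (k1, q))) = t \<and> E (g (Inl (k0, q))) c = t \<and> E y c = (\<not> t)" for q
  proof -
    have "Inr (Inr q) \<in> I" unfolding I_def by simp
    then show ?thesis using bspec[OF gK] unfolding K_def y_def c_def by fastforce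
  qed
  have gP: "g l \<in> P" for l using g by blast
  have "E (\<tau> y) (S k1 r) = t \<and> E (S k0 r) (\<tau> c) = t" for r
    using Kq[of r] Au_E[OF \<tau>(1) yP, of "g (Inl (k1, r))"] Au_E[OF \<tau>(1) _ cP, of "g (Inl (k0, r))"] \<tau>(2) gP by simp
  moreover have "E (\<tau> y) (\<tau> c) = (\<not> t)" using Au_E[OF \<tau>(1) yP cP] Kq[of 0] by simp
  ultimately show ?thesis
    using \<sigma>(2) \<rho>(2) Au_comp[OF \<tau>(1) \<sigma>(1)] Au_comp[OF \<tau>(1) \<rho>(1)]
    by (intro bexI[of _ "\<tau> \<circ> \<sigma>"] bexI[of _ "\<tau> \<circ> \<rho>"] exI[of _ t]) auto
qed

end

section \<open>Grids and initial arrays\<close>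

definition same2 :: "nat \<Rightarrow> rat list \<Rightarrow> rat list \<Rightarrow> rat list \<Rightarrow> rat list \<Rightarrow> bool" where
  "same2 d \<eta> \<xi> \<eta>' \<xi>' \<longleftrightarrow> length \<eta>' = d \<and> length \<xi>' = d \<and>
     (\<forall>i<d. (\<eta> ! i < \<xi> ! i \<longleftrightarrow> \<eta>' ! i < \<xi>' ! i) \<and> (\<xi> ! i < \<eta> ! i \<longleftrightarrow> \<xi>' ! i < \<eta>' ! i))"

lemma same2_eq: "same2 d \<eta> \<xi> \<eta>' \<xi>' \<Longrightarrow> i < d \<Longrightarrow> \<eta> ! i = \<xi> ! i \<longleftrightarrow> \<eta>' ! i = \<xi>' ! i"
  unfolding same2_def by (metis less_irrefl linorder_neqE)

lemma same2_less: "same2 d \<eta> \<xi> \<eta>' \<xi>' \<Longrightarrow> i < d \<Longrightarrow> \<eta> ! i < \<xi> ! i \<longleftrightarrow> \<eta>' ! i < \<xi>' ! i"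
  unfolding same2_def by simp

lemma same2_length: "same2 d \<eta> \<xi> \<eta>' \<xi>' \<Longrightarrow> length \<eta>' = d \<and> length \<xi>' = d"
  unfolding same2_def by simp

section \<open>Moving families of tuples, independent sequences, and the first leaf\<close>

context tuple_geometry
begin

text \<open>Indiscernibility for indexed families, which spares the construction of a map on tuples:
  the order condition forces \<open>l'\<close> to factor through \<open>l\<close>.\<close>

lemma ind_family:
  assumes ind: "ind_on K d A F" and len: "\<And>x. x \<in> X \<Longrightarrow> length (l x) = d \<and> length (l' x) = d"
    and ord: "\<And>x x' i. x \<in> X \<Longrightarrow> x' \<in> X \<Longrightarrow> i < d \<Longrightarrow> l x ! i < l x' ! i \<longleftrightarrow> l' x ! i < l' x' ! i"
  shows "\<exists>\<sigma> \<in> Au A. \<forall>k \<in> K. \<forall>x \<in> X. \<sigma> (F k (l x)) = F k (l' x)"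
proof -
  define f where "f \<xi> = l' (SOME x. x \<in> X \<and> l x = \<xi>)" for \<xi>
  have f: "f (l x) = l' x" if x: "x \<in> X" for x
  proof -
    let ?x = "SOME z. z \<in> X \<and> l z = l x"
    have z: "?x \<in> X \<and> l ?x = l x" by (rule someI[of _ x]) (use x in simp)
    have "l' ?x = l' x"
    proof (rule nth_equalityI)
      show "length (l' ?x) = length (l' x)" using len z x by simp
      fix i assume "i < length (l' ?x)"
      then have i: "i < d" using len z by simp
      show "l' ?x ! i = l' x ! i"
        using ord[of ?x x i] ord[of x ?x i] z x i by (metis less_irrefl linorder_neqE)
    qed
    then show ?thesis unfolding f_def .
  qed
  have "cmono d (l ` X) f"
    unfolding cmono_def using len ord f by auto
  then obtain \<sigma> where "\<sigma> \<in> Au A" "\<forall>k \<in> K. \<forall>\<xi> \<in> l ` X. \<sigma> (F k \<xi>) = F k (f \<xi>)"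
    using ind[unfolded ind_on_def] by blast
  then show ?thesis using f by auto
qed

text \<open>The form in which extraction is used below: a definable relation between two entries
  passes to \<open>F'\<close> if it holds in \<open>F\<close> whenever the positions compare in the
  same way.\<close>

lemma EM_pair:
  fixes F F' :: "'k \<Rightarrow> rat list \<Rightarrow> 'p"
  assumes em: "EM d A F F'" and Y: "dfn A (\<lambda>g :: bool \<Rightarrow> 'p. Y (g False) (g True))"
    and len: "length \<eta> = d" "length \<xi> = d"
    and all: "\<And>\<eta>' \<xi>'. same2 d \<eta> \<xi> \<eta>' \<xi>' \<Longrightarrow> Y (F k \<eta>') (F k' \<xi>')"
  shows "Y (F' k \<eta>) (F' k' \<xi>)"
proof -
  define X where "X g = Y (g (k, \<eta>)) (g (k', \<xi>))" for g :: "'k \<times> rat list \<Rightarrow> 'p"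
  have "dfn A (\<lambda>g :: 'k \<times> rat list \<Rightarrow> 'p. (\<lambda>g. Y (g False) (g True)) (\<lambda>b. g (if b then (k', \<xi>) else (k, \<eta>))))"
    by (rule dfn_reindex[OF Y])
  then have X: "dfn A X" unfolding X_def by simp
  have supp: "supported {l. snd l \<in> {\<eta>, \<xi>}} X"
    unfolding supported_def X_def
  proof (intro allI impI)
    fix f g :: "'k \<times> rat list \<Rightarrow> 'p"
    assume "range f \<subseteq> P" "range g \<subseteq> P" and "\<forall>l \<in> {l. snd l \<in> {\<eta>, \<xi>}}. f l = g l"
    then have "f (k, \<eta>) = g (k, \<eta>)" "f (k', \<xi>) = g (k', \<xi>)" by auto
    then show "Y (f (k, \<eta>)) (f (k', \<xi>)) = Y (g (k, \<eta>)) (g (k', \<xi>))" by (simp only:)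
  qed
  have "X (\<lambda>l. F (fst l) (f (snd l)))" if f: "cmono d {\<eta>, \<xi>} f" for f
  proof -
    have "same2 d \<eta> \<xi> (f \<eta>) (f \<xi>)" using f unfolding cmono_def same2_def by blast
    then show ?thesis unfolding X_def using all by simp
  qed
  then have "X (\<lambda>l. F' (fst l) (snd l))"
    using EM_D[OF em X _ _ supp] len by simp
  then show ?thesis unfolding X_def by simp
qed

lemma EM_one:
  assumes em: "EM d A F F'" and Y: "dfn A (\<lambda>g :: unit \<Rightarrow> 'p. Y (g ()))" and len: "length \<xi> = d"
    and all: "\<And>\<xi>'. length \<xi>' = d \<Longrightarrow> Y (F k \<xi>')"
  shows "Y (F' k \<xi>)"
proof -
  have Y': "dfn A (\<lambda>g :: bool \<Rightarrow> 'p. Y (g False))"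
    using dfn_reindex[OF Y, where h="\<lambda>_. False"] .
  show ?thesis
    by (rule EM_pair[OF em, where Y="\<lambda>p q. Y p" and k'=k, OF Y' len len]) (use all in \<open>simp add: same2_def\<close>)
qed

lemma EM_E:
  assumes em: "EM d A F F'" and len: "length \<eta> = d" "length \<xi> = d"
    and all: "\<And>\<eta>' \<xi>'. same2 d \<eta> \<xi> \<eta>' \<xi>' \<Longrightarrow> E (F k \<eta>') (F k' \<xi>') = t"
  shows "E (F' k \<eta>) (F' k' \<xi>) = t"
proof -
  have Y: "dfn A (\<lambda>g :: bool \<Rightarrow> 'p. E (g False) (g True) = t)"
    by (intro dfn_iff dfn_const dfn_E_labels)
  show ?thesis by (rule EM_pair[OF em, where Y="\<lambda>p q. E p q = t", OF Y len]) (rule all)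
qed

lemma EM_eq:
  assumes em: "EM d A F F'" and len: "length \<eta> = d" "length \<xi> = d"
    and all: "\<And>\<eta>' \<xi>'. same2 d \<eta> \<xi> \<eta>' \<xi>' \<Longrightarrow> F k \<eta>' = F k' \<xi>'"
  shows "F' k \<eta> = F' k' \<xi>"
proof -
  have Y: "dfn A (\<lambda>g :: bool \<Rightarrow> 'p. g False = g True)" by (rule dfn_eq_labels)
  show ?thesis by (rule EM_pair[OF em, where Y="\<lambda>p q. p = q", OF Y len]) (rule all)
qed

lemma EM_E_param:
  assumes em: "EM d A F F'" and len: "length \<xi> = d" and z: "z \<in> A" "z \<in> P"
    and all: "\<And>\<xi>'. length \<xi>' = d \<Longrightarrow> E z (F k \<xi>') = t"
  shows "E z (F' k \<xi>) = t"
proof -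
  have Y: "dfn A (\<lambda>g :: unit \<Rightarrow> 'p. E z (g ()) = t)"
    by (intro dfn_iff dfn_const dfn_E_left z)
  show ?thesis by (rule EM_one[OF em, where Y="\<lambda>p. E z p = t", OF Y len]) (rule all)
qed

lemma Au_unary:
  assumes "\<sigma> \<in> Au A" "dfn A (\<lambda>g :: unit \<Rightarrow> 'p. Y (g ()))" "p \<in> P"
  shows "Y (\<sigma> p) = Y p"
  using Au_dfn[OF assms(1,2), of "\<lambda>_. p"] assms(3) by auto

text \<open>Here \<open>k\<close> sequences of length \<open>N\<close> can be cut independently by
  \<open>E\<close>. The dimension \<open>d\<close> of the proof is a value of \<open>k\<close> for
  which this is possible at every length, while it fails at some length for
  \<open>Suc k\<close>.\<close>

definition grid :: "nat \<Rightarrow> nat \<Rightarrow> bool" where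
  "grid k N \<longleftrightarrow> (\<exists>\<gamma> :: nat \<Rightarrow> nat \<Rightarrow> 'p. (\<forall>i j. \<gamma> i j \<in> P) \<and>
     (\<forall>\<eta>. (\<forall>i<k. \<eta> i \<le> N) \<longrightarrow> (\<exists>c \<in> P. \<forall>i<k. \<forall>j<N. E (\<gamma> i j) c \<longleftrightarrow> j < \<eta> i)))"

lemma grid_one: "grid 1 N"
proof -
  obtain t where t: "range t \<subseteq> P" "\<And>i j :: nat. E (t i) (t j) \<longleftrightarrow> i < j" using order_chain by blast
  show ?thesis
    unfolding grid_def
  proof (intro exI[of _ "\<lambda>i j. t j"] conjI allI impI)
    fix \<eta> :: "nat \<Rightarrow> nat"
    show "\<exists>c \<in> P. \<forall>i<1. \<forall>j<N. E (t j) c \<longleftrightarrow> j < \<eta> i"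
      using t by (intro bexI[of _ "t (\<eta> 0)"]) auto
  qed (use t in auto)
qed

text \<open>For length 1 a grid is a family of \<open>k\<close> points shattered by
  \<open>E\<close>, so NIP bounds \<open>k\<close>.\<close>

lemma grid_bounded: "\<exists>k. \<not> grid k 1"
proof -
  have dE: "dfn {} (\<lambda>f :: unit + unit \<Rightarrow> 'p. E (f (Inl ())) (f (Inr ())))" by (rule dfn_E_labels)
  obtain m :: nat where m: "\<not> (\<exists>w y. (\<forall>i. range (w i) \<subseteq> P) \<and> (\<forall>I. range (y I) \<subseteq> P) \<and>
    (\<forall>I \<subseteq> {..<m}. \<forall>i<m. E (case_sum (w i) (y I) (Inl ())) (case_sum (w i) (y I) (Inr ())) \<longleftrightarrow> i \<in> I))"
    using finite_shattering_bound[OF countable_empty empty_subsetI dE] by (elim exE)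
  have "\<not> grid m 1"
  proof
    assume "grid m 1"
    then obtain \<gamma> :: "nat \<Rightarrow> nat \<Rightarrow> 'p" where \<gamma>: "\<forall>i j. \<gamma> i j \<in> P"
      "\<forall>\<eta>. (\<forall>i<m. \<eta> i \<le> 1) \<longrightarrow> (\<exists>c \<in> P. \<forall>i<m. \<forall>j<1. E (\<gamma> i j) c \<longleftrightarrow> j < \<eta> i)"
      unfolding grid_def by blast
    have "\<exists>c \<in> P. \<forall>i<m. E (\<gamma> i 0) c \<longleftrightarrow> i \<in> I" for I :: "nat set"
    proof -
      have "\<exists>c \<in> P. \<forall>i<m. \<forall>j<1. E (\<gamma> i j) c \<longleftrightarrow> j < (if i \<in> I then 1 else 0)"
        by (rule \<gamma>(2)[rule_format]) simp
      then obtain c where c: "c \<in> P" "\<forall>i<m. \<forall>j<1. E (\<gamma> i j) c \<longleftrightarrow> j < (if i \<in> I then 1 else 0)" by blast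
      have "E (\<gamma> i 0) c \<longleftrightarrow> i \<in> I" if "i < m" for i using c(2)[rule_format, OF that, of 0] by simp
      then show ?thesis using c(1) by blast
    qed
    then obtain c where c: "\<And>I. c I \<in> P" "\<And>I i. i < m \<Longrightarrow> E (\<gamma> i 0) (c I) \<longleftrightarrow> i \<in> I" by metis
    have "\<exists>w y. (\<forall>i. range (w i) \<subseteq> P) \<and> (\<forall>I. range (y I) \<subseteq> P) \<and>
      (\<forall>I \<subseteq> {..<m}. \<forall>i<m. E (case_sum (w i) (y I) (Inl ())) (case_sum (w i) (y I) (Inr ())) \<longleftrightarrow> i \<in> I)"
      using \<gamma>(1) c by (intro exI[of _ "\<lambda>i (_ :: unit). \<gamma> i 0"] exI[of _ "\<lambda>I (_ :: unit). c I"]) auto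
    then show False using m by blast
  qed
  then show ?thesis ..
qed

lemma ex_dimension: "\<exists>d\<ge>1. (\<forall>N. grid d N) \<and> \<not> (\<forall>N. grid (Suc d) N)"
proof (rule ccontr)
  assume *: "\<not> ?thesis"
  have "\<forall>N. grid (Suc k) N" for k
  proof (induction k)
    case 0
    show ?case using grid_one by simp
  next
    case (Suc k)
    then show ?case using * by (metis le_add1 plus_1_eq_Suc)
  qed
  moreover have "grid 0 1" 
  proof -
    obtain p where "p \<in> P" using P_nonempty by blast
    then show ?thesis unfolding grid_def by (intro exI[of _ "\<lambda>i j. p"]) auto
  qed
  ultimately have "grid k 1" for k by (cases k) auto
  then show False using grid_bounded by blast
qed

text \<open>The kinds below \<open>d\<close> are plain sequences. They are presented as arrays so
  that all kinds share one index set and extraction treats them uniformly.\<close>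

definition base_dep :: "nat \<Rightarrow> (nat \<Rightarrow> rat list \<Rightarrow> 'p) \<Rightarrow> bool" where
  "base_dep d F \<longleftrightarrow> (\<forall>i<d. \<forall>\<eta> \<eta>'. length \<eta> = d \<longrightarrow> length \<eta>' = d \<longrightarrow> \<eta> ! i = \<eta>' ! i \<longrightarrow> F i \<eta> = F i \<eta>')"

text \<open>The point at \<xi> realises the cut \<xi> of all \<open>d\<close> base sequences
  together; as for chains, the sign at equal positions is left open.\<close>

definition leaf :: "nat \<Rightarrow> (nat \<Rightarrow> rat list \<Rightarrow> 'p) \<Rightarrow> nat \<Rightarrow> bool" where
  "leaf d F \<beta> \<longleftrightarrow> (\<forall>i<d. \<forall>\<eta> \<xi>. length \<eta> = d \<longrightarrow> length \<xi> = d \<longrightarrow> \<eta> ! i \<noteq> \<xi> ! i \<longrightarrow>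
     (E (F i \<eta>) (F \<beta> \<xi>) \<longleftrightarrow> \<eta> ! i < \<xi> ! i))"

lemma EM_base_dep:
  assumes em: "EM d A F F'" and b: "base_dep d F"
  shows "base_dep d F'"
  unfolding base_dep_def
proof (intro allI impI)
  fix i and \<eta> \<eta>' :: "rat list" assume i: "i < d" and len: "length \<eta> = d" "length \<eta>' = d" and eq: "\<eta> ! i = \<eta>' ! i"
  show "F' i \<eta> = F' i \<eta>'"
  proof (rule EM_eq[OF em len])
    fix \<zeta> \<zeta>' assume s: "same2 d \<eta> \<eta>' \<zeta> \<zeta>'"
    show "F i \<zeta> = F i \<zeta>'"
      using b[unfolded base_dep_def, rule_format, of i \<zeta> \<zeta>'] same2_eq[OF s i] same2_length[OF s] i eq by simp
  qed
qed

lemma EM_leaf: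
  assumes em: "EM d A F F'" and b: "leaf d F \<beta>"
  shows "leaf d F' \<beta>"
  unfolding leaf_def
proof (intro allI impI)
  fix i and \<eta> \<xi> :: "rat list" assume i: "i < d" and len: "length \<eta> = d" "length \<xi> = d" and neq: "\<eta> ! i \<noteq> \<xi> ! i"
  show "E (F' i \<eta>) (F' \<beta> \<xi>) \<longleftrightarrow> \<eta> ! i < \<xi> ! i"
  proof (rule EM_E[OF em len])
    fix \<zeta> \<zeta>' assume s: "same2 d \<eta> \<xi> \<zeta> \<zeta>'"
    show "E (F i \<zeta>) (F \<beta> \<zeta>') \<longleftrightarrow> \<eta> ! i < \<xi> ! i"
      using b[unfolded leaf_def, rule_format, of i \<zeta> \<zeta>'] same2_eq[OF s i] same2_less[OF s i] same2_length[OF s] i neq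
      by simp
  qed
qed

lemma ind_on_empty: "ind_on {} d A F"
  unfolding ind_on_def using Au_id by blast

lemma initial_array:
  assumes grid: "\<And>N. grid d N"
  shows "\<exists>F. (\<forall>k \<eta>. F k \<eta> \<in> P) \<and> ind_on UNIV d {} F \<and> base_dep d F \<and> leaf d F d"
proof -
  define I where "I = {x :: nat \<times> rat \<times> rat list. fst x < d \<and> length (snd (snd x)) = d}"
  define K where "K x = (\<lambda>g :: (nat \<times> rat) + rat list \<Rightarrow> 'p.
     fst (snd x) \<noteq> snd (snd x) ! fst x \<longrightarrow>
     (E (g (Inl (fst x, fst (snd x)))) (g (Inr (snd (snd x)))) \<longleftrightarrow> fst (snd x) < snd (snd x) ! fst x))"
    for x :: "nat \<times> rat \<times> rat list"
  have "\<exists>g. range g \<subseteq> P \<and> (\<forall>x \<in> I. K x g)"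
  proof (rule compactness_indexed[of "{}"])
    show "dfn {} (K x)" for x unfolding K_def by (intro dfn_imp dfn_iff dfn_const dfn_E_labels)
    fix J assume J: "J \<subseteq> I" "finite J"
    define T where "T = (\<lambda>x. fst (snd x)) ` J \<union> (\<Union>x \<in> J. set (snd (snd x)))"
    have T: "finite T" unfolding T_def using J(2) by simp
    define rk where "rk q = card {s \<in> T. s < q}" for q
    have rk: "rk p < rk q \<longleftrightarrow> p < q" if "p \<in> T" "q \<in> T" for p q
      unfolding rk_def using strict_mono_on_less[OF strict_mono_rank[OF T] that] .
    have rkT: "rk q < card T" if "q \<in> T" for q
      unfolding rk_def using T that by (intro psubset_card_mono) auto
    have rk_le: "rk q \<le> card T" for q
      unfolding rk_def using T by (intro card_mono) auto
    obtain \<gamma> where \<gamma>: "\<forall>i j. \<gamma> i j \<in> P"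
      and ex: "\<forall>\<eta>. (\<forall>i<d. \<eta> i \<le> card T) \<longrightarrow> (\<exists>c \<in> P. \<forall>i<d. \<forall>j<card T. E (\<gamma> i j) c \<longleftrightarrow> j < \<eta> i)"
      using grid[of "card T"] unfolding grid_def by blast
    have "\<exists>c \<in> P. \<forall>i<d. \<forall>j<card T. E (\<gamma> i j) c \<longleftrightarrow> j < rk (\<xi> ! i)" for \<xi> :: "rat list"
      by (rule ex[rule_format]) (rule rk_le)
    then obtain c where c: "\<And>\<xi>. c \<xi> \<in> P" "\<And>\<xi> i j. i < d \<Longrightarrow> j < card T \<Longrightarrow> E (\<gamma> i j) (c \<xi>) \<longleftrightarrow> j < rk (\<xi> ! i)"
      by metis
    define g where "g l = (case l of Inl (i, r) \<Rightarrow> \<gamma> i (rk r) | Inr \<xi> \<Rightarrow> c \<xi>)" for l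
    have "range g \<subseteq> P" using \<gamma> c(1) by (auto simp: g_def split: sum.splits)
    moreover have "K x g" if x: "x \<in> J" for x
    proof -
      have i: "fst x < d" "length (snd (snd x)) = d" using x J(1) unfolding I_def by auto
      have "fst (snd x) \<in> T" unfolding T_def using x by blast
      moreover have "snd (snd x) ! fst x \<in> set (snd (snd x))" using i by simp
      then have "snd (snd x) ! fst x \<in> T" unfolding T_def using x by blast
      ultimately show ?thesis unfolding K_def g_def using c(2)[OF i(1) rkT] rk by simp
    qed
    ultimately show "\<exists>g. range g \<subseteq> P \<and> (\<forall>x \<in> J. K x g)" by blast
  qed simp_all
  then obtain g where g: "range g \<subseteq> P" "\<forall>x \<in> I. K x g" by blast
  \<comment> \<open>Kinds below \<open>d\<close> are the base sequences; all other kinds start as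
    copies of one and the same leaf.\<close>
  define F where "F k \<eta> = (if k < d then g (Inl (k, \<eta> ! k)) else g (Inr \<eta>))" for k \<eta>
  have F: "F k \<eta> \<in> P" for k \<eta> using g(1) by (auto simp: F_def)
  have b: "base_dep d F" unfolding base_dep_def F_def by simp
  have l: "leaf d F d"
    unfolding leaf_def
  proof (intro allI impI)
    fix i and \<eta> \<xi> :: "rat list" assume *: "i < d" "length \<eta> = d" "length \<xi> = d" "\<eta> ! i \<noteq> \<xi> ! i"
    have "(i, \<eta> ! i, \<xi>) \<in> I" unfolding I_def using * by simp
    then show "E (F i \<eta>) (F d \<xi>) \<longleftrightarrow> \<eta> ! i < \<xi> ! i"
      using bspec[OF g(2)] * unfolding K_def F_def by fastforce
  qed
  have "\<exists>F'. (\<forall>k \<eta>. F' k \<eta> \<in> P) \<and> EM d {} F F' \<and> ind_on UNIV d {} F' \<and>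
    (\<forall>k \<in> {}. \<forall>\<xi>. length \<xi> = d \<longrightarrow> F' k \<xi> = F k \<xi>)"
    by (rule extraction[OF _ _ F ind_on_empty]) simp_all
  then show ?thesis using EM_base_dep[OF _ b] EM_leaf[OF _ l] by blast
qed

end

section \<open>Coherent cuts\<close>

text \<open>Embeds the line into the open unit interval, so that positions up to 0 and from 1 on
  remain available as an outside.\<close>

definition hh :: "rat \<Rightarrow> rat" where
  "hh q = (1 + hs q) / 2"

lemma hh_less_iff [simp]: "hh p < hh q \<longleftrightarrow> p < q"
  unfolding hh_def by (simp add: divide_strict_right_mono)

lemma hh_eq_iff [simp]: "hh p = hh q \<longleftrightarrow> p = q"
  by (metis hh_less_iff less_irrefl linorder_neqE)

lemma hh_bounds: "0 < hh q" "hh q < 1"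
proof -
  have "- 1 < hs q" "hs q < 1" by (rule hs_bounds)+
  then have "0 < 1 + hs q" "1 + hs q < 2" by linarith+
  then show "0 < hh q" "hh q < 1" unfolding hh_def by auto
qed

definition one_at :: "nat \<Rightarrow> rat \<Rightarrow> nat \<Rightarrow> rat \<Rightarrow> rat list" where
  "one_at d b i r = (replicate d b)[i := r]"

lemma one_at_simps [simp]: "length (one_at d b i r) = d"
  "j < d \<Longrightarrow> one_at d b i r ! j = (if j = i then r else b)"
  by (auto simp: one_at_def nth_list_update)

lemma less_of_nat_rat: "i < j \<Longrightarrow> of_nat i + 1 \<le> (of_nat j :: rat)"
  by (metis Suc_eq_plus1 Suc_leI of_nat_1 of_nat_add of_nat_le_iff)

lemma finite_rat_bounds:
  assumes "finite (B :: rat set)"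
  shows "\<exists>u. \<forall>x \<in> B. x < u" "\<exists>l. \<forall>x \<in> B. l < x"
proof -
  have "x < Max (insert 0 B) + 1" "Min (insert 0 B) - 1 < x" if "x \<in> B" for x
  proof -
    have "x \<le> Max (insert 0 B)" by (rule Max_ge) (use assms that in auto)
    moreover have "Min (insert 0 B) \<le> x" by (rule Min_le) (use assms that in auto)
    ultimately show "x < Max (insert 0 B) + 1" "Min (insert 0 B) - 1 < x" by linarith+
  qed
  then show "\<exists>u. \<forall>x \<in> B. x < u" "\<exists>l. \<forall>x \<in> B. l < x" by blast+
qed

section \<open>Larger grids from single cuts, and coherence of bad pairs\<close>

context tuple_geometry
begin

text \<open>One point \<open>c\<close> yields a full grid if the required signs can be found at
  suitable positions: indiscernibility carries the positions chosen for \<open>\<eta>\<close> to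
  fixed ones, and the image of \<open>c\<close> then cuts as \<open>\<eta>\<close> prescribes. The
  dimension rises because two kinds, \<open>kk 0\<close> and \<open>kk (Suc 0)\<close>, are read
  along the last coordinate, at disjoint stretches of positions.\<close>

lemma shifted_grid:
  fixes F :: "nat \<Rightarrow> rat list \<Rightarrow> 'p"
  assumes A: "A \<subseteq> P" and d1: "1 \<le> d" and F: "\<And>k \<eta>. F k \<eta> \<in> P" and ind: "ind_on UNIV d A F" and c: "c \<in> P"
    and low: "\<And>i \<eta>. i < d - 1 \<Longrightarrow> length \<eta> = d \<Longrightarrow> \<eta> ! i \<noteq> 0 \<Longrightarrow> E (F i \<eta>) c \<longleftrightarrow> \<eta> ! i < 0"
    and W: "\<And>\<eta>. (\<forall>i<Suc d. \<eta> i \<le> N) \<Longrightarrow> \<exists>W :: nat \<Rightarrow> rat. strict_mono_on {..<N + N} W \<and>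
       (\<forall>j<N+N. - of_nat N - 1 < W j) \<and>
       (\<forall>j<N. \<forall>\<zeta>. length \<zeta> = d \<longrightarrow> \<zeta> ! (d - 1) = W j \<longrightarrow> (E (F (kk 0) \<zeta>) c \<longleftrightarrow> j < \<eta> (if sw then d else d - 1))) \<and>
       (\<forall>j<N. \<forall>\<zeta>. length \<zeta> = d \<longrightarrow> \<zeta> ! (d - 1) = W (N + j) \<longrightarrow>
          (E (F (kk (Suc 0)) \<zeta>) c \<longleftrightarrow> j < \<eta> (if sw then d - 1 else d)))"
  shows "grid (Suc d) N"
proof -
  let ?M = "d - 1"
  \<comment> \<open>\<open>lo\<close> lies below all other positions in use. Entries off the
    relevant coordinate are set to it, so they compare in the same way before and after the
    move.\<close>
  define lo :: rat where "lo = - of_nat N - 1"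
  \<comment> \<open>\<open>half i\<close> tells in which of the two stretches of positions sequence
    \<open>i\<close> is placed; \<open>sw\<close> exchanges the numbers of the two sequences on the
    last coordinate.\<close>
  define half where "half i = (if sw then (if i = d then 0 else 1) else (if i = d then 1 else (0 :: nat)))" for i
  define kd where "kd i = (if i < ?M then i else kk (half i))" for i
  define L' where "L' x = (if fst x < ?M then one_at d lo (fst x) (of_nat (snd x))
     else one_at d lo ?M (of_nat (half (fst x) * N + snd x)))" for x :: "nat \<times> nat"
  define X where "X = {x :: nat \<times> nat. fst x < Suc d \<and> snd x < N}"
  show ?thesis
    unfolding grid_def
  proof (intro exI[of _ "\<lambda>i j. F (kd i) (L' (i, j))"] conjI allI impI)
    show "F (kd i) (L' (i, j)) \<in> P" for i j by (rule F)
    fix \<eta> :: "nat \<Rightarrow> nat" assume \<eta>: "\<forall>i<Suc d. \<eta> i \<le> N"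
    obtain V where V: "strict_mono_on {..<N + N} V" "\<forall>j<N+N. lo < V j"
      "\<forall>j<N. \<forall>\<zeta>. length \<zeta> = d \<longrightarrow> \<zeta> ! ?M = V j \<longrightarrow> (E (F (kk 0) \<zeta>) c \<longleftrightarrow> j < \<eta> (if sw then d else ?M))"
      "\<forall>j<N. \<forall>\<zeta>. length \<zeta> = d \<longrightarrow> \<zeta> ! ?M = V (N + j) \<longrightarrow> (E (F (kk (Suc 0)) \<zeta>) c \<longleftrightarrow> j < \<eta> (if sw then ?M else d))"
      using W[OF \<eta>] unfolding lo_def by blast
    \<comment> \<open>The shift by \<open>1 / 2\<close> keeps the positions away from 0, where the
      sign of \<open>c\<close> is unknown.\<close>
    define L where "L x = (if fst x < ?M then one_at d lo (fst x) (of_nat (snd x) - of_nat (\<eta> (fst x)) + 1 / 2)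
     else one_at d lo ?M (V (half (fst x) * N + snd x)))" for x :: "nat \<times> nat"
    have half: "half i * N + j < N + N" if "j < N" for i j
      using that unfolding half_def by auto
    have "\<exists>\<sigma> \<in> Au A. \<forall>k \<in> UNIV. \<forall>x \<in> X. \<sigma> (F k (L x)) = F k (L' x)"
    proof (rule ind_family[OF ind])
      show "length (L x) = d \<and> length (L' x) = d" for x unfolding L_def L'_def by simp
      fix x x' :: "nat \<times> nat" and i assume x: "x \<in> X" "x' \<in> X" and i: "i < d"
      have sx: "snd x < N" "snd x' < N" using x unfolding X_def by auto
      have lo1: "lo < of_nat n" for n
      proof -
        have "(0 :: rat) \<le> of_nat n" "(0 :: rat) \<le> of_nat N" by simp_all
        then show ?thesis unfolding lo_def by linarith
      qed
      have lo2: "lo < of_nat (snd z) - of_nat (\<eta> (fst z)) + 1 / 2" if "z \<in> X" for z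
      proof -
        have "\<eta> (fst z) \<le> N" using \<eta> that unfolding X_def by simp
        then have "(of_nat (\<eta> (fst z)) :: rat) \<le> of_nat N" by simp
        moreover have "(0 :: rat) \<le> of_nat (snd z)" by simp
        ultimately show ?thesis unfolding lo_def by linarith
      qed
      have V_iff: "V (half (fst x) * N + snd x) < V (half (fst x') * N + snd x') \<longleftrightarrow>
          half (fst x) * N + snd x < half (fst x') * N + snd x'"
        by (rule strict_mono_on_less[OF V(1)]) (use half[OF sx(1)] half[OF sx(2)] in auto)
      have V_lo: "lo < V (half (fst x) * N + snd x)" "lo < V (half (fst x') * N + snd x')"
        using V(2) half[OF sx(1)] half[OF sx(2)] by blast+
      define cx where "cx z = (if fst z < ?M then fst z else ?M)" for z :: "nat \<times> nat"
      define px where "px z = (if fst z < ?M then of_nat (snd z) - of_nat (\<eta> (fst z)) + 1 / 2 else V (half (fst z) * N + snd z))"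
        for z :: "nat \<times> nat"
      define px' :: "nat \<times> nat \<Rightarrow> rat" where "px' z = (if fst z < ?M then of_nat (snd z) else of_nat (half (fst z) * N + snd z))" for z
      have L: "L z ! i = (if i = cx z then px z else lo)" "L' z ! i = (if i = cx z then px' z else lo)" for z
        unfolding L_def L'_def cx_def px_def px'_def using i by simp_all
      have lo_px: "lo < px x" "lo < px x'" "lo < px' x" "lo < px' x'"
        using lo1 lo2[OF x(1)] lo2[OF x(2)] V_lo unfolding px_def px'_def by (simp_all del: of_nat_add of_nat_mult)
      have same: "px x < px x' \<longleftrightarrow> px' x < px' x'" if "cx x = cx x'"
      proof (cases "fst x < ?M")
        case True
        then have "fst x' = fst x" using that unfolding cx_def by (cases "fst x' < ?M") simp_all
        then show ?thesis using True unfolding px_def px'_def by simp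
      next
        case False
        then have "\<not> fst x' < ?M" using that unfolding cx_def by (cases "fst x' < ?M") simp_all
        then show ?thesis using False V_iff unfolding px_def px'_def by (simp only: if_False of_nat_less_iff)
      qed
      consider "i = cx x" "i = cx x'" | "i = cx x" "i \<noteq> cx x'" | "i \<noteq> cx x" "i = cx x'" | "i \<noteq> cx x" "i \<noteq> cx x'"
        by blast
      then show "L x ! i < L x' ! i \<longleftrightarrow> L' x ! i < L' x' ! i"
      proof cases
        case 1
        then have "cx x = cx x'" by simp
        then show ?thesis using same 1 unfolding L by simp
      next
        case 2
        then show ?thesis using lo_px(1,3) unfolding L by (simp add: not_less)
      next
        case 3
        then show ?thesis using lo_px(2,4) unfolding L by simp
      qed (simp add: L)
    qed
    then obtain \<sigma> where \<sigma>: "\<sigma> \<in> Au A" "\<forall>k. \<forall>x \<in> X. \<sigma> (F k (L x)) = F k (L' x)" by auto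
    have "E (F (kd i) (L' (i, j))) (\<sigma> c) \<longleftrightarrow> j < \<eta> i" if ij: "i < Suc d" "j < N" for i j
    proof -
      have "(i, j) \<in> X" using ij unfolding X_def by simp
      then have "E (F (kd i) (L' (i, j))) (\<sigma> c) = E (F (kd i) (L (i, j))) c"
        using \<sigma>(2) Au_E[OF \<sigma>(1) F c] by metis
      also have "\<dots> \<longleftrightarrow> j < \<eta> i"
      proof (cases "i < ?M")
        case True
        have "(of_nat j :: rat) - of_nat (\<eta> i) + 1 / 2 < 0 \<longleftrightarrow> j < \<eta> i"
          "(of_nat j :: rat) - of_nat (\<eta> i) + 1 / 2 \<noteq> 0"
        proof -
          consider "j < \<eta> i" | "\<eta> i \<le> j" by linarith
          then have "(of_nat j :: rat) + 1 \<le> of_nat (\<eta> i) \<and> j < \<eta> i \<or> (of_nat (\<eta> i) :: rat) \<le> of_nat j \<and> \<not> j < \<eta> i"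
            by cases (auto simp: less_of_nat_rat)
          then show "(of_nat j :: rat) - of_nat (\<eta> i) + 1 / 2 < 0 \<longleftrightarrow> j < \<eta> i"
            "(of_nat j :: rat) - of_nat (\<eta> i) + 1 / 2 \<noteq> 0" by linarith+
        qed
        then show ?thesis using low[of i "L (i, j)"] True unfolding kd_def L_def by simp
      next
        case False
        then have i: "i = ?M \<or> i = d" using ij d1 by auto
        have "L (i, j) ! ?M = V (half i * N + j)" "length (L (i, j)) = d"
          using False d1 unfolding L_def by auto
        moreover have "half i = 0 \<and> i = (if sw then d else ?M) \<or> half i = Suc 0 \<and> i = (if sw then ?M else d)"
          using i d1 unfolding half_def by auto
        ultimately show ?thesis using V(3,4) ij(2) False unfolding kd_def by auto
      qed
      finally show ?thesis .
    qed
    then show "\<exists>c \<in> P. \<forall>i<Suc d. \<forall>j<N. E (F (kd i) (L' (i, j))) c \<longleftrightarrow> j < \<eta> i"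
      using Au_P[OF \<sigma>(1) c] by blast
  qed
qed

text \<open>The bad pair is taken on the part of the main coordinate between 0 and 1, with
  everything outside as parameters. Outside, \<open>y\<close> and \<open>c\<close> thus behave like
  the chain point and the leaf point to which they are conjugate. Inside, \<open>c\<close> has
  constant sign \<open>t\<close> on \<open>F \<kappa>\<close>, and the absence of larger grids
  leaves only finitely many places where \<open>F M\<close> has the other sign.\<close>

lemma cut_pair:
  fixes F :: "nat \<Rightarrow> rat list \<Rightarrow> 'p" and d :: nat
  defines "M \<equiv> d - 1"
  assumes nc: "\<not> concl" and A: "countable A" "A \<subseteq> P" and d1: "1 \<le> d" and nogrid: "\<not> (\<forall>N. grid (Suc d) N)"
    and F: "\<And>k \<eta>. F k \<eta> \<in> P" and ind: "ind_on UNIV d A F" and base: "base_dep d F" and lf: "leaf d F \<beta>"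
    and Ydep': "\<forall>\<eta> \<eta>'. length \<eta> = d \<longrightarrow> length \<eta>' = d \<longrightarrow> \<eta> ! M = \<eta>' ! M \<longrightarrow> F \<kappa> \<eta> = F \<kappa> \<eta>'"
    and Ychain': "\<forall>\<eta> \<xi>. length \<eta> = d \<longrightarrow> length \<xi> = d \<longrightarrow> \<eta> ! M \<noteq> \<xi> ! M \<longrightarrow>
      (E (F \<kappa> \<eta>) (F \<beta> \<xi>) \<longleftrightarrow> \<eta> ! M < \<xi> ! M)"
  shows "\<exists>\<sigma> \<in> Au A. \<exists>\<rho> \<in> Au A. \<exists>t q0 y c. y = \<sigma> (F \<kappa> (one_at d 0 M (hh 0))) \<and> c = \<rho> (F \<beta> (one_at d 0 M (hh 0))) \<and>
    (\<forall>\<eta>. length \<eta> = d \<longrightarrow> \<eta> ! M \<le> 0 \<longrightarrow> \<not> E y (F \<beta> \<eta>)) \<and>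
    (\<forall>\<eta>. length \<eta> = d \<longrightarrow> 1 \<le> \<eta> ! M \<longrightarrow> E y (F \<beta> \<eta>)) \<and>
    (\<forall>i<M. \<forall>\<eta>. length \<eta> = d \<longrightarrow> \<eta> ! i \<noteq> 0 \<longrightarrow> (E (F i \<eta>) c \<longleftrightarrow> \<eta> ! i < 0)) \<and>
    (\<forall>\<eta>. length \<eta> = d \<longrightarrow> \<eta> ! M \<le> 0 \<longrightarrow> E (F M \<eta>) c) \<and>
    (\<forall>\<eta>. length \<eta> = d \<longrightarrow> 1 \<le> \<eta> ! M \<longrightarrow> \<not> E (F M \<eta>) c) \<and>
    (\<forall>r. E y (F \<beta> (one_at d 0 M (hh r))) = t) \<and> E y c = (\<not> t) \<and>
    (\<forall>q \<eta>. length \<eta> = d \<longrightarrow> \<eta> ! M = hh q \<longrightarrow> (if t then q0 \<le> q else q \<le> q0) \<longrightarrow> E (F M \<eta>) c = t)"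
proof -
  note Ydep = Ydep'[rule_format] and Ychain = Ychain'[rule_format]
  have Md: "M < d" using d1 unfolding M_def by simp
  define outer where "outer = {\<zeta> :: rat list. length \<zeta> = d \<and> (\<zeta> ! M \<le> 0 \<or> 1 \<le> \<zeta> ! M)}"
  define A3 where "A3 = A \<union> (\<lambda>(k, \<zeta>). F k \<zeta>) ` (UNIV \<times> outer)"
  have A3: "countable A3" "A3 \<subseteq> P" "A \<subseteq> A3"
    unfolding A3_def using A F by (auto intro!: countable_image)
  have A3F: "F k \<zeta> \<in> A3" if "\<zeta> \<in> outer" for k \<zeta> unfolding A3_def using that by blast
  \<comment> \<open>Only the main entry of \<xi> is replaced, by a position inside the unit
    interval. The other coordinates become part of the name of a kind on the line
    \<open>S\<close>.\<close>
  define ml where "ml \<xi> q = map (\<lambda>i. if i = M then hh q else \<xi> ! i) [0..<d]" for \<xi> :: "rat list" and q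
  define S where "S x q = F (fst x) (ml (snd x) q)" for x :: "nat \<times> rat list" and q
  have ml0: "ml (replicate d 0) q = one_at d 0 M (hh q)" for q
    by (rule nth_equalityI) (auto simp: ml_def)
  have ind3: "ind_line A3 S"
    unfolding ind_line_def
  proof (intro allI impI)
    fix X and f :: "rat \<Rightarrow> rat" assume f: "strict_mono_on X f"
    let ?X = "{x :: (rat list \<times> rat) + rat list. case x of Inl z \<Rightarrow> snd z \<in> X | Inr \<zeta> \<Rightarrow> \<zeta> \<in> outer}"
    let ?l = "\<lambda>x. case x of Inl z \<Rightarrow> ml (fst z) (snd z) | Inr \<zeta> \<Rightarrow> \<zeta>"
    let ?l' = "\<lambda>x. case x of Inl z \<Rightarrow> ml (fst z) (f (snd z)) | Inr \<zeta> \<Rightarrow> \<zeta>"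
    have "\<exists>\<sigma> \<in> Au A. \<forall>k \<in> UNIV. \<forall>x \<in> ?X. \<sigma> (F k (?l x)) = F k (?l' x)"
    proof (rule ind_family[OF ind])
      show "length (?l x) = d \<and> length (?l' x) = d" if "x \<in> ?X" for x
        using that unfolding ml_def outer_def by (auto split: sum.splits)
      fix x x' i assume x: "x \<in> ?X" "x' \<in> ?X" and i: "i < d"
      have out: "hh q < \<zeta> ! M \<longleftrightarrow> hh q' < \<zeta> ! M" "\<zeta> ! M < hh q \<longleftrightarrow> \<zeta> ! M < hh q'" if "\<zeta> \<in> outer" for \<zeta> q q'
        using that hh_bounds[of q] hh_bounds[of q'] unfolding outer_def by auto
      have f_iff: "f p < f q \<longleftrightarrow> p < q" if "p \<in> X" "q \<in> X" for p q
        using strict_mono_on_less[OF f that] .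
      show "?l x ! i < ?l x' ! i \<longleftrightarrow> ?l' x ! i < ?l' x' ! i"
      proof (cases x; cases x')
        fix z z' assume "x = Inl z" "x' = Inl z'"
        then show ?thesis using x i f_iff by (simp add: ml_def)
      next
        fix z \<zeta> assume "x = Inl z" "x' = Inr \<zeta>"
        then show ?thesis using x i out(1)[of \<zeta> "snd z" "f (snd z)"] by (simp add: ml_def)
      next
        fix z \<zeta> assume "x = Inr \<zeta>" "x' = Inl z"
        then show ?thesis using x i out(2)[of \<zeta> "snd z" "f (snd z)"] by (simp add: ml_def)
      qed simp
    qed
    then obtain \<sigma> where \<sigma>: "\<sigma> \<in> Au A" "\<forall>k. \<forall>x \<in> ?X. \<sigma> (F k (?l x)) = F k (?l' x)" by auto
    have "\<sigma> (F k \<zeta>) = F k \<zeta>" if "\<zeta> \<in> outer" for k \<zeta>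
      using \<sigma>(2)[rule_format, of "Inr \<zeta>" k] that by simp
    then have "\<sigma> \<in> Au A3" unfolding A3_def by (intro Au_insertI[OF \<sigma>(1)]) auto
    moreover have "\<sigma> (S x r) = S x (f r)" if "r \<in> X" for x r
      using \<sigma>(2)[rule_format, of "Inl (snd x, r)" "fst x"] that by (simp add: S_def)
    ultimately show "\<exists>\<sigma> \<in> Au A3. \<forall>k. \<forall>r \<in> X. \<sigma> (S k r) = S k (f r)" by blast
  qed
  define y0 b0 where "y0 = F \<kappa> (one_at d 0 M (hh 0))" and "b0 = F \<beta> (one_at d 0 M (hh 0))"
  have "\<exists>\<sigma> \<in> Au A3. \<exists>\<rho> \<in> Au A3. \<exists>t.
     (\<forall>r. E (\<sigma> (S (\<kappa>, replicate d 0) 0)) (S (\<beta>, replicate d 0) r) = t \<and>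
          E (S (\<kappa>, replicate d 0) r) (\<rho> (S (\<beta>, replicate d 0) 0)) = t) \<and>
     E (\<sigma> (S (\<kappa>, replicate d 0) 0)) (\<rho> (S (\<beta>, replicate d 0) 0)) = (\<not> t)"
  proof (rule bad_pair_on_line[OF nc A3(1,2) _ ind3])
    show "S k r \<in> P" for k r unfolding S_def by (rule F)
    fix p q :: rat assume "p \<noteq> q"
    then show "E (S (\<kappa>, replicate d 0) p) (S (\<beta>, replicate d 0) q) \<longleftrightarrow> p < q"
      unfolding S_def fst_conv snd_conv ml0 using Ychain[of "one_at d 0 M (hh p)" "one_at d 0 M (hh q)"] Md by simp
  qed
  then obtain \<sigma> \<rho> t where \<sigma>: "\<sigma> \<in> Au A3" and \<rho>: "\<rho> \<in> Au A3"
    and yt: "\<And>r. E (\<sigma> y0) (F \<beta> (one_at d 0 M (hh r))) = t"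
    and tc: "\<And>r. E (F \<kappa> (one_at d 0 M (hh r))) (\<rho> b0) = t"
    and yc: "E (\<sigma> y0) (\<rho> b0) = (\<not> t)"
    unfolding S_def fst_conv snd_conv ml0 y0_def b0_def by blast
  define c where "c = \<rho> b0"
  have b0P: "b0 \<in> P" and y0P: "y0 \<in> P" unfolding b0_def y0_def by (rule F)+
  have cP: "c \<in> P" unfolding c_def using Au_P[OF \<rho> b0P] .
  have y_out: "E (\<sigma> y0) (F k \<zeta>) = E y0 (F k \<zeta>)" if "\<zeta> \<in> outer" for k \<zeta>
    using Au_E[OF \<sigma> y0P F[of k \<zeta>]] Au_fix[OF \<sigma> A3F[OF that]] by simp
  have c_out: "E (F k \<zeta>) c = E (F k \<zeta>) b0" if "\<zeta> \<in> outer" for k \<zeta>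
    using Au_E[OF \<rho> F[of k \<zeta>] b0P] Au_fix[OF \<rho> A3F[OF that]] unfolding c_def by simp
  have 1: "E (\<sigma> y0) (F \<beta> \<eta>) \<longleftrightarrow> hh 0 < \<eta> ! M" if "\<eta> \<in> outer" for \<eta>
    using y_out[OF that] Ychain[of "one_at d 0 M (hh 0)" \<eta>] that hh_bounds[of 0] Md unfolding y0_def outer_def by auto
  have 2: "E (F i \<eta>) c \<longleftrightarrow> \<eta> ! i < 0" if i: "i < M" and \<eta>: "length \<eta> = d" "\<eta> ! i \<noteq> 0" for i \<eta>
  proof -
    have "F i \<eta> = F i (\<eta>[M := 0])"
      using base[unfolded base_dep_def, rule_format, of i \<eta> "\<eta>[M := 0]"] i Md \<eta> by simp
    moreover have "\<eta>[M := 0] \<in> outer" unfolding outer_def using \<eta> Md by simp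
    ultimately have "E (F i \<eta>) c = E (F i (\<eta>[M := 0])) b0" using c_out by simp
    also have "\<dots> \<longleftrightarrow> \<eta> ! i < 0"
      unfolding b0_def using lf[unfolded leaf_def, rule_format, of i "\<eta>[M := 0]" "one_at d 0 M (hh 0)"] i Md \<eta> by simp
    finally show ?thesis .
  qed
  have go: "E (F M \<eta>) c \<longleftrightarrow> \<eta> ! M < hh 0" if "\<eta> \<in> outer" for \<eta>
    using c_out[OF that, of M] lf[unfolded leaf_def, rule_format, of M \<eta> "one_at d 0 M (hh 0)"] that hh_bounds[of 0] Md
    unfolding b0_def outer_def by auto
  have gM: "length \<eta> = d \<Longrightarrow> \<eta> ! M \<le> 0 \<Longrightarrow> E (F M \<eta>) c"
    "length \<eta> = d \<Longrightarrow> 1 \<le> \<eta> ! M \<Longrightarrow> \<not> E (F M \<eta>) c" for \<eta>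
    using go[of \<eta>] hh_bounds[of 0] unfolding outer_def by auto
  have Yo: "E (F \<kappa> \<eta>) c \<longleftrightarrow> \<eta> ! M < hh 0" if "\<eta> \<in> outer" for \<eta>
    using c_out[OF that, of \<kappa>] Ychain[of \<eta> "one_at d 0 M (hh 0)"] that hh_bounds[of 0] Md
    unfolding b0_def outer_def by auto
  have Yc: "length \<eta> = d \<Longrightarrow> \<eta> ! M \<le> 0 \<Longrightarrow> E (F \<kappa> \<eta>) c"
    "length \<eta> = d \<Longrightarrow> 1 \<le> \<eta> ! M \<Longrightarrow> \<not> E (F \<kappa> \<eta>) c" for \<eta>
    using Yo[of \<eta>] hh_bounds[of 0] unfolding outer_def by auto
  have Yz: "E (F \<kappa> \<eta>) c = t" if "length \<eta> = d" "\<eta> ! M = hh r" for \<eta> r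
    using Ydep[of \<eta> "one_at d 0 M (hh r)"] that Md tc[of r] unfolding c_def by simp
  have gz: "F M \<eta> = F M (one_at d 0 M (hh q))" if "length \<eta> = d" "\<eta> ! M = hh q" for \<eta> q
    using base[unfolded base_dep_def, rule_format, of M \<eta> "one_at d 0 M (hh q)"] that Md by simp
  \<comment> \<open>If \<open>Q\<close> were infinite, \<open>F M\<close> and \<open>F \<kappa>\<close> could be cut independently along the main coordinate.\<close>
  define Q where "Q = {q. E (F M (one_at d 0 M (hh q))) c \<noteq> t}"
  have gQ: "E (F M \<eta>) c \<longleftrightarrow> \<not> t" if "length \<eta> = d" "\<eta> ! M = hh q" "q \<in> Q" for \<eta> q
    using gz[OF that(1,2)] that(3) unfolding Q_def by auto
  have "finite Q"
  proof (rule ccontr)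
    assume inf: "infinite Q"
    have "grid (Suc d) N" for N
    proof -
      obtain B where B: "finite B" "card B = N" "B \<subseteq> Q"
        using infinite_arbitrarily_large[OF inf] by blast
      define q where "q j = sorted_list_of_set B ! j" for j
      have qB: "q j \<in> B" if "j < N" for j
        unfolding q_def using that B nth_mem[of j "sorted_list_of_set B"] by simp
      have qm: "q i < q j" if "i < j" "j < N" for i j
        unfolding q_def using that B sorted_wrt_nth_less[OF strict_sorted_list_of_set, of i j B] by simp
      obtain u where u: "\<And>x. x \<in> B \<Longrightarrow> x < u" using finite_rat_bounds(1)[OF B(1)] by blast
      obtain l where l: "\<And>x. x \<in> B \<Longrightarrow> l < x" using finite_rat_bounds(2)[OF B(1)] by blast
      have pos: "(0 :: rat) \<le> of_nat n" for n by simp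
      have neg: "(of_nat j :: rat) - of_nat N \<le> 0" "- of_nat N - 1 < (of_nat j :: rat) - of_nat N" if "j < N" for j
        using less_of_nat_rat[OF that] pos[of j] by linarith+
      \<comment> \<open>For true \<open>t\<close>, \<open>F \<kappa>\<close> is true throughout the
        interval and \<open>F M\<close> is false on \<open>Q\<close>; for false \<open>t\<close>,
        \<open>F \<kappa>\<close> is false there and \<open>F M\<close> is true on \<open>Q\<close>.
        In both cases \<open>kk\<close> names first the sequence that supplies false values
        inside.\<close>
      define kk where "kk n = (if (n = (0 :: nat)) = t then M else \<kappa>)" for n
      show ?thesis
      proof (rule shifted_grid[OF A(2) d1 F ind cP, where kk=kk and N=N and sw="\<not> t"])
        show "E (F i \<eta>) c \<longleftrightarrow> \<eta> ! i < 0" if "i < d - 1" "length \<eta> = d" "\<eta> ! i \<noteq> 0" for i \<eta>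
          using 2 that unfolding M_def by blast
        fix \<eta> :: "nat \<Rightarrow> nat" assume \<eta>: "\<forall>i<Suc d. \<eta> i \<le> N"
        show "\<exists>W :: nat \<Rightarrow> rat. strict_mono_on {..<N + N} W \<and> (\<forall>j<N+N. - of_nat N - 1 < W j) \<and>
          (\<forall>j<N. \<forall>\<zeta>. length \<zeta> = d \<longrightarrow> \<zeta> ! (d - 1) = W j \<longrightarrow> (E (F (kk 0) \<zeta>) c \<longleftrightarrow> j < \<eta> (if \<not> t then d else d - 1))) \<and>
          (\<forall>j<N. \<forall>\<zeta>. length \<zeta> = d \<longrightarrow> \<zeta> ! (d - 1) = W (N + j) \<longrightarrow>
             (E (F (kk (Suc 0)) \<zeta>) c \<longleftrightarrow> j < \<eta> (if \<not> t then d - 1 else d)))"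
        proof -
          define e1 e2 where "e1 = \<eta> (if t then M else d)" and "e2 = \<eta> (if t then d else M)"
          define z1 :: "nat \<Rightarrow> rat" where "z1 j = (if t then q j else l - of_nat N + of_nat j)" for j
          define z2 :: "nat \<Rightarrow> rat" where "z2 j = (if t then u + of_nat j else q j)" for j
          \<comment> \<open>In either sequence the true positions come before the false ones, and
            the first stretch precedes the second: integers below 0, then the inner positions
            \<open>z1\<close> and \<open>z2\<close>, separated by \<open>s\<close>, then integers
            from 1 on.\<close>
          define W :: "nat \<Rightarrow> rat" where "W m = (if m < N then (if m < e1 then of_nat m - of_nat N else hh (z1 m))
             else (if m - N < e2 then hh (z2 (m - N)) else 1 + of_nat (m - N)))" for m
          define s where "s = (if t then u else l)"
          have z1: "z1 i < z1 j" if "i < j" "j < N" for i j using qm that unfolding z1_def by simp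
          have z2: "z2 i < z2 j" if "i < j" "j < N" for i j using qm that unfolding z2_def by simp
          have z1s: "z1 j \<le> s" if "j < N" for j
            using u[OF qB[OF that]] neg(1)[OF that] unfolding z1_def s_def by (auto simp: algebra_simps)
          have z2s: "s \<le> z2 j" if "j < N" for j
            using l[OF qB[OF that]] unfolding z2_def s_def by auto
          have W1: "W m < hh s \<or> W m = hh s \<and> z1 m = s \<and> \<not> m < e1" if "m < N" for m
            using neg(1)[OF that] hh_bounds[of s] z1s[OF that] that unfolding W_def by (auto simp: order_le_less)
          have W2: "hh s \<le> W m" if "N \<le> m" "m < N + N" for m
          proof (cases "m - N < e2")
            case True
            have "s \<le> z2 (m - N)" using that by (intro z2s) auto
            then have "hh s \<le> hh (z2 (m - N))" by (simp add: not_less[symmetric])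
            then show ?thesis using that True unfolding W_def by simp
          next
            case False
            then show ?thesis using that hh_bounds[of s] pos[of "m - N"] unfolding W_def by auto
          qed
          have strict: "W m < W m'" if m: "m < m'" "m' < N + N" for m m'
          proof -
            consider "m' < N" | "m < N" "N \<le> m'" | "N \<le> m" by linarith
            then show ?thesis
            proof cases
              case 1
              then have n: "(of_nat m :: rat) - of_nat N < of_nat m' - of_nat N" using m by simp
              have "(of_nat m :: rat) - of_nat N < hh r" for r
                using neg(1)[of m] hh_bounds(1)[of r] 1 m by linarith
              then show ?thesis using 1 m z1 n unfolding W_def by auto
            next
              case 2
              have "z1 m < s" if "t" using u[OF qB[OF 2(1)]] that unfolding z1_def s_def by simp
              moreover have "z1 m < s" if "\<not> t"
                using less_of_nat_rat[OF 2(1)] that unfolding z1_def s_def by simp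
              ultimately have "z1 m < s" by blast
              then have "W m < hh s" using W1[OF 2(1)] by auto
              then show ?thesis using W2[OF 2(2) m(2)] by linarith
            next
              case 3
              have lt: "m - N < m' - N" "m' - N < N" using 3 m by auto
              have "hh r < 1 + of_nat n" for r n
                using hh_bounds(2)[of r] pos[of n] by linarith
              moreover have "(of_nat (m - N) :: rat) < of_nat (m' - N)" using lt by simp
              moreover have "z2 (m - N) < z2 (m' - N)" by (rule z2[OF lt])
              ultimately show ?thesis using 3 m lt unfolding W_def by (auto simp del: of_nat_diff)
            qed
          qed
          have e_le: "e1 \<le> N" "e2 \<le> N" using \<eta> Md unfolding e1_def e2_def by auto
          show ?thesis
          proof (intro exI[of _ W] conjI allI impI)
            show "strict_mono_on {..<N + N} W" by (rule strict_mono_onI) (use strict in simp)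
            show "- of_nat N - 1 < W j" if "j < N + N" for j
            proof -
              have "- of_nat N - 1 < hh r" "- of_nat N - 1 < 1 + (of_nat n :: rat)" for r n
                using hh_bounds(1)[of r] pos[of N] pos[of n] by linarith+
              then show ?thesis using neg(2)[of j] unfolding W_def by auto
            qed
            fix j and \<zeta> :: "rat list" assume j: "j < N" and \<zeta>: "length \<zeta> = d"
            {
              assume "\<zeta> ! (d - 1) = W j"
              then have \<zeta>W: "\<zeta> ! M = W j" unfolding M_def .
              have "E (F (kk 0) \<zeta>) c \<longleftrightarrow> j < e1"
              proof (cases "j < e1")
                case True
                then have "\<zeta> ! M \<le> 0" using \<zeta>W j neg(1)[OF j] unfolding W_def by simp
                then show ?thesis using gM(1)[OF \<zeta>] Yc(1)[OF \<zeta>] True unfolding kk_def by simp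
              next
                case False
                then have "\<zeta> ! M = hh (z1 j)" using \<zeta>W j unfolding W_def by simp
                moreover have "t \<Longrightarrow> z1 j \<in> Q" using qB[OF j] B(3) unfolding z1_def by auto
                ultimately show ?thesis
                  using gQ[OF \<zeta>, of "z1 j"] Yz[OF \<zeta>, of "z1 j"] False unfolding kk_def by (cases t) auto
              qed
              then show "E (F (kk 0) \<zeta>) c \<longleftrightarrow> j < \<eta> (if \<not> t then d else d - 1)"
                unfolding e1_def M_def by (cases t) simp_all
            next
              assume "\<zeta> ! (d - 1) = W (N + j)"
              then have \<zeta>W: "\<zeta> ! M = W (N + j)" unfolding M_def .
              have "E (F (kk (Suc 0)) \<zeta>) c \<longleftrightarrow> j < e2"
              proof (cases "j < e2")
                case False
                then have "1 \<le> \<zeta> ! M" using \<zeta>W j pos[of j] unfolding W_def by simp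
                then show ?thesis using gM(2)[OF \<zeta>] Yc(2)[OF \<zeta>] False unfolding kk_def by simp
              next
                case True
                then have "\<zeta> ! M = hh (z2 j)" using \<zeta>W j unfolding W_def by simp
                moreover have "\<not> t \<Longrightarrow> z2 j \<in> Q" using qB[OF j] B(3) unfolding z2_def by auto
                ultimately show ?thesis
                  using gQ[OF \<zeta>, of "z2 j"] Yz[OF \<zeta>, of "z2 j"] True unfolding kk_def by (cases t) auto
              qed
              then show "E (F (kk (Suc 0)) \<zeta>) c \<longleftrightarrow> j < \<eta> (if \<not> t then d - 1 else d)"
                unfolding e2_def M_def by (cases t) simp_all
            }
          qed
        qed
      qed
    qed
    then show False using nogrid by blast
  qed
  have ex_q0: "\<exists>q0. \<forall>q. (if t then q0 \<le> q else q \<le> q0) \<longrightarrow> q \<notin> Q"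
  proof (cases t)
    case True
    then show ?thesis using finite_rat_bounds(1)[OF \<open>finite Q\<close>] by (auto simp: not_less[symmetric])
  next
    case False
    then show ?thesis using finite_rat_bounds(2)[OF \<open>finite Q\<close>] by (auto simp: not_less[symmetric])
  qed
  then obtain q0 where q0: "\<And>q. (if t then q0 \<le> q else q \<le> q0) \<Longrightarrow> q \<notin> Q" by blast
  have "E (F M \<eta>) c = t" if "length \<eta> = d" "\<eta> ! M = hh q" "if t then q0 \<le> q else q \<le> q0" for q \<eta>
    using gz[OF that(1,2)] q0[OF that(3)] unfolding Q_def by simp
  moreover have "\<not> E (\<sigma> y0) (F \<beta> \<eta>)" if "length \<eta> = d" "\<eta> ! M \<le> 0" for \<eta>
    using 1[of \<eta>] that hh_bounds[of 0] unfolding outer_def by auto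
  moreover have "E (\<sigma> y0) (F \<beta> \<eta>)" if "length \<eta> = d" "1 \<le> \<eta> ! M" for \<eta>
    using 1[of \<eta>] that hh_bounds[of 0] unfolding outer_def by auto
  ultimately show ?thesis
    using gM 2 yt yc Au_mono[OF \<sigma> A3(3)] Au_mono[OF \<rho> A3(3)] unfolding c_def y0_def b0_def
    by (intro bexI[of _ \<sigma>] bexI[of _ \<rho>] exI[of _ t] exI[of _ q0] exI[of _ "\<sigma> (F \<kappa> (one_at d 0 M (hh 0)))"]
        exI[of _ "\<rho> (F \<beta> (one_at d 0 M (hh 0)))"] conjI allI impI) simp_all
qed

end

section \<open>Stages\<close>

definition app :: "nat \<Rightarrow> (nat \<Rightarrow> rat \<Rightarrow> rat) \<Rightarrow> rat list \<Rightarrow> rat list" where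
  "app d a \<xi> = map (\<lambda>i. a i (\<xi> ! i)) [0..<d]"

lemma app_simps [simp]: "length (app d a \<xi>) = d" "i < d \<Longrightarrow> app d a \<xi> ! i = a i (\<xi> ! i)"
  by (simp_all add: app_def)

text \<open>\<open>K\<close> bounds the kinds whose values are kept from now on; kinds from
  \<open>K\<close> on are free for new chains, leaves and points. \<open>Z\<close> collects the
  points chosen so far, and the array stays indiscernible over it.\<close>

locale array_state = tuple_geometry P D E
  for P :: "'p set" and D :: "((nat \<Rightarrow> 'p) \<Rightarrow> bool) set" and E :: "'p \<Rightarrow> 'p \<Rightarrow> bool" +
  fixes d K \<beta> :: nat and Z :: "'p set" and F :: "nat \<Rightarrow> rat list \<Rightarrow> 'p"
  assumes nc: "\<not> concl" and d1: "1 \<le> d" and nogrid: "\<not> (\<forall>N. grid (Suc d) N)"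
    and dK: "d \<le> K" and \<beta>K: "\<beta> < K" and Z: "finite Z" "Z \<subseteq> P"
    and F: "\<And>k \<eta>. F k \<eta> \<in> P" and ind: "ind_on UNIV d Z F" and base: "base_dep d F" and lf: "leaf d F \<beta>"
begin

definition M :: nat where "M = d - 1"

definition gg :: "nat \<Rightarrow> rat \<Rightarrow> 'p" where "gg i r = F i (replicate d r)"

definition bz :: 'p where "bz = F \<beta> (replicate d 0)"

definition Th :: "'p \<Rightarrow> bool" where "Th c \<longleftrightarrow> (\<forall>w \<in> Z. E w c = E w bz)"

text \<open>\<open>Dd H \<xi> f z s\<close>: some cut with the signs of the leaf on \<open>Z\<close> lies at position \<open>\<xi>\<close> of the copy along
  \<open>f\<close> of the block \<open>H\<close> of the base sequences and has sign \<open>s\<close> at \<open>z\<close>.\<close>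

definition Dd :: "rat set \<Rightarrow> rat list \<Rightarrow> (nat \<Rightarrow> rat \<Rightarrow> rat) \<Rightarrow> 'p \<Rightarrow> bool \<Rightarrow> bool" where
  "Dd H \<xi> f z s \<longleftrightarrow> (\<exists>c \<in> P. Th c \<and>
     (\<forall>i<d. \<forall>t \<in> H. t \<noteq> \<xi> ! i \<longrightarrow> (E (gg i (f i t)) c \<longleftrightarrow> t < \<xi> ! i)) \<and> (E z c \<longleftrightarrow> s))"

lemma Md: "M < d" using d1 unfolding M_def by simp

lemma less_d_cases: "i < d \<Longrightarrow> i < M \<or> i = M" unfolding M_def by auto

lemma gg_eq: "i < d \<Longrightarrow> length \<eta> = d \<Longrightarrow> F i \<eta> = gg i (\<eta> ! i)"
  unfolding gg_def using base[unfolded base_dep_def, rule_format, of i \<eta> "replicate d (\<eta> ! i)"] by simp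

lemma gg_P: "gg i r \<in> P" unfolding gg_def by (rule F)

lemma leafD: "i < d \<Longrightarrow> length \<xi> = d \<Longrightarrow> r \<noteq> \<xi> ! i \<Longrightarrow> E (gg i r) (F \<beta> \<xi>) \<longleftrightarrow> r < \<xi> ! i"
  unfolding gg_def using lf[unfolded leaf_def, rule_format, of i "replicate d r" \<xi>] by simp

text \<open>A single position carries no order information, so all positions of one kind are
  conjugate over \<open>Z\<close>.\<close>

lemma leaf_sign:
  assumes "w \<in> Z" "length \<xi> = d"
  shows "E w (F k \<xi>) = E w (F k (replicate d 0))"
proof -
  have "\<exists>\<sigma> \<in> Au Z. \<forall>k \<in> UNIV. \<forall>x \<in> {()}. \<sigma> (F k (replicate d 0)) = F k \<xi>"
    by (rule ind_family[OF ind]) (use assms in auto)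
  then obtain \<sigma> where \<sigma>: "\<sigma> \<in> Au Z" "\<sigma> (F k (replicate d 0)) = F k \<xi>" by blast
  have "w \<in> P" using assms Z by blast
  then have "E (\<sigma> w) (\<sigma> (F k (replicate d 0))) = E w (F k (replicate d 0))" by (rule Au_E[OF \<sigma>(1) _ F])
  then show ?thesis unfolding \<sigma>(2) Au_fix[OF \<sigma>(1) assms(1)] .
qed

lemma Th_leaf: "length \<xi> = d \<Longrightarrow> Th (F \<beta> \<xi>)"
  unfolding Th_def bz_def by (intro ballI leaf_sign)

lemma Th_Au: "\<sigma> \<in> Au Z \<Longrightarrow> c \<in> P \<Longrightarrow> Th (\<sigma> c) = Th c"
proof -
  assume *: "\<sigma> \<in> Au Z" "c \<in> P"
  have "E w (\<sigma> c) = E w c" if "w \<in> Z" for w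
    using Au_E[OF *(1) _ *(2), of w] Au_fix[OF *(1) that] that Z by auto
  then show ?thesis unfolding Th_def by simp
qed

lemma Dd_dfn:
  assumes A: "A \<subseteq> P" "Z \<subseteq> A" "finite H" "\<And>i t. i < d \<Longrightarrow> t \<in> H \<Longrightarrow> gg i (f i t) \<in> A"
  shows "dfn A (\<lambda>g :: unit \<Rightarrow> 'p. Dd H \<xi> f (g ()) s)"
proof -
  have "dfn A (\<lambda>g :: unit + unit \<Rightarrow> 'p. (\<forall>w \<in> Z. E w (g (Inl ())) = E w bz) \<and>
      (\<forall>i \<in> {..<d}. \<forall>t \<in> H. t \<noteq> \<xi> ! i \<longrightarrow> (E (gg i (f i t)) (g (Inl ())) \<longleftrightarrow> t < \<xi> ! i)) \<and>
      (E (g (Inr ())) (g (Inl ())) \<longleftrightarrow> s))"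
    by (intro dfn_conj dfn_ball dfn_imp dfn_iff dfn_const dfn_E_labels dfn_E_left) (use A Z gg_P in auto)
  from dfn_Ex[OF this] show ?thesis
  proof (rule dfn_cong)
    fix f' :: "unit \<Rightarrow> 'p" assume "range f' \<subseteq> P"
    have "(\<exists>g :: unit \<Rightarrow> 'p. range g \<subseteq> P \<and> Q (g ())) \<longleftrightarrow> (\<exists>c \<in> P. Q c)" for Q
    proof
      assume "\<exists>c \<in> P. Q c"
      then obtain c where "c \<in> P" "Q c" by blast
      then show "\<exists>g :: unit \<Rightarrow> 'p. range g \<subseteq> P \<and> Q (g ())" by (intro exI[of _ "\<lambda>_. c"]) auto
    qed auto
    then show "(\<exists>g :: unit \<Rightarrow> 'p. range g \<subseteq> P \<and>
        (\<forall>w \<in> Z. E w (case_sum g f' (Inl ())) = E w bz) \<and>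
        (\<forall>i \<in> {..<d}. \<forall>t \<in> H. t \<noteq> \<xi> ! i \<longrightarrow> (E (gg i (f i t)) (case_sum g f' (Inl ())) \<longleftrightarrow> t < \<xi> ! i)) \<and>
        (E (case_sum g f' (Inr ())) (case_sum g f' (Inl ())) \<longleftrightarrow> s)) \<longleftrightarrow> Dd H \<xi> f (f' ()) s"
      unfolding Dd_def Th_def sum.case lessThan_iff Ball_def[of "{..<d}"] by simp
  qed
qed

lemma Dd_move:
  assumes \<sigma>: "\<sigma> \<in> Au Z" and eq: "\<And>i t. i < d \<Longrightarrow> t \<in> H \<Longrightarrow> \<sigma> (gg i (f i t)) = gg i (f' i t)" and z: "z \<in> P"
  shows "Dd H \<xi> f' (\<sigma> z) s \<longleftrightarrow> Dd H \<xi> f z s"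
proof -
  have *: "(Th (\<sigma> c) \<and> (\<forall>i<d. \<forall>t \<in> H. t \<noteq> \<xi> ! i \<longrightarrow> (E (gg i (f' i t)) (\<sigma> c) \<longleftrightarrow> t < \<xi> ! i)) \<and> (E (\<sigma> z) (\<sigma> c) \<longleftrightarrow> s)) \<longleftrightarrow>
    (Th c \<and> (\<forall>i<d. \<forall>t \<in> H. t \<noteq> \<xi> ! i \<longrightarrow> (E (gg i (f i t)) c \<longleftrightarrow> t < \<xi> ! i)) \<and> (E z c \<longleftrightarrow> s))" if c: "c \<in> P" for c
  proof -
    have "E (gg i (f' i t)) (\<sigma> c) = E (gg i (f i t)) c" if "i < d" "t \<in> H" for i t
      using Au_E[OF \<sigma> gg_P c, of i "f i t"] eq[OF that] by simp
    then show ?thesis using Th_Au[OF \<sigma> c] Au_E[OF \<sigma> z c] by simp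
  qed
  obtain \<tau> where \<tau>: "\<tau> \<in> Au Z" "\<forall>p \<in> P. \<tau> (\<sigma> p) = p \<and> \<sigma> (\<tau> p) = p" using Au_inv[OF \<sigma> Z(2)] by blast
  show ?thesis
  proof
    assume "Dd H \<xi> f' (\<sigma> z) s"
    then obtain c where c: "c \<in> P" "Th c \<and> (\<forall>i<d. \<forall>t \<in> H. t \<noteq> \<xi> ! i \<longrightarrow> (E (gg i (f' i t)) c \<longleftrightarrow> t < \<xi> ! i)) \<and> (E (\<sigma> z) c \<longleftrightarrow> s)"
      unfolding Dd_def by blast
    have "\<tau> c \<in> P" "\<sigma> (\<tau> c) = c" using c(1) \<tau> Au_P by auto
    then show "Dd H \<xi> f z s" using *[of "\<tau> c"] c(2) unfolding Dd_def by auto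
  next
    assume "Dd H \<xi> f z s"
    then obtain c where c: "c \<in> P" "Th c \<and> (\<forall>i<d. \<forall>t \<in> H. t \<noteq> \<xi> ! i \<longrightarrow> (E (gg i (f i t)) c \<longleftrightarrow> t < \<xi> ! i)) \<and> (E z c \<longleftrightarrow> s)"
      unfolding Dd_def by blast
    then show "Dd H \<xi> f' (\<sigma> z) s" using *[OF c(1)] Au_P[OF \<sigma> c(1)] unfolding Dd_def by blast
  qed
qed

end

type_synonym block_record = "bool \<times> rat list \<times> (bool \<Rightarrow> nat \<Rightarrow> rat \<Rightarrow> rat)"

abbreviation sd :: "block_record \<Rightarrow> bool" where "sd x \<equiv> fst x"
abbreviation xi :: "block_record \<Rightarrow> rat list" where "xi x \<equiv> fst (snd x)"
abbreviation bl :: "block_record \<Rightarrow> bool \<Rightarrow> nat \<Rightarrow> rat \<Rightarrow> rat" where "bl x \<equiv> snd (snd x)"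

text \<open>A finite witness that the leaf does not split: no point finds cuts of both signs at
  every position in \<Xi>. The locale is entered for contradiction.\<close>

locale obstruction = array_state +
  fixes \<Xi> :: "rat list set" and H :: "rat set"
  assumes \<Xi>: "finite \<Xi>" "\<And>\<xi>. \<xi> \<in> \<Xi> \<Longrightarrow> length \<xi> = d" and H: "finite H"
    and obs: "\<And>z. z \<in> P \<Longrightarrow> \<exists>\<xi> \<in> \<Xi>. \<exists>s. \<not> Dd H \<xi> (\<lambda>i t. t) z s"
begin

text \<open>Copies of the base sequences along increasing functions are conjugate to them over
  \<open>Z\<close>, so the obstruction applies to every such copy of the block.\<close>

lemma obs_strict_mono:
  assumes f: "\<And>i. i < d \<Longrightarrow> strict_mono (f i)" and z: "z \<in> P"
  shows "\<exists>\<xi> \<in> \<Xi>. \<exists>s. \<not> Dd H \<xi> f z s"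
proof -
  have "\<exists>\<sigma> \<in> Au Z. \<forall>k \<in> UNIV. \<forall>t \<in> UNIV. \<sigma> (F k (map (\<lambda>i. f i t) [0..<d])) = F k (replicate d t)"
    by (rule ind_family[OF ind]) (auto simp: strict_mono_less[OF f])
  then obtain \<sigma> where \<sigma>: "\<sigma> \<in> Au Z" "\<And>k t. \<sigma> (F k (map (\<lambda>i. f i t) [0..<d])) = F k (replicate d t)" by blast
  have "\<sigma> (gg i (f i t)) = gg i t" if "i < d" for i t
    using \<sigma>(2)[of i t] gg_eq[OF that, of "map (\<lambda>i. f i t) [0..<d]"] that unfolding gg_def by simp
  then have "Dd H \<xi> (\<lambda>i t. t) (\<sigma> z) s \<longleftrightarrow> Dd H \<xi> f z s" for \<xi> s
    by (intro Dd_move[OF \<sigma>(1) _ z]) simp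
  then show ?thesis using obs[OF Au_P[OF \<sigma>(1) z]] by simp
qed

text \<open>A record consists of a side, a position in \<open>\<Xi>\<close> and two blocks. In \<open>stage y a v bs\<close> the newest record
  comes first. The obstructed formula \<open>Dd\<close> at \<open>y\<close> holds for the block \<open>True\<close> and fails for the block \<open>False\<close>
  of each record. The lines \<open>a\<close> and \<open>a(M := v)\<close>, along which \<open>E y\<close> is false and true on the leaf, lie
  before all blocks, except that in the main coordinate \<open>M\<close> they lie after those of side \<open>True\<close>.\<close>

definition rel :: "block_record \<Rightarrow> block_record \<Rightarrow> bool" where
  "rel x x' \<longleftrightarrow> (\<forall>c c' p q. (\<forall>i<M. bl x c i p < bl x' c' i q) \<and>
     (sd x = sd x' \<longrightarrow> (if sd x then bl x' c' M p < bl x c M q else bl x c M p < bl x' c' M q)))"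

definition pos :: "(nat \<Rightarrow> rat \<Rightarrow> rat) \<Rightarrow> (rat \<Rightarrow> rat) \<Rightarrow> block_record \<Rightarrow> bool" where
  "pos a v x \<longleftrightarrow> (\<forall>c. (\<forall>i<d. strict_mono (bl x c i)) \<and> (\<forall>i<M. \<forall>p q. a i p < bl x c i q) \<and>
     (\<forall>p q. if sd x then bl x c M q < a M p else v p < bl x c M q))"

definition val :: "'a \<Rightarrow> block_record \<Rightarrow> bool" where
  "val y x \<longleftrightarrow> xi x \<in> \<Xi> \<and> (\<forall>c. Dd H (xi x) (bl x c) y (sd x) \<longleftrightarrow> c)"

definition lines :: "(nat \<Rightarrow> rat \<Rightarrow> rat) \<Rightarrow> (rat \<Rightarrow> rat) \<Rightarrow> bool" where
  "lines a v \<longleftrightarrow> (\<forall>i<d. strict_mono (a i)) \<and> strict_mono v \<and> (\<forall>p q. a M p < v q)"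

definition stage :: "'a \<Rightarrow> (nat \<Rightarrow> rat \<Rightarrow> rat) \<Rightarrow> (rat \<Rightarrow> rat) \<Rightarrow> block_record list \<Rightarrow> bool" where
  "stage y a v bs \<longleftrightarrow> y \<in> P \<and> lines a v \<and>
     (\<forall>\<xi>. length \<xi> = d \<longrightarrow> \<not> E y (F \<beta> (app d a \<xi>)) \<and> E y (F \<beta> (app d (a(M := v)) \<xi>))) \<and>
     sorted_wrt rel bs \<and> (\<forall>x \<in> set bs. pos a v x \<and> val y x)"

text \<open>An automorphism that fixes these finitely many points carries \<open>y\<close> to a
  point with the same \<open>val\<close> at all records in \<open>bs\<close>.\<close>

definition A2 :: "block_record list \<Rightarrow> 'a set" where
  "A2 bs = Z \<union> (\<lambda>(x, c, i, t). gg i (bl x c i t)) ` (set bs \<times> UNIV \<times> {..<d} \<times> H)"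

lemma A2_facts: "finite (A2 bs)" "A2 bs \<subseteq> P" "Z \<subseteq> A2 bs"
  "x \<in> set bs \<Longrightarrow> i < d \<Longrightarrow> t \<in> H \<Longrightarrow> gg i (bl x c i t) \<in> A2 bs"
proof -
  show "finite (A2 bs)" unfolding A2_def using Z H by auto
  show "A2 bs \<subseteq> P" unfolding A2_def using Z gg_P by auto
  show "Z \<subseteq> A2 bs" unfolding A2_def by blast
  assume "x \<in> set bs" "i < d" "t \<in> H"
  then have "(x, c, i, t) \<in> set bs \<times> UNIV \<times> {..<d} \<times> H" by simp
  from imageI[OF this, of "\<lambda>(x, c, i, t). gg i (bl x c i t)"] show "gg i (bl x c i t) \<in> A2 bs"
    unfolding A2_def by simp
qed

lemma val_dfn:
  assumes "A \<subseteq> P" "A2 bs \<subseteq> A" "x \<in> set bs"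
  shows "dfn A (\<lambda>g :: unit \<Rightarrow> 'a. val (g ()) x)"
proof -
  have "dfn A (\<lambda>g :: unit \<Rightarrow> 'a. xi x \<in> \<Xi> \<and> (\<forall>c \<in> UNIV. Dd H (xi x) (bl x c) (g ()) (sd x) \<longleftrightarrow> c))"
  proof (intro dfn_conj dfn_const dfn_ball dfn_iff Dd_dfn)
    show "Z \<subseteq> A" using A2_facts(3)[of bs] assms(2) by blast
    show "gg i (bl x c i t) \<in> A" if "i < d" "t \<in> H" for c i t
      using A2_facts(4)[OF assms(3) that] assms(2) by blast
  qed (use assms(1) H in auto)
  then show ?thesis unfolding val_def by simp
qed

definition inside :: "(nat \<Rightarrow> rat \<Rightarrow> rat) \<Rightarrow> (rat \<Rightarrow> rat) \<Rightarrow> rat list \<Rightarrow> bool" where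
  "inside a v \<zeta> \<longleftrightarrow> length \<zeta> = d \<and> (\<forall>i<M. \<zeta> ! i \<in> range (a i)) \<and> \<zeta> ! M \<in> range (a M) \<union> range v"

text \<open>In each coordinate a block lies entirely on one side of both lines. Moving tuples within
  the lines thus keeps their order relative to the blocks, and the move extends by the identity on
  the blocks.\<close>

lemma block_move:
  fixes X :: "'x set"
  assumes ln: "lines a v" and bs: "\<And>x. x \<in> set bs \<Longrightarrow> pos a v x"
    and ins: "\<And>x. x \<in> X \<Longrightarrow> inside a v (l x) \<and> inside a v (l' x)"
    and ord: "\<And>x x' i. x \<in> X \<Longrightarrow> x' \<in> X \<Longrightarrow> i < d \<Longrightarrow> l x ! i < l x' ! i \<longleftrightarrow> l' x ! i < l' x' ! i"
  shows "\<exists>\<sigma> \<in> Au (A2 bs). \<forall>k. \<forall>x \<in> X. \<sigma> (F k (l x)) = F k (l' x)"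
proof -
  define bb where "bb z = map (\<lambda>i. bl (fst z) (fst (snd z)) i (snd (snd z))) [0..<d]"
    for z :: "block_record \<times> bool \<times> rat"
  let ?X = "{x :: 'x + (block_record \<times> bool \<times> rat). case x of Inl z \<Rightarrow> z \<in> X | Inr z \<Rightarrow> fst z \<in> set bs}"
  let ?l = "\<lambda>x. case x of Inl z \<Rightarrow> l z | Inr z \<Rightarrow> bb z"
  let ?l' = "\<lambda>x. case x of Inl z \<Rightarrow> l' z | Inr z \<Rightarrow> bb z"
  have cmp: "(\<zeta> ! i < bb z ! i \<longleftrightarrow> \<zeta>' ! i < bb z ! i) \<and> (bb z ! i < \<zeta> ! i \<longleftrightarrow> bb z ! i < \<zeta>' ! i)"
    if ins: "inside a v \<zeta>" "inside a v \<zeta>'" and z: "fst z \<in> set bs" and i: "i < d" for \<zeta> \<zeta>' z i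
  proof -
    have p: "(\<forall>i<M. \<forall>p q. a i p < bl (fst z) c i q) \<and> (\<forall>p q. if sd (fst z) then bl (fst z) c M q < a M p else v p < bl (fst z) c M q)" for c
      using bs[OF z] unfolding pos_def by blast
    consider "i < M" | "i = M" "sd (fst z)" | "i = M" "\<not> sd (fst z)" using less_d_cases[OF i] by blast
    then show ?thesis
    proof cases
      case 1
      have "\<zeta> ! i < bb z ! i" "\<zeta>' ! i < bb z ! i"
        using ins 1 p i unfolding inside_def bb_def by (fastforce simp: image_iff)+
      then show ?thesis by (auto dest: less_asym)
    next
      case 2
      have "bb z ! i < \<zeta> ! i" if "inside a v \<zeta>" for \<zeta>
      proof -
        have b: "bb z ! i < a M r" for r using p 2 i unfolding bb_def by simp
        moreover have "a M 0 < v r" for r using ln unfolding lines_def by simp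
        then have "bb z ! i < v r" for r using b less_trans by blast
        ultimately show ?thesis using that 2(1) unfolding inside_def by auto
      qed
      then have "bb z ! i < \<zeta> ! i" "bb z ! i < \<zeta>' ! i" using ins by blast+
      then show ?thesis by (auto dest: less_asym)
    next
      case 3
      have "\<zeta> ! i < bb z ! i" if "inside a v \<zeta>" for \<zeta>
      proof -
        have b: "v r < bb z ! i" for r using p 3 i unfolding bb_def by simp
        moreover have "a M r < v 0" for r using ln unfolding lines_def by simp
        then have "a M r < bb z ! i" for r using b less_trans by blast
        ultimately show ?thesis using that 3(1) unfolding inside_def by auto
      qed
      then have "\<zeta> ! i < bb z ! i" "\<zeta>' ! i < bb z ! i" using ins by blast+
      then show ?thesis by (auto dest: less_asym)
    qed
  qed
  have "\<exists>\<sigma> \<in> Au Z. \<forall>k \<in> UNIV. \<forall>x \<in> ?X. \<sigma> (F k (?l x)) = F k (?l' x)"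
  proof (rule ind_family[OF ind])
    show "length (?l x) = d \<and> length (?l' x) = d" if "x \<in> ?X" for x
      using that ins unfolding inside_def bb_def by (auto split: sum.splits)
    fix x x' i assume x: "x \<in> ?X" "x' \<in> ?X" and i: "i < d"
    show "?l x ! i < ?l x' ! i \<longleftrightarrow> ?l' x ! i < ?l' x' ! i"
    proof (cases x; cases x')
      fix z z' assume "x = Inl z" "x' = Inl z'"
      then show ?thesis using x i ord by simp
    next
      fix z z' assume e: "x = Inl z" "x' = Inr z'"
      then have "inside a v (l z)" "inside a v (l' z)" "fst z' \<in> set bs" using x ins by auto
      from cmp[OF this i] show ?thesis using e by simp
    next
      fix z z' assume e: "x = Inr z" "x' = Inl z'"
      then have "inside a v (l z')" "inside a v (l' z')" "fst z \<in> set bs" using x ins by auto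
      from cmp[OF this i] show ?thesis using e by simp
    qed simp
  qed
  then obtain \<sigma> where \<sigma>: "\<sigma> \<in> Au Z" "\<forall>k. \<forall>x \<in> ?X. \<sigma> (F k (?l x)) = F k (?l' x)" by auto
  have "\<sigma> (gg i (bl x c i t)) = gg i (bl x c i t)" if "x \<in> set bs" "i < d" for x c i t
  proof -
    have "\<sigma> (F i (bb (x, c, t))) = F i (bb (x, c, t))"
      using \<sigma>(2)[rule_format, of "Inr (x, c, t)" i] that by simp
    moreover have "F i (bb (x, c, t)) = gg i (bl x c i t)"
      using gg_eq[OF that(2), of "bb (x, c, t)"] that unfolding bb_def by simp
    ultimately show ?thesis by simp
  qed
  then have "\<sigma> \<in> Au (A2 bs)" unfolding A2_def by (intro Au_insertI[OF \<sigma>(1)]) auto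
  moreover have "\<sigma> (F k (l x)) = F k (l' x)" if "x \<in> X" for k x
    using \<sigma>(2)[rule_format, of "Inl x" k] that by simp
  ultimately show ?thesis by blast
qed

text \<open>\<open>y\<close> is false along \<open>a\<close> and true along
  \<open>a(M := v)\<close>. An automorphism that brings the composite of \<open>a\<close> below
  \<open>r\<close> and \<open>v\<close> from \<open>r\<close> on back to \<open>a\<close> turns
  \<open>y\<close> into a point whose sign along \<open>a\<close> changes at \<open>r\<close>. So
  one point gives a whole chain.\<close>

lemma slide:
  assumes st: "stage y a v bs"
  shows "\<exists>Y. \<forall>r. Y r \<in> P \<and> (\<exists>\<sigma> \<in> Au (A2 bs). Y r = \<sigma> y) \<and>
    (\<forall>\<xi>. length \<xi> = d \<longrightarrow> (E (Y r) (F \<beta> (app d a \<xi>)) \<longleftrightarrow> r \<le> \<xi> ! M))"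
proof -
  have y: "y \<in> P" and ln: "lines a v" and bs: "\<And>x. x \<in> set bs \<Longrightarrow> pos a v x"
    and sg: "\<And>\<xi>. length \<xi> = d \<Longrightarrow> \<not> E y (F \<beta> (app d a \<xi>)) \<and> E y (F \<beta> (app d (a(M := v)) \<xi>))"
    using st unfolding stage_def by blast+
  have mono: "strict_mono (a i)" if "i < d" for i using ln that unfolding lines_def by blast
  have "\<exists>p. p \<in> P \<and> (\<exists>\<sigma> \<in> Au (A2 bs). p = \<sigma> y) \<and>
    (\<forall>\<xi>. length \<xi> = d \<longrightarrow> (E p (F \<beta> (app d a \<xi>)) \<longleftrightarrow> r \<le> \<xi> ! M))" for r
  proof -
    define a' where "a' = a(M := \<lambda>q. if q < r then a M q else v q)"
    have main: "a' M p < a' M q \<longleftrightarrow> p < q" for p q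
    proof -
      have "a M p < a M q \<longleftrightarrow> p < q" "v p < v q \<longleftrightarrow> p < q" "a M p < v q" "\<not> v p < a M q"
        using strict_mono_less[OF mono[OF Md]] strict_mono_less[of v] ln less_asym unfolding lines_def by blast+
      then show ?thesis unfolding a'_def by (auto simp: not_less)
    qed
    have "\<exists>\<sigma> \<in> Au (A2 bs). \<forall>k. \<forall>\<xi> \<in> {\<xi> :: rat list. length \<xi> = d}. \<sigma> (F k (app d a' \<xi>)) = F k (app d a \<xi>)"
    proof (rule block_move[OF ln bs])
      fix \<xi> assume "\<xi> \<in> {\<xi> :: rat list. length \<xi> = d}"
      show "inside a v (app d a' \<xi>) \<and> inside a v (app d a \<xi>)"
        unfolding inside_def a'_def using Md by auto
    next
      fix \<xi> \<xi>' :: "rat list" and i assume i: "i < d"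
      show "app d a' \<xi> ! i < app d a' \<xi>' ! i \<longleftrightarrow> app d a \<xi> ! i < app d a \<xi>' ! i"
        using i main strict_mono_less[OF mono[OF i]] by (cases "i = M") (auto simp: a'_def)
    qed
    then obtain \<sigma> where \<sigma>: "\<sigma> \<in> Au (A2 bs)" "\<forall>k. \<forall>\<xi> \<in> {\<xi> :: rat list. length \<xi> = d}. \<sigma> (F k (app d a' \<xi>)) = F k (app d a \<xi>)"
      by blast
    have "E (\<sigma> y) (F \<beta> (app d a \<xi>)) \<longleftrightarrow> r \<le> \<xi> ! M" if len: "length \<xi> = d" for \<xi>
    proof -
      have "E (\<sigma> y) (F \<beta> (app d a \<xi>)) = E y (F \<beta> (app d a' \<xi>))"
        using Au_E[OF \<sigma>(1) y F, of \<beta> "app d a' \<xi>"] \<sigma>(2) len by simp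
      moreover have "app d a' \<xi> = (if \<xi> ! M < r then app d a \<xi> else app d (a(M := v)) \<xi>)"
        by (rule nth_equalityI) (auto simp: a'_def)
      ultimately show ?thesis using sg[OF len] by auto
    qed
    then show ?thesis using \<sigma>(1) Au_P[OF \<sigma>(1) y] by blast
  qed
  then show ?thesis by metis
qed

text \<open>The points from \<open>slide\<close> are added as kind \<open>K\<close> and made
  indiscernible together with the old kinds, which are read along \<open>a\<close> and kept. The new
  kind takes the part of \<open>F \<kappa>\<close> in \<open>cut_pair\<close>.\<close>

lemma second_array:
  assumes st: "stage y a v bs"
  shows "\<exists>F1. (\<forall>k \<eta>. F1 k \<eta> \<in> P) \<and> ind_on UNIV d (A2 bs) F1 \<and>
    (\<forall>k<K. \<forall>\<xi>. length \<xi> = d \<longrightarrow> F1 k \<xi> = F k (app d a \<xi>)) \<and>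
    (\<forall>\<eta> \<eta>'. length \<eta> = d \<longrightarrow> length \<eta>' = d \<longrightarrow> \<eta> ! M = \<eta>' ! M \<longrightarrow> F1 K \<eta> = F1 K \<eta>') \<and>
    (\<forall>\<eta> \<xi>. length \<eta> = d \<longrightarrow> length \<xi> = d \<longrightarrow> \<eta> ! M \<noteq> \<xi> ! M \<longrightarrow> (E (F1 K \<eta>) (F1 \<beta> \<xi>) \<longleftrightarrow> \<eta> ! M < \<xi> ! M)) \<and>
    (\<forall>\<eta>. length \<eta> = d \<longrightarrow> (\<forall>x \<in> set bs. val (F1 K \<eta>) x))"
proof -
  have y: "y \<in> P" and ln: "lines a v" and bs: "\<And>x. x \<in> set bs \<Longrightarrow> pos a v x" and vl: "\<And>x. x \<in> set bs \<Longrightarrow> val y x"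
    using st unfolding stage_def by blast+
  have mono: "strict_mono (a i)" if "i < d" for i using ln that unfolding lines_def by blast
  obtain Y where Y: "\<forall>r. Y r \<in> P \<and> (\<exists>\<sigma> \<in> Au (A2 bs). Y r = \<sigma> y) \<and>
    (\<forall>\<xi>. length \<xi> = d \<longrightarrow> (E (Y r) (F \<beta> (app d a \<xi>)) \<longleftrightarrow> r \<le> \<xi> ! M))"
    using slide[OF st] by (elim exE)
  define F0 where "F0 k \<xi> = (if k < K then F k (app d a \<xi>) else Y (\<xi> ! M))" for k and \<xi> :: "rat list"
  have F0P: "F0 k \<xi> \<in> P" for k \<xi> unfolding F0_def using F Y by simp
  have A: "countable (A2 bs)" "A2 bs \<subseteq> P" using A2_facts by (auto intro: countable_finite)
  have ind0: "ind_on {..<K} d (A2 bs) F0"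
    unfolding ind_on_def
  proof (intro allI impI)
    fix \<Xi>' f assume f: "cmono d \<Xi>' f"
    have "\<exists>\<sigma> \<in> Au (A2 bs). \<forall>k. \<forall>\<xi> \<in> \<Xi>'. \<sigma> (F k (app d a \<xi>)) = F k (app d a (f \<xi>))"
    proof (rule block_move[OF ln bs])
      show "inside a v (app d a \<xi>) \<and> inside a v (app d a (f \<xi>))" for \<xi>
        unfolding inside_def using Md by auto
      fix \<xi> \<xi>' i assume "\<xi> \<in> \<Xi>'" "\<xi>' \<in> \<Xi>'" and i: "i < d"
      then have "\<xi> ! i < \<xi>' ! i \<longleftrightarrow> f \<xi> ! i < f \<xi>' ! i" using f unfolding cmono_def by blast
      then show "app d a \<xi> ! i < app d a \<xi>' ! i \<longleftrightarrow> app d a (f \<xi>) ! i < app d a (f \<xi>') ! i"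
        using i strict_mono_less[OF mono[OF i]] by simp
    qed
    then show "\<exists>\<sigma> \<in> Au (A2 bs). \<forall>k \<in> {..<K}. \<forall>\<xi> \<in> \<Xi>'. \<sigma> (F0 k \<xi>) = F0 k (f \<xi>)"
      unfolding F0_def by (auto intro: bexI)
  qed
  obtain F1 where F1: "\<forall>k \<eta>. F1 k \<eta> \<in> P" and em: "EM d (A2 bs) F0 F1" and ind1: "ind_on UNIV d (A2 bs) F1"
    and eq: "\<forall>k \<in> {..<K}. \<forall>\<xi>. length \<xi> = d \<longrightarrow> F1 k \<xi> = F0 k \<xi>"
    using extraction[OF A, of F0, OF F0P ind0] by (elim exE conjE)
  have "F1 k \<xi> = F k (app d a \<xi>)" if "k < K" "length \<xi> = d" for k \<xi>
    using eq that unfolding F0_def by simp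
  moreover have "F1 K \<eta> = F1 K \<eta>'" if len: "length \<eta> = d" "length \<eta>' = d" and e: "\<eta> ! M = \<eta>' ! M" for \<eta> \<eta>'
  proof (rule EM_eq[OF em len])
    fix \<zeta> \<zeta>' assume "same2 d \<eta> \<eta>' \<zeta> \<zeta>'"
    then show "F0 K \<zeta> = F0 K \<zeta>'" using same2_eq[of d \<eta> \<eta>' \<zeta> \<zeta>' M] Md e unfolding F0_def by simp
  qed
  moreover have "E (F1 K \<eta>) (F1 \<beta> \<xi>) \<longleftrightarrow> \<eta> ! M < \<xi> ! M"
    if len: "length \<eta> = d" "length \<xi> = d" and e: "\<eta> ! M \<noteq> \<xi> ! M" for \<eta> \<xi>
  proof (rule EM_E[OF em len])
    fix \<zeta> \<zeta>' assume s: "same2 d \<eta> \<xi> \<zeta> \<zeta>'"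
    have "E (F0 K \<zeta>) (F0 \<beta> \<zeta>') \<longleftrightarrow> \<zeta> ! M \<le> \<zeta>' ! M"
      using Y \<beta>K same2_length[OF s] unfolding F0_def by simp
    then show "E (F0 K \<zeta>) (F0 \<beta> \<zeta>') \<longleftrightarrow> \<eta> ! M < \<xi> ! M"
      using same2_eq[OF s Md] same2_less[OF s Md] e by auto
  qed
  moreover have "val (F1 K \<eta>) x" if len: "length \<eta> = d" and x: "x \<in> set bs" for \<eta> x
  proof (rule EM_one[OF em, where Y="\<lambda>p. val p x", OF val_dfn[OF A(2) order_refl x] len])
    fix \<xi>' :: "rat list"
    obtain \<sigma> where \<sigma>: "\<sigma> \<in> Au (A2 bs)" "F0 K \<xi>' = \<sigma> y" using Y unfolding F0_def by auto
    show "val (F0 K \<xi>') x"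
      unfolding \<sigma>(2) using Au_unary[OF \<sigma>(1), where Y="\<lambda>p. val p x", OF val_dfn[OF A(2) order_refl x] y] vl[OF x] by simp
  qed
  ultimately show ?thesis using F1 ind1 by (intro exI[of _ F1]) blast
qed

text \<open>The blocks \<open>f\<close> of the new record and the new lines \<open>wu\<close>,
  \<open>wv\<close> are all placed on the old line \<open>a\<close>; their position relative to the
  older blocks is inherited from it.\<close>

lemma extend_stage:
  assumes st: "stage y a v bs" and y': "y' \<in> P" and old: "\<And>x. x \<in> set bs \<Longrightarrow> val y' x"
    and wu: "\<And>i. i < d \<Longrightarrow> strict_mono (wu i)" and wv: "strict_mono wv" and uv: "\<And>p q. wu M p < wv q"
    and sg: "\<And>\<xi>. length \<xi> = d \<Longrightarrow> \<not> E y' (F \<beta> (app d a (app d wu \<xi>))) \<and> E y' (F \<beta> (app d a (app d (wu(M := wv)) \<xi>)))"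
    and f: "\<And>c i. i < d \<Longrightarrow> strict_mono (f c i)" and fA: "\<And>c i p q. i < M \<Longrightarrow> wu i p < f c i q"
    and fM: "\<And>c p q. if s then f c M q < wu M p else wv p < f c M q"
    and \<xi>: "\<xi> \<in> \<Xi>" "\<And>c. Dd H \<xi> (\<lambda>i t. a i (f c i t)) y' s \<longleftrightarrow> c"
  shows "\<exists>a' v' x. stage y' a' v' (x # bs)"
proof -
  have ln: "lines a v" and bs: "\<And>x. x \<in> set bs \<Longrightarrow> pos a v x" and so: "sorted_wrt rel bs"
    using st unfolding stage_def by blast+
  have mono: "strict_mono (a i)" if "i < d" for i using ln that unfolding lines_def by blast
  have av: "a M p < v q" for p q using ln unfolding lines_def by blast
  define a' where "a' i r = a i (wu i r)" for i r
  define v' where "v' r = a M (wv r)" for r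
  define x :: block_record where "x = (s, \<xi>, \<lambda>c i t. a i (f c i t))"
  have posA: "a i p < bl x' c i q" if "x' \<in> set bs" "i < M" for x' c i p q
    using bs[OF that(1)] that(2) unfolding pos_def by blast
  have posM: "if sd x' then bl x' c M q < a M p else v p < bl x' c M q" if "x' \<in> set bs" for x' c p q
    using bs[OF that] unfolding pos_def by blast
  have posM': "a M p < bl x' c M q" if "x' \<in> set bs" "\<not> sd x'" for x' c p q
    using posM[OF that(1), of c q 0] that(2) av[of p 0] by (auto intro: less_trans)
  have "lines a' v'"
    unfolding lines_def a'_def v'_def using mono wu wv uv Md
    by (auto simp: strict_mono_def)
  moreover have "app d a' \<zeta> = app d a (app d wu \<zeta>)" for \<zeta>
    by (rule nth_equalityI) (auto simp: a'_def)
  moreover have "app d (a'(M := v')) \<zeta> = app d a (app d (wu(M := wv)) \<zeta>)" for \<zeta>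
    by (rule nth_equalityI) (auto simp: a'_def v'_def)
  moreover have "rel x x'" if x': "x' \<in> set bs" for x'
    unfolding rel_def
  proof (intro allI conjI impI)
    fix c c' p q
    show "bl x c i p < bl x' c' i q" if "i < M" for i using posA[OF x' that] unfolding x_def by simp
    assume "sd x = sd x'"
    then show "if sd x then bl x' c' M p < bl x c M q else bl x c M p < bl x' c' M q"
      using posM[OF x', of c' p] posM'[OF x', of _ c' q] unfolding x_def by (cases s) auto
  qed
  moreover have "pos a' v' x'" if x': "x' \<in> set bs" for x'
    unfolding pos_def
  proof (intro allI conjI impI)
    fix c
    show "strict_mono (bl x' c i)" if "i < d" for i using bs[OF x'] that unfolding pos_def by blast
    show "a' i p < bl x' c i q" if "i < M" for i p q unfolding a'_def by (rule posA[OF x' that])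
    fix p q
    show "if sd x' then bl x' c M q < a' M p else v' p < bl x' c M q"
      using posM[OF x', of c q] posM'[OF x', of _ c q] unfolding a'_def v'_def by simp
  qed
  moreover have "pos a' v' x"
    unfolding pos_def
  proof (intro allI conjI impI)
    fix c
    show "strict_mono (bl x c i)" if "i < d" for i
      using mono[OF that] f[OF that, of c] unfolding x_def by (auto simp: strict_mono_def)
    show "a' i p < bl x c i q" if "i < M" for i p q
      using strict_mono_less[OF mono[of i]] fA[OF that] that Md unfolding a'_def x_def by simp
    fix p q
    show "if sd x then bl x c M q < a' M p else v' p < bl x c M q"
    proof -
      have "if s then f c M q < wu M p else wv p < f c M q" by (rule fM)
      then show ?thesis using strict_mono_less[OF mono[OF Md]] unfolding a'_def v'_def x_def by simp
    qed
  qed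
  moreover have "val y' x" unfolding val_def x_def using \<xi> by simp
  ultimately have "stage y' a' v' (x # bs)"
    unfolding stage_def using y' sg so old by simp
  then show ?thesis by blast
qed

end

lemma hs_eq_iff [simp]: "hs r = hs s \<longleftrightarrow> r = s"
  by (metis hs_less_iff less_irrefl linorder_neqE)

lemma hs_sign: "hs r < 0 \<longleftrightarrow> r < 0" "hs r = 0 \<longleftrightarrow> r = 0"
proof -
  have "hs 0 = 0" by (simp add: hs_def)
  then show "hs r < 0 \<longleftrightarrow> r < 0" "hs r = 0 \<longleftrightarrow> r = 0" using hs_less_iff[of r 0] hs_eq_iff[of r 0] by simp_all
qed

lemma strict_mono_hs_shift: "strict_mono (\<lambda>r. c + hs r)"
  by (auto simp: strict_mono_def)

section \<open>Adding one record to a stage\<close>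

context obstruction
begin

text \<open>On the far right block \<open>FR\<close> leaves give the sign true at every position, so
  the obstruction must deny the sign false at some position. The block \<open>TR\<close> admits
  false there, by the cut \<open>c1\<close> of a bad pair or by an inner leaf. The two blocks form a
  record of side \<open>False\<close>. In the same way \<open>FL\<close> and \<open>TL\<close> form
  a record of side \<open>True\<close>.\<close>

lemma stage_step:
  assumes st: "stage y a v bs"
  shows "\<exists>y' a' v' x. stage y' a' v' (x # bs)"
proof -
  have ln: "lines a v" and bs: "\<And>x. x \<in> set bs \<Longrightarrow> pos a v x" using st unfolding stage_def by blast+
  have mono: "strict_mono (a i)" if "i < d" for i using ln that unfolding lines_def by blast
  obtain F1 where F1P: "\<forall>k \<eta>. F1 k \<eta> \<in> P" and ind1: "ind_on UNIV d (A2 bs) F1"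
    and F1K: "\<forall>k<K. \<forall>\<xi>. length \<xi> = d \<longrightarrow> F1 k \<xi> = F k (app d a \<xi>)"
    and Ydep: "\<forall>\<eta> \<eta>'. length \<eta> = d \<longrightarrow> length \<eta>' = d \<longrightarrow> \<eta> ! M = \<eta>' ! M \<longrightarrow> F1 K \<eta> = F1 K \<eta>'"
    and Ychain: "\<forall>\<eta> \<xi>. length \<eta> = d \<longrightarrow> length \<xi> = d \<longrightarrow> \<eta> ! M \<noteq> \<xi> ! M \<longrightarrow> (E (F1 K \<eta>) (F1 \<beta> \<xi>) \<longleftrightarrow> \<eta> ! M < \<xi> ! M)"
    and Yval: "\<forall>\<eta>. length \<eta> = d \<longrightarrow> (\<forall>x \<in> set bs. val (F1 K \<eta>) x)"
    using second_array[OF st] by (elim exE conjE)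
  have A: "countable (A2 bs)" "A2 bs \<subseteq> P" using A2_facts by (auto intro: countable_finite)
  have F1b: "F1 \<beta> \<xi> = F \<beta> (app d a \<xi>)" if "length \<xi> = d" for \<xi> using F1K \<beta>K that by simp
  have F1g: "F1 i \<eta> = gg i (a i (\<eta> ! i))" if "i < d" "length \<eta> = d" for i \<eta>
    using F1K dK that gg_eq[OF that(1), of "app d a \<eta>"] by simp
  have gF1: "gg i (a i r) = F1 i (replicate d r)" if "i < d" for i r
    using F1g[OF that, of "replicate d r"] that by simp
  have lf': "E (gg i (a i r)) (F1 \<beta> \<xi>) \<longleftrightarrow> r < \<xi> ! i" if "i < d" "length \<xi> = d" "r \<noteq> \<xi> ! i" for i r \<xi>
    using leafD[OF that(1), of "app d a \<xi>" "a i r"] that strict_mono_less[OF mono[OF that(1)]]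
      strict_mono_eq[OF mono[OF that(1)]] F1b by simp
  have base1: "base_dep d F1" unfolding base_dep_def using F1g by simp
  have leaf1: "leaf d F1 \<beta>" unfolding leaf_def using F1g lf' by simp
  obtain \<sigma> \<rho> t q0 y1 c1 where \<sigma>: "\<sigma> \<in> Au (A2 bs)" and \<rho>: "\<rho> \<in> Au (A2 bs)"
    and y1: "y1 = \<sigma> (F1 K (one_at d 0 M (hh 0)))" and c1: "c1 = \<rho> (F1 \<beta> (one_at d 0 M (hh 0)))"
    and y1F: "\<forall>\<eta>. length \<eta> = d \<longrightarrow> \<eta> ! M \<le> 0 \<longrightarrow> \<not> E y1 (F1 \<beta> \<eta>)"
    and y1T: "\<forall>\<eta>. length \<eta> = d \<longrightarrow> 1 \<le> \<eta> ! M \<longrightarrow> E y1 (F1 \<beta> \<eta>)"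
    and c1A: "\<forall>i<M. \<forall>\<eta>. length \<eta> = d \<longrightarrow> \<eta> ! i \<noteq> 0 \<longrightarrow> (E (F1 i \<eta>) c1 \<longleftrightarrow> \<eta> ! i < 0)"
    and c1L: "\<forall>\<eta>. length \<eta> = d \<longrightarrow> \<eta> ! M \<le> 0 \<longrightarrow> E (F1 M \<eta>) c1"
    and c1R: "\<forall>\<eta>. length \<eta> = d \<longrightarrow> 1 \<le> \<eta> ! M \<longrightarrow> \<not> E (F1 M \<eta>) c1"
    and y1t: "\<forall>r. E y1 (F1 \<beta> (one_at d 0 M (hh r))) = t" and yc: "E y1 c1 = (\<not> t)"
    and coh: "\<forall>q \<eta>. length \<eta> = d \<longrightarrow> \<eta> ! M = hh q \<longrightarrow> (if t then q0 \<le> q else q \<le> q0) \<longrightarrow> E (F1 M \<eta>) c1 = t"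
    using cut_pair[OF nc A d1 nogrid, of F1 \<beta> K, folded M_def, OF F1P[rule_format] ind1 base1 leaf1 Ydep Ychain]
    by (elim bexE exE conjE)
  have y1P: "y1 \<in> P" unfolding y1 using Au_P[OF \<sigma>] F1P by simp
  have c1P: "c1 \<in> P" unfolding c1 using Au_P[OF \<rho>] F1P by simp
  have y1val: "val y1 x" if x: "x \<in> set bs" for x
  proof -
    have "val (F1 K (one_at d 0 M (hh 0))) x" using Yval x by simp
    then show ?thesis
      unfolding y1 using Au_unary[OF \<sigma>, where Y="\<lambda>p. val p x", OF val_dfn[OF A(2) order_refl x]] F1P by simp
  qed
  have Th1: "Th (F1 \<beta> \<xi>)" if "length \<xi> = d" for \<xi> unfolding F1b[OF that] by (rule Th_leaf) simp
  have Thc: "Th c1"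
    unfolding c1 using Th_Au[OF Au_mono[OF \<rho> A2_facts(3)]] F1P Th1 by simp
  have gA: "E (gg i (a i r)) c1 \<longleftrightarrow> r < 0" if "i < M" "r \<noteq> 0" for i r
    using c1A[rule_format, of i "replicate d r"] gF1[of i r] that Md by simp
  have gL: "E (gg M (a M r)) c1" if "r \<le> 0" for r
    using c1L[rule_format, of "replicate d r"] gF1[OF Md] that Md by simp
  have gR: "\<not> E (gg M (a M r)) c1" if "1 \<le> r" for r
    using c1R[rule_format, of "replicate d r"] gF1[OF Md] that Md by simp
  have gz: "E (gg M (a M (hh q))) c1 = t" if "if t then q0 \<le> q else q \<le> q0" for q
    using coh[rule_format, of "replicate d (hh q)" q] gF1[OF Md] that Md by simp
  \<comment> \<open>\<open>q2\<close> reaches \<open>q0\<close>, beyond which the signs of the main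
    sequence at \<open>c1\<close> are known, and also 1 or -1, which keeps the blocks clear of the
    middle line \<open>w 1\<close>.\<close>
  define q2 where "q2 = (if t then max q0 1 else min q0 (- 1))"
  \<comment> \<open>For true \<open>t\<close> the block straddles the cut of \<open>c1\<close>,
    which lies at the right end of the interval; for false \<open>t\<close> it surrounds the inner
    leaf at \<open>hh 3\<close>. \<open>TL\<close> is the mirror image, with the roles of the two
    values of \<open>t\<close> exchanged. Off the main coordinate all blocks surround 0, the cut of
    both \<open>c1\<close> and these leaves.\<close>
  define TR where "TR \<xi> i r = (if i < M then hs (r - \<xi> ! i) else if t then
      (if r < \<xi> ! M then hh (q2 + 1 + hs (r - \<xi> ! M)) else 5 + (r - \<xi> ! M)) else hh (3 + hs (r - \<xi> ! M)))" for \<xi> i r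
  define TL where "TL \<xi> i r = (if i < M then hs (r - \<xi> ! i) else if t then hh (- 3 + hs (r - \<xi> ! M))
      else (if r \<le> \<xi> ! M then - 5 + (r - \<xi> ! M) else hh (q2 - 1 + hs (r - \<xi> ! M))))" for \<xi> i r
  define FR :: "nat \<Rightarrow> rat \<Rightarrow> rat" where "FR i r = 5 + hs r" for i r
  define FL where "FL i r = (if i < M then 5 + hs r else - 5 + hs r)" for i r
  have hsb: "- 1 < hs r" "hs r < 1" for r by (rule hs_bounds)+
  have hh5: "hh p < 5 + q" if "0 \<le> q" for p q using hh_bounds(2)[of p] that by linarith
  have hh5': "- 5 + q < hh p" if "q \<le> 0" for p q using hh_bounds(1)[of p] that by linarith
  have TRm: "strict_mono (TR \<xi> i)" for \<xi> i
  proof (rule strict_monoI)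
    fix r s :: rat assume rs: "r < s"
    show "TR \<xi> i r < TR \<xi> i s" unfolding TR_def using rs hh5[of "s - \<xi> ! M" "q2 + 1 + hs (r - \<xi> ! M)"] by auto
  qed
  have TLm: "strict_mono (TL \<xi> i)" for \<xi> i
  proof (rule strict_monoI)
    fix r s :: rat assume rs: "r < s"
    show "TL \<xi> i r < TL \<xi> i s" unfolding TL_def using rs hh5'[of "r - \<xi> ! M" "q2 - 1 + hs (s - \<xi> ! M)"] by auto
  qed
  have FRm: "strict_mono (FR i)" for i unfolding FR_def by (rule strict_mono_hs_shift)
  have FLm: "strict_mono (FL i)" for i unfolding FL_def by (auto simp: strict_mono_def)
  have am: "strict_mono (\<lambda>r. a i (f r))" if "i < d" "strict_mono f" for i f
    using mono[OF that(1)] that(2) by (auto simp: strict_mono_def)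
  have DdI: "Dd H \<xi> f z s" if "c \<in> P" "Th c" "E z c = s"
    "\<And>i r. i < d \<Longrightarrow> r \<noteq> \<xi> ! i \<Longrightarrow> E (gg i (f i r)) c \<longleftrightarrow> r < \<xi> ! i" for \<xi> f z s c
    unfolding Dd_def using that by blast
  have DdFR: "Dd H \<xi> (\<lambda>i r. a i (FR i r)) y1 True" for \<xi>
  proof (rule DdI[of "F1 \<beta> (app d FR \<xi>)"])
    have "1 \<le> app d FR \<xi> ! M" using hsb(1)[of "\<xi> ! M"] Md unfolding FR_def by simp
    then show "E y1 (F1 \<beta> (app d FR \<xi>)) = True" using y1T by simp
    fix i r assume "i < d" "r \<noteq> \<xi> ! i"
    then show "E (gg i (a i (FR i r))) (F1 \<beta> (app d FR \<xi>)) \<longleftrightarrow> r < \<xi> ! i"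
      using lf'[of i "app d FR \<xi>" "FR i r"] by (simp add: FR_def)
  qed (use F1P Th1 in auto)
  have DdFL: "Dd H \<xi> (\<lambda>i r. a i (FL i r)) y1 False" for \<xi>
  proof (rule DdI[of "F1 \<beta> (app d FL \<xi>)"])
    have "app d FL \<xi> ! M \<le> 0" using hsb(2)[of "\<xi> ! M"] Md unfolding FL_def by simp
    then show "E y1 (F1 \<beta> (app d FL \<xi>)) = False" using y1F by simp
    fix i r assume "i < d" "r \<noteq> \<xi> ! i"
    then show "E (gg i (a i (FL i r))) (F1 \<beta> (app d FL \<xi>)) \<longleftrightarrow> r < \<xi> ! i"
      using lf'[of i "app d FL \<xi>" "FL i r"] by (simp add: FL_def)
  qed (use F1P Th1 in auto)
  have "\<exists>\<xi> \<in> \<Xi>. \<exists>s. \<not> Dd H \<xi> (\<lambda>i r. a i (FR i r)) y1 s" by (rule obs_strict_mono[OF am[OF _ FRm] y1P])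
  then obtain \<xi>R where \<xi>R: "\<xi>R \<in> \<Xi>" "\<not> Dd H \<xi>R (\<lambda>i r. a i (FR i r)) y1 False" using DdFR by (metis (full_types))
  have "\<exists>\<xi> \<in> \<Xi>. \<exists>s. \<not> Dd H \<xi> (\<lambda>i r. a i (FL i r)) y1 s" by (rule obs_strict_mono[OF am[OF _ FLm] y1P])
  then obtain \<xi>L where \<xi>L: "\<xi>L \<in> \<Xi>" "\<not> Dd H \<xi>L (\<lambda>i r. a i (FL i r)) y1 True" using DdFL by (metis (full_types))
  have o_at: "length (one_at d 0 M r) = d" "one_at d 0 M r ! M = r" "i < M \<Longrightarrow> one_at d 0 M r ! i = 0" for r i
    using Md by auto
  have zero_hs: "hs (r - s) \<noteq> 0 \<longleftrightarrow> r \<noteq> s" "hs (r - s) < 0 \<longleftrightarrow> r < s" for r s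
    by (simp_all add: hs_sign)
  have DdTR: "Dd H \<xi> (\<lambda>i r. a i (TR \<xi> i r)) y1 False" for \<xi>
  proof (cases t)
    case True
    show ?thesis
    proof (rule DdI[OF c1P Thc])
      show "E y1 c1 = False" using yc True by simp
      fix i r assume i: "i < d" and r: "r \<noteq> \<xi> ! i"
      consider "i < M" | "i = M" "r < \<xi> ! M" | "i = M" "\<xi> ! M < r" using less_d_cases[OF i] r by force
      then show "E (gg i (a i (TR \<xi> i r))) c1 \<longleftrightarrow> r < \<xi> ! i"
      proof cases
        case 1
        then show ?thesis using gA[OF 1, of "hs (r - \<xi> ! i)"] r unfolding TR_def by (simp add: zero_hs)
      next
        case 2
        have "q0 \<le> q2 + 1 + hs (r - \<xi> ! M)" using hsb(1)[of "r - \<xi> ! M"] True unfolding q2_def by simp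
        then show ?thesis using gz[of "q2 + 1 + hs (r - \<xi> ! M)"] 2 True unfolding TR_def by simp
      next
        case 3
        then show ?thesis using gR[of "5 + (r - \<xi> ! M)"] True unfolding TR_def by simp
      qed
    qed
  next
    case False
    show ?thesis
    proof (rule DdI[of "F1 \<beta> (one_at d 0 M (hh 3))"])
      show "E y1 (F1 \<beta> (one_at d 0 M (hh 3))) = False" using y1t False by simp
      fix i r assume i: "i < d" and r: "r \<noteq> \<xi> ! i"
      show "E (gg i (a i (TR \<xi> i r))) (F1 \<beta> (one_at d 0 M (hh 3))) \<longleftrightarrow> r < \<xi> ! i"
        using lf'[OF i o_at(1)[of "hh 3"], of "TR \<xi> i r"] less_d_cases[OF i] r False o_at Md
        unfolding TR_def by (auto simp: zero_hs hs_sign)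
    qed (use F1P Th1 o_at in auto)
  qed
  have DdTL: "Dd H \<xi> (\<lambda>i r. a i (TL \<xi> i r)) y1 True" for \<xi>
  proof (cases t)
    case False
    show ?thesis
    proof (rule DdI[OF c1P Thc])
      show "E y1 c1 = True" using yc False by simp
      fix i r assume i: "i < d" and r: "r \<noteq> \<xi> ! i"
      consider "i < M" | "i = M" "r < \<xi> ! M" | "i = M" "\<xi> ! M < r" using less_d_cases[OF i] r by force
      then show "E (gg i (a i (TL \<xi> i r))) c1 \<longleftrightarrow> r < \<xi> ! i"
      proof cases
        case 1
        then show ?thesis using gA[OF 1, of "hs (r - \<xi> ! i)"] r unfolding TL_def by (simp add: zero_hs)
      next
        case 3
        have "q2 - 1 + hs (r - \<xi> ! M) \<le> q0" using hsb(2)[of "r - \<xi> ! M"] False unfolding q2_def by simp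
        then show ?thesis using gz[of "q2 - 1 + hs (r - \<xi> ! M)"] 3 False unfolding TL_def by simp
      next
        case 2
        then show ?thesis using gL[of "- 5 + (r - \<xi> ! M)"] False unfolding TL_def by simp
      qed
    qed
  next
    case True
    show ?thesis
    proof (rule DdI[of "F1 \<beta> (one_at d 0 M (hh (- 3)))"])
      show "E y1 (F1 \<beta> (one_at d 0 M (hh (- 3)))) = True" using y1t True by simp
      fix i r assume i: "i < d" and r: "r \<noteq> \<xi> ! i"
      show "E (gg i (a i (TL \<xi> i r))) (F1 \<beta> (one_at d 0 M (hh (- 3)))) \<longleftrightarrow> r < \<xi> ! i"
        using lf'[OF i o_at(1)[of "hh (- 3)"], of "TL \<xi> i r"] less_d_cases[OF i] r True o_at Md
        unfolding TL_def by (auto simp: zero_hs hs_sign)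
    qed (use F1P Th1 o_at in auto)
  qed
  define fS where "fS s c = (if s then (if c then TL \<xi>L else FL) else (if c then TR \<xi>R else FR))" for s c :: bool
  define \<xi>S where "\<xi>S s = (if s then \<xi>L else \<xi>R)" for s :: bool
  have fSm: "strict_mono (fS s c i)" for s c i unfolding fS_def using TLm TRm FLm FRm by simp
  have fSA: "- 1 < fS s c i r" if "i < M" for s c i r
  proof -
    have "- 1 < hs q" "- 1 < 5 + hs q" for q using hsb(1)[of q] by simp_all
    then show ?thesis unfolding fS_def TL_def FL_def TR_def FR_def using that by auto
  qed
  have fSR: "hh 1 < fS False c M r" "fS False c M r < 1 \<or> 4 < fS False c M r" for c r
  proof -
    have h: "hh p < 1" "hh p < 5 + hs r" "4 < 5 + hs r" for p r
      using hh_bounds(2)[of p] hsb(1)[of r] by linarith+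
    have q: "1 < q2 + 1 + hs s" if "t" for s using that hsb(1)[of s] unfolding q2_def by simp
    have q': "1 < 3 + hs s" for s using hsb(1)[of s] by simp
    show "hh 1 < fS False c M r"
      unfolding fS_def TR_def FR_def using h q q' hh5[of "r - \<xi>R ! M" 1] by simp
    show "fS False c M r < 1 \<or> 4 < fS False c M r"
      unfolding fS_def TR_def FR_def using h by simp
  qed
  have fSL: "fS True c M r < hh (- 1)" "0 < fS True c M r \<or> fS True c M r < - 4" for c r
  proof -
    have h: "0 < hh p" "- 5 + hs r < hh p" "- 5 + hs r < - 4" for p r
      using hh_bounds(1)[of p] hsb(2)[of r] by linarith+
    have q: "q2 - 1 + hs s < - 1" if "\<not> t" for s using that hsb(2)[of s] unfolding q2_def by simp
    have q': "- 3 + hs s < - 1" for s using hsb(2)[of s] by simp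
    show "fS True c M r < hh (- 1)"
      unfolding fS_def TL_def FL_def using h q q' hh5'[of "r - \<xi>L ! M" "- 1"] by simp
    show "0 < fS True c M r \<or> fS True c M r < - 4"
      unfolding fS_def TL_def FL_def using h by simp
  qed
  define w where "w n i r = (if i < M then - 5 + hs r else if n = 0 then - 3 + hs r else if n = 1 then hh (hs r) else 3 + hs r)"
    for n i :: nat and r
  have wm: "strict_mono (w n i)" for n i unfolding w_def by (auto simp: strict_mono_def)
  have w0: "- 4 < w 0 M r" "w 0 M r < - 2" for r unfolding w_def using hsb[of r] by simp_all
  have w1: "hh (- 1) < w 1 M r" "w 1 M r < hh 1" for r unfolding w_def using hsb[of r] by simp_all
  have w2: "2 < w 2 M r" "w 2 M r < 4" for r unfolding w_def using hsb[of r] by simp_all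
  have wA: "w n i r < - 4" if "i < M" for n i r unfolding w_def using hsb[of r] that by simp
  have hh1: "0 < hh (- 1)" "hh 1 < 1" by (rule hh_bounds)+
  have three: "n = 0 \<or> n = 1 \<or> n = 2" if "n \<le> 2" for n :: nat using that by auto
  have wlt: "w n M r < w n' M r'" if "n < n'" "n' \<le> 2" for n n' r r'
  proof -
    have "n = 0 \<and> n' = 1 \<or> n = 0 \<and> n' = 2 \<or> n = 1 \<and> n' = 2" using that by auto
    moreover have "w 0 M r < w 1 M r'" "w 0 M r < w 2 M r'" "w 1 M r < w 2 M r'"
      using w0(2)[of r] w1(1)[of r'] w1(2)[of r] w2(1)[of r'] hh1 by linarith+
    ultimately show ?thesis by (elim disjE conjE) simp_all
  qed
  have wf: "(\<forall>r. w n M r < fS s c M q) \<or> (\<forall>r. fS s c M q < w n M r)" if "n \<le> 2" for n s c q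
  proof (cases s)
    case False
    have "w 0 M r < fS False c M q" "w 1 M r < fS False c M q" for r
      using w0(2)[of r] w1(2)[of r] fSR(1)[of c q] hh_bounds(1)[of 1] by linarith+
    moreover have "(\<forall>r. w 2 M r < fS False c M q) \<or> (\<forall>r. fS False c M q < w 2 M r)"
      using fSR(2)[of c q]
    proof
      assume "fS False c M q < 1"
      then have "fS False c M q < w 2 M r" for r using w2(1)[of r] by linarith
      then show ?thesis by blast
    next
      assume "4 < fS False c M q"
      then have "w 2 M r < fS False c M q" for r using w2(2)[of r] by linarith
      then show ?thesis by blast
    qed
    ultimately show ?thesis using three[OF that] False by auto
  next
    case True
    have "fS True c M q < w 1 M r" "fS True c M q < w 2 M r" for r
      using w1(1)[of r] w2(1)[of r] fSL(1)[of c q] hh_bounds(2)[of "- 1"] by linarith+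
    moreover have "(\<forall>r. w 0 M r < fS True c M q) \<or> (\<forall>r. fS True c M q < w 0 M r)"
      using fSL(2)[of c q]
    proof
      assume "0 < fS True c M q"
      then have "w 0 M r < fS True c M q" for r using w0(2)[of r] by linarith
      then show ?thesis by blast
    next
      assume "fS True c M q < - 4"
      then have "fS True c M q < w 0 M r" for r using w0(1)[of r] by linarith
      then show ?thesis by blast
    qed
    ultimately show ?thesis using three[OF that] True by auto
  qed
  define B where "B = (\<lambda>(s, c, i, r). gg i (a i (fS s c i r))) ` (UNIV \<times> UNIV \<times> {..<d} \<times> H)"
  define A4 where "A4 = A2 bs \<union> B"
  have BI: "gg i (a i (fS s c i r)) \<in> A4" if "i < d" "r \<in> H" for s c i r
  proof -
    have "(s, c, i, r) \<in> UNIV \<times> UNIV \<times> {..<d} \<times> H" using that by simp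
    from imageI[OF this, of "\<lambda>(s, c, i, r). gg i (a i (fS s c i r))"] show ?thesis unfolding A4_def B_def by simp
  qed
  have A4: "countable A4" "A4 \<subseteq> P" "A2 bs \<subseteq> A4" "Z \<subseteq> A4"
  proof -
    have "finite A4" unfolding A4_def B_def using A2_facts(1) H by simp
    then show "countable A4" by (rule countable_finite)
    show "A4 \<subseteq> P" unfolding A4_def B_def using A(2) gg_P by auto
    show "A2 bs \<subseteq> A4" unfolding A4_def by blast
    then show "Z \<subseteq> A4" using A2_facts(3) by blast
  qed
  \<comment> \<open>The sign of \<open>y1\<close> along the middle line need not be constant.
    Extraction over the block points, with \<open>y1\<close> as a constant kind, replaces it by a
    point \<open>y2\<close> whose sign there is constant, while the leaves on the three lines are
    kept.\<close>
  define F2 where "F2 k \<xi> = (if k \<le> 2 then F1 \<beta> (app d (w k) \<xi>) else y1)" for k :: nat and \<xi>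
  have F2P: "F2 k \<xi> \<in> P" for k \<xi> unfolding F2_def using F1P y1P by simp
  have ind2: "ind_on {..2} d A4 F2"
    unfolding ind_on_def
  proof (intro allI impI)
    fix \<Xi>' f assume f: "cmono d \<Xi>' f"
    define bb where "bb z = map (\<lambda>i. fS (fst z) (fst (snd z)) i (snd (snd z))) [0..<d]" for z :: "bool \<times> bool \<times> rat"
    let ?X = "{x :: (nat \<times> rat list) + (bool \<times> bool \<times> rat). case x of Inl z \<Rightarrow> fst z \<le> 2 \<and> snd z \<in> \<Xi>' | Inr z \<Rightarrow> True}"
    let ?l = "\<lambda>x. case x of Inl z \<Rightarrow> app d (w (fst z)) (snd z) | Inr z \<Rightarrow> bb z"
    let ?l' = "\<lambda>x. case x of Inl z \<Rightarrow> app d (w (fst z)) (f (snd z)) | Inr z \<Rightarrow> bb z"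
    have "\<exists>\<sigma> \<in> Au (A2 bs). \<forall>k \<in> UNIV. \<forall>x \<in> ?X. \<sigma> (F1 k (?l x)) = F1 k (?l' x)"
    proof (rule ind_family[OF ind1])
      show "length (?l x) = d \<and> length (?l' x) = d" for x unfolding bb_def by (auto split: sum.splits)
      fix x x' i assume x: "x \<in> ?X" "x' \<in> ?X" and i: "i < d"
      have mix: "(app d (w n) \<zeta> ! i < bb z ! i \<longleftrightarrow> app d (w n) \<zeta>' ! i < bb z ! i) \<and>
          (bb z ! i < app d (w n) \<zeta> ! i \<longleftrightarrow> bb z ! i < app d (w n) \<zeta>' ! i)" if n: "n \<le> 2" for n z \<zeta> \<zeta>'
      proof -
        have "(\<forall>r. w n i r < bb z ! i) \<or> (\<forall>r. bb z ! i < w n i r)"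
        proof (cases "i = M")
          case True
          then show ?thesis using wf[OF n, of "fst z" "fst (snd z)" "snd (snd z)"] i unfolding bb_def by simp
        next
          case False
          then have iM: "i < M" using less_d_cases[OF i] by simp
          have "w n i r < bb z ! i" for r
            using wA[OF iM, of n r] fSA[OF iM, of "fst z" "fst (snd z)" "snd (snd z)"] i unfolding bb_def by simp
          then show ?thesis by blast
        qed
        then show ?thesis using i less_asym by (elim disjE) (simp_all, blast+)
      qed
      show "?l x ! i < ?l x' ! i \<longleftrightarrow> ?l' x ! i < ?l' x' ! i"
      proof (cases x; cases x')
        fix z z' assume e: "x = Inl z" "x' = Inl z'"
        then have z: "fst z \<le> 2" "fst z' \<le> 2" "snd z \<in> \<Xi>'" "snd z' \<in> \<Xi>'" using x by auto
        then have o: "snd z ! i < snd z' ! i \<longleftrightarrow> f (snd z) ! i < f (snd z') ! i" using f i unfolding cmono_def by blast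
        consider "i < M" | "i = M" "fst z = fst z'" | "i = M" "fst z < fst z'" | "i = M" "fst z' < fst z"
          using less_d_cases[OF i] by linarith
        then show ?thesis
        proof cases
          case 1
          then show ?thesis using e o i by (simp add: w_def)
        next
          case 2
          then show ?thesis using e o i strict_mono_less[OF wm] by simp
        next
          case 3
          then show ?thesis using e i wlt[OF 3(2) z(2)] by simp
        next
          case 4
          have "\<not> w (fst z) M r < w (fst z') M r'" for r r' using wlt[OF 4(2) z(1), of r' r] by (rule less_not_sym)
          then show ?thesis using e i 4(1) by simp
        qed
      next
        fix z z' assume e: "x = Inl z" "x' = Inr z'"
        then have "fst z \<le> 2" using x by auto
        from mix[OF this] show ?thesis using e by simp
      next
        fix z z' assume e: "x = Inr z" "x' = Inl z'"
        then have "fst z' \<le> 2" using x by auto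
        from mix[OF this] show ?thesis using e by simp
      qed simp
    qed
    then obtain \<tau> where \<tau>: "\<tau> \<in> Au (A2 bs)" "\<forall>k. \<forall>x \<in> ?X. \<tau> (F1 k (?l x)) = F1 k (?l' x)" by auto
    have "\<tau> (gg i (a i (fS s c i r))) = gg i (a i (fS s c i r))" if i: "i < d" for s c i r
    proof -
      have "\<tau> (F1 i (bb (s, c, r))) = F1 i (bb (s, c, r))" using \<tau>(2)[rule_format, of "Inr (s, c, r)" i] by simp
      moreover have "F1 i (bb (s, c, r)) = gg i (a i (fS s c i r))"
        using F1g[OF i, of "bb (s, c, r)"] i unfolding bb_def by simp
      ultimately show ?thesis by simp
    qed
    then have "\<tau> \<in> Au A4" unfolding A4_def B_def by (intro Au_insertI[OF \<tau>(1)]) auto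
    moreover have "\<tau> (F2 k \<xi>) = F2 k (f \<xi>)" if "k \<in> {..2}" "\<xi> \<in> \<Xi>'" for k \<xi>
      using \<tau>(2)[rule_format, of "Inl (k, \<xi>)" \<beta>] that unfolding F2_def by simp
    ultimately show "\<exists>\<sigma> \<in> Au A4. \<forall>k \<in> {..2}. \<forall>\<xi> \<in> \<Xi>'. \<sigma> (F2 k \<xi>) = F2 k (f \<xi>)" by blast
  qed
  obtain F3 where F3P: "\<forall>k \<eta>. F3 k \<eta> \<in> P" and em: "EM d A4 F2 F3" and ind3: "ind_on UNIV d A4 F3"
    and eq: "\<forall>k \<in> {..2}. \<forall>\<xi>. length \<xi> = d \<longrightarrow> F3 k \<xi> = F2 k \<xi>"
    using extraction[OF A4(1,2), of F2, OF F2P ind2] by (elim exE conjE)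
  define y2 where "y2 = F3 3 (replicate d 0)"
  have y2P: "y2 \<in> P" unfolding y2_def using F3P by simp
  have const: "F3 3 \<xi> = y2" if "length \<xi> = d" for \<xi>
    unfolding y2_def by (rule EM_eq[OF em]) (use that in \<open>auto simp: F2_def\<close>)
  have F3b: "F3 n \<xi> = F \<beta> (app d a (app d (w n) \<xi>))" if "n \<le> 2" "length \<xi> = d" for n \<xi>
    using eq that F1b unfolding F2_def by simp
  have lo: "\<not> E y2 (F3 0 \<xi>)" if len: "length \<xi> = d" for \<xi>
  proof -
    have "E (F3 3 \<xi>) (F3 0 \<xi>) = False"
    proof (rule EM_E[OF em len len])
      fix \<zeta> \<zeta>' :: "rat list"
      have "app d (w 0) \<zeta>' ! M \<le> 0" using w0(2)[of "\<zeta>' ! M"] Md by simp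
      then show "E (F2 3 \<zeta>) (F2 0 \<zeta>') = False" using y1F unfolding F2_def by simp
    qed
    then show ?thesis using const[OF len] by simp
  qed
  have hi: "E y2 (F3 2 \<xi>)" if len: "length \<xi> = d" for \<xi>
  proof -
    have "E (F3 3 \<xi>) (F3 2 \<xi>) = True"
    proof (rule EM_E[OF em len len])
      fix \<zeta> \<zeta>' :: "rat list"
      have "1 \<le> app d (w 2) \<zeta>' ! M" using w2(1)[of "\<zeta>' ! M"] Md by simp
      then show "E (F2 3 \<zeta>) (F2 2 \<zeta>') = True" using y1T unfolding F2_def by simp
    qed
    then show ?thesis using const[OF len] by simp
  qed
  define \<epsilon> where "\<epsilon> = E y2 (F3 1 (replicate d 0))"
  have mid: "E y2 (F3 1 \<xi>) = \<epsilon>" if len: "length \<xi> = d" for \<xi>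
  proof -
    have "\<exists>\<tau> \<in> Au A4. \<forall>k \<in> UNIV. \<forall>x \<in> {()}. \<tau> (F3 k (replicate d 0)) = F3 k \<xi>"
      by (rule ind_family[OF ind3]) (use len in auto)
    then obtain \<tau> where \<tau>: "\<tau> \<in> Au A4" "\<And>k. \<tau> (F3 k (replicate d 0)) = F3 k \<xi>" by blast
    have "E (\<tau> y2) (\<tau> (F3 1 (replicate d 0))) = \<epsilon>"
      unfolding \<epsilon>_def using Au_E[OF \<tau>(1) y2P] F3P by blast
    moreover have "\<tau> y2 = y2" using \<tau>(2)[of 3] const[OF len] unfolding y2_def by simp
    ultimately show ?thesis using \<tau>(2) by simp
  qed
  have val2: "val y2 x" if x: "x \<in> set bs" for x
    unfolding y2_def
    by (rule EM_one[OF em, where Y="\<lambda>p. val p x", OF val_dfn[OF A4(2,3) x]]) (use y1val[OF x] in \<open>auto simp: F2_def\<close>)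
  have Dd2: "Dd H (\<xi>S s) (\<lambda>i r. a i (fS s c i r)) y2 s \<longleftrightarrow> c" for s c
  proof -
    have "dfn A4 (\<lambda>g :: unit \<Rightarrow> 'a. Dd H (\<xi>S s) (\<lambda>i r. a i (fS s c i r)) (g ()) s \<longleftrightarrow> c)"
      by (intro dfn_iff dfn_const Dd_dfn A4(2,4) H BI)
    moreover have "Dd H (\<xi>S s) (\<lambda>i r. a i (fS s c i r)) y1 s \<longleftrightarrow> c"
      using DdTR DdTL \<xi>R(2) \<xi>L(2) unfolding fS_def \<xi>S_def by (cases s; cases c) simp_all
    ultimately show ?thesis
      unfolding y2_def
      by (intro EM_one[OF em, where Y="\<lambda>p. Dd H (\<xi>S s) (\<lambda>i r. a i (fS s c i r)) p s \<longleftrightarrow> c"]) (auto simp: F2_def)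
  qed
  have upd: "app d ((w n)(M := w n' M)) \<zeta> = app d (w n') \<zeta>" for n n' \<zeta>
    by (rule nth_equalityI) (use less_d_cases in \<open>auto simp: w_def\<close>)
  have fA: "w n i p < fS s c i q" if "i < M" for n s c i p q
    using wA[OF that, of n p] fSA[OF that, of s c q] by linarith
  have "\<exists>a' v' x. stage y2 a' v' (x # bs)"
  proof (cases \<epsilon>)
    case True
    show ?thesis
    proof (rule extend_stage[OF st y2P val2, where wu="w 0" and wv="w 1 M" and f="fS False" and s=False and \<xi>="\<xi>S False"])
      show "w 0 M p < w 1 M q" for p q by (rule wlt) simp_all
      show "\<not> E y2 (F \<beta> (app d a (app d (w 0) \<xi>))) \<and> E y2 (F \<beta> (app d a (app d ((w 0)(M := w 1 M)) \<xi>)))"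
        if "length \<xi> = d" for \<xi>
        using lo[OF that] mid[OF that] True F3b[OF _ that, of 0] F3b[OF _ that, of 1] unfolding upd by simp
      show "if False then fS False c M q < w 0 M p else w 1 M p < fS False c M q" for c p q
        using w1(2)[of p] fSR(1)[of c q] by simp
      show "\<xi>S False \<in> \<Xi>" using \<xi>R(1) unfolding \<xi>S_def by simp
    qed (use wm fSm fA Dd2 in simp_all)
  next
    case False
    show ?thesis
    proof (rule extend_stage[OF st y2P val2, where wu="w 1" and wv="w 2 M" and f="fS True" and s=True and \<xi>="\<xi>S True"])
      show "w 1 M p < w 2 M q" for p q by (rule wlt) simp_all
      show "\<not> E y2 (F \<beta> (app d a (app d (w 1) \<xi>))) \<and> E y2 (F \<beta> (app d a (app d ((w 1)(M := w 2 M)) \<xi>)))"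
        if "length \<xi> = d" for \<xi>
        using hi[OF that] mid[OF that] False F3b[OF _ that, of 1] F3b[OF _ that, of 2] unfolding upd by simp
      show "if True then fS True c M q < w 1 M p else w 2 M p < fS True c M q" for c p q
        using w1(1)[of p] fSL(1)[of c q] by simp
      show "\<xi>S True \<in> \<Xi>" using \<xi>L(1) unfolding \<xi>S_def by simp
    qed (use wm fSm fA Dd2 in simp_all)
  qed
  then show ?thesis by blast
qed

lemma stage_all: "\<exists>y a v bs. stage y a v bs \<and> length bs = n"
proof (induction n)
  case 0
  \<comment> \<open>The start is a point of the main base sequence, with one line to its left and
    one to its right.\<close>
  define a where "a i r = (if i = M then - 2 + hs r else r)" for i r
  define v where "v r = 2 + hs r" for r
  have b: "- 1 < hs r" "hs r < 1" for r by (rule hs_bounds)+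
  have neg: "a M p < 0" "0 < v p" for p using b[of p] unfolding a_def v_def by simp_all
  then have av: "a M p < v q" for p q using less_trans by blast
  have mono: "strict_mono (a i)" "strict_mono v" for i
    unfolding a_def v_def by (auto simp: strict_mono_def)
  have "stage (gg M 0) a v []"
    unfolding stage_def lines_def
  proof (intro conjI allI impI)
    fix \<xi> :: "rat list" assume "length \<xi> = d"
    show "\<not> E (gg M 0) (F \<beta> (app d a \<xi>))"
      using leafD[OF Md, of "app d a \<xi>" 0] neg(1)[of "\<xi> ! M"] Md by (simp add: less_imp_neq less_not_sym)
    show "E (gg M 0) (F \<beta> (app d (a(M := v)) \<xi>))"
      using leafD[OF Md, of "app d (a(M := v)) \<xi>" 0] neg(2)[of "\<xi> ! M"] Md by (simp add: less_imp_neq)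
  qed (use gg_P mono av in auto)
  then show ?case by auto
next
  case (Suc n)
  then obtain y a v bs where "stage y a v bs" "length bs = n" by blast
  then show ?case using stage_step[of y a v bs] by fastforce
qed

end

section \<open>Splitting a leaf\<close>

context obstruction
begin

text \<open>Records of the same side are ordered in the same way whichever of their two blocks is
  taken. For any \<open>I\<close>, the choice of the block \<open>True\<close> exactly for the
  members of \<open>I\<close> is therefore conjugate to one standard arrangement, and the image of
  \<open>y\<close> picks out \<open>I\<close> by the obstructed formula.\<close>

lemma no_obstruction: False
proof -
  \<comment> \<open>This is \<open>Dd\<close> with the block points as variables, so that
    \<open>Z\<close> contains all its parameters and one formula serves for all copies.\<close>
  define Q where "Q x g \<longleftrightarrow> (\<exists>c \<in> P. Th c \<and>
     (\<forall>i<d. \<forall>t \<in> H. t \<noteq> snd x ! i \<longrightarrow> (E (g (Inl (i, t))) c \<longleftrightarrow> t < snd x ! i)) \<and> (E (g (Inr ())) c \<longleftrightarrow> fst x))"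
    for x :: "bool \<times> rat list" and g :: "(nat \<times> rat) + unit \<Rightarrow> 'a"
  have dQ: "dfn Z (Q x)" for x
  proof -
    have "dfn Z (\<lambda>g :: unit + ((nat \<times> rat) + unit) \<Rightarrow> 'a. (\<forall>w \<in> Z. E w (g (Inl ())) = E w bz) \<and>
      (\<forall>i \<in> {..<d}. \<forall>t \<in> H. t \<noteq> snd x ! i \<longrightarrow> (E (g (Inr (Inl (i, t)))) (g (Inl ())) \<longleftrightarrow> t < snd x ! i)) \<and>
      (E (g (Inr (Inr ()))) (g (Inl ())) \<longleftrightarrow> fst x))"
      by (intro dfn_conj dfn_ball dfn_imp dfn_iff dfn_const dfn_E_labels dfn_E_left) (use Z H in auto)
    from dfn_Ex[OF this] show ?thesis
    proof (rule dfn_cong)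
      fix f :: "(nat \<times> rat) + unit \<Rightarrow> 'a" assume "range f \<subseteq> P"
      have "(\<exists>g :: unit \<Rightarrow> 'a. range g \<subseteq> P \<and> R (g ())) \<longleftrightarrow> (\<exists>c \<in> P. R c)" for R
      proof
        assume "\<exists>c \<in> P. R c"
        then obtain c where "c \<in> P" "R c" by blast
        then show "\<exists>g :: unit \<Rightarrow> 'a. range g \<subseteq> P \<and> R (g ())" by (intro exI[of _ "\<lambda>_. c"]) auto
      qed auto
      then show "(\<exists>g :: unit \<Rightarrow> 'a. range g \<subseteq> P \<and>
          (\<forall>w \<in> Z. E w (case_sum g f (Inl ())) = E w bz) \<and>
          (\<forall>i \<in> {..<d}. \<forall>t \<in> H. t \<noteq> snd x ! i \<longrightarrow>
             (E (case_sum g f (Inr (Inl (i, t)))) (case_sum g f (Inl ())) \<longleftrightarrow> t < snd x ! i)) \<and>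
          (E (case_sum g f (Inr (Inr ()))) (case_sum g f (Inl ())) \<longleftrightarrow> fst x)) \<longleftrightarrow> Q x f"
        unfolding Q_def Th_def sum.case lessThan_iff Ball_def[of "{..<d}"] by simp
    qed
  qed
  have "\<exists>m :: nat. \<not> (\<exists>w y. (\<forall>i. range (w i) \<subseteq> P) \<and> (\<forall>I. range (y I) \<subseteq> P) \<and>
    (\<forall>I \<subseteq> {..<m}. \<forall>i<m. Q x (case_sum (w i) (y I)) \<longleftrightarrow> i \<in> I))" for x
    by (rule finite_shattering_bound[OF countable_finite[OF Z(1)] Z(2) dQ])
  then obtain m :: "bool \<times> rat list \<Rightarrow> nat" where m: "\<And>x. \<not> (\<exists>w y. (\<forall>i. range (w i) \<subseteq> P) \<and> (\<forall>I. range (y I) \<subseteq> P) \<and>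
    (\<forall>I \<subseteq> {..<m x}. \<forall>i<m x. Q x (case_sum (w i) (y I)) \<longleftrightarrow> i \<in> I))" by metis
  define C where "C = (UNIV :: bool set) \<times> \<Xi>"
  have C: "finite C" unfolding C_def using \<Xi>(1) by simp
  obtain p where "p \<in> P" using P_nonempty by blast
  then have "C \<noteq> {}" using obs[of p] unfolding C_def by blast
  \<comment> \<open>With this many records, some combination \<open>x\<close> of side and position
    occurs at least \<open>m x\<close> times.\<close>
  obtain y a v bs where st: "stage y a v bs" and len: "length bs = (\<Sum>x\<in>C. m x)" using stage_all by blast
  have y: "y \<in> P" and so: "sorted_wrt rel bs" and bs: "\<And>x. x \<in> set bs \<Longrightarrow> pos a v x \<and> val y x"
    using st unfolding stage_def by blast+
  define cl where "cl b = (sd b, xi b)" for b :: block_record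
  have "set (map cl bs) \<subseteq> C" using bs unfolding val_def C_def cl_def by auto
  then have cnt: "(\<Sum>x\<in>C. count_list (map cl bs) x) = (\<Sum>x\<in>C. m x)"
    using sum_count_set[OF _ C] len by (metis length_map)
  have "\<exists>x \<in> C. m x \<le> count_list (map cl bs) x"
  proof (rule ccontr)
    assume "\<not> ?thesis"
    then have "(\<Sum>x\<in>C. count_list (map cl bs) x) < (\<Sum>x\<in>C. m x)"
      using C \<open>C \<noteq> {}\<close> by (intro sum_strict_mono) auto
    then show False using cnt by simp
  qed
  then obtain x where x: "m x \<le> count_list (map cl bs) x" by blast
  define xs where "xs = filter (\<lambda>b. cl b = x) bs"
  have "count_list (map cl bs) x = length xs"
    unfolding xs_def by (induction bs) auto
  then have lxs: "m x \<le> length xs" using x by simp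
  have sxs: "sorted_wrt rel xs" unfolding xs_def using so by (rule sorted_wrt_filter)
  have xs: "pos a v (xs ! j)" "val y (xs ! j)" "sd (xs ! j) = fst x" "xi (xs ! j) = snd x" if "j < m x" for j
  proof -
    have "xs ! j \<in> set xs" using that lxs by simp
    then have "xs ! j \<in> set bs" "cl (xs ! j) = x" unfolding xs_def by auto
    then show "pos a v (xs ! j)" "val y (xs ! j)" "sd (xs ! j) = fst x" "xi (xs ! j) = snd x"
      using bs unfolding cl_def by auto
  qed
  \<comment> \<open>Steps of 3 separate the copies, each of width less than 2. For side
    \<open>True\<close> the main coordinate is reversed, because there newer records, which come
    first in the list, lie further right.\<close>
  define std where "std j i t = (if i = M \<and> fst x then - (3 * of_nat j) + hs t else 3 * of_nat j + hs t)" for j i :: nat and t :: rat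
  have gap: "3 * of_nat j + hs t < 3 * of_nat j' + hs t'" "- (3 * of_nat j') + hs t' < - (3 * of_nat j) + hs t"
    if "j < j'" for j j' :: nat and t t'
    using less_of_nat_rat[OF that] hs_bounds[of t] hs_bounds[of t'] by linarith+
  have shift: "\<exists>\<sigma> \<in> Au Z. \<forall>i<d. \<forall>j<m x. \<forall>t. \<sigma> (gg i (bl (xs ! j) (j \<in> I) i t)) = gg i (std j i t)" for I :: "nat set"
  proof -
    let ?l = "\<lambda>z. map (\<lambda>i. bl (xs ! fst z) (fst z \<in> I) i (snd z)) [0..<d]"
    let ?l' = "\<lambda>z. map (\<lambda>i. std (fst z) i (snd z)) [0..<d]"
    have less: "?l z ! i < ?l z' ! i \<longleftrightarrow> ?l' z ! i < ?l' z' ! i" "?l z' ! i < ?l z ! i \<longleftrightarrow> ?l' z' ! i < ?l' z ! i"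
      if z: "fst z < m x" "fst z' < m x" and lt: "fst z < fst z'" and i: "i < d" for z z' :: "nat \<times> rat" and i
    proof -
      let ?j = "fst z" and ?j' = "fst z'"
      have r: "rel (xs ! ?j) (xs ! ?j')"
        using sorted_wrt_nth_less[OF sxs lt] z(2) lxs by simp
      show "?l z ! i < ?l z' ! i \<longleftrightarrow> ?l' z ! i < ?l' z' ! i" "?l z' ! i < ?l z ! i \<longleftrightarrow> ?l' z' ! i < ?l' z ! i"
      proof (atomize (full), cases "i = M \<and> fst x")
        case True
        then have "bl (xs ! ?j') (?j' \<in> I) i (snd z') < bl (xs ! ?j) (?j \<in> I) i (snd z)"
          using r xs(3)[OF z(1)] xs(3)[OF z(2)] unfolding rel_def by auto
        moreover have "std ?j' i (snd z') < std ?j i (snd z)" using gap(2)[OF lt] True unfolding std_def by simp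
        ultimately show "(?l z ! i < ?l z' ! i \<longleftrightarrow> ?l' z ! i < ?l' z' ! i) \<and> (?l z' ! i < ?l z ! i \<longleftrightarrow> ?l' z' ! i < ?l' z ! i)"
          using i by (simp add: less_not_sym)
      next
        case False
        then have "bl (xs ! ?j) (?j \<in> I) i (snd z) < bl (xs ! ?j') (?j' \<in> I) i (snd z')"
          using r xs(3)[OF z(1)] xs(3)[OF z(2)] less_d_cases[OF i] unfolding rel_def by auto
        moreover have "std ?j i (snd z) < std ?j' i (snd z')" using gap(1)[OF lt] unfolding std_def if_not_P[OF False] by simp
        ultimately show "(?l z ! i < ?l z' ! i \<longleftrightarrow> ?l' z ! i < ?l' z' ! i) \<and> (?l z' ! i < ?l z ! i \<longleftrightarrow> ?l' z' ! i < ?l' z ! i)"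
          using i by (simp add: less_not_sym)
      qed
    qed
    have "\<exists>\<sigma> \<in> Au Z. \<forall>k \<in> UNIV. \<forall>z \<in> {z :: nat \<times> rat. fst z < m x}. \<sigma> (F k (?l z)) = F k (?l' z)"
    proof (rule ind_family[OF ind])
      fix z z' :: "nat \<times> rat" and i
      assume z: "z \<in> {z. fst z < m x}" "z' \<in> {z. fst z < m x}" and i: "i < d"
      consider "fst z < fst z'" | "fst z' < fst z" | "fst z = fst z'" by linarith
      then show "?l z ! i < ?l z' ! i \<longleftrightarrow> ?l' z ! i < ?l' z' ! i"
      proof cases
        case 1
        show ?thesis by (rule less(1)[OF _ _ 1 i]) (use z in auto)
      next
        case 2
        show ?thesis by (rule less(2)[OF _ _ 2 i]) (use z in auto)
      next
        case 3
        have "strict_mono (bl (xs ! fst z) (fst z \<in> I) i)" using xs(1)[of "fst z"] z i unfolding pos_def by blast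
        then have "bl (xs ! fst z) (fst z \<in> I) i p < bl (xs ! fst z) (fst z \<in> I) i q \<longleftrightarrow> p < q" for p q
          by (rule strict_mono_less)
        moreover have "std j i p < std j i q \<longleftrightarrow> p < q" for j p q
          unfolding std_def by (cases "i = M \<and> fst x") auto
        ultimately show ?thesis using 3 i by simp
      qed
    qed simp
    then obtain \<sigma> where \<sigma>: "\<sigma> \<in> Au Z" "\<And>k z. fst z < m x \<Longrightarrow> \<sigma> (F k (?l z)) = F k (?l' z)" by auto
    have "\<sigma> (gg i (bl (xs ! j) (j \<in> I) i t)) = gg i (std j i t)" if "i < d" "j < m x" for i j t
      using \<sigma>(2)[of "(j, t)" i] gg_eq[OF that(1), of "?l (j, t)"] gg_eq[OF that(1), of "?l' (j, t)"] that by simp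
    then show ?thesis using \<sigma>(1) by blast
  qed
  have "\<exists>z \<in> P. \<forall>j<m x. Dd H (snd x) (std j) z (fst x) \<longleftrightarrow> j \<in> I" for I
  proof -
    obtain \<sigma> where \<sigma>: "\<sigma> \<in> Au Z" "\<forall>i<d. \<forall>j<m x. \<forall>t. \<sigma> (gg i (bl (xs ! j) (j \<in> I) i t)) = gg i (std j i t)"
      using shift by blast
    have "Dd H (snd x) (std j) (\<sigma> y) (fst x) \<longleftrightarrow> j \<in> I" if j: "j < m x" for j
    proof -
      have "Dd H (snd x) (std j) (\<sigma> y) (fst x) \<longleftrightarrow> Dd H (snd x) (bl (xs ! j) (j \<in> I)) y (fst x)"
        by (rule Dd_move[OF \<sigma>(1) _ y]) (use \<sigma>(2) j in simp)
      also have "\<dots> \<longleftrightarrow> j \<in> I" using xs(2,3,4)[OF j] unfolding val_def by simp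
      finally show ?thesis .
    qed
    then show ?thesis using Au_P[OF \<sigma>(1) y] by blast
  qed
  then obtain z where z: "\<And>I. z I \<in> P" "\<And>I j. j < m x \<Longrightarrow> Dd H (snd x) (std j) (z I) (fst x) \<longleftrightarrow> j \<in> I" by metis
  have "Q x (case_sum (\<lambda>l. gg (fst l) (std j (fst l) (snd l))) (\<lambda>_. z I)) \<longleftrightarrow> Dd H (snd x) (std j) (z I) (fst x)" for j I
    unfolding Q_def Dd_def by simp
  then have "\<exists>w y. (\<forall>i. range (w i) \<subseteq> P) \<and> (\<forall>I. range (y I) \<subseteq> P) \<and>
    (\<forall>I \<subseteq> {..<m x}. \<forall>i<m x. Q x (case_sum (w i) (y I)) \<longleftrightarrow> i \<in> I)"
    using z gg_P
    by (intro exI[of _ "\<lambda>j l. gg (fst l) (std j (fst l) (snd l))"] exI[of _ "\<lambda>I _. z I"] conjI allI impI image_subsetI)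
      simp_all
  then show False using m[of x] by (rule notE[rotated])
qed

end

section \<open>Two new leaves of opposite sign\<close>

context array_state
begin

text \<open>Without obstructions, finitely many positions and base points always admit a
  \<open>z\<close> with cuts of both signs. Compactness treats all positions together, and
  extraction makes the two families of cuts indiscernible along with the old kinds.\<close>

lemma leaf_pair:
  "\<exists>z F'. z \<in> P \<and> (\<forall>k \<eta>. F' k \<eta> \<in> P) \<and> ind_on UNIV d (insert z Z) F' \<and>
    (\<forall>k<K. \<forall>\<xi>. length \<xi> = d \<longrightarrow> F' k \<xi> = F k \<xi>) \<and> base_dep d F' \<and> leaf d F' K \<and> leaf d F' (Suc K) \<and>
    (\<forall>w \<in> Z. \<forall>\<xi>. length \<xi> = d \<longrightarrow> E w (F' K \<xi>) = E w bz \<and> E w (F' (Suc K) \<xi>) = E w bz) \<and>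
    (\<forall>\<xi>. length \<xi> = d \<longrightarrow> \<not> E z (F' K \<xi>) \<and> E z (F' (Suc K) \<xi>))"
proof -
  have free: "\<exists>z \<in> P. \<forall>\<xi> \<in> \<Xi>. \<forall>s. Dd H \<xi> (\<lambda>i t. t) z s"
    if "finite \<Xi>" "\<And>\<xi>. \<xi> \<in> \<Xi> \<Longrightarrow> length \<xi> = d" "finite H" for \<Xi> H
  proof (rule ccontr)
    assume "\<not> ?thesis"
    then interpret obstruction P D E d K \<beta> Z F \<Xi> H
      by unfold_locales (use that in auto)
    show False by (rule no_obstruction)
  qed
  define I where "I = {x :: bool \<times> rat list \<times> nat \<times> rat. length (fst (snd x)) = d \<and> fst (snd (snd x)) < d}"
  define R where "R x g \<longleftrightarrow> (\<forall>w \<in> Z. E w (g (Inr (fst x, fst (snd x)))) = E w bz) \<and>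
     (snd (snd (snd x)) \<noteq> fst (snd x) ! fst (snd (snd x)) \<longrightarrow>
       (E (gg (fst (snd (snd x))) (snd (snd (snd x)))) (g (Inr (fst x, fst (snd x)))) \<longleftrightarrow> snd (snd (snd x)) < fst (snd x) ! fst (snd (snd x)))) \<and>
     (E (g (Inl ())) (g (Inr (fst x, fst (snd x)))) \<longleftrightarrow> fst x)"
    for x :: "bool \<times> rat list \<times> nat \<times> rat" and g :: "unit + (bool \<times> rat list) \<Rightarrow> 'p"
  define A where "A = Z \<union> range (case_prod gg)"
  have A: "countable A" "A \<subseteq> P" unfolding A_def using Z gg_P by (auto intro: countable_finite)
  have "\<exists>g. range g \<subseteq> P \<and> (\<forall>x \<in> I. R x g)"
  proof (rule compactness_indexed[OF A])
    fix x :: "bool \<times> rat list \<times> nat \<times> rat"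
    have "gg (fst (snd (snd x))) (snd (snd (snd x))) \<in> A"
      using rangeI[of "case_prod gg" "(fst (snd (snd x)), snd (snd (snd x)))"] unfolding A_def prod.case by blast
    moreover have "w \<in> A" "w \<in> P" if "w \<in> Z" for w using that Z unfolding A_def by auto
    ultimately show "dfn A (R x)" unfolding R_def
      by (intro dfn_conj dfn_ball dfn_imp dfn_iff dfn_const dfn_E_labels dfn_E_left) (use Z gg_P in auto)
  next
    fix J assume J: "J \<subseteq> I" "finite J"
    define \<Xi> where "\<Xi> = (\<lambda>x. fst (snd x)) ` J"
    define H where "H = (\<lambda>x. snd (snd (snd x))) ` J"
    obtain z where z: "z \<in> P" "\<forall>\<xi> \<in> \<Xi>. \<forall>s. Dd H \<xi> (\<lambda>i t. t) z s"
      using free[of \<Xi> H] J unfolding \<Xi>_def H_def I_def by auto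
    have "\<forall>s. \<forall>\<xi>. \<exists>c \<in> P. \<xi> \<in> \<Xi> \<longrightarrow> Th c \<and>
       (\<forall>i<d. \<forall>t \<in> H. t \<noteq> \<xi> ! i \<longrightarrow> (E (gg i t) c \<longleftrightarrow> t < \<xi> ! i)) \<and> (E z c \<longleftrightarrow> s)"
      using z P_nonempty unfolding Dd_def by (metis ex_in_conv)
    then obtain c where c: "\<And>s \<xi>. c s \<xi> \<in> P" "\<And>s \<xi>. \<xi> \<in> \<Xi> \<Longrightarrow> Th (c s \<xi>) \<and>
       (\<forall>i<d. \<forall>t \<in> H. t \<noteq> \<xi> ! i \<longrightarrow> (E (gg i t) (c s \<xi>) \<longleftrightarrow> t < \<xi> ! i)) \<and> (E z (c s \<xi>) \<longleftrightarrow> s)"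
      by metis
    define g where "g l = (case l of Inl _ \<Rightarrow> z | Inr (s, \<xi>) \<Rightarrow> c s \<xi>)" for l :: "unit + (bool \<times> rat list)"
    have "range g \<subseteq> P" using z c(1) by (auto simp: g_def split: sum.splits)
    moreover have "R x g" if x: "x \<in> J" for x
    proof -
      have "fst (snd x) \<in> \<Xi>" "snd (snd (snd x)) \<in> H" "fst (snd (snd x)) < d"
        using x J(1) unfolding \<Xi>_def H_def I_def by auto
      then show ?thesis using c(2)[of "fst (snd x)" "fst x"] unfolding R_def g_def Th_def by simp
    qed
    ultimately show "\<exists>g. range g \<subseteq> P \<and> (\<forall>x \<in> J. R x g)" by blast
  qed
  then obtain g where g: "range g \<subseteq> P" "\<forall>x \<in> I. R x g" by blast
  have gR: "(\<forall>w \<in> Z. E w (g (Inr (s, \<xi>))) = E w bz) \<and> (r \<noteq> \<xi> ! i \<longrightarrow> (E (gg i r) (g (Inr (s, \<xi>))) \<longleftrightarrow> r < \<xi> ! i)) \<and>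
      (E (g (Inl ())) (g (Inr (s, \<xi>))) \<longleftrightarrow> s)" if "length \<xi> = d" "i < d" for s \<xi> i r
  proof -
    have "(s, \<xi>, i, r) \<in> I" using that unfolding I_def by simp
    then have "R (s, \<xi>, i, r) g" using g(2) by blast
    then show ?thesis unfolding R_def by simp
  qed
  \<comment> \<open>Kinds \<open>K\<close> and \<open>Suc K\<close> are the new leaves, all later
    kinds hold the single point. A constant kind stays constant under extraction, and an
    automorphism that shifts the array fixes its value; this is how indiscernibility over
    \<open>insert z Z\<close> arises.\<close>
  define F0 where "F0 k \<xi> = (if k < K then F k \<xi> else if k = K then g (Inr (False, \<xi>)) else
     if k = Suc K then g (Inr (True, \<xi>)) else g (Inl ()))" for k \<xi>
  have F0P: "F0 k \<xi> \<in> P" for k \<xi> unfolding F0_def using F g(1) by auto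
  have ind0: "ind_on {..<K} d Z F0"
    unfolding ind_on_def
  proof (intro allI impI)
    fix \<Xi> f assume f: "cmono d \<Xi> f"
    show "\<exists>\<sigma> \<in> Au Z. \<forall>k \<in> {..<K}. \<forall>\<xi> \<in> \<Xi>. \<sigma> (F0 k \<xi>) = F0 k (f \<xi>)"
      using ind[unfolded ind_on_def, rule_format, OF f] unfolding F0_def by auto
  qed
  have Zc: "countable Z" using Z(1) by (rule countable_finite)
  obtain F' where F'P: "\<forall>k \<eta>. F' k \<eta> \<in> P" and em: "EM d Z F0 F'" and ind': "ind_on UNIV d Z F'"
    and eq: "\<forall>k \<in> {..<K}. \<forall>\<xi>. length \<xi> = d \<longrightarrow> F' k \<xi> = F0 k \<xi>"
    using extraction[OF Zc Z(2), of F0, OF F0P ind0] by (elim exE conjE)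
  have base0: "base_dep d F0"
    unfolding base_dep_def
  proof (intro allI impI)
    fix i and \<eta> \<eta>' :: "rat list" assume *: "i < d" "length \<eta> = d" "length \<eta>' = d" "\<eta> ! i = \<eta>' ! i"
    then show "F0 i \<eta> = F0 i \<eta>'" using gg_eq[of i \<eta>] gg_eq[of i \<eta>'] dK unfolding F0_def by simp
  qed
  have leaf0: "leaf d F0 K" "leaf d F0 (Suc K)"
    unfolding leaf_def
  proof (atomize (full), intro allI impI conjI)
    fix i and \<eta> \<xi> :: "rat list" assume *: "i < d" "length \<eta> = d" "length \<xi> = d" "\<eta> ! i \<noteq> \<xi> ! i"
    have i: "F0 i \<eta> = gg i (\<eta> ! i)" using gg_eq[OF *(1,2)] *(1) dK unfolding F0_def by simp
    show "E (F0 i \<eta>) (F0 K \<xi>) \<longleftrightarrow> \<eta> ! i < \<xi> ! i"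
      unfolding i using gR[OF *(3,1), of False "\<eta> ! i"] *(4) unfolding F0_def by simp
    show "E (F0 i \<eta>) (F0 (Suc K) \<xi>) \<longleftrightarrow> \<eta> ! i < \<xi> ! i"
      unfolding i using gR[OF *(3,1), of True "\<eta> ! i"] *(4) unfolding F0_def by simp
  qed
  define z where "z = F' (K + 2) (replicate d 0)"
  have zc: "F' (K + 2) \<xi> = z" if "length \<xi> = d" for \<xi>
    unfolding z_def by (rule EM_eq[OF em]) (use that in \<open>auto simp: F0_def\<close>)
  have d0: "0 < d" using d1 by simp
  have signs: "E w (F' K \<xi>) = E w bz \<and> E w (F' (Suc K) \<xi>) = E w bz" if w: "w \<in> Z" and len: "length \<xi> = d" for w \<xi>
  proof -
    have wP: "w \<in> P" using w Z(2) by blast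
    have "E w (F' K \<xi>) = E w bz"
      by (rule EM_E_param[OF em len w wP]) (use gR[OF _ d0] w in \<open>simp add: F0_def\<close>)
    moreover have "E w (F' (Suc K) \<xi>) = E w bz"
      by (rule EM_E_param[OF em len w wP]) (use gR[OF _ d0] w in \<open>simp add: F0_def\<close>)
    ultimately show ?thesis by blast
  qed
  have Ez: "E (g (Inl ())) (g (Inr (s, \<xi>))) \<longleftrightarrow> s" if "length \<xi> = d" for s \<xi> using gR[OF that d0] by blast
  have zs: "\<not> E z (F' K \<xi>) \<and> E z (F' (Suc K) \<xi>)" if len: "length \<xi> = d" for \<xi>
  proof -
    have "E (F' (K + 2) \<xi>) (F' K \<xi>) = False"
      by (rule EM_E[OF em len len], drule same2_length) (simp add: F0_def Ez)
    moreover have "E (F' (K + 2) \<xi>) (F' (Suc K) \<xi>) = True"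
      by (rule EM_E[OF em len len], drule same2_length) (simp add: F0_def Ez)
    ultimately show ?thesis using zc[OF len] by simp
  qed
  have "ind_on UNIV d (insert z Z) F'"
    unfolding ind_on_def
  proof (intro allI impI)
    fix \<Xi> f assume f: "cmono d \<Xi> f"
    show "\<exists>\<sigma> \<in> Au (insert z Z). \<forall>k \<in> UNIV. \<forall>\<xi> \<in> \<Xi>. \<sigma> (F' k \<xi>) = F' k (f \<xi>)"
    proof (cases "\<Xi> = {}")
      case True
      then show ?thesis using Au_id by blast
    next
      case False
      then obtain \<xi> where \<xi>: "\<xi> \<in> \<Xi>" by blast
      obtain \<sigma> where \<sigma>: "\<sigma> \<in> Au Z" "\<forall>k \<in> UNIV. \<forall>\<xi> \<in> \<Xi>. \<sigma> (F' k \<xi>) = F' k (f \<xi>)"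
        using ind'[unfolded ind_on_def, rule_format, OF f] by blast
      have "length \<xi> = d" "length (f \<xi>) = d" using f \<xi> unfolding cmono_def by auto
      then have "\<sigma> z = z" using \<sigma>(2)[rule_format, of "K + 2" \<xi>] \<xi> zc by simp
      then have "\<sigma> \<in> Au (Z \<union> {z})" by (intro Au_insertI[OF \<sigma>(1)]) simp
      then show ?thesis using \<sigma>(2) by (intro bexI[of _ \<sigma>]) simp_all
    qed
  qed
  moreover have "F' k \<xi> = F k \<xi>" if "k < K" "length \<xi> = d" for k \<xi> using eq that unfolding F0_def by simp
  moreover have "z \<in> P" unfolding z_def using F'P by simp
  ultimately show ?thesis
    using F'P EM_base_dep[OF em base0] EM_leaf[OF em leaf0(1)] EM_leaf[OF em leaf0(2)] signs zs
    by (intro exI[of _ z] exI[of _ F'] conjI allI impI ballI) simp_all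
qed

end

section \<open>Trees of leaves\<close>

text \<open>A complete binary tree of depth \<open>n\<close> with nodes from \<open>Z\<close>, each
  of whose branches is realised in \<open>L\<close>. The greatest possible depth is known as the
  Littlestone dimension.\<close>

fun full_tree :: "('z \<Rightarrow> 'h \<Rightarrow> bool) \<Rightarrow> nat \<Rightarrow> 'z set \<Rightarrow> 'h set \<Rightarrow> bool" where
  "full_tree S 0 Z L \<longleftrightarrow> L \<noteq> {}"
| "full_tree S (Suc n) Z L \<longleftrightarrow>
     (\<exists>z \<in> Z. full_tree S n Z {h \<in> L. \<not> S z h} \<and> full_tree S n Z {h \<in> L. S z h})"

lemma full_tree_mono:
  "full_tree S n Z L \<Longrightarrow> Z \<subseteq> Z' \<Longrightarrow> L \<subseteq> L' \<Longrightarrow> (\<And>z h. h \<in> L \<Longrightarrow> S z h = S' z h) \<Longrightarrow> full_tree S' n Z' L'"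
proof (induction n arbitrary: L L')
  case 0
  then show ?case by auto
next
  case (Suc n)
  then obtain z where z: "z \<in> Z" "full_tree S n Z {h \<in> L. \<not> S z h}" "full_tree S n Z {h \<in> L. S z h}" by auto
  have "full_tree S' n Z' {h \<in> L'. \<not> S' z h}"
    by (rule Suc.IH[OF z(2) Suc.prems(2)]) (use Suc.prems(3,4) in auto)
  moreover have "full_tree S' n Z' {h \<in> L'. S' z h}"
    by (rule Suc.IH[OF z(3) Suc.prems(2)]) (use Suc.prems(3,4) in auto)
  ultimately show ?case using z(1) Suc.prems(2) by auto
qed

lemma full_tree_nonempty: "full_tree S n Z L \<Longrightarrow> L \<noteq> {}"
proof (induction n arbitrary: L)
  case (Suc n)
  then obtain z where "full_tree S n Z {h \<in> L. S z h}" by auto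
  then have "{h \<in> L. S z h} \<noteq> {}" by (rule Suc.IH)
  then show ?case by blast
qed simp

text \<open>A Ramsey property for two classes of nodes. The class of the root decides whether
  \<open>a\<close> or \<open>b\<close> drops by one for the two subtrees; either one of them already
  has a tree of the other class, or both have one of the class of the root, and the root joins
  them.\<close>

lemma full_tree_split:
  "full_tree S (a + b) (Z1 \<union> Z2) L \<Longrightarrow> full_tree S a Z1 L \<or> full_tree S b Z2 L"
proof (induction "a + b" arbitrary: a b L)
  case 0
  then show ?case by simp
next
  case (Suc n)
  show ?case
  proof (cases a)
    case 0
    then show ?thesis using full_tree_nonempty[OF Suc.prems] by simp
  next
    case (Suc a')
    show ?thesis
    proof (cases b)
      case 0
      then show ?thesis using full_tree_nonempty[OF Suc.prems] by simp
    next
      case b: (Suc b')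
      have up: "full_tree S c Y L" if "full_tree S c Y {h \<in> L. R h}" for c Y R
        using that by (rule full_tree_mono) auto
      have ft: "full_tree S (Suc n) (Z1 \<union> Z2) L" using Suc.prems Suc.hyps(2) by simp
      then obtain z where z: "z \<in> Z1 \<union> Z2" "full_tree S n (Z1 \<union> Z2) {h \<in> L. \<not> S z h}" "full_tree S n (Z1 \<union> Z2) {h \<in> L. S z h}"
        by auto
      show ?thesis
      proof (cases "z \<in> Z1")
        case True
        have n: "n = a' + b" using Suc.hyps(2) Suc by simp
        have "full_tree S a' Z1 {h \<in> L. \<not> S z h} \<or> full_tree S b Z2 {h \<in> L. \<not> S z h}"
          "full_tree S a' Z1 {h \<in> L. S z h} \<or> full_tree S b Z2 {h \<in> L. S z h}"
          using Suc.hyps(1)[OF n] z(2,3) n by auto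
        then show ?thesis using up True Suc by auto
      next
        case False
        then have z2: "z \<in> Z2" using z(1) by simp
        have n: "n = a + b'" using Suc.hyps(2) b by simp
        have "full_tree S a Z1 {h \<in> L. \<not> S z h} \<or> full_tree S b' Z2 {h \<in> L. \<not> S z h}"
          "full_tree S a Z1 {h \<in> L. S z h} \<or> full_tree S b' Z2 {h \<in> L. S z h}"
          using Suc.hyps(1)[OF n] z(2,3) n by auto
        then show ?thesis using up z2 b by auto
      qed
    qed
  qed
qed

text \<open>Fix some \<open>h0\<close> in \<open>L\<close>. The nodes that give it one and the same
  sign still carry a deep tree; its root becomes \<open>z0\<close>, and the construction continues
  in the branch where \<open>z0\<close> has the opposite sign. Doubling \<open>Suc N\<close> pays
  for the two classes of nodes, the successor for the root.\<close>

lemma full_tree_ladder: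
  "\<exists>N. \<forall>S :: 'z \<Rightarrow> 'h \<Rightarrow> bool. \<forall>Z L. full_tree S N Z L \<longrightarrow> (\<exists>z h s. (\<forall>i<n. z i \<in> Z \<and> h i \<in> L) \<and>
     (\<forall>i j. i < j \<longrightarrow> j < (n :: nat) \<longrightarrow> S (z j) (h i) = s i \<and> S (z i) (h j) = (\<not> s i)))"
proof (induction n)
  case 0
  then show ?case by simp
next
  case (Suc n)
  then obtain N where N: "\<And>S :: 'z \<Rightarrow> 'h \<Rightarrow> bool. \<And>Z L. full_tree S N Z L \<Longrightarrow> \<exists>z h s. (\<forall>i<n. z i \<in> Z \<and> h i \<in> L) \<and>
     (\<forall>i j. i < j \<longrightarrow> j < n \<longrightarrow> S (z j) (h i) = s i \<and> S (z i) (h j) = (\<not> s i))" by blast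
  have "\<exists>z h s. (\<forall>i<Suc n. z i \<in> Z \<and> h i \<in> L) \<and>
     (\<forall>i j. i < j \<longrightarrow> j < Suc n \<longrightarrow> S (z j) (h i) = s i \<and> S (z i) (h j) = (\<not> s i))"
    if ft: "full_tree S (Suc N + Suc N) Z L" for S :: "'z \<Rightarrow> 'h \<Rightarrow> bool" and Z L
  proof -
    obtain h0 where h0: "h0 \<in> L" using full_tree_nonempty[OF ft] by blast
    have "Z = {z \<in> Z. S z h0} \<union> {z \<in> Z. \<not> S z h0}" by blast
    then have "full_tree S (Suc N) {z \<in> Z. S z h0} L \<or> full_tree S (Suc N) {z \<in> Z. \<not> S z h0} L"
      using full_tree_split[of S "Suc N" "Suc N"] ft by metis
    then have "\<exists>s0. full_tree S (Suc N) {z \<in> Z. S z h0 = s0} L"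
    proof
      assume "full_tree S (Suc N) {z \<in> Z. S z h0} L"
      then show ?thesis by (intro exI[of _ True]) simp
    next
      assume "full_tree S (Suc N) {z \<in> Z. \<not> S z h0} L"
      then show ?thesis by (intro exI[of _ False]) simp
    qed
    then obtain s0 where "full_tree S (Suc N) {z \<in> Z. S z h0 = s0} L" by (elim exE)
    then obtain z0 where z0: "z0 \<in> Z" "S z0 h0 = s0"
      and "full_tree S N {z \<in> Z. S z h0 = s0} {h \<in> L. \<not> S z0 h}" "full_tree S N {z \<in> Z. S z h0 = s0} {h \<in> L. S z0 h}"
      by auto
    then have "full_tree S N {z \<in> Z. S z h0 = s0} {h \<in> L. S z0 h = (\<not> s0)}" by (cases s0) auto
    from N[OF this] obtain z h s where zh: "\<forall>i<n. z i \<in> {z \<in> Z. S z h0 = s0} \<and> h i \<in> {h \<in> L. S z0 h = (\<not> s0)}"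
      and zhs: "\<forall>i j. i < j \<longrightarrow> j < n \<longrightarrow> S (z j) (h i) = s i \<and> S (z i) (h j) = (\<not> s i)" by blast
    show ?thesis
    proof (intro exI[of _ "case_nat z0 z"] exI[of _ "case_nat h0 h"] exI[of _ "case_nat s0 s"] conjI allI impI)
      fix i assume "i < Suc n"
      then show "case_nat z0 z i \<in> Z" "case_nat h0 h i \<in> L" using z0 h0 zh by (cases i; auto)+
    next
      fix i j assume ij: "i < j" "j < Suc n"
      then obtain j' where j: "j = Suc j'" "j' < n" by (cases j) auto
      show "S (case_nat z0 z j) (case_nat h0 h i) = case_nat s0 s i" "S (case_nat z0 z i) (case_nat h0 h j) = (\<not> case_nat s0 s i)"
        using ij j zh zhs by (cases i; simp)+
    qed
  qed
  then show ?case by blast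
qed

section \<open>Growing trees in an array, and the contradiction with the dimension\<close>

context tuple_geometry
begin

text \<open>After a split at \<open>z\<close>, trees are grown from the two new leaves one after the
  other. Agreement of all descendants with their starting leaf on the points present at that time
  keeps the two families on opposite sides of \<open>z\<close>, and keeps the signs of \<beta> on
  \<open>Z\<close>.\<close>

lemma tree_growth:
  assumes "array_state P D E d K \<beta> Z F"
  shows "\<exists>K' Z' F'. array_state P D E d K' \<beta> Z' F' \<and> K \<le> K' \<and> Z \<subseteq> Z' \<and>
    (\<forall>k<K. \<forall>\<xi>. length \<xi> = d \<longrightarrow> F' k \<xi> = F k \<xi>) \<and>
    full_tree (\<lambda>z k. E z (F' k (replicate d 0))) n Z'
      {h. h < K' \<and> leaf d F' h \<and> (\<forall>w \<in> Z. E w (F' h (replicate d 0)) = E w (F \<beta> (replicate d 0)))}"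
  using assms
proof (induction n arbitrary: K \<beta> Z F)
  case 0
  then interpret array_state P D E d K \<beta> Z F .
  have "\<beta> \<in> {h. h < K \<and> leaf d F h \<and> (\<forall>w \<in> Z. E w (F h (replicate d 0)) = E w (F \<beta> (replicate d 0)))}"
    using \<beta>K lf by simp
  then show ?case using "0.prems" by (intro exI[of _ K] exI[of _ Z] exI[of _ F]) auto
next
  case (Suc n)
  interpret S0: array_state P D E d K \<beta> Z F by (rule Suc.prems)
  let ?r = "replicate d (0 :: rat)"
  obtain z F1 where z: "z \<in> P" and F1P: "\<forall>k \<eta>. F1 k \<eta> \<in> P" and ind1: "ind_on UNIV d (insert z Z) F1"
    and F1F: "\<forall>k<K. \<forall>\<xi>. length \<xi> = d \<longrightarrow> F1 k \<xi> = F k \<xi>" and base1: "base_dep d F1"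
    and leaf1: "leaf d F1 K" "leaf d F1 (Suc K)"
    and sg: "\<forall>w \<in> Z. \<forall>\<xi>. length \<xi> = d \<longrightarrow> E w (F1 K \<xi>) = E w S0.bz \<and> E w (F1 (Suc K) \<xi>) = E w S0.bz"
    and sz: "\<forall>\<xi>. length \<xi> = d \<longrightarrow> \<not> E z (F1 K \<xi>) \<and> E z (F1 (Suc K) \<xi>)"
    using S0.leaf_pair by (elim exE conjE)
  have "array_state P D E d (K + 2) K (insert z Z) F1"
    by unfold_locales (use S0.nc S0.d1 S0.nogrid S0.dK S0.Z z F1P ind1 base1 leaf1 in auto)
  from Suc.IH[OF this] obtain K2 Z2 F2 where st2: "array_state P D E d K2 K Z2 F2"
    and K2: "K + 2 \<le> K2" and Z2: "insert z Z \<subseteq> Z2" and F2F: "\<forall>k<K+2. \<forall>\<xi>. length \<xi> = d \<longrightarrow> F2 k \<xi> = F1 k \<xi>"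
    and ft2: "full_tree (\<lambda>z k. E z (F2 k ?r)) n Z2
      {h. h < K2 \<and> leaf d F2 h \<and> (\<forall>w \<in> insert z Z. E w (F2 h ?r) = E w (F1 K ?r))}"
    by (elim exE conjE)
  interpret S2: array_state P D E d K2 K Z2 F2 by (rule st2)
  have leaf_eq: "leaf d G' h" if "leaf d G h" "h < k" "d \<le> k" "\<forall>j<k. \<forall>\<xi>. length \<xi> = d \<longrightarrow> G' j \<xi> = G j \<xi>" for G G' :: "nat \<Rightarrow> rat list \<Rightarrow> 'p" and h k
    using that unfolding leaf_def by auto
  have "leaf d F2 (Suc K)" by (rule leaf_eq[OF leaf1(2) _ _ F2F]) (use S0.dK in auto)
  then have "array_state P D E d K2 (Suc K) Z2 F2"
    by unfold_locales (use K2 S2.nc S2.d1 S2.nogrid S2.dK S2.Z S2.F S2.ind S2.base in auto)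
  from Suc.IH[OF this] obtain K3 Z3 F3 where st3: "array_state P D E d K3 (Suc K) Z3 F3"
    and K3: "K2 \<le> K3" and Z3: "Z2 \<subseteq> Z3" and F3F: "\<forall>k<K2. \<forall>\<xi>. length \<xi> = d \<longrightarrow> F3 k \<xi> = F2 k \<xi>"
    and ft3: "full_tree (\<lambda>z k. E z (F3 k ?r)) n Z3
      {h. h < K3 \<and> leaf d F3 h \<and> (\<forall>w \<in> Z2. E w (F3 h ?r) = E w (F2 (Suc K) ?r))}"
    by (elim exE conjE)
  interpret S3: array_state P D E d K3 "Suc K" Z3 F3 by (rule st3)
  let ?L = "{h. h < K3 \<and> leaf d F3 h \<and> (\<forall>w \<in> Z. E w (F3 h ?r) = E w (F \<beta> ?r))}"
  have bz: "S0.bz = F \<beta> ?r" by (rule S0.bz_def)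
  have left: "full_tree (\<lambda>z k. E z (F3 k ?r)) n Z3 {h \<in> ?L. \<not> E z (F3 h ?r)}"
  proof (rule full_tree_mono[OF ft2 Z3])
    show "{h. h < K2 \<and> leaf d F2 h \<and> (\<forall>w \<in> insert z Z. E w (F2 h ?r) = E w (F1 K ?r))} \<subseteq> {h \<in> ?L. \<not> E z (F3 h ?r)}"
    proof
      fix h assume "h \<in> {h. h < K2 \<and> leaf d F2 h \<and> (\<forall>w \<in> insert z Z. E w (F2 h ?r) = E w (F1 K ?r))}"
      then have h: "h < K2" "leaf d F2 h" "\<forall>w \<in> insert z Z. E w (F2 h ?r) = E w (F1 K ?r)" by auto
      have "F3 h ?r = F2 h ?r" using F3F h(1) by simp
      moreover have "leaf d F3 h" by (rule leaf_eq[OF h(2,1) S2.dK F3F])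
      ultimately show "h \<in> {h \<in> ?L. \<not> E z (F3 h ?r)}" using h K3 sg sz bz by auto
    qed
  qed (use F3F in auto)
  have right: "full_tree (\<lambda>z k. E z (F3 k ?r)) n Z3 {h \<in> ?L. E z (F3 h ?r)}"
  proof (rule full_tree_mono[OF ft3 order_refl])
    have "F2 (Suc K) ?r = F1 (Suc K) ?r" using F2F by simp
    then show "{h. h < K3 \<and> leaf d F3 h \<and> (\<forall>w \<in> Z2. E w (F3 h ?r) = E w (F2 (Suc K) ?r))} \<subseteq> {h \<in> ?L. E z (F3 h ?r)}"
      using Z2 sg sz bz by auto
  qed simp
  have F3F0: "\<forall>k<K. \<forall>\<xi>. length \<xi> = d \<longrightarrow> F3 k \<xi> = F k \<xi>" using F3F F2F F1F K2 by simp
  have "leaf d F3 \<beta>" by (rule leaf_eq[OF S0.lf S0.\<beta>K S0.dK F3F0])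
  then have "array_state P D E d K3 \<beta> Z3 F3"
    by unfold_locales (use S0.\<beta>K K2 K3 S3.nc S3.d1 S3.nogrid S3.dK S3.Z S3.F S3.ind S3.base in auto)
  moreover have "full_tree (\<lambda>z k. E z (F3 k ?r)) (Suc n) Z3 ?L"
    using left right Z2 Z3 by auto
  ultimately show ?case
    using K2 K3 Z2 Z3 F3F0 by (intro exI[of _ K3] exI[of _ Z3] exI[of _ F3]) auto
qed

theorem concl_holds: concl
proof (rule ccontr)
  assume nc: "\<not> concl"
  obtain d where d: "1 \<le> d" "\<forall>N. grid d N" "\<not> (\<forall>N. grid (Suc d) N)" using ex_dimension by blast
  obtain F0 where F0: "\<forall>k \<eta>. F0 k \<eta> \<in> P" "ind_on UNIV d {} F0" "base_dep d F0" "leaf d F0 d"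
    using initial_array[of d] d(2) by blast
  have st0: "array_state P D E d (Suc d) d {} F0"
    by unfold_locales (use nc d F0 in auto)
  let ?r = "replicate d (0 :: rat)"
  have "grid (Suc d) N" for N
  proof -
    \<comment> \<open>Half of a ladder of length \<open>2 * n\<close> has a common sign
      \<open>b\<close>. The indices chosen by parity below reach at most
      \<open>2 * N + 1\<close>.\<close>
    define n where "n = 2 * N + 2"
    have "\<exists>K F Z L. array_state P D E d K d Z F \<and> (\<forall>h \<in> L. h < K \<and> leaf d F h) \<and>
      (\<exists>z h s. (\<forall>i<n+n. z i \<in> Z \<and> h i \<in> L) \<and>
     (\<forall>i j. i < j \<longrightarrow> j < n+n \<longrightarrow> E (z j) (F (h i) ?r) = s i \<and> E (z i) (F (h j) ?r) = (\<not> s i)))"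
    proof -
      have ladder: "\<exists>N. \<forall>S :: 'p \<Rightarrow> nat \<Rightarrow> bool. \<forall>Z L. full_tree S N Z L \<longrightarrow> (\<exists>z h s. (\<forall>i<n+n. z i \<in> Z \<and> h i \<in> L) \<and>
        (\<forall>i j. i < j \<longrightarrow> j < n+n \<longrightarrow> S (z j) (h i) = s i \<and> S (z i) (h j) = (\<not> s i)))"
        by (rule full_tree_ladder)
      then obtain m where m: "\<And>S :: 'p \<Rightarrow> nat \<Rightarrow> bool. \<And>Z L. full_tree S m Z L \<Longrightarrow> \<exists>z h s. (\<forall>i<n+n. z i \<in> Z \<and> h i \<in> L) \<and>
        (\<forall>i j. i < j \<longrightarrow> j < n+n \<longrightarrow> S (z j) (h i) = s i \<and> S (z i) (h j) = (\<not> s i))" by blast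
      obtain K Z F where st: "array_state P D E d K d Z F" and ft: "full_tree (\<lambda>z k. E z (F k ?r)) m Z
        {h. h < K \<and> leaf d F h \<and> (\<forall>w \<in> {}. E w (F h ?r) = E w (F0 d ?r))}"
        using tree_growth[OF st0, of m] by (elim exE conjE)
      show ?thesis
        by (rule exI[of _ K], rule exI[of _ F], rule exI[of _ Z],
            rule exI[of _ "{h. h < K \<and> leaf d F h \<and> (\<forall>w \<in> {}. E w (F h ?r) = E w (F0 d ?r))}"])
          (use st m[OF ft] in simp)
    qed
    then obtain K F Z L z h s where st: "array_state P D E d K d Z F" and L: "\<forall>h \<in> L. h < K \<and> leaf d F h"
      and zh: "\<forall>i<n+n. z i \<in> Z \<and> h i \<in> L"
      and zhs: "\<forall>i j. i < j \<longrightarrow> j < n+n \<longrightarrow> E (z j) (F (h i) ?r) = s i \<and> E (z i) (F (h j) ?r) = (\<not> s i)"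
      by (elim exE conjE)
    interpret array_state P D E d K d Z F by (rule st)
    have "\<exists>b. n \<le> card {i. i < n + n \<and> s i = b}"
    proof -
      have "card ({i. i < n + n \<and> s i = True} \<union> {i. i < n + n \<and> s i = False}) =
          card {i. i < n + n \<and> s i = True} + card {i. i < n + n \<and> s i = False}"
        by (rule card_Un_disjoint) auto
      moreover have "{i. i < n + n \<and> s i = True} \<union> {i. i < n + n \<and> s i = False} = {..<n + n}" by auto
      ultimately have "card {i. i < n + n \<and> s i = True} + card {i. i < n + n \<and> s i = False} = n + n"
        by (metis card_lessThan)
      then have "n \<le> card {i. i < n + n \<and> s i = True} \<or> n \<le> card {i. i < n + n \<and> s i = False}" by linarith
      then show ?thesis by blast
    qed
    then obtain b where b: "n \<le> card {i. i < n + n \<and> s i = b}" by blast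
    obtain e where e: "\<And>i j. i < j \<Longrightarrow> j < n \<Longrightarrow> e i < e j" "\<And>i. i < n \<Longrightarrow> e i \<in> {i. i < n + n \<and> s i = b}"
      using increasing_selection[OF _ b] by auto
    define zz where "zz i = z (e i)" for i
    define hh where "hh i = h (e i)" for i
    have zZ: "zz i \<in> Z" and hL: "leaf d F (hh i)" if "i < n" for i
      using zh L e(2)[OF that] unfolding zz_def hh_def by auto
    have sgn: "E (zz i) (F (hh j) \<xi>) \<longleftrightarrow> (if b then j < i else i < j)" if ij: "i < n" "j < n" "i \<noteq> j" and len: "length \<xi> = d" for i j \<xi>
    proof -
      have "E (zz i) (F (hh j) \<xi>) = E (zz i) (F (hh j) ?r)" by (rule leaf_sign[OF zZ[OF ij(1)] len])
      also have "\<dots> \<longleftrightarrow> (if b then j < i else i < j)"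
      proof (cases "i < j")
        case True
        then have "e i < e j" "e j < n + n" "s (e i) = b" using e ij by auto
        then show ?thesis using zhs[rule_format, of "e i" "e j"] True unfolding zz_def hh_def by auto
      next
        case False
        then have "j < i" using ij by simp
        then have "e j < e i" "e i < n + n" "s (e j) = b" using e ij by auto
        then show ?thesis using zhs[rule_format, of "e j" "e i"] False \<open>j < i\<close> unfolding zz_def hh_def by auto
      qed
      finally show ?thesis .
    qed
    \<comment> \<open>Points and leaves are taken at indices of different parity, so no rung is used
      on the diagonal, where the sign is unknown. For true \<open>b\<close> the order is reversed by
      counting down from \<open>N\<close>.\<close>
    define zi where "zi j = (if b then 2 * (N - j) else 2 * j + 1)" for j
    define hi where "hi t = (if b then 2 * (N - t) + 1 else 2 * t)" for t
    \<comment> \<open>The ladder points join the base sequences as sequence \<open>d\<close>. A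
      ladder leaf at position \<xi> cuts the base sequences at \<xi>, while its signs on the ladder
      depend only on its rank; so both cuts can be prescribed. Index 0 is a filler beyond the length
      of the grid.\<close>
    define \<gamma> where "\<gamma> i j = (if i < d then gg i (of_nat j) else zz (if j < N then zi j else 0))" for i j
    have zP: "zz i \<in> P" if "i < n" for i using zZ[OF that] Z by blast
    show ?thesis
      unfolding grid_def
    proof (intro exI[of _ \<gamma>] conjI allI impI)
      show "\<gamma> i j \<in> P" for i j
        unfolding \<gamma>_def using gg_P zP[of "zi j"] zP[of 0] by (auto simp: zi_def n_def)
      fix \<eta> :: "nat \<Rightarrow> nat" assume \<eta>: "\<forall>i<Suc d. \<eta> i \<le> N"
      define \<xi> where "\<xi> = map (\<lambda>i. of_nat (\<eta> i) - 1 / 2 :: rat) [0..<d]"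
      have len: "length \<xi> = d" unfolding \<xi>_def by simp
      have hi: "hi (\<eta> d) < n" unfolding hi_def n_def using \<eta> by auto
      have "E (\<gamma> i j) (F (hh (hi (\<eta> d))) \<xi>) \<longleftrightarrow> j < \<eta> i" if ij: "i < Suc d" "j < N" for i j
      proof (cases "i < d")
        case True
        have cmp: "(of_nat j :: rat) < of_nat (\<eta> i) - 1 / 2 \<longleftrightarrow> j < \<eta> i" "(of_nat j :: rat) \<noteq> of_nat (\<eta> i) - 1 / 2"
        proof -
          consider "j < \<eta> i" | "\<eta> i \<le> j" by linarith
          then have "(of_nat j :: rat) + 1 \<le> of_nat (\<eta> i) \<and> j < \<eta> i \<or> (of_nat (\<eta> i) :: rat) \<le> of_nat j \<and> \<not> j < \<eta> i"
            by cases (auto simp: less_of_nat_rat)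
          then show "(of_nat j :: rat) < of_nat (\<eta> i) - 1 / 2 \<longleftrightarrow> j < \<eta> i" "(of_nat j :: rat) \<noteq> of_nat (\<eta> i) - 1 / 2"
            by linarith+
        qed
        have "E (gg i (of_nat j)) (F (hh (hi (\<eta> d))) \<xi>) \<longleftrightarrow> of_nat j < \<xi> ! i"
          using hL[OF hi, unfolded leaf_def, rule_format, of i "replicate d (of_nat j)" \<xi>] True len cmp(2)
          unfolding gg_def \<xi>_def by simp
        then show ?thesis using True cmp(1) unfolding \<gamma>_def \<xi>_def by simp
      next
        case False
        then have i: "i = d" using ij by simp
        have ed: "\<eta> d \<le> N" using \<eta> by simp
        have zi: "zi j < n" unfolding zi_def n_def using ij by auto
        have ne: "zi j \<noteq> hi (\<eta> d)"
        proof -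
          have "even (zi j) \<noteq> even (hi (\<eta> d))" unfolding zi_def hi_def by simp
          then show ?thesis by metis
        qed
        have "E (\<gamma> i j) (F (hh (hi (\<eta> d))) \<xi>) \<longleftrightarrow> (if b then hi (\<eta> d) < zi j else zi j < hi (\<eta> d))"
          using sgn[OF zi hi ne len] ij i unfolding \<gamma>_def by simp
        also have "\<dots> \<longleftrightarrow> j < \<eta> d" unfolding zi_def hi_def using ij ed by auto
        finally show ?thesis using i by simp
      qed
      then show "\<exists>c \<in> P. \<forall>i<Suc d. \<forall>j<N. E (\<gamma> i j) c \<longleftrightarrow> j < \<eta> i" using F by blast
    qed
  qed
  then show False using d(3) by blast
qed

end

section \<open>The monster model\<close>

text \<open>A sequence of \<open>K\<close>-tuples becomes one assignment of the variables, block by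
  block; predicates of tuples can then be given by ordinary formulas.\<close>

definition flat :: "nat \<Rightarrow> (nat \<Rightarrow> 'u list) \<Rightarrow> nat \<Rightarrow> 'u" where
  "flat K v i = v (i div K) ! (i mod K)"

definition unflat :: "nat \<Rightarrow> (nat \<Rightarrow> 'u) \<Rightarrow> nat \<Rightarrow> 'u list" where
  "unflat K s j = map (\<lambda>r. s (j * K + r)) [0..<K]"

definition tuple_predicates ::
  "('f, 'r) language \<Rightarrow> ('f, 'r, 'u) struct \<Rightarrow> nat \<Rightarrow> ((nat \<Rightarrow> 'u list) \<Rightarrow> bool) set" where
  "tuple_predicates L U K =
     {Q. \<exists>\<phi> \<in> formulas L. \<forall>v. range v \<subseteq> tuples U K \<longrightarrow> Q v = sat U (flat K v) \<phi>}"

lemma flat_univ: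
  assumes "range v \<subseteq> tuples U K" "0 < K"
  shows "flat K v i \<in> univ U"
proof -
  have "v (i div K) \<in> tuples U K" using assms(1) by blast
  then have "length (v (i div K)) = K" "set (v (i div K)) \<subseteq> univ U" by (auto simp: tuples_def)
  moreover have "i mod K < K" using assms(2) by simp
  ultimately show ?thesis unfolding flat_def using nth_mem by fastforce
qed

lemma flat_unflat: "0 < K \<Longrightarrow> flat K (unflat K s) = s"
  by (auto simp: flat_def unflat_def fun_eq_iff)

lemma unflat_tuples: "range s \<subseteq> univ U \<Longrightarrow> unflat K s j \<in> tuples U K"
  by (auto simp: unflat_def tuples_def)

lemma flat_block: "r < K \<Longrightarrow> flat K v (j * K + r) = v j ! r"
  by (simp add: flat_def)

lemma unflat_flat: "v j \<in> tuples U K \<Longrightarrow> unflat K (flat K v) j = v j"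
  by (auto simp: unflat_def tuples_def flat_block intro!: nth_equalityI)

lemma tuple_predicatesI:
  "\<phi> \<in> formulas L \<Longrightarrow> (\<And>v. range v \<subseteq> tuples U K \<Longrightarrow> Q v = sat U (flat K v) \<phi>) \<Longrightarrow> Q \<in> tuple_predicates L U K"
  unfolding tuple_predicates_def by blast

lemma tuple_predicatesE:
  assumes "Q \<in> tuple_predicates L U K"
  shows "\<exists>\<phi>. \<phi> \<in> formulas L \<and> (\<forall>v. range v \<subseteq> tuples U K \<longrightarrow> Q v = sat U (flat K v) \<phi>)"
  using assms unfolding tuple_predicates_def by blast

text \<open>A quantifier over a tuple is a block of quantifiers over the first \<open>K\<close>
  variables, after which the remaining variables move down by one block.\<close>

lemma tuple_predicates_ex:
  fixes U :: "('f, 'r, 'u) struct"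
  assumes "Q \<in> tuple_predicates L U K" and K: "0 < K"
  shows "(\<lambda>v. \<exists>a \<in> tuples U K. Q (case_nat a v)) \<in> tuple_predicates L U K"
proof -
  obtain \<phi> where \<phi>: "\<phi> \<in> formulas L" and Q: "\<And>v. range v \<subseteq> tuples U K \<Longrightarrow> Q v = sat U (flat K v) \<phi>"
    using tuple_predicatesE[OF assms(1)] by auto
  show ?thesis
  proof (rule tuple_predicatesI)
    \<comment> \<open>Truncated subtraction merges the variables below \<open>K\<close>, which is
      harmless as they have just been bound.\<close>
    show "ren (\<lambda>i. i - K) (Exis [0..<K] \<phi>) \<in> formulas L" by (intro ren_formulas Exis_formulas \<phi>)
    fix v :: "nat \<Rightarrow> 'u list" assume v: "range v \<subseteq> tuples U K"
    have vP: "v j \<in> tuples U K" for j using v by blast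
    have Qc: "Q (case_nat a v) = sat U (flat K (case_nat a v)) \<phi>" if "a \<in> tuples U K" for a
      by (rule Q) (use that vP in \<open>auto split: nat.splits\<close>)
    have hi: "flat K (case_nat a v) i = flat K v (i - K)" if "K \<le> i" for a i
      using that K by (simp add: flat_def le_div_geq le_mod_geq)
    show "(\<exists>a \<in> tuples U K. Q (case_nat a v)) = sat U (flat K v) (ren (\<lambda>i. i - K) (Exis [0..<K] \<phi>))"
      unfolding sat_ren sat_Exis
    proof
      assume "\<exists>a \<in> tuples U K. Q (case_nat a v)"
      then obtain a where a: "a \<in> tuples U K" "sat U (flat K (case_nat a v)) \<phi>" using Qc by blast
      have "range (case_nat a v) \<subseteq> tuples U K" using a vP by (auto split: nat.splits)
      then have "flat K (case_nat a v) ` set [0..<K] \<subseteq> univ U" using flat_univ[OF _ K] by blast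
      then show "\<exists>s'. (\<forall>i. i \<notin> set [0..<K] \<longrightarrow> s' i = flat K v (i - K)) \<and> s' ` set [0..<K] \<subseteq> univ U \<and> sat U s' \<phi>"
        using a(2) hi by (intro exI[of _ "flat K (case_nat a v)"]) auto
    next
      assume "\<exists>s'. (\<forall>i. i \<notin> set [0..<K] \<longrightarrow> s' i = flat K v (i - K)) \<and> s' ` set [0..<K] \<subseteq> univ U \<and> sat U s' \<phi>"
      then obtain s' where s': "\<forall>i. i \<notin> set [0..<K] \<longrightarrow> s' i = flat K v (i - K)" "s' ` set [0..<K] \<subseteq> univ U" "sat U s' \<phi>"
        by blast
      define a where "a = map s' [0..<K]"
      have a: "a \<in> tuples U K" using s'(2) by (auto simp: a_def tuples_def)
      have "flat K (case_nat a v) i = s' i" for i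
      proof (cases "K \<le> i")
        case True
        then show ?thesis using s'(1) hi by simp
      next
        case False
        then show ?thesis by (simp add: flat_def a_def)
      qed
      then have "flat K (case_nat a v) = s'" by (rule ext)
      then show "\<exists>a \<in> tuples U K. Q (case_nat a v)" using a Qc s'(3) by auto
    qed
  qed
qed

text \<open>Only finitely many argument places matter. Concatenation of the first \<open>N\<close>
  tuples of \<open>w i\<close> and of \<open>u\<close> makes \<open>Q\<close> a partitioned formula
  that shatters the tuples coming from \<open>w\<close>; these are distinct, since singletons
  \<open>I\<close> separate them.\<close>

lemma tuple_predicates_nip:
  fixes U :: "('f, 'r, 'u) struct"
  assumes nip: "NIP L U" and K: "0 < K" and "Q \<in> tuple_predicates L U K"
  shows "\<not> (\<exists>w. (\<forall>i. range (w i) \<subseteq> tuples U K) \<and>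
    (\<forall>I :: nat set. \<exists>u. range u \<subseteq> tuples U K \<and> (\<forall>i. Q (weave u (w i)) \<longleftrightarrow> i \<in> I)))"
proof
  assume "\<exists>w. (\<forall>i. range (w i) \<subseteq> tuples U K) \<and>
    (\<forall>I :: nat set. \<exists>u. range u \<subseteq> tuples U K \<and> (\<forall>i. Q (weave u (w i)) \<longleftrightarrow> i \<in> I))"
  then obtain w where w: "\<forall>i. range (w i) \<subseteq> tuples U K"
    and ex: "\<forall>I :: nat set. \<exists>u. range u \<subseteq> tuples U K \<and> (\<forall>i. Q (weave u (w i)) \<longleftrightarrow> i \<in> I)"
    by (elim exE conjE)
  obtain \<phi> where \<phi>: "\<phi> \<in> formulas L" and Q: "\<And>v. range v \<subseteq> tuples U K \<Longrightarrow> Q v = sat U (flat K v) \<phi>"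
    using tuple_predicatesE[OF assms(3)] by auto
  obtain N where N: "\<forall>x \<in> free_vars \<phi>. x < N"
    using finite_free_vars finite_nat_set_iff_bounded by metis
  \<comment> \<open>Sorts the interleaved blocks: the odd ones, from \<open>w i\<close>, go to the
    first half, the even ones, from \<open>u\<close>, to the second.\<close>
  define f where "f x = (if odd (x div K) then (x div K div 2) * K + x mod K
     else N * K + ((x div K div 2) * K + x mod K))" for x
  define a where "a i = map (flat K (w i)) [0..<N * K]" for i
  define b where "b u = map (flat K u) [0..<N * K]" for u :: "nat \<Rightarrow> 'u list"
  have bound: "(x div K div 2) * K + x mod K < N * K" if "x < N" for x
  proof -
    have "x div K div 2 \<le> x div K" by simp
    also have "\<dots> \<le> x" by simp
    finally have "Suc (x div K div 2) \<le> N" using that by linarith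
    then have "Suc (x div K div 2) * K \<le> N * K" by (rule mult_le_mono1)
    moreover have "x mod K < K" using K by simp
    ultimately show ?thesis by simp
  qed
  have form: "ren f \<phi> \<in> formulas_in L (N * K + N * K)"
  proof -
    have "f x < N * K + N * K" if "x < N" for x using bound[OF that] unfolding f_def by simp
    then have "free_vars (ren f \<phi>) \<subseteq> {..<N * K + N * K}" using free_vars_ren[of f \<phi>] N by fastforce
    then show ?thesis using ren_formulas[OF \<phi>] by (simp add: formulas_in_def)
  qed
  have holds: "holds U (ren f \<phi>) (a i @ b u) \<longleftrightarrow> Q (weave u (w i))" if u: "range u \<subseteq> tuples U K" for i u
  proof -
    have "range (weave u (w i)) \<subseteq> tuples U K" using u w unfolding weave_def by (auto simp: image_subset_iff)
    then have "Q (weave u (w i)) = sat U (flat K (weave u (w i))) \<phi>" by (rule Q)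
    also have "\<dots> = sat U (\<lambda>x. (a i @ b u) ! f x) \<phi>"
    proof (rule sat_cong)
      fix x assume "x \<in> free_vars \<phi>"
      then have x: "x < N" using N by blast
      have r: "x mod K < K" using K by simp
      show "flat K (weave u (w i)) x = (a i @ b u) ! f x"
        using bound[OF x] flat_block[OF r, of "w i" "x div K div 2"] flat_block[OF r, of u "x div K div 2"]
        unfolding f_def a_def b_def by (simp add: nth_append flat_def weave_def)
    qed
    finally show ?thesis unfolding holds_def sat_ren by simp
  qed
  have aT: "a i \<in> tuples U (N * K)" for i
  proof -
    have "range (w i) \<subseteq> tuples U K" using w by blast
    from flat_univ[OF this K] show ?thesis by (auto simp: a_def tuples_def)
  qed
  have bT: "b u \<in> tuples U (N * K)" if "range u \<subseteq> tuples U K" for u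
    using flat_univ[OF that K] by (auto simp: b_def tuples_def)
  have "inj a"
  proof (rule injI)
    fix i j assume eq: "a i = a j"
    obtain u where u: "range u \<subseteq> tuples U K" "\<forall>k. Q (weave u (w k)) \<longleftrightarrow> k \<in> {i}" using ex by blast
    have "Q (weave u (w i)) = Q (weave u (w j))" using holds[OF u(1), of i] holds[OF u(1), of j] eq by simp
    then show "i = j" using u(2) by auto
  qed
  then have "infinite (range a)" by (simp add: finite_image_iff)
  moreover have "range a \<subseteq> tuples U (N * K)" using aT by blast
  moreover have "shattered U (ren f \<phi>) (N * K) (range a)"
    unfolding shattered_def
  proof (intro allI impI)
    fix I assume "I \<subseteq> range a"
    obtain u where u: "range u \<subseteq> tuples U K" "\<forall>k. Q (weave u (w k)) \<longleftrightarrow> k \<in> {i. a i \<in> I}" using ex by blast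
    then show "\<exists>b \<in> tuples U (N * K). \<forall>a \<in> range a. holds U (ren f \<phi>) (a @ b) \<longleftrightarrow> a \<in> I"
      using bT[OF u(1)] holds[OF u(1)] by (intro bexI[of _ "b u"]) auto
  qed
  ultimately show False using nip form unfolding NIP_def by blast
qed

text \<open>\<open>E s t\<close> reads the first part of \<open>s\<close> and the second part of
  \<open>t\<close>. Both sides of the order property then live in one sort, and its two sequences
  merge into a single chain of points.\<close>

lemma tuple_geometry_monster:
  fixes U :: "('f, 'r, 'u) struct"
  assumes M: "monster_model L T \<kappa> U" and nip: "NIP L U"
    and \<phi>: "\<phi> \<in> formulas_in L (n + m)" and ord: "order_property U \<phi> n m"
  shows "0 < n + m" "tuple_geometry (tuples U (n + m)) (tuple_predicates L U (n + m))
    (\<lambda>s t. holds U \<phi> (take n s @ drop n t))"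
proof -
  define K where "K = n + m"
  obtain a b where ab: "\<forall>i :: nat. a i \<in> tuples U n \<and> b i \<in> tuples U m"
    and ab_less: "\<forall>i j. holds U \<phi> (a i @ b j) \<longleftrightarrow> i < j" using ord unfolding order_property_def by blast
  \<comment> \<open>With empty tuples there would be a single instance of the formula, which cannot
    be both true and false.\<close>
  have K: "0 < K"
  proof (rule ccontr)
    assume "\<not> 0 < K"
    then have "n = 0" "m = 0" unfolding K_def by auto
    then have "a i = []" "b i = []" for i using ab by (auto simp: tuples_def)
    then show False using ab_less[rule_format, of 0 1] ab_less[rule_format, of 1 0] by simp
  qed
  then show "0 < n + m" unfolding K_def .
  have str: "is_struct L U" using M by (simp add: monster_model_def)
  let ?P = "tuples U K" and ?D = "tuple_predicates L U K"
  let ?E = "\<lambda>s t. holds U \<phi> (take n s @ drop n t)"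
  have "tuple_geometry ?P ?D ?E"
  proof
    obtain u where "u \<in> univ U" using str unfolding is_struct_def by blast
    then have "replicate K u \<in> ?P" by (auto simp: tuples_def)
    then show "?P \<noteq> {}" by blast
  next
    fix Q assume "Q \<in> ?D"
    then obtain \<psi> where \<psi>: "\<psi> \<in> formulas L" "\<forall>v. range v \<subseteq> ?P \<longrightarrow> Q v = sat U (flat K v) \<psi>"
      using tuple_predicatesE by blast
    show "(\<lambda>v. \<not> Q v) \<in> ?D"
      by (rule tuple_predicatesI[of "Neg \<psi>"]) (use \<psi> in \<open>auto simp: formulas_def\<close>)
    fix Q' assume "Q' \<in> ?D"
    then obtain \<psi>' where \<psi>': "\<psi>' \<in> formulas L" "\<forall>v. range v \<subseteq> ?P \<longrightarrow> Q' v = sat U (flat K v) \<psi>'"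
      using tuple_predicatesE by blast
    show "(\<lambda>v. Q v \<and> Q' v) \<in> ?D"
      by (rule tuple_predicatesI[of "And \<psi> \<psi>'"]) (use \<psi> \<psi>' in \<open>auto simp: formulas_def\<close>)
  next
    fix Q assume "Q \<in> ?D"
    then show "(\<lambda>v. \<exists>a \<in> ?P. Q (case_nat a v)) \<in> ?D" using K by (rule tuple_predicates_ex)
  next
    fix Q f assume "Q \<in> ?D"
    then obtain \<psi> where \<psi>: "\<psi> \<in> formulas L" "\<forall>v. range v \<subseteq> ?P \<longrightarrow> Q v = sat U (flat K v) \<psi>"
      using tuple_predicatesE by blast
    show "(\<lambda>v. Q (\<lambda>j. v (f j))) \<in> ?D"
    proof (rule tuple_predicatesI[of "ren (\<lambda>i. f (i div K) * K + i mod K) \<psi>"])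
      show "ren (\<lambda>i. f (i div K) * K + i mod K) \<psi> \<in> formulas L" by (rule ren_formulas[OF \<psi>(1)])
      fix v :: "nat \<Rightarrow> 'u list" assume v: "range v \<subseteq> ?P"
      have "range (\<lambda>j. v (f j)) \<subseteq> ?P" using v by blast
      then have "Q (\<lambda>j. v (f j)) = sat U (flat K (\<lambda>j. v (f j))) \<psi>" using \<psi>(2) by simp
      moreover have "flat K (\<lambda>j. v (f j)) = (\<lambda>i. flat K v (f (i div K) * K + i mod K))"
      proof
        fix i
        have "i mod K < K" using K by simp
        then show "flat K (\<lambda>j. v (f j)) i = flat K v (f (i div K) * K + i mod K)"
          by (simp add: flat_block) (simp add: flat_def)
      qed
      ultimately show "Q (\<lambda>j. v (f j)) = sat U (flat K v) (ren (\<lambda>i. f (i div K) * K + i mod K) \<psi>)"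
        unfolding sat_ren by simp
    qed
  next
    show "(\<lambda>v. v 0 = v 1) \<in> ?D"
    proof (rule tuple_predicatesI[of "Conjs (map (\<lambda>r. Eq (Var r) (Var (K + r))) [0..<K])"])
      show "Conjs (map (\<lambda>r. Eq (Var r) (Var (K + r))) [0..<K]) \<in> formulas L"
        by (rule Conjs_formulas) (auto simp: formulas_def)
      fix v :: "nat \<Rightarrow> 'u list" assume v: "range v \<subseteq> ?P"
      have "v 0 \<in> ?P" "v 1 \<in> ?P" using v by blast+
      then have "length (v 0) = K" "length (v 1) = K" by (auto simp: tuples_def)
      then have "v 0 = v 1 \<longleftrightarrow> (\<forall>r<K. v 0 ! r = v 1 ! r)" by (auto intro: nth_equalityI)
      also have "\<dots> \<longleftrightarrow> (\<forall>r<K. flat K v r = flat K v (K + r))"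
        using flat_block[of _ K v 0] flat_block[of _ K v 1] by simp
      finally show "(v 0 = v 1) = sat U (flat K v) (Conjs (map (\<lambda>r. Eq (Var r) (Var (K + r))) [0..<K]))"
        by (auto simp: sat_Conjs)
    qed
  next
    define f where "f r = (if r < n then r else K + r)" for r
    show "(\<lambda>v. ?E (v 0) (v 1)) \<in> ?D"
    proof (rule tuple_predicatesI[of "ren f \<phi>"])
      show "ren f \<phi> \<in> formulas L" using \<phi> by (intro ren_formulas) (simp add: formulas_in_def)
      fix v :: "nat \<Rightarrow> 'u list" assume v: "range v \<subseteq> ?P"
      have "v 0 \<in> ?P" "v 1 \<in> ?P" using v by blast+
      then have len: "length (v 0) = K" "length (v 1) = K" by (auto simp: tuples_def)
      show "?E (v 0) (v 1) = sat U (flat K v) (ren f \<phi>)"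
        unfolding holds_def sat_ren
      proof (rule sat_cong)
        fix r assume "r \<in> free_vars \<phi>"
        then have r: "r < K" using \<phi> unfolding formulas_in_def K_def by auto
        show "(take n (v 0) @ drop n (v 1)) ! r = flat K v (f r)"
          using flat_block[OF r, of v 0] flat_block[OF r, of v 1] r len unfolding f_def K_def
          by (auto simp: nth_append)
      qed
    qed
  next
    fix Q assume "Q \<in> ?D"
    then obtain \<psi> where \<psi>: "\<psi> \<in> formulas L" "\<forall>v. range v \<subseteq> ?P \<longrightarrow> Q v = sat U (flat K v) \<psi>"
      using tuple_predicatesE by blast
    obtain N where N: "\<forall>x \<in> free_vars \<psi>. x < N"
      using finite_free_vars finite_nat_set_iff_bounded by metis
    have "Q v = Q v'" if v: "range v \<subseteq> ?P" "range v' \<subseteq> ?P" "\<forall>i<N. v i = v' i" for v v'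
    proof -
      have "sat U (flat K v) \<psi> = sat U (flat K v') \<psi>"
      proof (rule sat_cong)
        fix x assume "x \<in> free_vars \<psi>"
        then have "x < N" using N by blast
        then have "x div K < N" by (meson div_le_dividend le_less_trans)
        then show "flat K v x = flat K v' x" using v(3) by (simp add: flat_def)
      qed
      then show ?thesis using \<psi>(2) v(1,2) by simp
    qed
    then show "\<exists>n. \<forall>v w. range v \<subseteq> ?P \<longrightarrow> range w \<subseteq> ?P \<longrightarrow> (\<forall>i<n. v i = w i) \<longrightarrow> Q v = Q w" by blast
  next
    fix S and v :: "nat \<Rightarrow> 'u list" and V
    assume S: "S \<subseteq> ?D" and v: "range v \<subseteq> ?P"
      and fin: "\<And>S0. S0 \<subseteq> S \<Longrightarrow> finite S0 \<Longrightarrow> \<exists>w. range w \<subseteq> ?P \<and> (\<forall>j. j \<notin> V \<longrightarrow> w j = v j) \<and> (\<forall>Q \<in> S0. Q w)"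
    have "\<forall>Q \<in> S. \<exists>\<psi>. \<psi> \<in> formulas L \<and> (\<forall>v. range v \<subseteq> ?P \<longrightarrow> Q v = sat U (flat K v) \<psi>)"
      using S tuple_predicatesE by blast
    from bchoice[OF this] obtain g where g: "\<forall>Q \<in> S. g Q \<in> formulas L \<and> (\<forall>v. range v \<subseteq> ?P \<longrightarrow> Q v = sat U (flat K v) (g Q))"
      by (elim exE)
    have "\<exists>s'. range s' \<subseteq> univ U \<and> (\<forall>i. i \<notin> {i. i div K \<in> V} \<longrightarrow> s' i = flat K v i) \<and> (\<forall>\<psi> \<in> g ` S. sat U s' \<psi>)"
    proof (rule compactness[OF M])
      show "range (flat K v) \<subseteq> univ U" using flat_univ[OF v K] by blast
      show "g ` S \<subseteq> formulas L" using g by blast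
      fix \<Phi>0 assume "\<Phi>0 \<subseteq> g ` S" "finite \<Phi>0"
      then obtain S0 where S0: "S0 \<subseteq> S" "finite S0" "\<Phi>0 = g ` S0"
        using finite_subset_image[of \<Phi>0 g S] by blast
      obtain w where w: "range w \<subseteq> ?P" "\<forall>j. j \<notin> V \<longrightarrow> w j = v j" "\<forall>Q \<in> S0. Q w"
        using fin[OF S0(1,2)] by (elim exE conjE)
      have "sat U (flat K w) (g Q)" if "Q \<in> S0" for Q
        using bspec[OF w(3) that] g S0(1) that w(1) by auto
      then show "\<exists>s'. range s' \<subseteq> univ U \<and> (\<forall>i. i \<notin> {i. i div K \<in> V} \<longrightarrow> s' i = flat K v i) \<and> (\<forall>\<psi> \<in> \<Phi>0. sat U s' \<psi>)"
        using flat_univ[OF w(1) K] w(2) S0(3) by (intro exI[of _ "flat K w"]) (auto simp: flat_def)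
    qed
    then obtain s' where s': "range s' \<subseteq> univ U" "\<forall>i. i \<notin> {i. i div K \<in> V} \<longrightarrow> s' i = flat K v i" "\<forall>\<psi> \<in> g ` S. sat U s' \<psi>"
      by (elim exE conjE)
    have wP: "range (unflat K s') \<subseteq> ?P" using unflat_tuples[OF s'(1)] by blast
    moreover have "unflat K s' j = v j" if "j \<notin> V" for j
    proof -
      have "unflat K s' j = unflat K (flat K v) j" using s'(2) that by (simp add: unflat_def)
      also have "\<dots> = v j" using v by (intro unflat_flat) blast
      finally show ?thesis .
    qed
    moreover have "Q (unflat K s')" if Q: "Q \<in> S" for Q
    proof -
      have "Q (unflat K s') = sat U (flat K (unflat K s')) (g Q)" using g Q wP by simp
      then show ?thesis unfolding flat_unflat[OF K] using s'(3) Q by simp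
    qed
    ultimately show "\<exists>w. range w \<subseteq> ?P \<and> (\<forall>j. j \<notin> V \<longrightarrow> w j = v j) \<and> (\<forall>Q \<in> S. Q w)"
      by (intro exI[of _ "unflat K s'"] conjI allI impI ballI)
  next
    fix v w :: "nat \<Rightarrow> 'u list"
    assume v: "range v \<subseteq> ?P" and w: "range w \<subseteq> ?P" and eq: "\<And>Q. Q \<in> ?D \<Longrightarrow> Q v = Q w"
    have "sat U (flat K v) \<psi> \<longleftrightarrow> sat U (flat K w) \<psi>" if "\<psi> \<in> formulas L" for \<psi>
      by (rule eq[of "\<lambda>v. sat U (flat K v) \<psi>"]) (rule tuple_predicatesI[OF that], simp)
    then obtain g where g: "automorphism L U g" "\<forall>i. g (flat K v i) = flat K w i"
      using homogeneity[OF M, of "flat K v" "flat K w"] flat_univ[OF v K] flat_univ[OF w K] by blast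
    have bij: "bij_betw g (univ U) (univ U)" using g(1) by (simp add: automorphism_def)
    have "bij_betw (map g) ?P ?P"
    proof (rule bij_betwI')
      fix x y assume xy: "x \<in> ?P" "y \<in> ?P"
      then show "(map g x = map g y) = (x = y)"
        using bij by (auto simp: tuples_def bij_betw_def intro!: map_inj_on[of g x y] inj_on_subset[of g "univ U"])
    next
      fix x assume "x \<in> ?P"
      then show "map g x \<in> ?P" using bij by (auto simp: tuples_def bij_betw_def)
    next
      fix y assume y: "y \<in> ?P"
      let ?x = "map (inv_into (univ U) g) y"
      have "?x \<in> ?P" using y bij by (auto simp: tuples_def bij_betw_def intro!: inv_into_into)
      moreover have "map g ?x = y"
        using y bij by (auto simp: tuples_def bij_betw_def f_inv_into_f subset_iff intro!: nth_equalityI)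
      ultimately show "\<exists>x \<in> ?P. y = map g x" by (intro bexI[of _ ?x]) simp_all
    qed
    moreover have "Q (\<lambda>j. map g (u j)) = Q u" if "Q \<in> ?D" "range u \<subseteq> ?P" for Q u
    proof -
      obtain \<psi> where \<psi>: "\<psi> \<in> formulas L" "\<forall>v. range v \<subseteq> ?P \<longrightarrow> Q v = sat U (flat K v) \<psi>"
        using tuple_predicatesE[OF \<open>Q \<in> ?D\<close>] by blast
      have uP: "u j \<in> ?P" for j using that(2) by blast
      then have len: "length (u j) = K" for j by (simp add: tuples_def)
      have "map g (u j) \<in> ?P" for j
        using uP[of j] bij by (auto simp: tuples_def bij_betw_def)
      then have "range (\<lambda>j. map g (u j)) \<subseteq> ?P" by blast
      then have "Q (\<lambda>j. map g (u j)) = sat U (flat K (\<lambda>j. map g (u j))) \<psi>" using \<psi>(2) by simp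
      also have "flat K (\<lambda>j. map g (u j)) = (\<lambda>i. g (flat K u i))"
        using len K by (auto simp: flat_def fun_eq_iff)
      also have "sat U (\<lambda>i. g (flat K u i)) \<psi> = sat U (flat K u) \<psi>"
        using \<psi>(1) flat_univ[OF that(2) K] by (intro automorphism_sat[OF str g(1)]) (auto simp: formulas_def)
      also have "\<dots> = Q u" using \<psi>(2) that(2) by simp
      finally show ?thesis .
    qed
    moreover have "map g (v j) = w j" for j
    proof (rule nth_equalityI)
      have "v j \<in> ?P" "w j \<in> ?P" using v w by blast+
      then have len: "length (v j) = K" "length (w j) = K" by (auto simp: tuples_def)
      then show "length (map g (v j)) = length (w j)" by simp
      fix r assume "r < length (map g (v j))"
      then have r: "r < K" using len by simp
      show "map g (v j) ! r = w j ! r"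
        using g(2)[rule_format, of "j * K + r"] flat_block[OF r, of v j] flat_block[OF r, of w j] r len by simp
    qed
    ultimately show "\<exists>\<sigma>. bij_betw \<sigma> ?P ?P \<and> (\<forall>Q \<in> ?D. \<forall>u. range u \<subseteq> ?P \<longrightarrow> Q (\<lambda>j. \<sigma> (u j)) = Q u) \<and> (\<forall>j. \<sigma> (v j) = w j)"
      by (intro exI[of _ "map g"]) simp
  next
    fix Q assume "Q \<in> ?D"
    then show "\<not> (\<exists>w. (\<forall>i. range (w i) \<subseteq> ?P) \<and>
      (\<forall>I :: nat set. \<exists>u. range u \<subseteq> ?P \<and> (\<forall>i. Q (weave u (w i)) \<longleftrightarrow> i \<in> I)))"
      by (rule tuple_predicates_nip[OF nip K])
  next
    have len: "length (a i) = n" for i using ab by (simp add: tuples_def)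
    have "a i @ b i \<in> ?P" for i using ab by (auto simp: tuples_def K_def)
    moreover have "?E (a i @ b i) (a j @ b j) \<longleftrightarrow> i < j" for i j using ab_less len by simp
    ultimately show "\<exists>t. range t \<subseteq> ?P \<and> (\<forall>i j :: nat. ?E (t i) (t j) \<longleftrightarrow> i < j)"
      by (intro exI[of _ "\<lambda>i. a i @ b i"]) auto
  qed
  then show "tuple_geometry (tuples U (n + m)) (tuple_predicates L U (n + m)) (\<lambda>s t. holds U \<phi> (take n s @ drop n t))"
    unfolding K_def .
qed

text \<open>Leads from the geometry back to formulas over a set of elements: label \<open>l\<close>
  occupies the block of variables with number \<open>e l\<close>, and the entries of the parameter
  tuples become the parameters of the formula.\<close>

lemma dfn_formula:
  assumes geo: "tuple_geometry (tuples U K) (tuple_predicates L U K) E" and K: "0 < K"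
    and X: "tuple_geometry.dfn (tuples U K) (tuple_predicates L U K) A0 X"
    and u0: "u0 \<in> A" and A: "\<forall>p \<in> A0. set p \<subseteq> A" and e: "\<And>l. e l < k"
  shows "\<exists>\<psi> \<in> formulas_over L A (k * K). \<forall>f t. range f \<subseteq> tuples U K \<longrightarrow> length t = k * K \<longrightarrow>
    (\<forall>l. \<forall>r<K. t ! (e l * K + r) = f l ! r) \<longrightarrow> (holds_over U \<psi> t \<longleftrightarrow> X f)"
proof -
  interpret tuple_geometry "tuples U K" "tuple_predicates L U K" E by (rule geo)
  obtain Q a where Q: "Q \<in> tuple_predicates L U K" and a: "\<And>j. a j \<in> Inl ` (A0 \<inter> tuples U K) \<union> range Inr"
    and XQ: "\<And>f. range f \<subseteq> tuples U K \<Longrightarrow> X f = Q (\<lambda>j. vl f (a j))"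
    using X by (rule dfnE) blast
  obtain \<phi> where \<phi>: "\<phi> \<in> formulas L" and Q\<phi>: "\<And>v. range v \<subseteq> tuples U K \<Longrightarrow> Q v = sat U (flat K v) \<phi>"
    using tuple_predicatesE[OF Q] by auto
  obtain N where N: "\<forall>x \<in> free_vars \<phi>. x < N"
    using finite_free_vars finite_nat_set_iff_bounded by metis
  \<comment> \<open>\<open>b\<close> keeps one entry for each variable below \<open>N\<close>; at
    variables that belong to labels the entry is the filler \<open>u0\<close>.\<close>
  define b where "b = map (\<lambda>x. case a (x div K) of Inl p \<Rightarrow> p ! (x mod K) | Inr _ \<Rightarrow> u0) [0..<N]"
  define g where "g x = (case a (x div K) of Inl _ \<Rightarrow> k * K + x | Inr l \<Rightarrow> e l * K + x mod K)" for x
  have r: "x mod K < K" for x using K by simp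
  have small: "e l * K + x mod K < k * K" for l x
  proof -
    have "Suc (e l) * K \<le> k * K" using e[of l] by (intro mult_le_mono1) simp
    then show ?thesis using r[of x] by simp
  qed
  have "set b \<subseteq> A"
  proof
    fix c assume "c \<in> set b"
    then obtain x where c: "c = (case a (x div K) of Inl p \<Rightarrow> p ! (x mod K) | Inr _ \<Rightarrow> u0)" by (auto simp: b_def)
    show "c \<in> A"
    proof (cases "a (x div K)")
      case (Inl p)
      then have "p \<in> A0" "length p = K" using a[of "x div K"] by (auto simp: tuples_def)
      then show ?thesis using A[rule_format, of p] c Inl nth_mem[of "x mod K" p] r[of x] by auto
    next
      case (Inr l)
      then show ?thesis using c u0 by simp
    qed
  qed
  moreover have "ren g \<phi> \<in> formulas_in L (k * K + length b)"
  proof -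
    have "g x < k * K + N" if "x < N" for x
      using that small[of _ x] unfolding g_def by (auto split: sum.splits intro: trans_less_add1)
    then have "free_vars (ren g \<phi>) \<subseteq> {..<k * K + length b}"
      using free_vars_ren[of g \<phi>] N by (fastforce simp: b_def)
    then show ?thesis using ren_formulas[OF \<phi>] by (simp add: formulas_in_def)
  qed
  ultimately have "(ren g \<phi>, b) \<in> formulas_over L A (k * K)" by (simp add: formulas_over_def)
  moreover have "holds_over U (ren g \<phi>, b) t \<longleftrightarrow> X f"
    if f: "range f \<subseteq> tuples U K" and t: "length t = k * K" "\<forall>l. \<forall>r<K. t ! (e l * K + r) = f l ! r" for f t
  proof -
    have "range (\<lambda>j. vl f (a j)) \<subseteq> tuples U K" using vl_in_P[OF f a] by blast
    then have "X f = sat U (flat K (\<lambda>j. vl f (a j))) \<phi>" using XQ[OF f] Q\<phi> by simp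
    also have "\<dots> = sat U (\<lambda>x. (t @ b) ! g x) \<phi>"
    proof (rule sat_cong)
      fix x assume "x \<in> free_vars \<phi>"
      then have x: "x < N" using N by blast
      show "flat K (\<lambda>j. vl f (a j)) x = (t @ b) ! g x"
        using x t small[of _ x] r[of x] by (cases "a (x div K)") (simp_all add: flat_def g_def b_def nth_append)
    qed
    finally show ?thesis unfolding holds_over_def holds_def sat_ren fst_conv snd_conv by simp
  qed
  ultimately show ?thesis by blast
qed

theorem theorem5p12:
  fixes L :: "('f, 'r) language"
    and T :: "('f, 'r) fm set"
    and \<kappa> :: "'k rel"
    and U :: "('f, 'r, 'u) struct"
  assumes "complete_theory L T"
    and "monster_model L T \<kappa> U"
    and "NIP L U"
    and "\<not> stable L U"
  shows "\<exists>A n \<theta> R.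
    finite A \<and> A \<subseteq> univ U \<and>
    \<theta> \<in> formulas_over L A n \<and>
    Or_definable L U A n R \<and>
    linear_quasi_order_on (solutions U n \<theta>) R \<and>
    dense_on (solutions U n \<theta>) R \<and>
    has_increasing_chain (solutions U n \<theta>) R"
proof -
  obtain n m \<phi> where \<phi>: "\<phi> \<in> formulas_in L (n + m)" "order_property U \<phi> n m"
    using assms(4) unfolding stable_def by blast
  define K where "K = n + m"
  have K: "0 < K" and geo: "tuple_geometry (tuples U K) (tuple_predicates L U K) (\<lambda>s t. holds U \<phi> (take n s @ drop n t))"
    unfolding K_def by (rule tuple_geometry_monster[OF assms(2,3) \<phi>])+
  interpret tuple_geometry "tuples U K" "tuple_predicates L U K" "\<lambda>s t. holds U \<phi> (take n s @ drop n t)" by (rule geo)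
  obtain A0 \<Theta> W where A0: "finite A0" "A0 \<subseteq> tuples U K"
    and \<Theta>: "dfn A0 (\<lambda>f :: unit \<Rightarrow> 'u list. \<Theta> (f ()))"
    and W: "\<forall>N :: nat. dfn A0 (\<lambda>f :: bool \<Rightarrow> 'u list. W N (f False) (f True))"
    and lin: "let S = {p \<in> tuples U K. \<Theta> p}; R = {(a, b). a \<in> tuples U K \<and> b \<in> tuples U K \<and> (\<exists>N. W N a b)}
      in linear_quasi_order_on S R \<and> dense_on S R \<and> has_increasing_chain S R"
    using concl_holds unfolding concl_def by (elim exE conjE)
  obtain u0 where u0: "u0 \<in> univ U" using assms(2) unfolding monster_model_def is_struct_def by blast
  \<comment> \<open>\<open>u0\<close> ensures that a filler parameter exists even if
    \<open>A0\<close> is empty.\<close>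
  define A where "A = insert u0 (\<Union>p \<in> A0. set p)"
  have A: "finite A" "A \<subseteq> univ U" "u0 \<in> A" "\<forall>p \<in> A0. set p \<subseteq> A"
    using A0 u0 unfolding A_def by (auto simp: tuples_def)
  obtain \<theta> where \<theta>: "\<theta> \<in> formulas_over L A (1 * K)"
    and \<theta>\<Theta>: "\<forall>f t. range f \<subseteq> tuples U K \<longrightarrow> length t = 1 * K \<longrightarrow>
      (\<forall>l :: unit. \<forall>r<K. t ! (0 * K + r) = f l ! r) \<longrightarrow> (holds_over U \<theta> t \<longleftrightarrow> \<Theta> (f ()))"
    using dfn_formula[OF geo K \<Theta> A(3,4), of "\<lambda>_. 0" 1, OF zero_less_one] by (elim bexE)
  have \<theta>_iff: "holds_over U \<theta> p \<longleftrightarrow> \<Theta> p" if "p \<in> tuples U K" for p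
    using \<theta>\<Theta>[rule_format, of "\<lambda>_. p" p] that by (simp add: tuples_def image_subset_iff)
  have "\<exists>\<psi>. \<forall>N. \<psi> N \<in> formulas_over L A (K + K) \<and> (\<forall>a c. a \<in> tuples U K \<longrightarrow> c \<in> tuples U K \<longrightarrow>
      (holds_over U (\<psi> N) (a @ c) \<longleftrightarrow> W N a c))"
  proof (rule choice, rule allI)
    fix N
    have e: "(if l then 1 else 0 :: nat) < 2" for l :: bool by simp
    obtain \<psi> where \<psi>: "\<psi> \<in> formulas_over L A (2 * K)"
      and \<psi>W: "\<forall>f t. range f \<subseteq> tuples U K \<longrightarrow> length t = 2 * K \<longrightarrow>
        (\<forall>l :: bool. \<forall>r<K. t ! ((if l then 1 else 0) * K + r) = f l ! r) \<longrightarrow> (holds_over U \<psi> t \<longleftrightarrow> W N (f False) (f True))"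
      using dfn_formula[OF geo K W[rule_format, of N] A(3,4), of "\<lambda>l. if l then 1 else 0" 2, OF e] by (elim bexE)
    have "holds_over U \<psi> (a @ c) \<longleftrightarrow> W N a c" if "a \<in> tuples U K" "c \<in> tuples U K" for a c
      using \<psi>W[rule_format, of "\<lambda>l. if l then c else a" "a @ c"] that
      by (auto simp: tuples_def nth_append image_subset_iff)
    then show "\<exists>\<psi>. \<psi> \<in> formulas_over L A (K + K) \<and> (\<forall>a c. a \<in> tuples U K \<longrightarrow> c \<in> tuples U K \<longrightarrow>
      (holds_over U \<psi> (a @ c) \<longleftrightarrow> W N a c))"
      using \<psi> by (intro exI[of _ \<psi>]) (simp add: mult_2)
  qed
  then obtain \<psi> where \<psi>: "\<And>N. \<psi> N \<in> formulas_over L A (K + K)"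
    "\<And>N a c. a \<in> tuples U K \<Longrightarrow> c \<in> tuples U K \<Longrightarrow> holds_over U (\<psi> N) (a @ c) \<longleftrightarrow> W N a c"
    by blast
  define R where "R = {(a, b). a \<in> tuples U K \<and> b \<in> tuples U K \<and> (\<exists>N. W N a b)}"
  \<comment> \<open>The disjunction runs over the formulas for all \<open>W N\<close>, each with
    parameters from the same finite \<open>A\<close>.\<close>
  have "Or_definable L U A K R"
    unfolding Or_definable_def R_def
    by (rule exI[of _ "range \<psi>"]) (use \<psi> in auto)
  moreover have "solutions U K \<theta> = {p \<in> tuples U K. \<Theta> p}"
    unfolding solutions_def using \<theta>_iff by auto
  ultimately show ?thesis
    using A(1,2) \<theta> lin unfolding Let_def R_def[symmetric]
    by (intro exI[of _ A] exI[of _ K] exI[of _ \<theta>] exI[of _ R]) simp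
qed

end
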